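(* Consider the functional linear model $$Y_n(t)=\int_0^1\psi(t,s)X_n(s)\,ds+\varepsilon_n(t),\qquad n=1,2,\ldots,N.$$ Suppose $\{X_n\}\subset L_H^4$ is a zero mean $L^4$--$m$-approximable sequence independent of the sequence of i.i.d. errors $\{\varepsilon_n\}$. Let $\lambda_j$, $v_j$ be the eigenvalues and eigenfunctions of the covariance operator of $X$ and $\gamma_j$, $u_j$ those of $Y$, and let $\xi_\ell=\langle X,v_\ell\rangle$, $\zeta_k=\langle Y,u_k\rangle$. Assume that $$\Psi:=\sum_{k=1}^\infty\sum_{\ell=1}^\infty\frac{(E[\xi_\ell\zeta_k])^2}{\lambda_\ell^2}<\infty,$$ that $\lambda_1>\lambda_2>\cdots$ and $\gamma_1>\gamma_2>\cdots$, and that $K=K(N)\to\infty$, $L=L(N)\to\infty$ satisfy $$\frac{KL}{\lambda_L\min\{h_L,h_K'\}}=o(N^{1/2}).$$ Then the estimator $\hat\psi_{KL}(t,s)=\sum_{k=1}^K\sum_{\ell=1}^L\hat\lambda_\ell^{-1}\hat\sigma_{\ell k}\hat u_k(t)\hat v_\ell(s)$ satisfies $$\int_0^1\!\!\int_0^1\bigl[\hat\psi_{KL}(t,s)-\psi(t,s)\bigr]^2dt\,ds\stackrel{P}{\longrightarrow}0\qquad(N\to\infty).$$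
   Context: $H=L^2([0,1],\mathcal B_{[0,1]},\lambda)$ with inner product $\langle\cdot,\cdot\rangle$ and norm $\|f\|^2=\int_0^1|f(t)|^2dt$. $L_H^p$ is the space of $H$-valued random elements $X$ with $\nu_p(X)=(E\|X\|^p)^{1/p}<\infty$. The regressors $X_n$ and the responses $Y_n$ are random functions on $[0,1]$; the $X_n$ are jointly measurable in $(t,\omega)$ with $\sup_tE|X_1(t)|^2<\infty$. $X$ and $Y$ denote random functions distributed as $X_n$ and $Y_n$ (jointly as $(X_n,Y_n)$), with expansions $X(s)=\sum_{i=1}^\infty\xi_iv_i(s)$ and $Y(t)=\sum_{j=1}^\infty\zeta_ju_j(t)$. In this setting $\{Y_n\}$ is also regarded as $L^4$--$m$-approximable (the authors describe this as an easily seen consequence of the $L^4$--$m$-approximability of $\{X_n\}$), and the authors state that for this model the condition $\Psi<\infty$ is equivalent to $\psi$ being a Hilbert--Schmidt kernel, i.e. $\int_0^1\!\int_0^1\psi^2(t,s)\,dt\,ds<\infty$. $L^p$--$m$-approximability: a sequence $\{X_n\}\subset L_H^p$ is $L^p$--$m$-approximable if each $X_n$ admits the representation $X_n=f(\delta_n,\delta_{n-1},\ldots)$, where the $\delta_i$ are i.i.d. elements with values in a measurable space $S$ and $f:S^\infty\to H$ is measurable, and moreover, if $\{\delta_i'\}$ is an independent copy of $\{\delta_i\}$ defined on the same probability space and $$X_n^{(m)}=f(\delta_n,\delta_{n-1},\ldots,\delta_{n-m+1},\delta_{n-m}',\delta_{n-m-1}',\ldots),$$ then $\sum_{m=1}^\infty\nu_p(X_m-X_m^{(m)})<\infty$.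 Eigenvalues of the covariance operators are listed in decreasing order and eigenfunctions are orthonormal. $\hat\lambda_j,\hat v_j$ are the (ordered) eigenvalues and orthonormal eigenfunctions of the operator with kernel $N^{-1}\sum_{n=1}^N(X_n(t)-\bar X_N(t))(X_n(s)-\bar X_N(s))$, $\bar X_N=N^{-1}\sum_{n=1}^NX_n$, and $\hat u_j$ are the orthonormal eigenfunctions of the analogous operator built from $Y_1,\ldots,Y_N$. Further, $$\hat\sigma_{\ell k}=\frac1N\sum_{i=1}^N\langle X_i,\hat v_\ell\rangle\langle Y_i,\hat u_k\rangle.$$ Let $\alpha_1=\lambda_1-\lambda_2$, $\alpha_j=\min(\lambda_{j-1}-\lambda_j,\lambda_j-\lambda_{j+1})$ for $j\ge2$, and define $\alpha_j'$ in the same way with $\gamma_j$ in place of $\lambda_j$. Set $h_L=\min\{\alpha_j:1\le j\le L\}$ and $h_K'=\min\{\alpha_j':1\le j\le K\}$.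
   Formalization: It is assumed that ψ vanishes on the null space of the covariance operator of X (automatic if that operator is injective); otherwise ψ is not determined by the model and the claim fails. Of the approximability of Y only Y_n in L^4_H is assumed. *)

theory Defs
  imports "HOL-Probability.Probability" "HOL-Library.Landau_Symbols"
begin

text \<open>
  Elements of \<open>H = L\<^sup>2([0,1])\<close> are represented by square-integrable functions; equality in \<open>H\<close> is
  equality almost everywhere. Sequences are indexed from \<open>1\<close>: the values at index \<open>0\<close> are
  never used.
\<close>

definition unit_leb :: "real measure" where
  "unit_leb = restrict_space lborel {0..1}"

definition L2_fun :: "(real \<Rightarrow> real) set" where
  "L2_fun = {f. f \<in> borel_measurable unit_leb \<and> integrable unit_leb (\<lambda>t. (f t)\<^sup>2)}"

definition L2_inner :: "(real \<Rightarrow> real) \<Rightarrow> (real \<Rightarrow> real) \<Rightarrow> real" where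
  "L2_inner f g = (LINT t|unit_leb. f t * g t)"

definition L2_norm :: "(real \<Rightarrow> real) \<Rightarrow> real" where
  "L2_norm f = sqrt (LINT t|unit_leb. (f t)\<^sup>2)"

text \<open>The Borel sets of \<open>H\<close>: generated by the sets that are open for the \<open>L\<^sup>2\<close> seminorm. Open sets
  are invariant under changes on null sets, so this is the Borel \<open>\<sigma>\<close>-algebra of the quotient.\<close>

definition L2_open :: "(real \<Rightarrow> real) set \<Rightarrow> bool" where
  "L2_open V \<longleftrightarrow> V \<subseteq> L2_fun \<and>
     (\<forall>f\<in>V. \<exists>e>0. \<forall>g\<in>L2_fun. L2_norm (\<lambda>t. g t - f t) < e \<longrightarrow> g \<in> V)"

definition L2_borel :: "(real \<Rightarrow> real) measure" where
  "L2_borel = sigma L2_fun {V. L2_open V}"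

text \<open>A random element of \<open>H\<close>, given by a jointly measurable process with paths in \<open>L\<^sup>2\<close>.\<close>

definition random_fun :: "'w measure \<Rightarrow> ('w \<Rightarrow> real \<Rightarrow> real) \<Rightarrow> bool" where
  "random_fun M Z \<longleftrightarrow>
     (\<lambda>(\<omega>, t). Z \<omega> t) \<in> borel_measurable (M \<Otimes>\<^sub>M unit_leb) \<and> (\<forall>\<omega>\<in>space M. Z \<omega> \<in> L2_fun)"

definition in_LpH :: "'w measure \<Rightarrow> real \<Rightarrow> ('w \<Rightarrow> real \<Rightarrow> real) \<Rightarrow> bool" where
  "in_LpH M p Z \<longleftrightarrow> random_fun M Z \<and> integrable M (\<lambda>\<omega>. L2_norm (Z \<omega>) powr p)"

definition nu :: "'w measure \<Rightarrow> real \<Rightarrow> ('w \<Rightarrow> real \<Rightarrow> real) \<Rightarrow> real" where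
  "nu M p Z = (LINT \<omega>|M. L2_norm (Z \<omega>) powr p) powr (1 / p)"

definition iid :: "'w measure \<Rightarrow> 's measure \<Rightarrow> ('i \<Rightarrow> 'w \<Rightarrow> 's) \<Rightarrow> 'i set \<Rightarrow> bool" where
  "iid M S Z I \<longleftrightarrow> prob_space.indep_vars M (\<lambda>_. S) Z I \<and>
     (\<forall>i\<in>I. \<forall>j\<in>I. distr M S (Z i) = distr M S (Z j))"

definition independent_copy ::
  "'w measure \<Rightarrow> 's measure \<Rightarrow> (int \<Rightarrow> 'w \<Rightarrow> 's) \<Rightarrow> (int \<Rightarrow> 'w \<Rightarrow> 's) \<Rightarrow> bool" where
  "independent_copy M S \<delta> \<delta>' \<longleftrightarrow>
     (let P = Pi\<^sub>M UNIV (\<lambda>_::int. S) in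
        prob_space.indep_var M P (\<lambda>\<omega> i. \<delta> i \<omega>) P (\<lambda>\<omega> i. \<delta>' i \<omega>) \<and>
        distr M P (\<lambda>\<omega> i. \<delta>' i \<omega>) = distr M P (\<lambda>\<omega> i. \<delta> i \<omega>))"

definition shift_rep ::
  "((nat \<Rightarrow> 's) \<Rightarrow> real \<Rightarrow> real) \<Rightarrow> (int \<Rightarrow> 'w \<Rightarrow> 's) \<Rightarrow> nat \<Rightarrow> 'w \<Rightarrow> real \<Rightarrow> real" where
  "shift_rep f \<delta> n \<omega> = f (\<lambda>k. \<delta> (int n - int k) \<omega>)"

text \<open>\<open>X\<^sub>n\<^sup>(\<^sup>m\<^sup>) = f(\<delta>\<^sub>n, \<dots>, \<delta>\<^sub>n\<^sub>-\<^sub>m\<^sub>+\<^sub>1, \<delta>'\<^sub>n\<^sub>-\<^sub>m, \<delta>'\<^sub>n\<^sub>-\<^sub>m\<^sub>-\<^sub>1, \<dots>)\<close>\<close>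

definition coupled_rep ::
  "((nat \<Rightarrow> 's) \<Rightarrow> real \<Rightarrow> real) \<Rightarrow> (int \<Rightarrow> 'w \<Rightarrow> 's) \<Rightarrow> (int \<Rightarrow> 'w \<Rightarrow> 's) \<Rightarrow>
     nat \<Rightarrow> nat \<Rightarrow> 'w \<Rightarrow> real \<Rightarrow> real" where
  "coupled_rep f \<delta> \<delta>' m n \<omega> =
     f (\<lambda>k. if k < m then \<delta> (int n - int k) \<omega> else \<delta>' (int n - int k) \<omega>)"

definition Lp_m_approximable ::
  "'w measure \<Rightarrow> 's measure \<Rightarrow> real \<Rightarrow> (nat \<Rightarrow> 'w \<Rightarrow> real \<Rightarrow> real) \<Rightarrow> bool" where
  "Lp_m_approximable M S p X \<longleftrightarrow>
     (\<forall>n\<ge>1. in_LpH M p (X n)) \<and>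
     (\<exists>\<delta> \<delta>' f.
        iid M S \<delta> UNIV \<and> independent_copy M S \<delta> \<delta>' \<and>
        f \<in> measurable (Pi\<^sub>M UNIV (\<lambda>_::nat. S)) L2_borel \<and>
        (\<forall>n\<ge>1. AE \<omega> in M. AE t in unit_leb. X n \<omega> t = shift_rep f \<delta> n \<omega> t) \<and>
        (\<lambda>m. nu M p (\<lambda>\<omega> t. X m \<omega> t - coupled_rep f \<delta> \<delta>' m m \<omega> t)) summable_on {1..})"

definition kernel_op :: "(real \<Rightarrow> real \<Rightarrow> real) \<Rightarrow> (real \<Rightarrow> real) \<Rightarrow> real \<Rightarrow> real" where
  "kernel_op c f t = (LINT s|unit_leb. c t s * f s)"

definition mean_fun :: "'w measure \<Rightarrow> ('w \<Rightarrow> real \<Rightarrow> real) \<Rightarrow> real \<Rightarrow> real" where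
  "mean_fun M Z t = (LINT \<omega>|M. Z \<omega> t)"

definition cov_kernel :: "'w measure \<Rightarrow> ('w \<Rightarrow> real \<Rightarrow> real) \<Rightarrow> real \<Rightarrow> real \<Rightarrow> real" where
  "cov_kernel M Z t s = (LINT \<omega>|M. (Z \<omega> t - mean_fun M Z t) * (Z \<omega> s - mean_fun M Z s))"

definition sample_mean :: "nat \<Rightarrow> (nat \<Rightarrow> real \<Rightarrow> real) \<Rightarrow> real \<Rightarrow> real" where
  "sample_mean N z t = (\<Sum>n=1..N. z n t) / real N"

definition sample_cov_kernel :: "nat \<Rightarrow> (nat \<Rightarrow> real \<Rightarrow> real) \<Rightarrow> real \<Rightarrow> real \<Rightarrow> real" where
  "sample_cov_kernel N z t s =
     (\<Sum>n=1..N. (z n t - sample_mean N z t) * (z n s - sample_mean N z s)) / real N"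

text \<open>
  \<open>(l\<^sub>j, e\<^sub>j)\<^sub>j\<^sub>\<ge>\<^sub>1\<close> lists the eigenvalues, in decreasing order and with multiplicity, and orthonormal
  eigenfunctions of the operator with kernel \<open>c\<close>. The last conjunct says that no eigenfunction of a
  nonzero eigenvalue is missing. An operator of finite rank has \<open>l\<^sub>j = 0\<close> from some index on, and
  the corresponding \<open>e\<^sub>j\<close> are an arbitrary orthonormal sequence in the null space.
\<close>

definition eigensystem ::
  "(real \<Rightarrow> real \<Rightarrow> real) \<Rightarrow> (nat \<Rightarrow> real) \<Rightarrow> (nat \<Rightarrow> real \<Rightarrow> real) \<Rightarrow> bool" where
  "eigensystem c l e \<longleftrightarrow>
     (\<forall>j\<ge>1. e j \<in> L2_fun) \<and>
     (\<forall>i\<ge>1. \<forall>j\<ge>1. L2_inner (e i) (e j) = (if i = j then 1 else 0)) \<and>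
     (\<forall>j\<ge>1. AE t in unit_leb. kernel_op c (e j) t = l j * e j t) \<and>
     (\<forall>j\<ge>1. l (Suc j) \<le> l j) \<and>
     (\<forall>f\<in>L2_fun. \<forall>\<mu>. \<mu> \<noteq> 0 \<longrightarrow> (AE t in unit_leb. kernel_op c f t = \<mu> * f t) \<longrightarrow>
        (\<forall>j\<ge>1. L2_inner f (e j) = 0) \<longrightarrow> (AE t in unit_leb. f t = 0))"

definition gap :: "(nat \<Rightarrow> real) \<Rightarrow> nat \<Rightarrow> real" where
  "gap l j = (if j = 1 then l 1 - l 2 else min (l (j - 1) - l j) (l j - l (j + 1)))"

definition min_gap :: "(nat \<Rightarrow> real) \<Rightarrow> nat \<Rightarrow> real" where
  "min_gap l J = Min (gap l ` {1..J})"

definition sigma_hat ::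
  "nat \<Rightarrow> (nat \<Rightarrow> real \<Rightarrow> real) \<Rightarrow> (nat \<Rightarrow> real \<Rightarrow> real) \<Rightarrow>
     (nat \<Rightarrow> real \<Rightarrow> real) \<Rightarrow> (nat \<Rightarrow> real \<Rightarrow> real) \<Rightarrow> nat \<Rightarrow> nat \<Rightarrow> real" where
  "sigma_hat N x y vh uh l k =
     (\<Sum>i=1..N. L2_inner (x i) (vh l) * L2_inner (y i) (uh k)) / real N"

definition psi_hat ::
  "nat \<Rightarrow> (nat \<Rightarrow> real \<Rightarrow> real) \<Rightarrow> (nat \<Rightarrow> real \<Rightarrow> real) \<Rightarrow> (nat \<Rightarrow> real) \<Rightarrow>
     (nat \<Rightarrow> real \<Rightarrow> real) \<Rightarrow> (nat \<Rightarrow> real \<Rightarrow> real) \<Rightarrow> nat \<Rightarrow> nat \<Rightarrow> real \<Rightarrow> real \<Rightarrow> real" where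
  "psi_hat N x y lh vh uh K L t s =
     (\<Sum>k=1..K. \<Sum>l=1..L. inverse (lh l) * sigma_hat N x y vh uh l k * uh k t * vh l s)"

text \<open>Convergence to \<open>0\<close> in probability of \<open>[0,\<infinity>]\<close>-valued random variables.\<close>

definition to_zero_in_prob :: "'w measure \<Rightarrow> (nat \<Rightarrow> 'w \<Rightarrow> ennreal) \<Rightarrow> bool" where
  "to_zero_in_prob M Z \<longleftrightarrow>
     (\<forall>e::real. e > 0 \<longrightarrow> (\<lambda>N. measure M {\<omega> \<in> space M. Z N \<omega> > ennreal e}) \<longlonglongrightarrow> 0)"

end

theory Submission
  imports Defs
begin

text \<open>Write \<open>c\<close> for the covariance kernel of \<open>X\<close>, \<open>D\<close> for the cross-covariance kernel of \<open>Y\<close> and \<open>X\<close>, and \<open>\<parallel>\<cdot>\<parallel>\<close> for the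
  Hilbert--Schmidt norm of kernels. The model gives \<open>D = \<psi> \<circ> c\<close>, so \<open>\<psi>\<close> has the coefficients
  \<open>\<langle>D, u\<^sub>k \<otimes> v\<^sub>l\<rangle> / \<lambda>\<^sub>l\<close> with respect to the products of eigenfunctions, and the estimator replaces every ingredient of the
  \<open>K L\<close> leading terms of this expansion by its empirical counterpart.

  There are two errors. The truncation error tends to zero because \<open>\<Psi>\<close> is the sum of all squared coefficients and equals
  \<open>\<parallel>\<psi>\<parallel>\<^sup>2\<close>: the products of eigenfunctions are complete for \<open>\<psi>\<close>, since \<open>\<psi>\<close> vanishes on the null space of \<open>c\<close> and
  \<open>\<langle>Y, r\<rangle>\<close> is almost surely constant for every \<open>r\<close> orthogonal to all \<open>u\<^sub>k\<close> (\<open>regression_kernel_hilbert_schmidt\<close>). This uses that a positive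
  compact operator vanishes on the orthogonal complement of its eigenfunctions (\<open>null_on_complement\<close>).

  The stochastic error is bounded summand by summand. Let \<open>\<delta>\<close> bound the deviations of the empirical covariance kernels of
  \<open>X\<close> and \<open>Y\<close> and of the empirical cross-covariance kernel. Weyl's inequality bounds the error of every eigenvalue by \<open>\<delta>\<close>, and the error
  of an eigenfunction, as the sine of an angle, by \<open>2 \<delta>\<close> divided by the spectral gap (\<open>weyl\<close>, \<open>eigenfunction_perturbation\<close>). An empirical
  eigenfunction is determined up to sign at best, but it enters the estimator twice: a summand is \<open>1 / \<lambda>\<^sub>l\<close> times the orthogonal projection of
  \<open>D\<close> onto the line spanned by \<open>u\<^sub>k \<otimes> v\<^sub>l\<close>, and projections move by the sine of the angle (\<open>rank_one_projection_diff\<close>). So every summand is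
  wrong by at most a constant times \<open>\<delta> / (\<lambda>\<^sub>L min {h\<^sub>L, h'\<^sub>K})\<close>, and the sum by \<open>K L\<close> times that (\<open>estimator_error\<close>).

  It remains to see that \<open>\<delta>\<close> is of order \<open>N\<close> to the power \<open>- 1/2\<close> in probability; then the growth condition makes the stochastic error vanish.
  Inserting the model, \<open>\<delta>\<close> is controlled by five averages of products of regressors and centred errors, for which
  \<open>\<psi>\<close> only contributes factors \<open>\<parallel>\<psi>\<parallel>\<close> (locale \<open>observations\<close>). The mean squared norm of an average is \<open>1 / N\<^sup>2\<close> times the sum of the
  inner products of its terms, hence of order \<open>1 / N\<close> if these decay summably with the lag (\<open>nm_sum_short_range\<close>). For the products of
  regressors they do: the version of \<open>X\<^sub>j\<close> coupled with lag \<open>j - i\<close> is independent of \<open>X\<^sub>i\<close>, and the cost of the replacement is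
  the summable coupling distance (\<open>approximable_weak_dependence\<close>). Errors are independent of each other and of the regressors.\<close>

section \<open>Square-integrable functions\<close>

text \<open>Functions are not identified up to null sets: random functions have to be evaluated at points and to be
  jointly measurable. Consequently \<open>nm\<close> is only a seminorm, and equations between functions hold almost everywhere.\<close>

definition sqint :: "'a measure \<Rightarrow> ('a \<Rightarrow> real) set" where
  "sqint \<mu> = {f. f \<in> borel_measurable \<mu> \<and> integrable \<mu> (\<lambda>x. (f x)\<^sup>2)}"

definition ip :: "'a measure \<Rightarrow> ('a \<Rightarrow> real) \<Rightarrow> ('a \<Rightarrow> real) \<Rightarrow> real" where
  "ip \<mu> f g = (\<integral>x. f x * g x \<partial>\<mu>)"

definition nm :: "'a measure \<Rightarrow> ('a \<Rightarrow> real) \<Rightarrow> real" where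
  "nm \<mu> f = sqrt (\<integral>x. (f x)\<^sup>2 \<partial>\<mu>)"

lemma L2_fun_eq: "L2_fun = sqint unit_leb"
  by (simp add: L2_fun_def sqint_def)

lemma L2_inner_eq: "L2_inner = ip unit_leb"
  by (simp add: L2_inner_def ip_def fun_eq_iff)

lemma L2_norm_eq: "L2_norm = nm unit_leb"
  by (simp add: L2_norm_def nm_def fun_eq_iff)

lemma sqint_measurable [measurable_dest]: "f \<in> sqint \<mu> \<Longrightarrow> f \<in> borel_measurable \<mu>"
  by (simp add: sqint_def)

lemma sqint_integrable_sq: "f \<in> sqint \<mu> \<Longrightarrow> integrable \<mu> (\<lambda>x. (f x)\<^sup>2)"
  by (simp add: sqint_def)

lemma sqint_integrable_mult:
  assumes "f \<in> sqint \<mu>" "g \<in> sqint \<mu>"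
  shows "integrable \<mu> (\<lambda>x. f x * g x)"
proof (rule Bochner_Integration.integrable_bound)
  show "integrable \<mu> (\<lambda>x. (f x)\<^sup>2 + (g x)\<^sup>2)"
    using assms by (auto simp: sqint_def)
  show "(\<lambda>x. f x * g x) \<in> borel_measurable \<mu>"
    using assms by (auto simp: sqint_def)
  show "AE x in \<mu>. norm (f x * g x) \<le> norm ((f x)\<^sup>2 + (g x)\<^sup>2)"
  proof (rule AE_I2)
    fix x
    have "2 * (\<bar>f x\<bar> * \<bar>g x\<bar>) \<le> \<bar>f x\<bar>\<^sup>2 + \<bar>g x\<bar>\<^sup>2"
      using sum_squares_bound[of "\<bar>f x\<bar>" "\<bar>g x\<bar>"] by simp
    moreover have "0 \<le> \<bar>f x\<bar> * \<bar>g x\<bar>" by simp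
    ultimately have "\<bar>f x\<bar> * \<bar>g x\<bar> \<le> \<bar>f x\<bar>\<^sup>2 + \<bar>g x\<bar>\<^sup>2" by linarith
    then show "norm (f x * g x) \<le> norm ((f x)\<^sup>2 + (g x)\<^sup>2)"
      by (simp add: abs_mult)
  qed
qed

lemma sqint_bound:
  assumes "g \<in> sqint \<mu>" "f \<in> borel_measurable \<mu>" "AE x in \<mu>. \<bar>f x\<bar> \<le> \<bar>g x\<bar>"
  shows "f \<in> sqint \<mu>"
proof -
  have "integrable \<mu> (\<lambda>x. (f x)\<^sup>2)"
    by (rule Bochner_Integration.integrable_bound[OF sqint_integrable_sq[OF assms(1)]])
      (use assms in \<open>auto simp: abs_le_square_iff[symmetric]\<close>)
  then show ?thesis using assms by (simp add: sqint_def)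
qed

lemma sqint_cong_AE:
  assumes "g \<in> sqint \<mu>" "f \<in> borel_measurable \<mu>" "AE x in \<mu>. f x = g x"
  shows "f \<in> sqint \<mu>"
  using assms(3) by (intro sqint_bound[OF assms(1,2)]) auto

lemma sqint_zero [simp]: "(\<lambda>x. 0) \<in> sqint \<mu>"
  by (simp add: sqint_def)

lemma sqint_scale: "f \<in> sqint \<mu> \<Longrightarrow> (\<lambda>x. c * f x) \<in> sqint \<mu>"
  by (auto simp: sqint_def power_mult_distrib)

lemma sqint_add:
  assumes "f \<in> sqint \<mu>" "g \<in> sqint \<mu>"
  shows "(\<lambda>x. f x + g x) \<in> sqint \<mu>"
  using assms sqint_integrable_mult[OF assms]
  by (auto simp: sqint_def power2_sum mult.assoc)

lemma sqint_uminus: "f \<in> sqint \<mu> \<Longrightarrow> (\<lambda>x. - f x) \<in> sqint \<mu>"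
  using sqint_scale[of f \<mu> "-1"] by simp

lemma sqint_diff:
  assumes "f \<in> sqint \<mu>" "g \<in> sqint \<mu>"
  shows "(\<lambda>x. f x - g x) \<in> sqint \<mu>"
  using sqint_add[OF assms(1) sqint_uminus[OF assms(2)]] by simp

lemma sqint_sum:
  assumes "\<And>i. i \<in> I \<Longrightarrow> f i \<in> sqint \<mu>"
  shows "(\<lambda>x. \<Sum>i\<in>I. f i x) \<in> sqint \<mu>"
  using assms by (induction I rule: infinite_finite_induct) (auto intro: sqint_add)

lemmas sqint_intros = sqint_zero sqint_scale sqint_add sqint_diff sqint_uminus sqint_sum

lemma ip_commute: "ip \<mu> f g = ip \<mu> g f"
  by (simp add: ip_def mult.commute)

lemma ip_add_left:
  assumes "f \<in> sqint \<mu>" "g \<in> sqint \<mu>" "h \<in> sqint \<mu>"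
  shows "ip \<mu> (\<lambda>x. f x + g x) h = ip \<mu> f h + ip \<mu> g h"
  using assms by (simp add: ip_def distrib_right sqint_integrable_mult)

lemma ip_diff_left:
  assumes "f \<in> sqint \<mu>" "g \<in> sqint \<mu>" "h \<in> sqint \<mu>"
  shows "ip \<mu> (\<lambda>x. f x - g x) h = ip \<mu> f h - ip \<mu> g h"
  using assms by (simp add: ip_def left_diff_distrib sqint_integrable_mult)

lemma ip_scale_left: "ip \<mu> (\<lambda>x. c * f x) h = c * ip \<mu> f h"
  by (simp add: ip_def mult.assoc)

lemma ip_zero_left [simp]: "ip \<mu> (\<lambda>x. 0) h = 0"
  by (simp add: ip_def)

lemma ip_sum_left:
  assumes "\<And>i. i \<in> I \<Longrightarrow> f i \<in> sqint \<mu>" "h \<in> sqint \<mu>"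
  shows "ip \<mu> (\<lambda>x. \<Sum>i\<in>I. f i x) h = (\<Sum>i\<in>I. ip \<mu> (f i) h)"
  using assms by (simp add: ip_def sum_distrib_right sqint_integrable_mult)

lemma ip_add_right:
  "f \<in> sqint \<mu> \<Longrightarrow> g \<in> sqint \<mu> \<Longrightarrow> h \<in> sqint \<mu> \<Longrightarrow>
    ip \<mu> h (\<lambda>x. f x + g x) = ip \<mu> h f + ip \<mu> h g"
  by (simp add: ip_commute[of \<mu> h] ip_add_left)

lemma ip_diff_right:
  "f \<in> sqint \<mu> \<Longrightarrow> g \<in> sqint \<mu> \<Longrightarrow> h \<in> sqint \<mu> \<Longrightarrow>
    ip \<mu> h (\<lambda>x. f x - g x) = ip \<mu> h f - ip \<mu> h g"
  by (simp add: ip_commute[of \<mu> h] ip_diff_left)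

lemma ip_scale_right: "ip \<mu> h (\<lambda>x. c * f x) = c * ip \<mu> h f"
  by (simp add: ip_commute[of \<mu> h] ip_scale_left)

lemma ip_sum_right:
  "(\<And>i. i \<in> I \<Longrightarrow> f i \<in> sqint \<mu>) \<Longrightarrow> h \<in> sqint \<mu> \<Longrightarrow>
    ip \<mu> h (\<lambda>x. \<Sum>i\<in>I. f i x) = (\<Sum>i\<in>I. ip \<mu> h (f i))"
  by (simp add: ip_commute[of \<mu> h] ip_sum_left)

lemmas ip_simps = ip_add_left ip_add_right ip_diff_left ip_diff_right ip_scale_left ip_scale_right
  ip_sum_left ip_sum_right

lemma ip_cong_AE:
  assumes "f \<in> borel_measurable \<mu>" "f' \<in> borel_measurable \<mu>"
    "g \<in> borel_measurable \<mu>" "g' \<in> borel_measurable \<mu>"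
    "AE x in \<mu>. f x = f' x" "AE x in \<mu>. g x = g' x"
  shows "ip \<mu> f g = ip \<mu> f' g'"
  unfolding ip_def using assms by (intro integral_cong_AE) auto

lemma nm_sq: "(nm \<mu> f)\<^sup>2 = ip \<mu> f f"
  by (simp add: nm_def ip_def power2_eq_square)

lemma nm_sq_int: "(nm \<mu> f)\<^sup>2 = (\<integral>x. (f x)\<^sup>2 \<partial>\<mu>)"
  by (simp add: nm_def)

lemma nm_nonneg [simp]: "0 \<le> nm \<mu> f"
  by (simp add: nm_def)

lemma ip_self_nonneg [simp]: "0 \<le> ip \<mu> f f"
  by (simp add: nm_sq[symmetric])

lemma nm_cong_AE:
  assumes "f \<in> borel_measurable \<mu>" "f' \<in> borel_measurable \<mu>" "AE x in \<mu>. f x = f' x"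
  shows "nm \<mu> f = nm \<mu> f'"
  using ip_cong_AE[OF assms(1,2,1,2,3,3)] by (simp add: nm_sq[symmetric])

lemma nm_eq_0_iff:
  assumes "f \<in> sqint \<mu>"
  shows "nm \<mu> f = 0 \<longleftrightarrow> (AE x in \<mu>. f x = 0)"
proof -
  have "nm \<mu> f = 0 \<longleftrightarrow> (\<integral>x. (f x)\<^sup>2 \<partial>\<mu>) = 0"
    by (simp add: nm_def)
  also have "\<dots> \<longleftrightarrow> (AE x in \<mu>. (f x)\<^sup>2 = 0)"
    using assms by (intro integral_nonneg_eq_0_iff_AE) (auto simp: sqint_def)
  finally show ?thesis by simp
qed

lemma nm_scale: "nm \<mu> (\<lambda>x. c * f x) = \<bar>c\<bar> * nm \<mu> f"
  by (simp add: nm_def power_mult_distrib real_sqrt_mult)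

lemma ip_cauchy_schwarz_sq:
  assumes f: "f \<in> sqint \<mu>" and g: "g \<in> sqint \<mu>"
  shows "(ip \<mu> f g)\<^sup>2 \<le> ip \<mu> f f * ip \<mu> g g"
proof (cases "ip \<mu> g g = 0")
  case True
  then have "AE x in \<mu>. g x = 0"
    using nm_eq_0_iff[OF g] by (simp add: nm_sq[symmetric])
  then have "ip \<mu> f g = ip \<mu> f (\<lambda>x. 0)"
    using f g by (intro ip_cong_AE) (auto simp: sqint_def)
  then have "ip \<mu> f g = 0" by (simp add: ip_def)
  then show ?thesis using True by simp
next
  case False
  then have pos: "ip \<mu> g g > 0" by (simp add: less_le)
  define a where "a = ip \<mu> f g / ip \<mu> g g"
  have "0 \<le> ip \<mu> (\<lambda>x. f x - a * g x) (\<lambda>x. f x - a * g x)" by simp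
  also have "\<dots> = ip \<mu> f f - 2 * a * ip \<mu> f g + a\<^sup>2 * ip \<mu> g g"
    using f g by (simp add: ip_simps sqint_intros ip_commute[of \<mu> g f] power2_eq_square algebra_simps)
  also have "\<dots> = ip \<mu> f f - (ip \<mu> f g)\<^sup>2 / ip \<mu> g g"
    using pos by (simp add: a_def field_simps power2_eq_square)
  finally show ?thesis using pos by (simp add: field_simps)
qed

lemma ip_cauchy_schwarz:
  assumes "f \<in> sqint \<mu>" "g \<in> sqint \<mu>"
  shows "\<bar>ip \<mu> f g\<bar> \<le> nm \<mu> f * nm \<mu> g"
proof -
  have "\<bar>ip \<mu> f g\<bar>\<^sup>2 \<le> (nm \<mu> f * nm \<mu> g)\<^sup>2"
    using ip_cauchy_schwarz_sq[OF assms] by (simp add: power_mult_distrib nm_sq)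
  then show ?thesis by (rule power2_le_imp_le) simp
qed

lemma ip_add_self:
  assumes "f \<in> sqint \<mu>" "g \<in> sqint \<mu>"
  shows "ip \<mu> (\<lambda>x. f x + g x) (\<lambda>x. f x + g x) = ip \<mu> f f + 2 * ip \<mu> f g + ip \<mu> g g"
  using assms by (simp add: ip_simps sqint_intros ip_commute[of \<mu> g f])

lemma ip_diff_self:
  assumes "f \<in> sqint \<mu>" "g \<in> sqint \<mu>"
  shows "ip \<mu> (\<lambda>x. f x - g x) (\<lambda>x. f x - g x) = ip \<mu> f f - 2 * ip \<mu> f g + ip \<mu> g g"
  using assms by (simp add: ip_simps sqint_intros ip_commute[of \<mu> g f])

lemma nm_triangle:
  assumes "f \<in> sqint \<mu>" "g \<in> sqint \<mu>"
  shows "nm \<mu> (\<lambda>x. f x + g x) \<le> nm \<mu> f + nm \<mu> g"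
proof (rule power2_le_imp_le)
  have "(nm \<mu> (\<lambda>x. f x + g x))\<^sup>2 = (nm \<mu> f)\<^sup>2 + 2 * ip \<mu> f g + (nm \<mu> g)\<^sup>2"
    using assms by (simp add: nm_sq ip_add_self)
  also have "\<dots> \<le> (nm \<mu> f)\<^sup>2 + 2 * (nm \<mu> f * nm \<mu> g) + (nm \<mu> g)\<^sup>2"
    using ip_cauchy_schwarz[OF assms] by simp
  finally show "(nm \<mu> (\<lambda>x. f x + g x))\<^sup>2 \<le> (nm \<mu> f + nm \<mu> g)\<^sup>2"
    by (simp add: power2_sum)
qed simp

lemma nm_uminus [simp]: "nm \<mu> (\<lambda>x. - f x) = nm \<mu> f"
  by (simp add: nm_def)

lemma nm_minus_commute: "nm \<mu> (\<lambda>x. f x - g x) = nm \<mu> (\<lambda>x. g x - f x)"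
  by (simp add: nm_def power2_commute)

lemma nm_triangle_diff:
  assumes "f \<in> sqint \<mu>" "g \<in> sqint \<mu>"
  shows "nm \<mu> (\<lambda>x. f x - g x) \<le> nm \<mu> f + nm \<mu> g"
  using nm_triangle[OF assms(1) sqint_uminus[OF assms(2)]] by simp

lemma nm_triangle_via:
  assumes "f \<in> sqint \<mu>" "g \<in> sqint \<mu>" "h \<in> sqint \<mu>"
  shows "nm \<mu> (\<lambda>x. f x - h x) \<le> nm \<mu> (\<lambda>x. f x - g x) + nm \<mu> (\<lambda>x. g x - h x)"
  using nm_triangle[OF sqint_diff[OF assms(1,2)] sqint_diff[OF assms(2,3)]] by simp

lemma nm_le_add_diff:
  assumes "f \<in> sqint \<mu>" "g \<in> sqint \<mu>"
  shows "nm \<mu> f \<le> nm \<mu> g + nm \<mu> (\<lambda>x. f x - g x)"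
  using nm_triangle[OF assms(2) sqint_diff[OF assms]] by simp

lemma nm_sum_le:
  assumes "\<And>i. i \<in> I \<Longrightarrow> f i \<in> sqint \<mu>"
  shows "nm \<mu> (\<lambda>x. \<Sum>i\<in>I. f i x) \<le> (\<Sum>i\<in>I. nm \<mu> (f i))"
  using assms
proof (induction I rule: infinite_finite_induct)
  case (insert i I)
  then have "nm \<mu> (\<lambda>x. f i x + (\<Sum>i\<in>I. f i x)) \<le> nm \<mu> (f i) + nm \<mu> (\<lambda>x. \<Sum>i\<in>I. f i x)"
    by (intro nm_triangle sqint_sum) auto
  then show ?case using insert by auto
qed (auto simp: nm_def)

lemma ip_sum_self:
  assumes "\<And>i. i \<in> I \<Longrightarrow> f i \<in> sqint \<mu>"
  shows "ip \<mu> (\<lambda>x. \<Sum>i\<in>I. f i x) (\<lambda>x. \<Sum>i\<in>I. f i x) = (\<Sum>i\<in>I. \<Sum>j\<in>I. ip \<mu> (f i) (f j))"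
  using assms by (simp add: ip_simps sqint_sum)

text \<open>This is Bessel's inequality in the plane spanned by \<open>e\<close> and \<open>e'\<close>: the left-hand side \<open>D\<close> equals
  \<open>\<langle>x, w\<rangle>\<close> for the vector \<open>w\<close> below, and \<open>\<parallel>w\<parallel>\<^sup>2 = D (1 - \<langle>e, e'\<rangle>\<^sup>2)\<close>. Since a projection does
  not change when \<open>e'\<close> is replaced by \<open>- e'\<close>, the signs of empirical eigenfunctions never have to be matched with
  those of the population eigenfunctions.\<close>

lemma rank_one_projection_diff:
  assumes x: "x \<in> sqint \<mu>" and e: "e \<in> sqint \<mu>" and e': "e' \<in> sqint \<mu>"
    and unit: "ip \<mu> e e = 1" "ip \<mu> e' e' = 1"
  shows "(nm \<mu> (\<lambda>t. ip \<mu> x e' * e' t - ip \<mu> x e * e t))\<^sup>2 \<le> (nm \<mu> x)\<^sup>2 * (1 - (ip \<mu> e' e)\<^sup>2)"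
proof -
  define p q c where "p = ip \<mu> x e" and "q = ip \<mu> x e'" and "c = ip \<mu> e' e"
  define D where "D = p\<^sup>2 + q\<^sup>2 - 2 * p * q * c"
  have D: "(nm \<mu> (\<lambda>t. ip \<mu> x e' * e' t - ip \<mu> x e * e t))\<^sup>2 = D"
    unfolding nm_sq using x e e' unit
    by (simp add: ip_simps sqint_intros D_def p_def q_def c_def ip_commute[of \<mu> e e'])
      (simp add: power2_eq_square algebra_simps)
  define w where "w = (\<lambda>t. (p - c * q) * e t + (q - c * p) * e' t)"
  have w: "w \<in> sqint \<mu>" using e e' by (simp add: w_def sqint_intros)
  have xw: "ip \<mu> x w = D"
    using x e e' by (simp add: w_def ip_simps sqint_intros D_def p_def[symmetric] q_def[symmetric]
        power2_eq_square algebra_simps)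
  have ww: "ip \<mu> w w = D * (1 - c\<^sup>2)"
    using e e' unit by (simp add: w_def ip_simps sqint_intros D_def ip_commute[of \<mu> e e']
        c_def[symmetric] power2_eq_square algebra_simps)
  have "c\<^sup>2 \<le> 1"
    using ip_cauchy_schwarz_sq[OF e' e] unit by (simp add: c_def)
  have D0: "0 \<le> D" using D[symmetric] by simp
  have "D\<^sup>2 \<le> (nm \<mu> x)\<^sup>2 * (D * (1 - c\<^sup>2))"
    using ip_cauchy_schwarz_sq[OF x w] by (simp add: xw ww nm_sq)
  then have "D * D \<le> D * ((nm \<mu> x)\<^sup>2 * (1 - c\<^sup>2))"
    by (simp add: power2_eq_square algebra_simps)
  moreover have "0 \<le> (nm \<mu> x)\<^sup>2 * (1 - c\<^sup>2)" using \<open>c\<^sup>2 \<le> 1\<close> by simp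
  ultimately have "D \<le> (nm \<mu> x)\<^sup>2 * (1 - c\<^sup>2)"
    using D0 by (cases "D = 0") auto
  then show ?thesis using D by (simp add: c_def)
qed

subsection \<open>Completeness\<close>

lemma (in finite_measure) sqint_integrable:
  assumes "f \<in> sqint M" shows "integrable M f"
  using sqint_integrable_mult[OF assms, of "\<lambda>x. 1"] by (simp add: sqint_def)

lemma (in prob_space) sqint_L1_le:
  assumes "f \<in> sqint M" shows "(\<integral>x. \<bar>f x\<bar> \<partial>M) \<le> nm M f"
proof -
  have one: "(\<lambda>x. 1) \<in> sqint M" by (simp add: sqint_def)
  have ab: "(\<lambda>x. \<bar>f x\<bar>) \<in> sqint M" using assms by (auto simp: sqint_def)
  have "\<bar>ip M (\<lambda>x. \<bar>f x\<bar>) (\<lambda>x. 1)\<bar> \<le> nm M (\<lambda>x. \<bar>f x\<bar>) * nm M (\<lambda>x. 1)"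
    by (rule ip_cauchy_schwarz[OF ab one])
  then show ?thesis by (simp add: ip_def nm_def prob_space)
qed

text \<open>Fatou's lemma for the squares.\<close>

lemma nm_le_of_AE_limit:
  assumes h: "\<And>n. h n \<in> sqint \<mu>" and g: "g \<in> borel_measurable \<mu>"
    and lim: "AE x in \<mu>. (\<lambda>n. h n x) \<longlonglongrightarrow> g x"
    and b: "\<And>n. n \<ge> n0 \<Longrightarrow> nm \<mu> (h n) \<le> b"
  shows "g \<in> sqint \<mu>" "nm \<mu> g \<le> b"
proof -
  have b0: "0 \<le> b" using b[of n0] order_trans[OF nm_nonneg] by auto
  have hn: "(\<integral>\<^sup>+x. ennreal ((h n x)\<^sup>2) \<partial>\<mu>) = ennreal ((nm \<mu> (h n))\<^sup>2)" for n
    using h[of n] by (subst nn_integral_eq_integral) (auto simp: nm_sq_int sqint_def)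
  have "(\<integral>\<^sup>+x. ennreal ((g x)\<^sup>2) \<partial>\<mu>) = (\<integral>\<^sup>+x. liminf (\<lambda>n. ennreal ((h n x)\<^sup>2)) \<partial>\<mu>)"
  proof (rule nn_integral_cong_AE)
    show "AE x in \<mu>. ennreal ((g x)\<^sup>2) = liminf (\<lambda>n. ennreal ((h n x)\<^sup>2))"
      using lim
    proof eventually_elim
      case (elim x)
      have "(\<lambda>n. ennreal ((h n x)\<^sup>2)) \<longlonglongrightarrow> ennreal ((g x)\<^sup>2)"
        using elim by (intro tendsto_ennrealI tendsto_power)
      then show ?case using lim_imp_Liminf[OF trivial_limit_sequentially] by metis
    qed
  qed
  also have "\<dots> \<le> liminf (\<lambda>n. \<integral>\<^sup>+x. ennreal ((h n x)\<^sup>2) \<partial>\<mu>)"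
    using h by (intro nn_integral_liminf) (auto simp: sqint_def)
  also have "\<dots> \<le> ennreal (b\<^sup>2)"
  proof (rule Liminf_le)
    show "\<forall>\<^sub>F n in sequentially. (\<integral>\<^sup>+x. ennreal ((h n x)\<^sup>2) \<partial>\<mu>) \<le> ennreal (b\<^sup>2)"
      using b by (auto simp: hn eventually_sequentially intro!: exI[of _ n0] ennreal_leI power_mono)
  qed simp
  finally have le: "(\<integral>\<^sup>+x. ennreal ((g x)\<^sup>2) \<partial>\<mu>) \<le> ennreal (b\<^sup>2)" .
  have int: "integrable \<mu> (\<lambda>x. (g x)\<^sup>2)"
    using g le by (intro integrableI_nonneg) (auto intro: le_less_trans)
  then show gs: "g \<in> sqint \<mu>" using g by (simp add: sqint_def)
  have "ennreal ((nm \<mu> g)\<^sup>2) \<le> ennreal (b\<^sup>2)"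
    using le int by (simp add: nm_sq_int nn_integral_eq_integral)
  then have "(nm \<mu> g)\<^sup>2 \<le> b\<^sup>2" by simp
  then show "nm \<mu> g \<le> b" using b0 by (rule power2_le_imp_le)
qed

text \<open>The theorem of Riesz and Fischer: a sequence that is Cauchy in the square mean is Cauchy in \<open>L\<^sup>1\<close>, hence has an
  almost everywhere convergent subsequence, and Fatou's lemma identifies its limit as the limit in the square mean.\<close>

lemma (in prob_space) sqint_complete:
  assumes f: "\<And>n. f n \<in> sqint M"
    and cauchy: "\<And>e. e > 0 \<Longrightarrow> \<exists>n0. \<forall>n\<ge>n0. \<forall>m\<ge>n0. nm M (\<lambda>x. f n x - f m x) < e"
  obtains g where "g \<in> sqint M" "(\<lambda>n. nm M (\<lambda>x. f n x - g x)) \<longlonglongrightarrow> 0"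
proof -
  have L1: "\<exists>N. \<forall>i\<ge>N. \<forall>j\<ge>N. LINT x|M. norm (f i x - f j x) < e" if e: "e > 0" for e
  proof -
    obtain n0 where n0: "\<forall>n\<ge>n0. \<forall>m\<ge>n0. nm M (\<lambda>x. f n x - f m x) < e"
      using cauchy[OF e] by blast
    show ?thesis
    proof (intro exI[of _ n0] allI impI)
      fix i j assume "i \<ge> n0" "j \<ge> n0"
      then show "LINT x|M. norm (f i x - f j x) < e"
        using sqint_L1_le[OF sqint_diff[OF f f], of i j] n0 by (auto intro: le_less_trans)
    qed
  qed
  obtain r where r: "strict_mono r" "AE x in M. Cauchy (\<lambda>i. f (r i) x)"
    by (rule cauchy_L1_AE_cauchy_subseq[of M f])
      (use L1 f sqint_integrable in auto)
  define g where "g x = lim (\<lambda>i. f (r i) x)" for x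
  have gm: "g \<in> borel_measurable M"
    unfolding g_def using f by (intro borel_measurable_lim_metric) (auto simp: sqint_def)
  have conv: "AE x in M. (\<lambda>i. f (r i) x) \<longlonglongrightarrow> g x"
    using r(2) by eventually_elim (auto simp: g_def convergent_LIMSEQ_iff[symmetric] real_Cauchy_convergent)
  have key: "(\<lambda>x. f n x - g x) \<in> sqint M \<and> nm M (\<lambda>x. f n x - g x) \<le> e"
    if n: "\<forall>n\<ge>n0. \<forall>m\<ge>n0. nm M (\<lambda>x. f n x - f m x) < e" "n \<ge> n0" for n n0 e
  proof -
    have c: "AE x in M. (\<lambda>i. f n x - f (r i) x) \<longlonglongrightarrow> f n x - g x"
      using conv by eventually_elim (auto intro: tendsto_intros)
    have b: "nm M (\<lambda>x. f n x - f (r i) x) \<le> e" if "i \<ge> n0" for i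
      using n seq_suble[OF r(1), of i] that by (auto intro!: less_imp_le)
    show ?thesis
      using nm_le_of_AE_limit[where h = "\<lambda>i x. f n x - f (r i) x", OF sqint_diff[OF f f] _ c b] gm f[of n]
      by (auto simp: sqint_def)
  qed
  obtain n1 where n1: "\<forall>n\<ge>n1. \<forall>m\<ge>n1. nm M (\<lambda>x. f n x - f m x) < 1" using cauchy[of 1] by auto
  have "(\<lambda>x. f n1 x - (f n1 x - g x)) \<in> sqint M"
    using sqint_diff[OF f[of n1] conjunct1[OF key[OF n1 order_refl]]] .
  then have g: "g \<in> sqint M" by simp
  moreover have "(\<lambda>n. nm M (\<lambda>x. f n x - g x)) \<longlonglongrightarrow> 0"
  proof (rule LIMSEQ_I)
    fix e :: real assume "e > 0"
    then obtain n0 where n0: "\<forall>n\<ge>n0. \<forall>m\<ge>n0. nm M (\<lambda>x. f n x - f m x) < e/2" using cauchy[of "e/2"] by auto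
    show "\<exists>n0. \<forall>n\<ge>n0. norm (nm M (\<lambda>x. f n x - g x) - 0) < e"
      using key[OF n0] \<open>e > 0\<close> by (intro exI[of _ n0]) force
  qed
  ultimately show ?thesis by (rule that)
qed

lemma ip_tendsto:
  assumes f: "\<And>n. f n \<in> sqint \<mu>" and g: "g \<in> sqint \<mu>" and h: "h \<in> sqint \<mu>"
    and lim: "(\<lambda>n. nm \<mu> (\<lambda>x. f n x - g x)) \<longlonglongrightarrow> 0"
  shows "(\<lambda>n. ip \<mu> (f n) h) \<longlonglongrightarrow> ip \<mu> g h"
proof -
  have "(\<lambda>n. ip \<mu> (f n) h - ip \<mu> g h) \<longlonglongrightarrow> 0"
  proof (rule Lim_null_comparison)
    show "\<forall>\<^sub>F n in sequentially. norm (ip \<mu> (f n) h - ip \<mu> g h) \<le> nm \<mu> (\<lambda>x. f n x - g x) * nm \<mu> h"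
      using ip_cauchy_schwarz[OF sqint_diff[OF f g] h] f g h by (intro always_eventually) (simp add: ip_diff_left)
    show "(\<lambda>n. nm \<mu> (\<lambda>x. f n x - g x) * nm \<mu> h) \<longlonglongrightarrow> 0"
      using tendsto_mult_right[OF lim, of "nm \<mu> h"] by simp
  qed
  then show ?thesis by (simp add: LIM_zero_iff)
qed

lemma nm_tendsto:
  assumes f: "\<And>n. f n \<in> sqint \<mu>" and g: "g \<in> sqint \<mu>"
    and lim: "(\<lambda>n. nm \<mu> (\<lambda>x. f n x - g x)) \<longlonglongrightarrow> 0"
  shows "(\<lambda>n. nm \<mu> (f n)) \<longlonglongrightarrow> nm \<mu> g"
proof -
  have "(\<lambda>n. nm \<mu> (f n) - nm \<mu> g) \<longlonglongrightarrow> 0"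
  proof (rule Lim_null_comparison[OF _ lim])
    have "\<bar>nm \<mu> (f n) - nm \<mu> g\<bar> \<le> nm \<mu> (\<lambda>x. f n x - g x)" for n
      using nm_le_add_diff[OF f[of n] g] nm_le_add_diff[OF g f[of n]] nm_minus_commute[of \<mu> "f n" g] by linarith
    then show "\<forall>\<^sub>F n in sequentially. norm (nm \<mu> (f n) - nm \<mu> g) \<le> nm \<mu> (\<lambda>x. f n x - g x)"
      by (intro always_eventually) simp
  qed
  then show ?thesis by (simp add: LIM_zero_iff)
qed

subsection \<open>Orthonormal sequences\<close>

text \<open>Eigenvalues are counted from \<open>1\<close>, so nothing is said about \<open>e 0\<close>.\<close>

definition onseq :: "'a measure \<Rightarrow> (nat \<Rightarrow> 'a \<Rightarrow> real) \<Rightarrow> bool" where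
  "onseq \<mu> e \<longleftrightarrow> (\<forall>j\<ge>1. e j \<in> sqint \<mu>) \<and>
     (\<forall>i\<ge>1. \<forall>j\<ge>1. ip \<mu> (e i) (e j) = (if i = j then 1 else 0))"

lemma onseq_sqint: "onseq \<mu> e \<Longrightarrow> j \<ge> 1 \<Longrightarrow> e j \<in> sqint \<mu>"
  by (simp add: onseq_def)

lemma onseq_ip: "onseq \<mu> e \<Longrightarrow> i \<ge> 1 \<Longrightarrow> j \<ge> 1 \<Longrightarrow> ip \<mu> (e i) (e j) = (if i = j then 1 else 0)"
  by (simp add: onseq_def)

lemma orthonormal_ip_combination:
  assumes "finite I" "\<And>i. i \<in> I \<Longrightarrow> e i \<in> sqint \<mu>"
    "\<And>i j. i \<in> I \<Longrightarrow> j \<in> I \<Longrightarrow> ip \<mu> (e i) (e j) = (if i = j then 1 else 0)"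
  shows "ip \<mu> (\<lambda>x. \<Sum>i\<in>I. a i * e i x) (\<lambda>x. \<Sum>i\<in>I. b i * e i x) = (\<Sum>i\<in>I. a i * b i)"
proof -
  have "ip \<mu> (\<lambda>x. \<Sum>i\<in>I. a i * e i x) (\<lambda>x. \<Sum>i\<in>I. b i * e i x)
      = (\<Sum>i\<in>I. a i * (\<Sum>j\<in>I. b j * ip \<mu> (e i) (e j)))"
    using assms(2) by (simp add: ip_simps sqint_intros)
  also have "\<dots> = (\<Sum>i\<in>I. a i * (\<Sum>j\<in>I. if i = j then b j else 0))"
    using assms(3) by (intro sum.cong arg_cong2[where f = "(*)"]) auto
  also have "\<dots> = (\<Sum>i\<in>I. a i * b i)"
    using assms(1) by (simp add: sum.delta)
  finally show ?thesis .
qed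

text \<open>Pythagoras for the orthogonal projection onto a finite orthonormal family.\<close>

lemma orthonormal_residual:
  assumes "finite I" "\<And>i. i \<in> I \<Longrightarrow> e i \<in> sqint \<mu>"
    "\<And>i j. i \<in> I \<Longrightarrow> j \<in> I \<Longrightarrow> ip \<mu> (e i) (e j) = (if i = j then 1 else 0)"
    and f: "f \<in> sqint \<mu>"
  shows "(nm \<mu> (\<lambda>x. f x - (\<Sum>i\<in>I. ip \<mu> f (e i) * e i x)))\<^sup>2 = (nm \<mu> f)\<^sup>2 - (\<Sum>i\<in>I. (ip \<mu> f (e i))\<^sup>2)"
proof -
  let ?s = "\<lambda>x. \<Sum>i\<in>I. ip \<mu> f (e i) * e i x"
  have s: "?s \<in> sqint \<mu>" using assms by (intro sqint_sum sqint_scale) auto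
  have fs: "ip \<mu> f ?s = (\<Sum>i\<in>I. (ip \<mu> f (e i))\<^sup>2)"
    using assms by (simp add: ip_simps sqint_intros power2_eq_square)
  have ss: "ip \<mu> ?s ?s = (\<Sum>i\<in>I. (ip \<mu> f (e i))\<^sup>2)"
    using orthonormal_ip_combination[OF assms(1-3)] by (simp add: power2_eq_square)
  show ?thesis by (simp add: nm_sq ip_diff_self[OF f s] fs ss)
qed

lemma onseq_residual:
  assumes "onseq \<mu> e" "f \<in> sqint \<mu>"
  shows "(nm \<mu> (\<lambda>x. f x - (\<Sum>i=1..n. ip \<mu> f (e i) * e i x)))\<^sup>2
    = (nm \<mu> f)\<^sup>2 - (\<Sum>i=1..n. (ip \<mu> f (e i))\<^sup>2)"
  using assms by (intro orthonormal_residual) (auto simp: onseq_def)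

lemma onseq_bessel:
  assumes "onseq \<mu> e" "f \<in> sqint \<mu>"
  shows "(\<Sum>i=1..n. (ip \<mu> f (e i))\<^sup>2) \<le> (nm \<mu> f)\<^sup>2"
  using onseq_residual[OF assms, of n]
    zero_le_power2[of "nm \<mu> (\<lambda>x. f x - (\<Sum>i=1..n. ip \<mu> f (e i) * e i x))"] by linarith

text \<open>By Bessel's inequality the sums of the squared coefficients converge, so the partial sums are Cauchy; their limit is the
  orthogonal projection of \<open>f\<close> onto the closed span of the sequence.\<close>

lemma (in prob_space) onseq_projection:
  assumes e: "onseq M e" and f: "f \<in> sqint M"
  obtains p where "p \<in> sqint M"
    "(\<lambda>n. nm M (\<lambda>x. (\<Sum>i=1..n. ip M f (e i) * e i x) - p x)) \<longlonglongrightarrow> 0"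
    "\<And>j. j \<ge> 1 \<Longrightarrow> ip M p (e j) = ip M f (e j)"
proof -
  let ?s = "\<lambda>n x. \<Sum>i=1..n. ip M f (e i) * e i x"
  let ?a = "\<lambda>n. \<Sum>i=1..n. (ip M f (e i))\<^sup>2"
  have s: "?s n \<in> sqint M" for n using e by (intro sqint_sum sqint_scale) (auto simp: onseq_def)
  have inc: "incseq ?a"
    by (intro incseq_SucI) auto
  have "bdd_above (range ?a)" using onseq_bessel[OF e f] by (auto intro!: bdd_aboveI)
  then have "convergent ?a" using inc by (metis Bseq_mono_convergent LIMSEQ_incseq_SUP convergentI)
  then have Ca: "Cauchy ?a" by (rule convergent_Cauchy)
  have dist: "(nm M (\<lambda>x. ?s n x - ?s m x))\<^sup>2 = ?a n - ?a m" if "m \<le> n" for n m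
  proof -
    have "(\<lambda>x. ?s n x - ?s m x) = (\<lambda>x. \<Sum>i\<in>{m+1..n}. ip M f (e i) * e i x)"
    proof
      fix x
      have "?s n x = ?s m x + (\<Sum>i\<in>{m+1..n}. ip M f (e i) * e i x)"
        using that sum.ub_add_nat[of 1 m "\<lambda>i. ip M f (e i) * e i x" "n - m"] by simp
      then show "?s n x - ?s m x = (\<Sum>i\<in>{m+1..n}. ip M f (e i) * e i x)" by simp
    qed
    moreover have "?a n = ?a m + (\<Sum>i\<in>{m+1..n}. (ip M f (e i))\<^sup>2)"
      using that sum.ub_add_nat[of 1 m "\<lambda>i. (ip M f (e i))\<^sup>2" "n - m"] by simp
    moreover have "(nm M (\<lambda>x. \<Sum>i\<in>{m+1..n}. ip M f (e i) * e i x))\<^sup>2 = (\<Sum>i\<in>{m+1..n}. ip M f (e i) * ip M f (e i))"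
      unfolding nm_sq using e by (intro orthonormal_ip_combination) (auto simp: onseq_def)
    ultimately show ?thesis by (simp add: power2_eq_square)
  qed
  have cau: "\<exists>n0. \<forall>n\<ge>n0. \<forall>m\<ge>n0. nm M (\<lambda>x. ?s n x - ?s m x) < r" if r: "r > 0" for r
  proof -
    obtain n0 where n0: "\<forall>n\<ge>n0. \<forall>m\<ge>n0. norm (?a n - ?a m) < r\<^sup>2"
      using CauchyD[OF Ca, of "r\<^sup>2"] r by auto
    have *: "nm M (\<lambda>x. ?s n x - ?s m x) < r" if nm: "n \<ge> n0" "m \<ge> n0" "m \<le> n" for n m
    proof (rule power2_less_imp_less)
      have "norm (?a n - ?a m) < r\<^sup>2" using n0 nm(1,2) by blast
      then have "?a n - ?a m < r\<^sup>2" unfolding real_norm_def by linarith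
      then show "(nm M (\<lambda>x. ?s n x - ?s m x))\<^sup>2 < r\<^sup>2"
        unfolding dist[OF nm(3)] .
    qed (use r in simp)
    show ?thesis
    proof (intro exI[of _ n0] allI impI)
      fix n m assume "n \<ge> n0" "m \<ge> n0"
      then show "nm M (\<lambda>x. ?s n x - ?s m x) < r"
        using *[of n m] *[of m n] nm_minus_commute[of M "?s n" "?s m"] by (cases "m \<le> n") auto
    qed
  qed
  obtain p where p: "p \<in> sqint M" "(\<lambda>n. nm M (\<lambda>x. ?s n x - p x)) \<longlonglongrightarrow> 0"
    using sqint_complete[of ?s, OF s cau] by blast
  have "ip M p (e j) = ip M f (e j)" if j: "j \<ge> 1" for j
  proof -
    have "(\<lambda>n. ip M (?s n) (e j)) \<longlonglongrightarrow> ip M p (e j)"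
      using ip_tendsto[OF s p(1) onseq_sqint[OF e j] p(2)] .
    moreover have "ip M (?s n) (e j) = ip M f (e j)" if "n \<ge> j" for n
    proof -
      have "ip M (?s n) (e j) = (\<Sum>i=1..n. ip M f (e i) * ip M (e i) (e j))"
        using e j by (subst ip_sum_left) (auto simp: ip_scale_left onseq_def intro: sqint_scale)
      also have "\<dots> = (\<Sum>i=1..n. if i = j then ip M f (e j) else 0)"
        using e j by (intro sum.cong) (auto simp: onseq_ip)
      finally show ?thesis using that j by simp
    qed
    then have "(\<lambda>n. ip M (?s n) (e j)) \<longlonglongrightarrow> ip M f (e j)"
      by (intro tendsto_eventually) (auto simp: eventually_sequentially)
    ultimately show ?thesis by (rule LIMSEQ_unique)
  qed
  then show ?thesis using that p by blast
qed

text \<open>The residual \<open>r\<close> of the projection \<open>p\<close> of \<open>f\<close> is orthogonal to \<open>p\<close>; if it is orthogonal to \<open>f\<close> as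
  well, then \<open>\<langle>r, r\<rangle> = \<langle>r, f\<rangle> - \<langle>r, p\<rangle> = 0\<close>. The sequence itself need not be complete, which matters because
  eigenfunctions of a covariance operator may have a nontrivial complement.\<close>

lemma (in prob_space) onseq_parseval:
  assumes e: "onseq M e" and f: "f \<in> sqint M"
    and orth: "\<And>r. r \<in> sqint M \<Longrightarrow> (\<And>j. j \<ge> 1 \<Longrightarrow> ip M r (e j) = 0) \<Longrightarrow> ip M r f = 0"
  shows "(\<lambda>n. \<Sum>i=1..n. (ip M f (e i))\<^sup>2) \<longlonglongrightarrow> (nm M f)\<^sup>2"
proof -
  let ?s = "\<lambda>n x. \<Sum>i=1..n. ip M f (e i) * e i x"
  have s: "?s n \<in> sqint M" for n using e by (intro sqint_sum sqint_scale) (auto simp: onseq_def)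
  obtain p where p: "p \<in> sqint M" "(\<lambda>n. nm M (\<lambda>x. ?s n x - p x)) \<longlonglongrightarrow> 0"
    "\<And>j. j \<ge> 1 \<Longrightarrow> ip M p (e j) = ip M f (e j)"
    using onseq_projection[OF e f] by blast
  define r where "r = (\<lambda>x. f x - p x)"
  have r: "r \<in> sqint M" using f p by (simp add: r_def sqint_diff)
  have re: "ip M r (e j) = 0" if "j \<ge> 1" for j
    using f p e that by (simp add: r_def ip_diff_left onseq_def)
  have rf: "ip M r f = 0" by (rule orth[OF r re])
  have "(\<lambda>n. ip M (?s n) r) \<longlonglongrightarrow> ip M p r" by (rule ip_tendsto[OF s p(1) r p(2)])
  moreover have "ip M (?s n) r = 0" for n
  proof -
    have "ip M (?s n) r = (\<Sum>i=1..n. ip M f (e i) * ip M (e i) r)"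
      using e r by (subst ip_sum_left) (auto simp: ip_scale_left onseq_def intro: sqint_scale)
    also have "\<dots> = 0" using re by (intro sum.neutral) (auto simp: ip_commute[of M _ r])
    finally show ?thesis .
  qed
  ultimately have pr: "ip M p r = 0" using LIMSEQ_unique[of "\<lambda>n. 0::real"] by simp
  have "ip M r r = ip M r f - ip M r p"
    using ip_diff_right[OF f p(1) r] by (simp only: r_def[symmetric])
  then have "ip M r r = 0"
    using pr rf ip_commute[of M r p] by simp
  then have "nm M r = 0" by (simp add: nm_sq[symmetric])
  then have r0: "AE x in M. f x = p x" using nm_eq_0_iff[OF r] by (simp add: r_def)
  have "(nm M (\<lambda>x. f x - ?s n x))\<^sup>2 = (nm M (\<lambda>x. ?s n x - p x))\<^sup>2" for n
  proof -
    have "nm M (\<lambda>x. f x - ?s n x) = nm M (\<lambda>x. p x - ?s n x)"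
      using r0 f p(1) s[of n] by (intro nm_cong_AE) (auto simp: sqint_def)
    then show ?thesis by (simp add: nm_minus_commute)
  qed
  then have "(\<lambda>n. (nm M (\<lambda>x. f x - ?s n x))\<^sup>2) \<longlonglongrightarrow> 0"
    using tendsto_power[OF p(2), of 2] by simp
  then have "(\<lambda>n. (nm M f)\<^sup>2 - ((nm M f)\<^sup>2 - (\<Sum>i=1..n. (ip M f (e i))\<^sup>2))) \<longlonglongrightarrow> (nm M f)\<^sup>2 - 0"
    unfolding onseq_residual[OF e f] by (intro tendsto_diff tendsto_const)
  then show ?thesis by simp
qed

text \<open>Finite linear combinations of a family, encoded by lists of coefficients and indices; the index type may be infinite,
  and a combination of two combinations is an appended list.\<close>

definition span_comb :: "('i \<Rightarrow> 'a \<Rightarrow> real) \<Rightarrow> (real \<times> 'i) list \<Rightarrow> 'a \<Rightarrow> real" where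
  "span_comb b xs t = (\<Sum>(c, i)\<leftarrow>xs. c * b i t)"

lemma span_comb_sqint:
  assumes "\<And>i. b i \<in> sqint \<mu>"
  shows "span_comb b xs \<in> sqint \<mu>"
proof (induction xs)
  case (Cons a xs)
  then show ?case using sqint_add[OF sqint_scale[OF assms[of "snd a"], of "fst a"] Cons.IH]
    by (simp add: span_comb_def[abs_def] case_prod_beta)
qed (simp add: span_comb_def[abs_def])

lemma span_comb_append: "span_comb b (xs @ ys) t = span_comb b xs t + span_comb b ys t"
  by (simp add: span_comb_def)

lemma span_comb_scale: "span_comb b (map (\<lambda>(d, i). (c * d, i)) xs) t = c * span_comb b xs t"
  by (induction xs) (auto simp: span_comb_def algebra_simps)

text \<open>A sequence of combinations whose distance to \<open>f\<close> approaches the infimum is Cauchy by the parallelogram law.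
  The difference of \<open>f\<close> and its limit is orthogonal to every \<open>b i\<close>, because otherwise adding a small multiple of
  \<open>b i\<close> would decrease the distance below the infimum; hence it is null.\<close>

lemma (in prob_space) total_imp_dense:
  assumes b: "\<And>i. b i \<in> sqint M"
    and total: "\<And>h. h \<in> sqint M \<Longrightarrow> (\<And>i. ip M h (b i) = 0) \<Longrightarrow> AE x in M. h x = 0"
    and f: "f \<in> sqint M" and r: "r > 0"
  obtains xs where "nm M (\<lambda>x. f x - span_comb b xs x) < r"
proof -
  define S where "S = range (\<lambda>xs. (nm M (\<lambda>x. f x - span_comb b xs x))\<^sup>2)"
  define d where "d = Inf S"
  have Sne: "S \<noteq> {}" by (simp add: S_def)
  have Sbdd: "bdd_below S" by (auto simp: S_def intro: bdd_belowI[of _ 0])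
  have dle: "d \<le> (nm M (\<lambda>x. f x - span_comb b xs x))\<^sup>2" for xs
    unfolding d_def using Sbdd by (intro cInf_lower) (auto simp: S_def)
  have d0: "0 \<le> d" unfolding d_def using Sne by (intro cInf_greatest) (auto simp: S_def)
  have "\<exists>xs. (nm M (\<lambda>x. f x - span_comb b xs x))\<^sup>2 < d + 1 / Suc n" for n
    using cInf_lessD[OF Sne, of "d + 1 / Suc n"] by (auto simp: d_def S_def)
  then obtain xs where xs: "\<And>n. (nm M (\<lambda>x. f x - span_comb b (xs n) x))\<^sup>2 < d + 1 / Suc n" by metis
  define s where "s n = span_comb b (xs n)" for n
  have s: "s n \<in> sqint M" for n by (simp add: s_def span_comb_sqint[OF b])
  have par: "(nm M (\<lambda>x. s n x - s m x))\<^sup>2 \<le> 2 / Suc n + 2 / Suc m" for n m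
  proof -
    let ?u = "\<lambda>x. f x - s n x" and ?v = "\<lambda>x. f x - s m x"
    let ?h = "map (\<lambda>(d, i). ((1/2) * d, i)) (xs n @ xs m)"
    have u: "?u \<in> sqint M" and v: "?v \<in> sqint M" using f s by (auto intro: sqint_diff)
    have hh: "span_comb b ?h x = (1/2) * (s n x + s m x)" for x
      by (simp only: span_comb_scale span_comb_append s_def)
    have "(\<lambda>x. f x - span_comb b ?h x) = (\<lambda>x. (1/2) * (?u x + ?v x))"
      unfolding hh by (rule ext) (simp add: field_simps)
    then have "(nm M (\<lambda>x. f x - span_comb b ?h x))\<^sup>2 = (nm M (\<lambda>x. (1/2) * (?u x + ?v x)))\<^sup>2"
      by simp
    also have "\<dots> = (1/4) * ip M (\<lambda>x. ?u x + ?v x) (\<lambda>x. ?u x + ?v x)"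
      by (simp only: nm_scale power_mult_distrib nm_sq) (simp add: power2_eq_square)
    finally have "4 * d \<le> ip M (\<lambda>x. ?u x + ?v x) (\<lambda>x. ?u x + ?v x)"
      using dle[of ?h] by linarith
    moreover have "(nm M (\<lambda>x. s n x - s m x))\<^sup>2 = ip M (\<lambda>x. ?v x - ?u x) (\<lambda>x. ?v x - ?u x)"
      by (simp add: nm_sq)
    ultimately show ?thesis
      using xs[of n] xs[of m] unfolding ip_diff_self[OF v u] ip_add_self[OF u v]
      by (simp add: nm_sq s_def[symmetric] ip_commute[of M ?v ?u])
  qed
  have cau: "\<exists>n0. \<forall>n\<ge>n0. \<forall>m\<ge>n0. nm M (\<lambda>x. s n x - s m x) < e" if e: "e > 0" for e
  proof -
    obtain n0 :: nat where n0: "4 / e\<^sup>2 < n0" using reals_Archimedean2 by blast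
    have n0': "4 / Suc n0 < e\<^sup>2" using n0 e by (simp add: field_simps) (smt (verit) zero_less_power)
    show ?thesis
    proof (intro exI[of _ n0] allI impI)
      fix n m assume nm: "n \<ge> n0" "m \<ge> n0"
      have "2 / Suc n \<le> 2 / Suc n0" "2 / Suc m \<le> 2 / Suc n0" using nm by (auto intro!: divide_left_mono)
      then have "(nm M (\<lambda>x. s n x - s m x))\<^sup>2 < e\<^sup>2" using par[of n m] n0' by linarith
      then show "nm M (\<lambda>x. s n x - s m x) < e" using e by (intro power2_less_imp_less[of _ e]) auto
    qed
  qed
  obtain p where p: "p \<in> sqint M" "(\<lambda>n. nm M (\<lambda>x. s n x - p x)) \<longlonglongrightarrow> 0"
    using sqint_complete[of s, OF s cau] by blast
  let ?h = "\<lambda>x. f x - p x"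
  have h: "?h \<in> sqint M" using f p by (simp add: sqint_diff)
  have limd: "(\<lambda>n. nm M (\<lambda>x. (f x - s n x) - ?h x)) \<longlonglongrightarrow> 0"
  proof -
    have "nm M (\<lambda>x. (f x - s n x) - ?h x) = nm M (\<lambda>x. s n x - p x)" for n
      using nm_minus_commute[of M p "s n"] by simp
    then show ?thesis using p(2) by simp
  qed
  have orth: "ip M ?h (b i) = 0" for i
  proof -
    have key: "0 \<le> -2 * c * ip M ?h (b i) + c\<^sup>2 * ip M (b i) (b i)" for c
    proof -
      have 1: "d \<le> (nm M (\<lambda>x. f x - s n x))\<^sup>2 - 2 * c * ip M (\<lambda>x. f x - s n x) (b i) + c\<^sup>2 * ip M (b i) (b i)" for n
      proof -
        have fs: "(\<lambda>x. f x - s n x) \<in> sqint M" and cb: "(\<lambda>x. c * b i x) \<in> sqint M"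
          using f s b by (auto intro: sqint_intros)
        have "d \<le> (nm M (\<lambda>x. f x - span_comb b (xs n @ [(c, i)]) x))\<^sup>2" by (rule dle)
        also have "(\<lambda>x. f x - span_comb b (xs n @ [(c, i)]) x) = (\<lambda>x. (f x - s n x) - c * b i x)"
          unfolding span_comb_append s_def by (rule ext) (simp add: span_comb_def)
        also have "(nm M (\<lambda>x. (f x - s n x) - c * b i x))\<^sup>2
            = ip M (\<lambda>x. f x - s n x) (\<lambda>x. f x - s n x) - 2 * ip M (\<lambda>x. f x - s n x) (\<lambda>x. c * b i x)
              + ip M (\<lambda>x. c * b i x) (\<lambda>x. c * b i x)"
          unfolding nm_sq by (rule ip_diff_self[OF fs cb])
        finally show ?thesis
          unfolding nm_sq ip_scale_left ip_scale_right by (simp only: power2_eq_square mult.assoc)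
      qed
      have 2: "d \<le> d + 1 / Suc n - 2 * c * ip M (\<lambda>x. f x - s n x) (b i) + c\<^sup>2 * ip M (b i) (b i)" for n
        using 1[of n] xs[of n] by (simp add: s_def[symmetric])
      have "(\<lambda>n. d + 1 / Suc n - 2 * c * ip M (\<lambda>x. f x - s n x) (b i) + c\<^sup>2 * ip M (b i) (b i))
        \<longlonglongrightarrow> d + 0 - 2 * c * ip M ?h (b i) + c\<^sup>2 * ip M (b i) (b i)"
        using lim_1_over_n[THEN LIMSEQ_Suc] ip_tendsto[OF sqint_diff[OF f s] h b limd, of i]
        by (intro tendsto_intros) (auto simp: o_def)
      then have "d \<le> d + 0 - 2 * c * ip M ?h (b i) + c\<^sup>2 * ip M (b i) (b i)"
        by (rule LIMSEQ_le_const) (use 2 in blast)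
      then show ?thesis by simp
    qed
    define B where "B = ip M (b i) (b i) + 1"
    have B: "B > 0" unfolding B_def by (smt (verit) ip_self_nonneg)
    let ?q = "ip M ?h (b i)"
    have "0 \<le> -2 * (?q / B) * ?q + (?q / B)\<^sup>2 * ip M (b i) (b i)" by (rule key)
    also have "\<dots> \<le> -2 * (?q / B) * ?q + (?q / B)\<^sup>2 * B"
      by (intro add_left_mono mult_left_mono) (auto simp: B_def)
    also have "\<dots> = - (?q\<^sup>2 / B)" using B by (simp add: power2_eq_square field_simps)
    finally have "?q\<^sup>2 / B \<le> 0" by simp
    then show "?q = 0" using B by (simp add: divide_le_0_iff)
  qed
  have "AE x in M. f x - p x = 0" by (rule total[OF h orth])
  then have "nm M ?h = 0" using nm_eq_0_iff[OF h] by simp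
  have "(\<lambda>n. nm M (\<lambda>x. f x - s n x)) \<longlonglongrightarrow> 0"
    using nm_tendsto[OF sqint_diff[OF f s] h limd] \<open>nm M ?h = 0\<close> by simp
  then obtain n where "nm M (\<lambda>x. f x - s n x) < r"
    using LIMSEQ_D[of "\<lambda>n. nm M (\<lambda>x. f x - s n x)" 0 r] r by auto
  then show ?thesis using that[of "xs n"] by (simp add: s_def)
qed

section \<open>The unit interval\<close>

lemma prob_space_unit_leb: "prob_space unit_leb"
  unfolding unit_leb_def by (intro prob_spaceI) (simp add: space_restrict_space emeasure_restrict_space)

interpretation unit_leb: prob_space unit_leb
  by (rule prob_space_unit_leb)

interpretation unit_leb2: pair_prob_space unit_leb unit_leb ..

abbreviation leb2 :: "(real \<times> real) measure" where
  "leb2 \<equiv> unit_leb \<Otimes>\<^sub>M unit_leb"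

lemma space_unit_leb [simp]: "space unit_leb = {0..1}"
  by (simp add: unit_leb_def space_restrict_space)

lemma borel_measurable_unit_leb: "f \<in> borel_measurable borel \<Longrightarrow> f \<in> borel_measurable unit_leb"
  unfolding unit_leb_def by (intro measurable_restrict_space1) simp

lemma sets_unit_leb_subset: "A \<in> sets unit_leb \<Longrightarrow> A \<in> sets borel"
  by (auto simp: unit_leb_def sets_restrict_space)

text \<open>Indicators of initial segments with rational endpoints: a countable family that determines an integrable function.\<close>

definition initial_ind :: "rat \<Rightarrow> real \<Rightarrow> real" where
  "initial_ind q = indicator {..of_rat q}"

lemma measurable_initial_ind [measurable]: "initial_ind q \<in> borel_measurable unit_leb"
  unfolding initial_ind_def by (intro borel_measurable_unit_leb) simp

lemma initial_ind_sqint: "initial_ind q \<in> sqint unit_leb"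
  unfolding sqint_def using measurable_initial_ind[of q]
  by (auto simp: initial_ind_def power2_eq_square indicator_inter_arith[symmetric]
      intro!: unit_leb.integrable_const_bound[where B = 1])

text \<open>The positive and the negative part of \<open>h\<close> are densities of finite Borel measures. By right-continuity in the endpoint the
  two distribution functions agree at all reals, so the measures agree; but each part vanishes where the other is
  positive.\<close>

lemma integrable_eq_0_of_initial:
  assumes h: "integrable unit_leb h"
    and z: "\<And>q. (\<integral>t. h t * initial_ind q t \<partial>unit_leb) = 0"
  shows "AE t in unit_leb. h t = 0"
proof -
  have hm [measurable]: "h \<in> borel_measurable unit_leb" using h by auto
  have ind_m [measurable]: "indicator {..a} \<in> borel_measurable unit_leb" for a :: real
    by (intro borel_measurable_unit_leb) simp
  have za: "(\<integral>t. h t * indicator {..a} t \<partial>unit_leb) = 0" for a :: real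
  proof -
    have "\<exists>q. a < of_rat q \<and> of_rat q < a + 1 / Suc n" for n
      using of_rat_dense[of a "a + 1 / Suc n"] by simp
    then obtain q where q: "\<And>n. a < of_rat (q n)" "\<And>n. of_rat (q n) < a + 1 / Suc n" by metis
    have ql: "(\<lambda>n. of_rat (q n) :: real) \<longlonglongrightarrow> a"
    proof (rule tendsto_sandwich[of "\<lambda>n. a" _ _ "\<lambda>n. a + 1 / Suc n"])
      show "(\<lambda>n. a + 1 / Suc n) \<longlonglongrightarrow> a"
        using tendsto_add[OF tendsto_const LIMSEQ_inverse_real_of_nat, of a] by (simp add: inverse_eq_divide)
    qed (use q in \<open>auto intro!: always_eventually less_imp_le\<close>)
    have "(\<lambda>n. \<integral>t. h t * initial_ind (q n) t \<partial>unit_leb) \<longlonglongrightarrow> (\<integral>t. h t * indicator {..a} t \<partial>unit_leb)"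
    proof (rule integral_dominated_convergence[where w = "\<lambda>t. \<bar>h t\<bar>"])
      show "AE t in unit_leb. (\<lambda>n. h t * initial_ind (q n) t) \<longlonglongrightarrow> h t * indicator {..a} t"
      proof (rule AE_I2)
        fix t
        have "\<forall>\<^sub>F n in sequentially. initial_ind (q n) t = indicator {..a} t"
        proof (cases "t \<le> a")
          case True
          then have "t \<le> of_rat (q n)" for n using q(1)[of n] by simp
          then show ?thesis using True by (simp add: initial_ind_def)
        next
          case False
          then have "\<forall>\<^sub>F n in sequentially. of_rat (q n) < t" using order_tendstoD(2)[OF ql, of t] by simp
          then show ?thesis by eventually_elim (use False in \<open>simp add: initial_ind_def\<close>)
        qed
        then show "(\<lambda>n. h t * initial_ind (q n) t) \<longlonglongrightarrow> h t * indicator {..a} t"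
          by (intro tendsto_mult tendsto_const tendsto_eventually)
      qed
      show "AE t in unit_leb. norm (h t * initial_ind (q n) t) \<le> \<bar>h t\<bar>" for n
        by (auto simp: initial_ind_def indicator_def)
    qed (use h in auto)
    then show ?thesis using z LIMSEQ_unique[OF _ tendsto_const] by simp
  qed
  have iA: "integrable unit_leb (\<lambda>t. g t * indicator A t)"
    if g: "integrable unit_leb g" and A: "A \<in> sets borel" for g :: "real \<Rightarrow> real" and A
  proof (rule Bochner_Integration.integrable_bound[OF g])
    have "indicator A \<in> borel_measurable unit_leb" using A by (intro borel_measurable_unit_leb) simp
    then show "(\<lambda>t. g t * indicator A t) \<in> borel_measurable unit_leb"
      using g by (intro borel_measurable_times) auto
  qed (auto simp: indicator_def)
  define D where "D = (\<lambda>g::real \<Rightarrow> real. distr (density unit_leb (\<lambda>t. ennreal (g t))) borel (\<lambda>t. t))"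
  have idm: "(\<lambda>t. t) \<in> measurable (density unit_leb (\<lambda>t. ennreal (g t))) borel" for g
    using borel_measurable_unit_leb[of "\<lambda>t. t"] by simp
  have em: "emeasure (D g) A = ennreal (\<integral>t. g t * indicator A t \<partial>unit_leb)"
    if g: "integrable unit_leb g" "\<And>t. 0 \<le> g t" and A: "A \<in> sets borel" for g A
  proof -
    have AU: "A \<inter> {0..1} \<in> sets unit_leb" using A by (auto simp: unit_leb_def sets_restrict_space)
    have "emeasure (D g) A = emeasure (density unit_leb (\<lambda>t. ennreal (g t))) (A \<inter> {0..1})"
      unfolding D_def using A idm[of g] by (simp add: emeasure_distr)
    also have "\<dots> = (\<integral>\<^sup>+t. ennreal (g t) * indicator (A \<inter> {0..1}) t \<partial>unit_leb)"
      using AU g by (intro emeasure_density) auto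
    also have "\<dots> = (\<integral>\<^sup>+t. ennreal (g t * indicator A t) \<partial>unit_leb)"
      by (intro nn_integral_cong) (auto simp: indicator_def)
    also have "\<dots> = ennreal (\<integral>t. g t * indicator A t \<partial>unit_leb)"
    proof (rule nn_integral_eq_integral)
      show "integrable unit_leb (\<lambda>t. g t * indicator A t)" by (rule iA[OF g(1) A])
      show "AE t in unit_leb. 0 \<le> g t * indicator A t" using g(2) by simp
    qed
    finally show ?thesis .
  qed
  define hp where "hp t = max 0 (h t)" for t
  define hn where "hn t = max 0 (- h t)" for t
  have ip: "integrable unit_leb hp" and "integrable unit_leb hn"
    unfolding hp_def hn_def using h by (auto intro!: integrable_max)
  note int = this
  have nn: "\<And>t. 0 \<le> hp t" "\<And>t. 0 \<le> hn t" by (auto simp: hp_def hn_def)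
  have fb: "finite_borel_measure (D g)" if g: "integrable unit_leb g" "\<And>t. 0 \<le> g t" for g
    using em[OF g, of UNIV] by (intro finite_borel_measure.intro finite_measureI finite_borel_measure_axioms.intro)
      (auto simp: D_def)
  have "cdf (D hp) a = cdf (D hn) a" for a
  proof -
    have "(\<integral>t. hp t * indicator {..a} t \<partial>unit_leb) - (\<integral>t. hn t * indicator {..a} t \<partial>unit_leb)
      = (\<integral>t. hp t * indicator {..a} t - hn t * indicator {..a} t \<partial>unit_leb)"
      using int by (intro Bochner_Integration.integral_diff[symmetric] iA) auto
    also have "\<dots> = (\<integral>t. h t * indicator {..a} t \<partial>unit_leb)"
      by (intro Bochner_Integration.integral_cong) (auto simp: hp_def hn_def indicator_def)
    also have "\<dots> = 0" by (rule za)
    finally show ?thesis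
      using em[OF int(1) nn(1), of "{..a}"] em[OF int(2) nn(2), of "{..a}"]
      by (simp add: cdf_def measure_def)
  qed
  then have "D hp = D hn" by (intro cdf_unique' fb int nn ext)
  then have eqA: "(\<integral>t. hp t * indicator A t \<partial>unit_leb) = (\<integral>t. hn t * indicator A t \<partial>unit_leb)"
    if "A \<in> sets borel" for A
  proof -
    have "ennreal (\<integral>t. hp t * indicator A t \<partial>unit_leb) = ennreal (\<integral>t. hn t * indicator A t \<partial>unit_leb)"
      using em[OF int(1) nn(1) that] em[OF int(2) nn(2) that] \<open>D hp = D hn\<close> by simp
    then show ?thesis using nn by (subst (asm) ennreal_inj) (auto intro!: Bochner_Integration.integral_nonneg)
  qed
  have pos: "AE t in unit_leb. g t = 0"
    if g: "integrable unit_leb g" "\<And>t. 0 \<le> g t" and z: "(\<integral>t. g t * indicator {t \<in> space unit_leb. 0 < g t} t \<partial>unit_leb) = 0"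
    for g :: "real \<Rightarrow> real"
  proof -
    have "(\<integral>t. g t * indicator {t \<in> space unit_leb. 0 < g t} t \<partial>unit_leb) = (\<integral>t. g t \<partial>unit_leb)"
      using g(2) by (intro Bochner_Integration.integral_cong) (auto simp: indicator_def not_less intro: order_antisym)
    then show ?thesis using integral_nonneg_eq_0_iff_AE[OF g(1)] g(2) z by simp
  qed
  have "AE t in unit_leb. hp t = 0"
  proof (rule pos[OF int(1) nn(1)])
    have "{t \<in> space unit_leb. 0 < hp t} \<in> sets unit_leb" using int(1) by measurable
    then have "(\<integral>t. hp t * indicator {t \<in> space unit_leb. 0 < hp t} t \<partial>unit_leb)
      = (\<integral>t. hn t * indicator {t \<in> space unit_leb. 0 < hp t} t \<partial>unit_leb)"
      by (intro eqA sets_unit_leb_subset)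
    also have "\<dots> = (\<integral>t. 0 \<partial>unit_leb)"
      by (intro Bochner_Integration.integral_cong) (auto simp: indicator_def hp_def hn_def)
    finally show "(\<integral>t. hp t * indicator {t \<in> space unit_leb. 0 < hp t} t \<partial>unit_leb) = 0" by simp
  qed
  moreover have "AE t in unit_leb. hn t = 0"
  proof (rule pos[OF int(2) nn(2)])
    have "{t \<in> space unit_leb. 0 < hn t} \<in> sets unit_leb" using int(2) by measurable
    then have "(\<integral>t. hn t * indicator {t \<in> space unit_leb. 0 < hn t} t \<partial>unit_leb)
      = (\<integral>t. hp t * indicator {t \<in> space unit_leb. 0 < hn t} t \<partial>unit_leb)"
      by (intro eqA[symmetric] sets_unit_leb_subset)
    also have "\<dots> = (\<integral>t. 0 \<partial>unit_leb)"
      by (intro Bochner_Integration.integral_cong) (auto simp: indicator_def hp_def hn_def)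
    finally show "(\<integral>t. hn t * indicator {t \<in> space unit_leb. 0 < hn t} t \<partial>unit_leb) = 0" by simp
  qed
  ultimately show ?thesis by eventually_elim (auto simp: hp_def hn_def max_def split: if_splits)
qed

lemma initial_ind_total:
  assumes "h \<in> sqint unit_leb" "\<And>q. ip unit_leb h (initial_ind q) = 0"
  shows "AE t in unit_leb. h t = 0"
  using assms by (intro integrable_eq_0_of_initial unit_leb.sqint_integrable) (auto simp: ip_def)

lemma initial_ind_dense:
  assumes "f \<in> sqint unit_leb" "r > 0"
  obtains xs where "nm unit_leb (\<lambda>x. f x - span_comb initial_ind xs x) < r"
  by (rule unit_leb.total_imp_dense[of initial_ind f r])
    (use assms initial_ind_sqint initial_ind_total that in blast)+

lemma sqint_eq_0I:
  assumes "h \<in> sqint unit_leb" "\<And>g. g \<in> sqint unit_leb \<Longrightarrow> ip unit_leb h g = 0"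
  shows "AE t in unit_leb. h t = 0"
  using assms initial_ind_sqint by (intro initial_ind_total) auto

subsection \<open>Weak sequential compactness\<close>

text \<open>A diagonal sequence converges against each of the countably many initial indicators; their linear combinations are
  dense, and boundedness carries the convergence over to all square-integrable functions.\<close>

lemma weak_subsequence:
  assumes f: "\<And>n. f n \<in> sqint unit_leb" and B: "\<And>n. nm unit_leb (f n) \<le> B"
  obtains r :: "nat \<Rightarrow> nat" where "strict_mono r"
    "\<And>h. h \<in> sqint unit_leb \<Longrightarrow> convergent (\<lambda>n. ip unit_leb (f (r n)) h)"
proof -
  let ?b = "\<lambda>n. initial_ind (from_nat n)"
  let ?P = "\<lambda>n s. convergent (\<lambda>k. ip unit_leb (f (s k)) (?b n))"
  have B0: "0 \<le> B" using B[of 0] by (meson nm_nonneg order_trans)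
  have bound: "\<bar>ip unit_leb (f n) h\<bar> \<le> B * nm unit_leb h" if "h \<in> sqint unit_leb" for n h
    using ip_cauchy_schwarz[OF f[of n] that] mult_right_mono[OF B[of n] nm_nonneg[of unit_leb h]] by linarith
  interpret subseqs ?P
  proof (unfold subseqs_def, intro allI impI)
    fix n :: nat and s :: "nat \<Rightarrow> nat"
    have "bounded (range (\<lambda>k. ip unit_leb (f (s k)) (?b n)))"
      using bound[OF initial_ind_sqint] by (intro boundedI[where B = "B * nm unit_leb (?b n)"]) auto
    then obtain l r where "strict_mono r" "((\<lambda>k. ip unit_leb (f (s k)) (?b n)) \<circ> r) \<longlonglongrightarrow> l"
      using bounded_imp_convergent_subsequence by blast
    then show "\<exists>r'. strict_mono r' \<and> ?P n (s \<circ> r')"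
      by (auto simp: o_def convergent_def)
  qed
  have conv: "convergent (\<lambda>k. ip unit_leb (f (diagseq k)) (?b n))" for n
  proof -
    have "?P n (diagseq \<circ> ((+) (Suc n)))"
    proof (rule diagseq_holds)
      fix r s :: "nat \<Rightarrow> nat" and n
      assume "strict_mono r" "?P n s"
      then show "?P n (s \<circ> r)"
        using LIMSEQ_subseq_LIMSEQ[of "\<lambda>k. ip unit_leb (f (s k)) (?b n)" _ r] by (auto simp: convergent_def o_def)
    qed
    then have "convergent (\<lambda>k. ip unit_leb (f (diagseq (k + Suc n))) (?b n))" by (simp add: o_def add.commute)
    then show ?thesis by (simp only: convergent_ignore_initial_segment[where f = "\<lambda>k. ip unit_leb (f (diagseq k)) (?b n)"])
  qed
  have conv_q: "convergent (\<lambda>k. ip unit_leb (f (diagseq k)) (initial_ind q))" for q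
    using conv[of "to_nat q"] by simp
  have conv_span: "convergent (\<lambda>k. ip unit_leb (f (diagseq k)) (span_comb initial_ind xs))" for xs
  proof (induction xs)
    case Nil
    then show ?case by (simp add: span_comb_def[abs_def] ip_def convergent_const)
  next
    case (Cons a xs)
    have "ip unit_leb (f (diagseq k)) (span_comb initial_ind (a # xs))
      = fst a * ip unit_leb (f (diagseq k)) (initial_ind (snd a)) + ip unit_leb (f (diagseq k)) (span_comb initial_ind xs)" for k
    proof -
      have "span_comb initial_ind (a # xs) = (\<lambda>t. fst a * initial_ind (snd a) t + span_comb initial_ind xs t)"
        by (simp add: span_comb_def[abs_def] case_prod_beta)
      then show ?thesis
        using f initial_ind_sqint span_comb_sqint[of initial_ind unit_leb]
        by (simp add: ip_add_right sqint_scale ip_scale_right)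
    qed
    then show ?case using Cons.IH conv_q
      by (auto intro!: convergent_add convergent_mult convergent_const)
  qed
  have "convergent (\<lambda>k. ip unit_leb (f (diagseq k)) h)" if h: "h \<in> sqint unit_leb" for h
  proof (rule Cauchy_convergent, rule CauchyI)
    fix e :: real assume e: "e > 0"
    define r where "r = (e / 3) / (B + 1)"
    have r: "r > 0" using e B0 by (simp add: r_def)
    obtain xs where xs: "nm unit_leb (\<lambda>x. h x - span_comb initial_ind xs x) < r"
      using initial_ind_dense[OF h r] by blast
    let ?g = "span_comb initial_ind xs"
    have g: "?g \<in> sqint unit_leb" by (simp add: span_comb_sqint initial_ind_sqint)
    have d: "\<bar>ip unit_leb (f n) h - ip unit_leb (f n) ?g\<bar> < e / 3" for n
    proof -
      have "\<bar>ip unit_leb (f n) h - ip unit_leb (f n) ?g\<bar> \<le> B * nm unit_leb (\<lambda>x. h x - ?g x)"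
        using bound[OF sqint_diff[OF h g], of n] ip_diff_right[OF h g f[of n]] by simp
      also have "\<dots> \<le> (B + 1) * nm unit_leb (\<lambda>x. h x - ?g x)" by (simp add: algebra_simps)
      also have "\<dots> < (B + 1) * r" using xs B0 by (intro mult_strict_left_mono) auto
      also have "\<dots> = e / 3"
      proof -
        have "B + 1 \<noteq> 0" using B0 by simp
        from nonzero_mult_div_cancel_left[OF this, of "e / 3"] show ?thesis
          by (simp only: r_def times_divide_eq_right)
      qed
      finally show ?thesis .
    qed
    have "Cauchy (\<lambda>k. ip unit_leb (f (diagseq k)) ?g)" using conv_span by (rule convergent_Cauchy)
    then obtain N where N: "\<forall>m\<ge>N. \<forall>n\<ge>N. norm (ip unit_leb (f (diagseq m)) ?g - ip unit_leb (f (diagseq n)) ?g) < e / 3"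
      using CauchyD[of "\<lambda>k. ip unit_leb (f (diagseq k)) ?g" "e / 3"] e by auto
    show "\<exists>N. \<forall>m\<ge>N. \<forall>n\<ge>N. norm (ip unit_leb (f (diagseq m)) h - ip unit_leb (f (diagseq n)) h) < e"
    proof (intro exI[of _ N] allI impI)
      fix m n assume "m \<ge> N" "n \<ge> N"
      then have "\<bar>ip unit_leb (f (diagseq m)) ?g - ip unit_leb (f (diagseq n)) ?g\<bar> < e / 3" using N by auto
      then show "norm (ip unit_leb (f (diagseq m)) h - ip unit_leb (f (diagseq n)) h) < e"
        using d[of "diagseq m"] d[of "diagseq n"] unfolding real_norm_def by linarith
    qed
  qed
  then show ?thesis using that subseq_diagseq by blast
qed

section \<open>Kernels\<close>

text \<open>The kernel \<open>f \<otimes> g\<close> of rank one.\<close>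

definition tens :: "('a \<Rightarrow> real) \<Rightarrow> ('b \<Rightarrow> real) \<Rightarrow> 'a \<times> 'b \<Rightarrow> real" where
  "tens f g p = f (fst p) * g (snd p)"

text \<open>The integral operator with kernel \<open>k\<close>. The two variables may range over different spaces, so that the expectation of
  a random function is the special case of the constant function \<open>1\<close> on the probability space.\<close>

definition kapp :: "'b measure \<Rightarrow> ('a \<times> 'b \<Rightarrow> real) \<Rightarrow> ('b \<Rightarrow> real) \<Rightarrow> 'a \<Rightarrow> real" where
  "kapp \<mu> k g t = ip \<mu> (\<lambda>s. k (t, s)) g"

lemma kernel_op_eq: "kernel_op c = kapp unit_leb (case_prod c)"
  by (simp add: fun_eq_iff kernel_op_def kapp_def ip_def)

context pair_prob_space
begin

lemma measurable_section: "k \<in> borel_measurable (M1 \<Otimes>\<^sub>M M2) \<Longrightarrow> x \<in> space M1 \<Longrightarrow> (\<lambda>y. k (x, y)) \<in> borel_measurable M2"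
  by (rule measurable_compose[OF measurable_Pair1'])

lemma sqint_section:
  assumes "k \<in> sqint (M1 \<Otimes>\<^sub>M M2)"
  shows "AE x in M1. (\<lambda>y. k (x, y)) \<in> sqint M2"
  using AE_integrable_fst'[OF sqint_integrable_sq[OF assms]] AE_space
proof eventually_elim
  case (elim x)
  then show ?case using measurable_section[of k x] assms by (simp add: sqint_def)
qed

lemma ip_sections:
  assumes "k \<in> sqint (M1 \<Otimes>\<^sub>M M2)" "k' \<in> sqint (M1 \<Otimes>\<^sub>M M2)"
  shows "integrable M1 (\<lambda>x. ip M2 (\<lambda>y. k (x, y)) (\<lambda>y. k' (x, y)))"
    and "ip (M1 \<Otimes>\<^sub>M M2) k k' = (\<integral>x. ip M2 (\<lambda>y. k (x, y)) (\<lambda>y. k' (x, y)) \<partial>M1)"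
  using integrable_fst'[OF sqint_integrable_mult[OF assms]] integral_fst'[OF sqint_integrable_mult[OF assms]]
  by (simp_all add: ip_def)

lemma nm_sections:
  assumes "k \<in> sqint (M1 \<Otimes>\<^sub>M M2)"
  shows "integrable M1 (\<lambda>x. (nm M2 (\<lambda>y. k (x, y)))\<^sup>2)"
    and "(nm (M1 \<Otimes>\<^sub>M M2) k)\<^sup>2 = (\<integral>x. (nm M2 (\<lambda>y. k (x, y)))\<^sup>2 \<partial>M1)"
  using ip_sections[OF assms assms] by (simp_all add: nm_sq)

lemma sqint_pairI:
  assumes k: "k \<in> borel_measurable (M1 \<Otimes>\<^sub>M M2)" and s: "AE x in M1. (\<lambda>y. k (x, y)) \<in> sqint M2"
    and i: "integrable M1 (\<lambda>x. (nm M2 (\<lambda>y. k (x, y)))\<^sup>2)"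
  shows "k \<in> sqint (M1 \<Otimes>\<^sub>M M2)"
proof -
  have "integrable (M1 \<Otimes>\<^sub>M M2) (\<lambda>p. (k p)\<^sup>2)"
    using k s i by (intro Fubini_integrable) (auto simp: nm_sq_int sqint_def)
  then show ?thesis using k by (simp add: sqint_def)
qed

lemma measurable_nm_section:
  assumes k: "k \<in> borel_measurable (M1 \<Otimes>\<^sub>M M2)"
  shows "(\<lambda>x. nm M2 (\<lambda>y. k (x, y))) \<in> borel_measurable M1"
proof -
  have "(\<lambda>x. \<integral>y. (k (x, y))\<^sup>2 \<partial>M2) \<in> borel_measurable M1"
    using k by (intro M2.borel_measurable_lebesgue_integral) (auto simp: case_prod_beta)
  then show ?thesis by (simp add: nm_def[abs_def])
qed

lemma measurable_kapp:
  assumes k: "k \<in> borel_measurable (M1 \<Otimes>\<^sub>M M2)" and g [measurable]: "g \<in> borel_measurable M2"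
  shows "kapp M2 k g \<in> borel_measurable M1"
proof -
  have "(\<lambda>x. \<integral>y. k (x, y) * g y \<partial>M2) \<in> borel_measurable M1"
    using k by (intro M2.borel_measurable_lebesgue_integral) (auto simp: case_prod_beta)
  then show ?thesis by (simp add: kapp_def[abs_def] ip_def)
qed

lemma tens_measurable:
  assumes [measurable]: "f \<in> borel_measurable M1" "g \<in> borel_measurable M2"
  shows "tens f g \<in> borel_measurable (M1 \<Otimes>\<^sub>M M2)"
  unfolding tens_def[abs_def] by measurable

lemma tens_sqint:
  assumes f: "f \<in> sqint M1" and g: "g \<in> sqint M2"
  shows "tens f g \<in> sqint (M1 \<Otimes>\<^sub>M M2)"
proof (rule sqint_pairI)
  show "tens f g \<in> borel_measurable (M1 \<Otimes>\<^sub>M M2)" using f g by (intro tens_measurable) (auto simp: sqint_def)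
  show "AE x in M1. (\<lambda>y. tens f g (x, y)) \<in> sqint M2" using g by (simp add: tens_def sqint_scale)
  show "integrable M1 (\<lambda>x. (nm M2 (\<lambda>y. tens f g (x, y)))\<^sup>2)"
    using f by (simp add: tens_def nm_scale power_mult_distrib sqint_integrable_sq)
qed

lemma ip_tens_right:
  assumes k: "k \<in> sqint (M1 \<Otimes>\<^sub>M M2)" and f: "f \<in> sqint M1" and g: "g \<in> sqint M2"
  shows "ip (M1 \<Otimes>\<^sub>M M2) k (tens f g) = ip M1 (kapp M2 k g) f"
  unfolding ip_sections(2)[OF k tens_sqint[OF f g]]
  by (simp add: tens_def ip_scale_right) (simp add: ip_def kapp_def mult.commute)

lemma ip_tens_tens:
  assumes f: "f \<in> sqint M1" "f' \<in> sqint M1" and g: "g \<in> sqint M2" "g' \<in> sqint M2"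
  shows "ip (M1 \<Otimes>\<^sub>M M2) (tens f g) (tens f' g') = ip M1 f f' * ip M2 g g'"
proof -
  have "kapp M2 (tens f g) g' = (\<lambda>x. ip M2 g g' * f x)"
    by (simp add: fun_eq_iff kapp_def tens_def ip_scale_left)
  then show ?thesis using ip_tens_right[OF tens_sqint[OF f(1) g(1)] f(2) g(2)] by (simp add: ip_scale_left)
qed

lemma nm_tens:
  assumes f: "f \<in> sqint M1" and g: "g \<in> sqint M2"
  shows "nm (M1 \<Otimes>\<^sub>M M2) (tens f g) = nm M1 f * nm M2 g"
proof -
  have "(nm (M1 \<Otimes>\<^sub>M M2) (tens f g))\<^sup>2 = (nm M1 f * nm M2 g)\<^sup>2"
    using ip_tens_tens[OF f f g g] by (simp add: nm_sq power_mult_distrib)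
  then show ?thesis by (simp add: power2_eq_iff_nonneg)
qed

lemma kapp_bound:
  assumes k: "k \<in> sqint (M1 \<Otimes>\<^sub>M M2)" and g: "g \<in> sqint M2"
  shows "AE x in M1. (kapp M2 k g x)\<^sup>2 \<le> (nm M2 (\<lambda>y. k (x, y)))\<^sup>2 * (nm M2 g)\<^sup>2"
  using sqint_section[OF k]
proof eventually_elim
  case (elim x)
  then show ?case using ip_cauchy_schwarz_sq[OF elim g] by (simp add: kapp_def nm_sq)
qed

lemma kapp_sqint:
  assumes k: "k \<in> sqint (M1 \<Otimes>\<^sub>M M2)" and g: "g \<in> sqint M2"
  shows "kapp M2 k g \<in> sqint M1"
proof -
  have "(\<lambda>x. nm M2 (\<lambda>y. k (x, y)) * nm M2 g) \<in> sqint M1"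
    using nm_sections(1)[OF k] measurable_nm_section[of k] k by (auto simp: sqint_def power_mult_distrib)
  moreover have "kapp M2 k g \<in> borel_measurable M1"
    using k g by (intro measurable_kapp) (auto simp: sqint_def)
  moreover have "AE x in M1. \<bar>kapp M2 k g x\<bar> \<le> \<bar>nm M2 (\<lambda>y. k (x, y)) * nm M2 g\<bar>"
    using kapp_bound[OF assms] by eventually_elim (metis abs_le_square_iff power_mult_distrib)
  ultimately show ?thesis by (rule sqint_bound)
qed

lemma nm_kapp_le:
  assumes k: "k \<in> sqint (M1 \<Otimes>\<^sub>M M2)" and g: "g \<in> sqint M2"
  shows "nm M1 (kapp M2 k g) \<le> nm (M1 \<Otimes>\<^sub>M M2) k * nm M2 g"
proof (rule power2_le_imp_le)
  have "(nm M1 (kapp M2 k g))\<^sup>2 \<le> (\<integral>x. (nm M2 (\<lambda>y. k (x, y)))\<^sup>2 * (nm M2 g)\<^sup>2 \<partial>M1)"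
    unfolding nm_sq_int[of M1] using kapp_bound[OF assms] sqint_integrable_sq[OF kapp_sqint[OF assms]] nm_sections(1)[OF k]
    by (intro integral_mono_AE) auto
  also have "\<dots> = (nm (M1 \<Otimes>\<^sub>M M2) k * nm M2 g)\<^sup>2"
    by (simp add: nm_sections(2)[OF k] power_mult_distrib)
  finally show "(nm M1 (kapp M2 k g))\<^sup>2 \<le> (nm (M1 \<Otimes>\<^sub>M M2) k * nm M2 g)\<^sup>2" .
qed simp

lemma kapp_diff_kernel:
  assumes "k \<in> sqint (M1 \<Otimes>\<^sub>M M2)" "k' \<in> sqint (M1 \<Otimes>\<^sub>M M2)" "g \<in> sqint M2"
  shows "AE x in M1. kapp M2 (\<lambda>p. k p - k' p) g x = kapp M2 k g x - kapp M2 k' g x"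
  using sqint_section[OF assms(1)] sqint_section[OF assms(2)]
  by eventually_elim (simp add: kapp_def ip_diff_left assms)

lemma AE_pairI:
  assumes k [measurable]: "k \<in> borel_measurable (M1 \<Otimes>\<^sub>M M2)" "k' \<in> borel_measurable (M1 \<Otimes>\<^sub>M M2)"
    and s: "AE x in M1. AE y in M2. k (x, y) = (k' (x, y) :: real)"
  shows "AE p in M1 \<Otimes>\<^sub>M M2. k p = k' p"
proof -
  have "{p \<in> space (M1 \<Otimes>\<^sub>M M2). k p = k' p} \<in> sets (M1 \<Otimes>\<^sub>M M2)" by measurable
  then show ?thesis using s by (intro AE_pair_measure) auto
qed

end

definition ktransp :: "('a \<times> 'b \<Rightarrow> real) \<Rightarrow> 'b \<times> 'a \<Rightarrow> real" where
  "ktransp k p = k (snd p, fst p)"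

lemma (in pair_prob_space) ktransp_sqint:
  assumes "k \<in> sqint (M1 \<Otimes>\<^sub>M M2)"
  shows "ktransp k \<in> sqint (M2 \<Otimes>\<^sub>M M1)" "nm (M2 \<Otimes>\<^sub>M M1) (ktransp k) = nm (M1 \<Otimes>\<^sub>M M2) k"
proof -
  have m: "(\<lambda>p. (k p)\<^sup>2) \<in> borel_measurable (M1 \<Otimes>\<^sub>M M2)" using assms by (auto simp: sqint_def)
  have "(\<lambda>p. (snd p, fst p)) \<in> measurable (M2 \<Otimes>\<^sub>M M1) (M1 \<Otimes>\<^sub>M M2)" by simp
  from measurable_compose[OF this sqint_measurable[OF assms]]
  have "ktransp k \<in> borel_measurable (M2 \<Otimes>\<^sub>M M1)" by (simp add: ktransp_def[abs_def])
  then show "ktransp k \<in> sqint (M2 \<Otimes>\<^sub>M M1)"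
    using integrable_product_swap[OF sqint_integrable_sq[OF assms]]
    by (simp add: sqint_def ktransp_def[abs_def] case_prod_beta')
  have "(\<integral>p. (ktransp k p)\<^sup>2 \<partial>(M2 \<Otimes>\<^sub>M M1)) = (\<integral>p. (k p)\<^sup>2 \<partial>(M1 \<Otimes>\<^sub>M M2))"
    unfolding integral_product_swap[OF m, symmetric] ktransp_def case_prod_beta' ..
  then show "nm (M2 \<Otimes>\<^sub>M M1) (ktransp k) = nm (M1 \<Otimes>\<^sub>M M2) k"
    unfolding nm_def by simp
qed

text \<open>The kernel of the composition of the operators with kernels \<open>k\<close> and \<open>h\<close>, see \<open>ip_kcomp_tens\<close>.\<close>

definition kcomp :: "(real \<times> real \<Rightarrow> real) \<Rightarrow> (real \<times> real \<Rightarrow> real) \<Rightarrow> real \<times> real \<Rightarrow> real" where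
  "kcomp k h p = (\<integral>r. k (fst p, r) * h (r, snd p) \<partial>unit_leb)"

lemma kcomp_eq_ip: "kcomp k h (t, s) = ip unit_leb (\<lambda>r. k (t, r)) (\<lambda>r. h (r, s))"
  by (simp add: kcomp_def ip_def)

lemma kcomp_measurable:
  assumes [measurable]: "k \<in> borel_measurable leb2" "h \<in> borel_measurable leb2"
  shows "kcomp k h \<in> borel_measurable leb2"
  unfolding kcomp_def[abs_def]
  by (intro unit_leb.borel_measurable_lebesgue_integral) (simp add: case_prod_beta')

lemma sqint_section_snd:
  assumes "h \<in> sqint leb2"
  shows "AE s in unit_leb. (\<lambda>r. h (r, s)) \<in> sqint unit_leb"
    and "integrable unit_leb (\<lambda>s. (nm unit_leb (\<lambda>r. h (r, s)))\<^sup>2)"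
    and "(\<integral>s. (nm unit_leb (\<lambda>r. h (r, s)))\<^sup>2 \<partial>unit_leb) = (nm leb2 h)\<^sup>2"
  using unit_leb2.sqint_section[OF unit_leb2.ktransp_sqint(1)[OF assms]]
    unit_leb2.nm_sections[OF unit_leb2.ktransp_sqint(1)[OF assms]] unit_leb2.ktransp_sqint(2)[OF assms]
  by (simp_all add: ktransp_def)

text \<open>The Cauchy--Schwarz inequality in the middle variable bounds the composition by the product of the norms of the
  sections, a kernel of rank one.\<close>

lemma kcomp_sqint:
  assumes k: "k \<in> sqint leb2" and h: "h \<in> sqint leb2"
  shows "kcomp k h \<in> sqint leb2" "nm leb2 (kcomp k h) \<le> nm leb2 k * nm leb2 h"
proof -
  have m: "kcomp k h \<in> borel_measurable leb2" using k h by (intro kcomp_measurable) (auto simp: sqint_def)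
  let ?b = "tens (\<lambda>t. nm unit_leb (\<lambda>r. k (t, r))) (\<lambda>s. nm unit_leb (\<lambda>r. h (r, s)))"
  have f: "(\<lambda>t. nm unit_leb (\<lambda>r. k (t, r))) \<in> sqint unit_leb"
    using unit_leb2.nm_sections(1)[OF k] unit_leb2.measurable_nm_section[of k] k by (auto simp: sqint_def)
  have g: "(\<lambda>s. nm unit_leb (\<lambda>r. h (r, s))) \<in> sqint unit_leb"
    using sqint_section_snd(2)[OF h] unit_leb2.measurable_nm_section[of "ktransp h"] unit_leb2.ktransp_sqint(1)[OF h]
    by (auto simp: sqint_def ktransp_def)
  have b: "?b \<in> sqint leb2" by (rule unit_leb2.tens_sqint[OF f g])
  have le: "AE p in leb2. \<bar>kcomp k h p\<bar> \<le> \<bar>?b p\<bar>"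
  proof -
    have "{p \<in> space leb2. \<bar>kcomp k h p\<bar> \<le> \<bar>?b p\<bar>} \<in> sets leb2" using m b by measurable
    moreover have "AE t in unit_leb. AE s in unit_leb. \<bar>kcomp k h (t, s)\<bar> \<le> \<bar>?b (t, s)\<bar>"
      using unit_leb2.sqint_section[OF k]
    proof eventually_elim
      case (elim t)
      show ?case using sqint_section_snd(1)[OF h]
      proof eventually_elim
        case (elim s)
        then show ?case using ip_cauchy_schwarz[OF \<open>(\<lambda>r. k (t, r)) \<in> sqint unit_leb\<close> elim]
          by (simp add: kcomp_eq_ip tens_def)
      qed
    qed
    ultimately show ?thesis by (intro unit_leb2.AE_pair_measure) auto
  qed
  show s: "kcomp k h \<in> sqint leb2" by (rule sqint_bound[OF b m le])
  have "(nm leb2 (kcomp k h))\<^sup>2 \<le> (nm leb2 ?b)\<^sup>2"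
    unfolding nm_sq_int using s b le
    by (intro integral_mono_AE sqint_integrable_sq) (auto simp: abs_le_square_iff)
  also have "nm leb2 ?b = nm leb2 k * nm leb2 h"
  proof -
    have "(nm leb2 ?b)\<^sup>2 = (nm leb2 k * nm leb2 h)\<^sup>2"
      using unit_leb2.nm_tens[OF f g] unit_leb2.nm_sections(2)[OF k] sqint_section_snd(3)[OF h]
      by (simp add: nm_sq_int[of unit_leb "\<lambda>t. nm unit_leb (\<lambda>r. _ t r)"] power_mult_distrib)
    then show ?thesis by (simp add: power2_eq_iff_nonneg)
  qed
  finally show "nm leb2 (kcomp k h) \<le> nm leb2 k * nm leb2 h"
    by (rule power2_le_imp_le) simp
qed

lemma kcomp_tens: "kcomp k (tens x y) = tens (kapp unit_leb k x) y"
  by (simp add: fun_eq_iff kcomp_def tens_def kapp_def ip_def mult.assoc[symmetric])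

lemma ktransp_tens: "ktransp (tens x y) = tens y x"
  by (simp add: fun_eq_iff ktransp_def tens_def)

lemma kcomp_sum_diff:
  assumes fin: "finite I" and k: "k \<in> sqint leb2" and h: "\<And>i. i \<in> I \<Longrightarrow> h i \<in> sqint leb2" and h': "h' \<in> sqint leb2"
  shows "AE p in leb2. kcomp k (\<lambda>p. c * (\<Sum>i\<in>I. h i p) - h' p) p = c * (\<Sum>i\<in>I. kcomp k (h i) p) - kcomp k h' p"
proof (rule unit_leb2.AE_pairI)
  show "kcomp k (\<lambda>p. c * (\<Sum>i\<in>I. h i p) - h' p) \<in> borel_measurable leb2"
    using k h h' sqint_measurable[OF sqint_diff[OF sqint_scale[OF sqint_sum] h'], of I h c] by (intro kcomp_measurable) (auto simp: sqint_def)
  have "(\<lambda>p. c * (\<Sum>i\<in>I. kcomp k (h i) p) - kcomp k h' p) \<in> sqint leb2"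
    using k h h' by (intro sqint_intros kcomp_sqint) auto
  then show "(\<lambda>p. c * (\<Sum>i\<in>I. kcomp k (h i) p) - kcomp k h' p) \<in> borel_measurable leb2" by auto
  show "AE x in unit_leb. AE y in unit_leb. kcomp k (\<lambda>p. c * (\<Sum>i\<in>I. h i p) - h' p) (x, y)
    = c * (\<Sum>i\<in>I. kcomp k (h i) (x, y)) - kcomp k h' (x, y)"
    using unit_leb2.sqint_section[OF k]
  proof eventually_elim
    case (elim t)
    have "AE s in unit_leb. \<forall>i\<in>I. (\<lambda>r. h i (r, s)) \<in> sqint unit_leb"
      using h sqint_section_snd(1) fin by (intro AE_finite_allI) auto
    then show ?case using sqint_section_snd(1)[OF h']
    proof eventually_elim
      case (elim s)
      then show ?case using \<open>(\<lambda>r. k (t, r)) \<in> sqint unit_leb\<close>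
        by (simp add: kcomp_eq_ip ip_diff_right ip_scale_right ip_sum_right sqint_intros)
    qed
  qed
qed

lemma ip_kcomp_tens:
  assumes k: "k \<in> sqint leb2" and h: "h \<in> sqint leb2" and f: "f \<in> sqint unit_leb" and g: "g \<in> sqint unit_leb"
  shows "ip leb2 (kcomp k h) (tens f g) = ip leb2 k (tens f (kapp unit_leb h g))"
proof -
  have swap: "AE t in unit_leb. kapp unit_leb (kcomp k h) g t = kapp unit_leb k (kapp unit_leb h g) t"
    using unit_leb2.sqint_section[OF k]
  proof eventually_elim
    case (elim t)
    have i: "integrable leb2 (\<lambda>p. h p * tens (\<lambda>r. k (t, r)) g p)"
      using elim g h by (intro sqint_integrable_mult unit_leb2.tens_sqint)
    have "kapp unit_leb k (kapp unit_leb h g) t = ip leb2 h (tens (\<lambda>r. k (t, r)) g)"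
      using unit_leb2.ip_tens_right[OF h elim g] by (simp add: kapp_def ip_commute)
    also have "\<dots> = (\<integral>s. (\<integral>r. h (r, s) * tens (\<lambda>r. k (t, r)) g (r, s) \<partial>unit_leb) \<partial>unit_leb)"
      using unit_leb2.integral_snd[of "\<lambda>r s. h (r, s) * tens (\<lambda>r. k (t, r)) g (r, s)"] i
      by (simp add: ip_def case_prod_beta')
    also have "\<dots> = kapp unit_leb (kcomp k h) g t"
      by (simp add: kapp_def kcomp_eq_ip tens_def) (simp add: ip_def mult_ac)
    finally show ?case by simp
  qed
  have "ip leb2 (kcomp k h) (tens f g) = ip unit_leb (kapp unit_leb (kcomp k h) g) f"
    by (rule unit_leb2.ip_tens_right[OF kcomp_sqint(1)[OF k h] f g])
  also have "\<dots> = ip unit_leb (kapp unit_leb k (kapp unit_leb h g)) f"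
    using f g swap kcomp_sqint(1)[OF k h] k h
    by (intro ip_cong_AE swap) (auto intro!: sqint_measurable unit_leb2.kapp_sqint)
  also have "\<dots> = ip leb2 k (tens f (kapp unit_leb h g))"
    using unit_leb2.ip_tens_right[OF k f unit_leb2.kapp_sqint[OF h g]] by simp
  finally show ?thesis .
qed

text \<open>Products with initial indicators in the second variable suffice. There are countably many of them, so almost every
  section is orthogonal to all of them at once.\<close>

lemma kernel_eq_0I:
  assumes k: "k \<in> sqint leb2"
    and z: "\<And>f g. f \<in> sqint unit_leb \<Longrightarrow> g \<in> sqint unit_leb \<Longrightarrow> ip leb2 k (tens f g) = 0"
  shows "AE p in leb2. k p = 0"
proof -
  have "AE t in unit_leb. kapp unit_leb k (initial_ind q) t = 0" for q
  proof (rule sqint_eq_0I)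
    show "kapp unit_leb k (initial_ind q) \<in> sqint unit_leb"
      by (rule unit_leb2.kapp_sqint[OF k initial_ind_sqint])
    show "ip unit_leb (kapp unit_leb k (initial_ind q)) f = 0" if "f \<in> sqint unit_leb" for f
      using z[OF that initial_ind_sqint] unit_leb2.ip_tens_right[OF k that initial_ind_sqint] by simp
  qed
  then have "AE t in unit_leb. \<forall>q. kapp unit_leb k (initial_ind q) t = 0" by (simp add: AE_all_countable)
  then have "AE t in unit_leb. AE s in unit_leb. k (t, s) = 0"
    using unit_leb2.sqint_section[OF k]
    by eventually_elim (auto intro!: initial_ind_total simp: kapp_def)
  then show ?thesis using k by (intro unit_leb2.AE_pairI) auto
qed

section \<open>Positive integral operators and their eigensystems\<close>

abbreviation sq01 :: "(real \<Rightarrow> real) set" where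
  "sq01 \<equiv> sqint unit_leb"

abbreviation ip01 :: "(real \<Rightarrow> real) \<Rightarrow> (real \<Rightarrow> real) \<Rightarrow> real" where
  "ip01 \<equiv> ip unit_leb"

abbreviation nm01 :: "(real \<Rightarrow> real) \<Rightarrow> real" where
  "nm01 \<equiv> nm unit_leb"

abbreviation op01 :: "(real \<times> real \<Rightarrow> real) \<Rightarrow> (real \<Rightarrow> real) \<Rightarrow> real \<Rightarrow> real" where
  "op01 \<equiv> kapp unit_leb"

lemmas op01_sqint = unit_leb2.kapp_sqint
lemmas nm_op01_le = unit_leb2.nm_kapp_le

lemma op01_combination:
  assumes k: "k \<in> sqint leb2" and f: "f \<in> sq01" and g: "g \<in> sq01"
  shows "AE t in unit_leb. op01 k (\<lambda>x. a * f x + b * g x) t = a * op01 k f t + b * op01 k g t"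
  using unit_leb2.sqint_section[OF k]
  by eventually_elim (simp add: kapp_def ip_add_right ip_scale_right sqint_scale f g)

lemma ip_op01_eq: "k \<in> sqint leb2 \<Longrightarrow> f \<in> sq01 \<Longrightarrow> g \<in> sq01 \<Longrightarrow> ip01 (op01 k f) g = ip leb2 k (tens g f)"
  by (simp add: unit_leb2.ip_tens_right)

lemma ip_op01_combination_left:
  assumes k: "k \<in> sqint leb2" and f: "f \<in> sq01" and g: "g \<in> sq01" and h: "h \<in> sq01"
  shows "ip01 (op01 k (\<lambda>x. a * f x + b * g x)) h = a * ip01 (op01 k f) h + b * ip01 (op01 k g) h"
proof -
  have fg: "(\<lambda>x. a * f x + b * g x) \<in> sq01" using f g by (intro sqint_intros)
  have s: "(\<lambda>t. a * op01 k f t + b * op01 k g t) \<in> sq01" using op01_sqint[OF k] f g by (intro sqint_intros)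
  have "ip01 (op01 k (\<lambda>x. a * f x + b * g x)) h = ip01 (\<lambda>t. a * op01 k f t + b * op01 k g t) h"
    by (rule ip_cong_AE) (use op01_sqint[OF k fg] s h op01_combination[OF k f g] in auto)
  then show ?thesis using op01_sqint[OF k] f g h by (simp add: ip_add_left ip_scale_left sqint_scale)
qed

text \<open>Compactness of Hilbert--Schmidt operators: \<open>op01 k f t\<close> is the inner product of \<open>f\<close> with the section \<open>k (t, \<cdot>)\<close>, so weak
  convergence gives pointwise convergence, which is dominated by the norms of the sections.\<close>

lemma op01_compact:
  assumes k: "k \<in> sqint leb2" and f: "\<And>n. f n \<in> sq01" and B: "\<And>n. nm01 (f n) \<le> B"
    and weak: "\<And>h. h \<in> sq01 \<Longrightarrow> convergent (\<lambda>n. ip01 (f n) h)"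
  obtains g where "g \<in> sq01" "(\<lambda>n. nm01 (\<lambda>t. op01 k (f n) t - g t)) \<longlonglongrightarrow> 0"
proof -
  define g where "g t = lim (\<lambda>n. op01 k (f n) t)" for t
  have Tm: "op01 k (f n) \<in> borel_measurable unit_leb" for n using op01_sqint[OF k f] by auto
  have gm: "g \<in> borel_measurable unit_leb"
    unfolding g_def using Tm by (intro borel_measurable_lim_metric)
  have conv: "AE t in unit_leb. (\<lambda>n. op01 k (f n) t) \<longlonglongrightarrow> g t"
    using unit_leb2.sqint_section[OF k]
  proof eventually_elim
    case (elim t)
    have "op01 k (f n) t = ip01 (f n) (\<lambda>s. k (t, s))" for n by (simp add: kapp_def ip_commute)
    then show ?case using weak[OF elim] by (simp add: g_def convergent_LIMSEQ_iff)
  qed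
  let ?w = "\<lambda>t. B * nm01 (\<lambda>s. k (t, s))"
  have B0: "0 \<le> B" using B[of 0] by (meson nm_nonneg order_trans)
  have le: "AE t in unit_leb. \<bar>op01 k (f n) t\<bar> \<le> ?w t" for n
    using unit_leb2.sqint_section[OF k]
  proof eventually_elim
    case (elim t)
    have "\<bar>op01 k (f n) t\<bar> \<le> nm01 (\<lambda>s. k (t, s)) * nm01 (f n)"
      using ip_cauchy_schwarz[OF elim f[of n]] by (simp add: kapp_def)
    also have "\<dots> \<le> nm01 (\<lambda>s. k (t, s)) * B" using B[of n] by (intro mult_left_mono) auto
    finally show ?case by (simp add: mult.commute)
  qed
  have le_all: "AE t in unit_leb. \<forall>n. \<bar>op01 k (f n) t\<bar> \<le> ?w t" using le by (simp add: AE_all_countable)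
  have gle: "AE t in unit_leb. \<bar>g t\<bar> \<le> ?w t"
    using conv le_all
  proof eventually_elim
    case (elim t)
    have "(\<lambda>n. \<bar>op01 k (f n) t\<bar>) \<longlonglongrightarrow> \<bar>g t\<bar>" using elim(1) by (rule tendsto_rabs)
    then show ?case by (rule LIMSEQ_le_const2) (use elim(2) in auto)
  qed
  have w: "?w \<in> sq01"
    using unit_leb2.nm_sections(1)[OF k] unit_leb2.measurable_nm_section[of k] k
    by (intro sqint_scale) (auto simp: sqint_def)
  have w2: "integrable unit_leb (\<lambda>t. (2 * ?w t)\<^sup>2)"
    using sqint_integrable_sq[OF sqint_scale[OF w, of 2]] .
  have gs: "g \<in> sq01"
    using gle B0 by (intro sqint_bound[OF w gm]) auto
  have "(\<lambda>n. \<integral>t. (op01 k (f n) t - g t)\<^sup>2 \<partial>unit_leb) \<longlonglongrightarrow> (\<integral>t. 0 \<partial>unit_leb)"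
  proof (rule integral_dominated_convergence[OF _ _ w2])
    show "AE t in unit_leb. (\<lambda>n. (op01 k (f n) t - g t)\<^sup>2) \<longlonglongrightarrow> 0"
      using conv
    proof eventually_elim
      case (elim t)
      have "(\<lambda>n. (op01 k (f n) t - g t)\<^sup>2) \<longlonglongrightarrow> (g t - g t)\<^sup>2"
        using elim by (intro tendsto_power tendsto_diff tendsto_const)
      then show ?case by simp
    qed
    show "AE t in unit_leb. norm ((op01 k (f n) t - g t)\<^sup>2) \<le> (2 * ?w t)\<^sup>2" for n
      using le[of n] gle
    proof eventually_elim
      case (elim t)
      then have "\<bar>op01 k (f n) t - g t\<bar> \<le> \<bar>2 * ?w t\<bar>" by linarith
      then have "(op01 k (f n) t - g t)\<^sup>2 \<le> (2 * ?w t)\<^sup>2" by (simp only: abs_le_square_iff)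
      then show ?case by simp
    qed
  qed (use Tm gm in auto)
  then have "(\<lambda>n. sqrt (\<integral>t. (op01 k (f n) t - g t)\<^sup>2 \<partial>unit_leb)) \<longlonglongrightarrow> sqrt 0"
    by (intro tendsto_real_sqrt) simp
  then have "(\<lambda>n. nm01 (\<lambda>t. op01 k (f n) t - g t)) \<longlonglongrightarrow> 0" by (simp add: nm_def)
  then show ?thesis using that gs by blast
qed

text \<open>Symmetry and positivity are formulated through the operator, hence are invariant under changes of the kernel on null
  sets.\<close>

definition psd_kernel :: "(real \<times> real \<Rightarrow> real) \<Rightarrow> bool" where
  "psd_kernel k \<longleftrightarrow> k \<in> sqint leb2 \<and>
     (\<forall>f\<in>sq01. \<forall>g\<in>sq01. ip01 (op01 k f) g = ip01 f (op01 k g)) \<and>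
     (\<forall>f\<in>sq01. 0 \<le> ip01 (op01 k f) f)"

lemma psd_kernelI:
  assumes "k \<in> sqint leb2"
    "\<And>f g. f \<in> sq01 \<Longrightarrow> g \<in> sq01 \<Longrightarrow> ip leb2 k (tens f g) = ip leb2 k (tens g f)"
    "\<And>f. f \<in> sq01 \<Longrightarrow> 0 \<le> ip leb2 k (tens f f)"
  shows "psd_kernel k"
  unfolding psd_kernel_def
proof (intro conjI ballI)
  fix f g assume fg: "f \<in> sq01" "g \<in> sq01"
  show "ip01 (op01 k f) g = ip01 f (op01 k g)"
    using assms fg by (simp add: ip_op01_eq ip_commute[of _ f])
  show "0 \<le> ip01 (op01 k f) f" using assms fg by (simp add: ip_op01_eq)
qed (rule assms(1))

text \<open>The discriminant of the nonnegative quadratic form in the coefficients of \<open>f\<close> and \<open>g\<close>.\<close>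

lemma psd_cauchy_schwarz:
  assumes k: "psd_kernel k" and f: "f \<in> sq01" and g: "g \<in> sq01"
  shows "(ip01 (op01 k f) g)\<^sup>2 \<le> ip01 (op01 k f) f * ip01 (op01 k g) g"
proof -
  have ks: "k \<in> sqint leb2" using k by (simp add: psd_kernel_def)
  let ?p = "ip01 (op01 k f) f" and ?q = "ip01 (op01 k f) g" and ?r = "ip01 (op01 k g) g"
  have gf: "ip01 (op01 k g) f = ?q"
    using k f g by (simp add: psd_kernel_def ip_commute[of _ g])
  have quad: "0 \<le> a\<^sup>2 * ?p + 2 * a * b * ?q + b\<^sup>2 * ?r" for a b
  proof -
    let ?h = "\<lambda>x. a * f x + b * g x"
    have h: "?h \<in> sq01" using f g by (intro sqint_intros)
    have "0 \<le> ip01 (op01 k ?h) ?h" using k h unfolding psd_kernel_def by blast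
    also have "\<dots> = a * ip01 (op01 k f) ?h + b * ip01 (op01 k g) ?h"
      by (rule ip_op01_combination_left[OF ks f g h])
    also have "\<dots> = a\<^sup>2 * ?p + 2 * a * b * ?q + b\<^sup>2 * ?r"
      using op01_sqint[OF ks] f g
      by (simp add: ip_add_right ip_scale_right sqint_scale gf power2_eq_square algebra_simps)
    finally show ?thesis .
  qed
  have p0: "0 \<le> ?p" "0 \<le> ?r" using k f g unfolding psd_kernel_def by blast+
  show ?thesis
  proof (cases "?r = 0")
    case True
    have "?q = 0"
    proof (rule ccontr)
      assume q: "?q \<noteq> 0"
      have "0 \<le> 1\<^sup>2 * ?p + 2 * 1 * (- (?p + 1) / (2 * ?q)) * ?q + (- (?p + 1) / (2 * ?q))\<^sup>2 * ?r" by (rule quad)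
      also have "\<dots> = -1" using q True by (simp add: field_simps)
      finally show False by simp
    qed
    then show ?thesis using True by simp
  next
    case False
    then have r: "?r > 0" using p0 by simp
    have "0 \<le> (?r)\<^sup>2 * ?p + 2 * ?r * (- ?q) * ?q + (- ?q)\<^sup>2 * ?r" by (rule quad)
    also have "\<dots> = ?r * (?p * ?r - ?q\<^sup>2)" by (simp add: power2_eq_square algebra_simps)
    finally show ?thesis using r by (simp add: zero_le_mult_iff)
  qed
qed

text \<open>A positive kernel together with the list of eigenvalues and eigenfunctions of its operator. Completeness is only known
  for eigenfunctions that belong to nonzero eigenvalues; that the operator vanishes on the complement of the list has to be
  proved (\<open>null_on_complement\<close>).\<close>

locale psd_eigen =
  fixes c :: "real \<Rightarrow> real \<Rightarrow> real" and l :: "nat \<Rightarrow> real" and e :: "nat \<Rightarrow> real \<Rightarrow> real"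
  assumes psd: "psd_kernel (case_prod c)" and es: "eigensystem c l e"
begin

abbreviation k where "k \<equiv> case_prod c"
abbreviation T where "T \<equiv> op01 k"

lemma k_sqint: "k \<in> sqint leb2"
  using psd by (simp add: psd_kernel_def)

lemma T_sqint: "f \<in> sq01 \<Longrightarrow> T f \<in> sq01"
  by (rule op01_sqint[OF k_sqint])

lemma T_sym: "f \<in> sq01 \<Longrightarrow> g \<in> sq01 \<Longrightarrow> ip01 (T f) g = ip01 f (T g)"
  using psd by (simp add: psd_kernel_def)

lemma T_psd: "f \<in> sq01 \<Longrightarrow> 0 \<le> ip01 (T f) f"
  using psd unfolding psd_kernel_def by blast

lemma on: "onseq unit_leb e"
  using es by (simp add: eigensystem_def onseq_def L2_fun_eq L2_inner_eq)

lemma e_sqint: "j \<ge> 1 \<Longrightarrow> e j \<in> sq01"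
  using on by (simp add: onseq_def)

lemma e_ip: "i \<ge> 1 \<Longrightarrow> j \<ge> 1 \<Longrightarrow> ip01 (e i) (e j) = (if i = j then 1 else 0)"
  using on by (simp add: onseq_def)

lemma e_nm: "j \<ge> 1 \<Longrightarrow> nm01 (e j) = 1"
  using e_ip[of j j] by (simp add: nm_def ip_def power2_eq_square)

lemma T_e: "j \<ge> 1 \<Longrightarrow> AE t in unit_leb. T (e j) t = l j * e j t"
  using es by (simp add: eigensystem_def kernel_op_eq)

lemma complete:
  "f \<in> sq01 \<Longrightarrow> \<mu> \<noteq> 0 \<Longrightarrow> AE t in unit_leb. T f t = \<mu> * f t \<Longrightarrow> (\<And>j. j \<ge> 1 \<Longrightarrow> ip01 f (e j) = 0) \<Longrightarrow>
    AE t in unit_leb. f t = 0"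
  using es by (simp add: eigensystem_def L2_fun_eq L2_inner_eq kernel_op_eq)

lemma l_decreasing: "i \<ge> 1 \<Longrightarrow> i \<le> j \<Longrightarrow> l j \<le> l i"
proof (induction j rule: nat_induct)
  case (Suc j)
  have step: "l (Suc j) \<le> l j" if "j \<ge> 1" using es that by (simp add: eigensystem_def)
  show ?case
  proof (cases "i = Suc j")
    case False
    then have "i \<le> j" using Suc.prems by simp
    then have "l j \<le> l i" using Suc by simp
    then show ?thesis using step \<open>i \<le> j\<close> Suc.prems by linarith
  qed simp
qed simp

lemma ip_T_e: "f \<in> sq01 \<Longrightarrow> j \<ge> 1 \<Longrightarrow> ip01 (T f) (e j) = l j * ip01 f (e j)"
proof -
  assume f: "f \<in> sq01" and j: "j \<ge> 1"
  have "ip01 (T f) (e j) = ip01 f (T (e j))" by (rule T_sym[OF f e_sqint[OF j]])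
  also have "\<dots> = ip01 f (\<lambda>t. l j * e j t)"
    using f e_sqint[OF j] T_sqint T_e[OF j] by (intro ip_cong_AE) (auto intro: sqint_scale)
  finally show ?thesis by (simp add: ip_scale_right)
qed

lemma l_nonneg: "j \<ge> 1 \<Longrightarrow> 0 \<le> l j"
  using T_psd[OF e_sqint, of j] ip_T_e[OF e_sqint, of j j] e_ip[of j j] by simp

lemma gap_le: "j \<ge> 1 \<Longrightarrow> gap l j \<le> l j"
  using l_nonneg[of "j + 1"] l_nonneg[of 2] by (auto simp: gap_def min_def numeral_2_eq_2)

lemma gap_nonneg: "j \<ge> 1 \<Longrightarrow> 0 \<le> gap l j"
  using l_decreasing[of j "j + 1"] l_decreasing[of "j - 1" j] l_decreasing[of 1 2] by (auto simp: gap_def)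

lemma gap_le_diff: "i \<ge> 1 \<Longrightarrow> j \<ge> 1 \<Longrightarrow> i \<noteq> j \<Longrightarrow> gap l j \<le> \<bar>l i - l j\<bar>"
proof -
  assume i: "i \<ge> 1" and j: "j \<ge> 1" and ne: "i \<noteq> j"
  show ?thesis
  proof (cases "i < j")
    case True
    then have "l (j - 1) \<le> l i" using i l_decreasing[of i "j - 1"] by simp
    moreover have "gap l j \<le> l (j - 1) - l j" using True i by (simp add: gap_def)
    ultimately show ?thesis by linarith
  next
    case False
    then have "l i \<le> l (j + 1)" using ne j l_decreasing[of "j + 1" i] by simp
    moreover have "gap l j \<le> l j - l (j + 1)" by (simp add: gap_def numeral_2_eq_2)
    ultimately show ?thesis by linarith
  qed
qed

text \<open>Otherwise the quadratic form has a positive supremum \<open>\<mu>\<close> on the unit ball of the orthogonal complement of the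
  eigenfunctions. A maximising sequence consists of approximate eigenvectors for \<open>\<mu>\<close>; by compactness the images of a
  subsequence converge, and the limit is an eigenfunction for \<open>\<mu>\<close> that is orthogonal to all listed ones, hence null.
  But then the form tends to \<open>0\<close> along the subsequence.\<close>

lemma null_on_complement:
  assumes f0: "f0 \<in> sq01" and orth: "\<And>j. j \<ge> 1 \<Longrightarrow> ip01 f0 (e j) = 0"
  shows "AE t in unit_leb. T f0 t = 0"
proof (rule ccontr)
  assume neg: "\<not> (AE t in unit_leb. T f0 t = 0)"
  \<comment> \<open>the orthogonal complement of the eigenfunctions, with the quadratic form of the operator\<close>
  define V where "V = {f \<in> sq01. \<forall>j\<ge>1. ip01 f (e j) = 0}"
  let ?q = "\<lambda>f. ip01 (T f) f"
  have V_sq: "f \<in> sq01" if "f \<in> V" for f using that by (simp add: V_def)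
  have V_T: "T f \<in> V" if "f \<in> V" for f using that ip_T_e T_sqint by (simp add: V_def)
  have V_scale: "(\<lambda>x. a * f x) \<in> V" if "f \<in> V" for a f using that by (simp add: V_def sqint_scale ip_scale_left)
  have q_scale: "?q (\<lambda>x. a * f x) = a\<^sup>2 * ?q f" if f: "f \<in> sq01" for a f
  proof -
    have "?q (\<lambda>x. a * f x) = a * ip01 (T f) (\<lambda>x. a * f x)"
      using ip_op01_combination_left[OF k_sqint f f sqint_scale[OF f], of a 0 a] by simp
    then show ?thesis by (simp add: ip_scale_right power2_eq_square)
  qed
  have q_le: "?q f \<le> nm leb2 k * (nm01 f)\<^sup>2" if f: "f \<in> sq01" for f
  proof -
    have "?q f \<le> nm01 (T f) * nm01 f" using ip_cauchy_schwarz[OF T_sqint[OF f] f] by linarith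
    also have "\<dots> \<le> (nm leb2 k * nm01 f) * nm01 f"
      by (rule mult_right_mono[OF nm_op01_le[OF k_sqint f]]) simp
    finally show ?thesis by (simp add: power2_eq_square mult.assoc)
  qed
  define Q where "Q = {?q f | f. f \<in> V \<and> nm01 f \<le> 1}"
  define \<mu> where "\<mu> = Sup Q"
  have zV: "(\<lambda>x. 0) \<in> V" by (simp add: V_def)
  have zq: "?q (\<lambda>x. 0) = 0" using q_scale[OF sqint_zero, of 0] by simp
  have znm: "nm01 (\<lambda>x. 0) \<le> 1" by (simp add: nm_def)
  have Q0: "0 \<in> Q" using zV zq znm unfolding Q_def by force
  have Qle: "x \<le> nm leb2 k" if xQ: "x \<in> Q" for x
  proof -
    obtain f where f: "x = ?q f" "f \<in> V" "nm01 f \<le> 1" using xQ unfolding Q_def by blast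
    have "nm leb2 k * (nm01 f)\<^sup>2 \<le> nm leb2 k * 1" using f(3) by (intro mult_left_mono power_le_one) auto
    then show ?thesis using q_le[OF V_sq[OF f(2)]] f(1) by linarith
  qed
  have bdd: "bdd_above Q" by (rule bdd_aboveI[OF Qle])
  have le1: "?q f \<le> \<mu>" if "f \<in> V" "nm01 f \<le> 1" for f
    unfolding \<mu>_def using that bdd by (intro cSup_upper) (auto simp: Q_def)
  have mu0: "0 \<le> \<mu>" unfolding \<mu>_def using Q0 bdd by (rule cSup_upper)
  have leq: "?q f \<le> \<mu> * (nm01 f)\<^sup>2" if f: "f \<in> V" for f
  proof (cases "nm01 f = 0")
    case True
    then show ?thesis using q_le[OF V_sq[OF f]] by simp
  next
    case False
    then have pos: "nm01 f > 0" by (simp add: less_le)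
    have "?q (\<lambda>x. inverse (nm01 f) * f x) \<le> \<mu>"
      using False by (intro le1 V_scale f) (simp add: nm_scale)
    then have "(inverse (nm01 f))\<^sup>2 * ?q f \<le> \<mu>" using q_scale[OF V_sq[OF f]] by simp
    then show ?thesis using pos by (simp add: field_simps)
  qed
  \<comment> \<open>The Cauchy--Schwarz inequality for the form itself makes a maximiser of the form an approximate eigenvector.\<close>
  have nmT: "(nm01 (T f))\<^sup>2 \<le> \<mu> * ?q f" if f: "f \<in> V" for f
  proof (cases "nm01 (T f) = 0")
    case True
    then show ?thesis using T_psd[OF V_sq[OF f]] mu0 by simp
  next
    case False
    then have pos: "(nm01 (T f))\<^sup>2 > 0" by simp
    have "((nm01 (T f))\<^sup>2)\<^sup>2 \<le> ?q f * ?q (T f)"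
      using psd_cauchy_schwarz[OF psd V_sq[OF f] T_sqint[OF V_sq[OF f]]] by (simp add: nm_sq)
    also have "\<dots> \<le> ?q f * (\<mu> * (nm01 (T f))\<^sup>2)"
      using leq[OF V_T[OF f]] T_psd[OF V_sq[OF f]] by (rule mult_left_mono)
    finally have "(nm01 (T f))\<^sup>2 * (nm01 (T f))\<^sup>2 \<le> (\<mu> * ?q f) * (nm01 (T f))\<^sup>2"
      by (simp only: power2_eq_square[of "(nm01 (T f))\<^sup>2"] mult_ac)
    then show ?thesis using pos by (simp only: mult_le_cancel_right_pos)
  qed
  have f0V: "f0 \<in> V" using f0 orth by (simp add: V_def)
  have "nm01 (T f0) \<noteq> 0" using neg nm_eq_0_iff[OF T_sqint[OF f0]] by simp
  then have "0 < (nm01 (T f0))\<^sup>2" by simp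
  then have "\<mu> * ?q f0 > 0" using nmT[OF f0V] by linarith
  then have mu: "\<mu> > 0" using mu0 by (cases "\<mu> = 0") auto
  have "\<exists>f. f \<in> V \<and> nm01 f \<le> 1 \<and> \<mu> - 1 / Suc n < ?q f" for n
  proof -
    have "\<exists>x\<in>Q. \<mu> - 1 / Suc n < x"
      unfolding \<mu>_def using Q0 bdd by (intro less_cSup_iff[THEN iffD1]) auto
    then show ?thesis by (auto simp: Q_def)
  qed
  then obtain f where f: "\<And>n. f n \<in> V" "\<And>n. nm01 (f n) \<le> 1" "\<And>n. \<mu> - 1 / Suc n < ?q (f n)" by metis
  obtain r :: "nat \<Rightarrow> nat" where r: "strict_mono r"
    "\<And>h. h \<in> sq01 \<Longrightarrow> convergent (\<lambda>n. ip01 (f (r n)) h)"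
    using weak_subsequence[of f 1] V_sq f(1,2) by blast
  obtain g where g: "g \<in> sq01" "(\<lambda>n. nm01 (\<lambda>t. T (f (r n)) t - g t)) \<longlonglongrightarrow> 0"
    using op01_compact[OF k_sqint, of "\<lambda>n. f (r n)" 1] V_sq f(1,2) r(2) by blast
  have fs: "f n \<in> sq01" for n using V_sq f(1) by blast
  have Tfs: "T (f n) \<in> sq01" for n using T_sqint fs by blast
  have mfs: "(\<lambda>t. \<mu> * f n t) \<in> sq01" for n by (intro sqint_scale fs)
  have inv0: "(\<lambda>n. 1 / Suc (r n)) \<longlonglongrightarrow> 0"
    using LIMSEQ_subseq_LIMSEQ[OF LIMSEQ_inverse_real_of_nat r(1)] by (simp add: o_def inverse_eq_divide)
  have close: "(nm01 (\<lambda>t. T (f n) t - \<mu> * f n t))\<^sup>2 \<le> \<mu> * (1 / Suc n)" for n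
  proof -
    have "(nm01 (\<lambda>t. T (f n) t - \<mu> * f n t))\<^sup>2 = (nm01 (T (f n)))\<^sup>2 - 2 * \<mu> * ?q (f n) + \<mu>\<^sup>2 * (nm01 (f n))\<^sup>2"
      unfolding nm_sq ip_diff_self[OF Tfs mfs] by (simp add: ip_scale_left ip_scale_right power2_eq_square)
    also have "\<dots> \<le> \<mu> * ?q (f n) - 2 * \<mu> * ?q (f n) + \<mu>\<^sup>2 * 1"
      using nmT[OF f(1)] f(2) mu0 by (intro add_mono diff_mono mult_left_mono power_le_one) auto
    also have "\<dots> = \<mu> * (\<mu> - ?q (f n))" by (simp add: power2_eq_square algebra_simps)
    also have "\<dots> \<le> \<mu> * (1 / Suc n)" using f(3)[of n] mu0 by (intro mult_left_mono) auto
    finally show ?thesis .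
  qed
  have close0: "(\<lambda>n. nm01 (\<lambda>t. T (f (r n)) t - \<mu> * f (r n) t)) \<longlonglongrightarrow> 0"
  proof (rule tendsto_sandwich[of "\<lambda>n. 0" _ _ "\<lambda>n. sqrt (\<mu> * (1 / Suc (r n)))"])
    show "(\<lambda>n. sqrt (\<mu> * (1 / Suc (r n)))) \<longlonglongrightarrow> 0"
      using tendsto_real_sqrt[OF tendsto_mult_right_zero[OF inv0, of \<mu>]] by simp
    show "\<forall>\<^sub>F n in sequentially. nm01 (\<lambda>t. T (f (r n)) t - \<mu> * f (r n) t) \<le> sqrt (\<mu> * (1 / Suc (r n)))"
      using close by (intro always_eventually allI real_le_rsqrt)
  qed auto
  have lim: "(\<lambda>n. nm01 (\<lambda>t. \<mu> * f (r n) t - g t)) \<longlonglongrightarrow> 0"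
  proof (rule tendsto_sandwich[OF _ _ tendsto_const])
    show "(\<lambda>n. nm01 (\<lambda>t. T (f (r n)) t - \<mu> * f (r n) t) + nm01 (\<lambda>t. T (f (r n)) t - g t)) \<longlonglongrightarrow> 0"
      using tendsto_add[OF close0 g(2)] by simp
    show "\<forall>\<^sub>F n in sequentially. nm01 (\<lambda>t. \<mu> * f (r n) t - g t)
      \<le> nm01 (\<lambda>t. T (f (r n)) t - \<mu> * f (r n) t) + nm01 (\<lambda>t. T (f (r n)) t - g t)"
    proof (intro always_eventually allI)
      fix n
      show "nm01 (\<lambda>t. \<mu> * f (r n) t - g t)
        \<le> nm01 (\<lambda>t. T (f (r n)) t - \<mu> * f (r n) t) + nm01 (\<lambda>t. T (f (r n)) t - g t)"
        using nm_triangle_via[OF mfs Tfs g(1)] nm_minus_commute[of unit_leb "T (f (r n))" "\<lambda>t. \<mu> * f (r n) t"] by simp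
    qed
  qed auto
  have gV: "ip01 g (e j) = 0" if j: "j \<ge> 1" for j
  proof -
    have "(\<lambda>n. ip01 (\<lambda>t. \<mu> * f (r n) t) (e j)) \<longlonglongrightarrow> ip01 g (e j)"
      by (rule ip_tendsto[OF mfs g(1) e_sqint[OF j] lim])
    moreover have "ip01 (\<lambda>t. \<mu> * f (r n) t) (e j) = 0" for n
      using f(1)[of "r n"] j by (simp add: ip_scale_left V_def)
    ultimately show ?thesis using LIMSEQ_unique[of "\<lambda>n. 0::real"] by simp
  qed
  have Tg: "AE t in unit_leb. T g t = \<mu> * g t"
  proof -
    have mg: "(\<lambda>t. \<mu> * g t) \<in> sq01" by (intro sqint_scale g)
    have mT: "(\<lambda>t. \<mu> * T (f n) t) \<in> sq01" for n by (intro sqint_scale Tfs)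
    have b: "nm01 (\<lambda>t. T g t - \<mu> * g t)
      \<le> nm leb2 k * nm01 (\<lambda>t. \<mu> * f (r n) t - g t) + \<mu> * nm01 (\<lambda>t. T (f (r n)) t - g t)" for n
    proof -
      have d: "(\<lambda>t. g t - \<mu> * f (r n) t) \<in> sq01" by (intro sqint_diff g mfs)
      have "AE t in unit_leb. T (\<lambda>t. g t - \<mu> * f (r n) t) t = T g t - \<mu> * T (f (r n)) t"
        using op01_combination[OF k_sqint g(1) fs[of "r n"], of 1 "-\<mu>"] by simp
      then have "nm01 (\<lambda>t. T g t - \<mu> * T (f (r n)) t) = nm01 (T (\<lambda>t. g t - \<mu> * f (r n) t))"
        using T_sqint[OF d] sqint_diff[OF T_sqint[OF g(1)] mT] by (intro nm_cong_AE) auto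
      also have "\<dots> \<le> nm leb2 k * nm01 (\<lambda>t. \<mu> * f (r n) t - g t)"
        using nm_op01_le[OF k_sqint d] by (simp only: nm_minus_commute[of unit_leb g])
      finally have 1: "nm01 (\<lambda>t. T g t - \<mu> * T (f (r n)) t) \<le> nm leb2 k * nm01 (\<lambda>t. \<mu> * f (r n) t - g t)" .
      have "(\<lambda>t. \<mu> * T (f (r n)) t - \<mu> * g t) = (\<lambda>t. \<mu> * (T (f (r n)) t - g t))" by (simp add: right_diff_distrib)
      then have 2: "nm01 (\<lambda>t. \<mu> * T (f (r n)) t - \<mu> * g t) = \<mu> * nm01 (\<lambda>t. T (f (r n)) t - g t)"
        using mu by (simp add: nm_scale)
      show ?thesis using nm_triangle_via[OF T_sqint[OF g(1)] mT[of "r n"] mg] 1 2 by linarith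
    qed
    have "(\<lambda>n. nm leb2 k * nm01 (\<lambda>t. \<mu> * f (r n) t - g t) + \<mu> * nm01 (\<lambda>t. T (f (r n)) t - g t)) \<longlonglongrightarrow> nm leb2 k * 0 + \<mu> * 0"
      by (intro tendsto_intros lim g(2))
    then have "nm01 (\<lambda>t. T g t - \<mu> * g t) \<le> nm leb2 k * 0 + \<mu> * 0"
      by (rule LIMSEQ_le_const) (use b in blast)
    then have "nm01 (\<lambda>t. T g t - \<mu> * g t) = 0" using nm_nonneg[of unit_leb "\<lambda>t. T g t - \<mu> * g t"] by simp
    then show ?thesis using nm_eq_0_iff[OF sqint_diff[OF T_sqint[OF g(1)] mg]] by simp
  qed
  have "AE t in unit_leb. g t = 0" using complete[OF g(1) _ Tg gV] mu by simp
  then have g0: "nm01 g = 0" using nm_eq_0_iff[OF g(1)] by simp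
  have "(\<lambda>n. nm01 (T (f (r n)))) \<longlonglongrightarrow> 0" using nm_tendsto[OF Tfs g(1,2)] g0 by simp
  then have "(\<lambda>n. nm01 (T (f (r n))) + 1 / Suc (r n)) \<longlonglongrightarrow> 0 + 0" by (rule tendsto_add[OF _ inv0])
  moreover have "\<mu> \<le> nm01 (T (f (r n))) + 1 / Suc (r n)" for n
  proof -
    have "?q (f (r n)) \<le> nm01 (T (f (r n))) * nm01 (f (r n))"
      using ip_cauchy_schwarz[OF Tfs fs, of "r n" "r n"] by linarith
    also have "\<dots> \<le> nm01 (T (f (r n))) * 1" using f(2) by (intro mult_left_mono) auto
    finally show ?thesis using f(3)[of "r n"] by linarith
  qed
  ultimately have "\<mu> \<le> 0 + 0" by (intro LIMSEQ_le_const) auto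
  then show False using mu by simp
qed

lemma ip_T_complement:
  assumes "f \<in> sq01" "r \<in> sq01" "\<And>j. j \<ge> 1 \<Longrightarrow> ip01 r (e j) = 0"
  shows "ip01 (T f) r = 0"
proof -
  have "ip01 (T f) r = ip01 f (T r)" using assms T_sym by simp
  also have "\<dots> = ip01 f (\<lambda>t. 0)"
    using assms T_sqint null_on_complement[of r] by (intro ip_cong_AE) auto
  finally show ?thesis by (simp add: ip_def)
qed

text \<open>The image of the operator is orthogonal to everything that is orthogonal to the eigenfunctions, so Parseval's identity
  holds for it.\<close>

lemma nm_T_expansion:
  assumes f: "f \<in> sq01"
  shows "(\<lambda>n. \<Sum>i=1..n. (l i)\<^sup>2 * (ip01 f (e i))\<^sup>2) \<longlonglongrightarrow> (nm01 (T f))\<^sup>2"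
proof -
  have "(\<lambda>n. \<Sum>i=1..n. (ip01 (T f) (e i))\<^sup>2) \<longlonglongrightarrow> (nm01 (T f))\<^sup>2"
  proof (rule unit_leb.onseq_parseval[OF on T_sqint[OF f]])
    fix r assume "r \<in> sq01" "\<And>j. j \<ge> 1 \<Longrightarrow> ip01 r (e j) = 0"
    then show "ip01 r (T f) = 0"
      using ip_T_complement[OF f, of r] ip_commute[of unit_leb r "T f"] by simp
  qed
  moreover have "(\<Sum>i=1..n. (ip01 (T f) (e i))\<^sup>2) = (\<Sum>i=1..n. (l i)\<^sup>2 * (ip01 f (e i))\<^sup>2)" for n
    by (intro sum.cong) (auto simp: ip_T_e[OF f] power_mult_distrib)
  ultimately show ?thesis by simp
qed

lemma form_expansion:
  assumes f: "f \<in> sq01"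
  shows "(\<lambda>n. \<Sum>i=1..n. l i * (ip01 f (e i))\<^sup>2) \<longlonglongrightarrow> ip01 (T f) f"
proof -
  let ?s = "\<lambda>n x. \<Sum>i=1..n. ip01 f (e i) * e i x"
  have s: "?s n \<in> sq01" for n using e_sqint by (intro sqint_sum sqint_scale) auto
  obtain p where p: "p \<in> sq01" "(\<lambda>n. nm01 (\<lambda>x. ?s n x - p x)) \<longlonglongrightarrow> 0"
    "\<And>j. j \<ge> 1 \<Longrightarrow> ip01 p (e j) = ip01 f (e j)"
    using unit_leb.onseq_projection[OF on f] by blast
  have "ip01 (T f) (\<lambda>x. f x - p x) = 0"
    using f p e_sqint by (intro ip_T_complement) (auto simp: ip_diff_left intro: sqint_diff)
  then have eq: "ip01 p (T f) = ip01 (T f) f"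
    using f p T_sqint[OF f] by (simp add: ip_diff_right ip_commute[of _ p])
  have "(\<lambda>n. ip01 (?s n) (T f)) \<longlonglongrightarrow> ip01 p (T f)"
    by (rule ip_tendsto[OF s p(1) T_sqint[OF f] p(2)])
  moreover have "ip01 (?s n) (T f) = (\<Sum>i=1..n. l i * (ip01 f (e i))\<^sup>2)" for n
  proof -
    have "ip01 (?s n) (T f) = (\<Sum>i=1..n. ip01 f (e i) * ip01 (T f) (e i))"
      using e_sqint T_sqint[OF f] by (subst ip_sum_left) (auto simp: ip_scale_left ip_commute[of _ "e _"] intro: sqint_scale)
    then show ?thesis by (simp add: ip_T_e[OF f] power2_eq_square mult_ac cong: sum.cong_simp)
  qed
  ultimately show ?thesis using eq by simp
qed

text \<open>Expanded in eigenfunctions, \<open>T - l j\<close> multiplies every coefficient other than the \<open>j\<close>-th by at least the gap in absolute value, and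
  the component of \<open>f\<close> outside their span by \<open>l j\<close>, which is not smaller than the gap either.\<close>

lemma resolvent_bound:
  assumes f: "f \<in> sq01" and j: "j \<ge> 1"
  shows "(gap l j)\<^sup>2 * ((nm01 f)\<^sup>2 - (ip01 f (e j))\<^sup>2) \<le> (nm01 (\<lambda>t. T f t - l j * f t))\<^sup>2"
proof -
  let ?a = "\<lambda>i. (ip01 f (e i))\<^sup>2" and ?g = "(gap l j)\<^sup>2"
  have lf: "(\<lambda>t. l j * f t) \<in> sq01" by (intro sqint_scale f)
  have "(\<lambda>n. (\<Sum>i=1..n. (l i)\<^sup>2 * ?a i) - 2 * l j * (\<Sum>i=1..n. l i * ?a i) + (l j)\<^sup>2 * (nm01 f)\<^sup>2)
    \<longlonglongrightarrow> (nm01 (T f))\<^sup>2 - 2 * l j * ip01 (T f) f + (l j)\<^sup>2 * (nm01 f)\<^sup>2"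
    by (intro tendsto_intros nm_T_expansion[OF f] form_expansion[OF f])
  moreover have "(nm01 (\<lambda>t. T f t - l j * f t))\<^sup>2 = (nm01 (T f))\<^sup>2 - 2 * l j * ip01 (T f) f + (l j)\<^sup>2 * (nm01 f)\<^sup>2"
    unfolding nm_sq ip_diff_self[OF T_sqint[OF f] lf] by (simp add: ip_scale_left ip_scale_right power2_eq_square)
  moreover have "?g * ((nm01 f)\<^sup>2 - ?a j) \<le> (\<Sum>i=1..n. (l i)\<^sup>2 * ?a i) - 2 * l j * (\<Sum>i=1..n. l i * ?a i) + (l j)\<^sup>2 * (nm01 f)\<^sup>2"
    if n: "n \<ge> j" for n
  proof -
    have g0: "0 \<le> gap l j" "gap l j \<le> l j" using gap_nonneg gap_le j by auto
    have "?g * (\<Sum>i=1..n. ?a i) - ?g * ?a j = (\<Sum>i\<in>{1..n}-{j}. ?g * ?a i)"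
      using n j by (simp add: sum_distrib_left sum_diff1)
    also have "\<dots> \<le> (\<Sum>i\<in>{1..n}-{j}. (l i - l j)\<^sup>2 * ?a i)"
    proof (intro sum_mono mult_right_mono)
      fix i assume "i \<in> {1..n} - {j}"
      then have "\<bar>gap l j\<bar> \<le> \<bar>l i - l j\<bar>" using gap_le_diff[of i j] j g0 by auto
      then show "?g \<le> (l i - l j)\<^sup>2" by (simp only: abs_le_square_iff)
    qed simp
    also have "\<dots> \<le> (\<Sum>i=1..n. (l i - l j)\<^sup>2 * ?a i)" by (intro sum_mono2) auto
    also have "\<dots> = (\<Sum>i=1..n. (l i)\<^sup>2 * ?a i) - 2 * l j * (\<Sum>i=1..n. l i * ?a i) + (l j)\<^sup>2 * (\<Sum>i=1..n. ?a i)"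
      by (simp add: sum_distrib_left sum.distrib[symmetric] sum_subtractf[symmetric] power2_diff algebra_simps)
    finally have 1: "?g * (\<Sum>i=1..n. ?a i) - ?g * ?a j \<le> \<dots>" .
    have "0 \<le> (nm01 f)\<^sup>2 - (\<Sum>i=1..n. ?a i)" using onseq_bessel[OF on f, of n] by simp
    moreover have "?g \<le> (l j)\<^sup>2" using g0 by (intro power_mono) auto
    ultimately have "?g * ((nm01 f)\<^sup>2 - (\<Sum>i=1..n. ?a i)) \<le> (l j)\<^sup>2 * ((nm01 f)\<^sup>2 - (\<Sum>i=1..n. ?a i))"
      by (intro mult_right_mono)
    then show ?thesis using 1 by (simp add: algebra_simps)
  qed
  ultimately show ?thesis by (intro LIMSEQ_le_const) auto
qed

end

subsection \<open>Perturbation of eigenvalues and eigenfunctions\<close>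

text \<open>Gaussian elimination of one unknown per equation.\<close>

lemma underdetermined_system:
  fixes B :: "nat \<Rightarrow> 'i \<Rightarrow> real"
  assumes "finite J" "m < card J"
  shows "\<exists>a. (\<exists>i\<in>J. a i \<noteq> 0) \<and> (\<forall>r<m. (\<Sum>i\<in>J. B r i * a i) = 0)"
  using assms
proof (induction m arbitrary: J B)
  case 0
  then have "J \<noteq> {}" by auto
  then show ?case by (intro exI[of _ "\<lambda>i. 1"]) auto
next
  case (Suc m)
  show ?case
  proof (cases "\<forall>i\<in>J. B m i = 0")
    case True
    obtain a where "\<exists>i\<in>J. a i \<noteq> 0" "\<forall>r<m. (\<Sum>i\<in>J. B r i * a i) = 0"
      using Suc.IH[of J B] Suc.prems by auto
    then show ?thesis using True by (intro exI[of _ a]) (auto simp: less_Suc_eq)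
  next
    case False
    then obtain p where p: "p \<in> J" "B m p \<noteq> 0" by blast
    let ?J = "J - {p}"
    have "m < card ?J" using Suc.prems p by simp
    then obtain a where a: "\<exists>i\<in>?J. a i \<noteq> 0" "\<forall>r<m. (\<Sum>i\<in>?J. (B r i - B r p * B m i / B m p) * a i) = 0"
      using Suc.IH[of ?J "\<lambda>r i. B r i - B r p * B m i / B m p"] Suc.prems by auto
    define s where "s = (\<Sum>i\<in>?J. B m i * a i)"
    define a' where "a' = a(p := - s / B m p)"
    have split: "(\<Sum>i\<in>J. B r i * a' i) = B r p * (- s / B m p) + (\<Sum>i\<in>?J. B r i * a i)" for r
      using p Suc.prems by (simp add: sum.remove[of J p] a'_def)
    have "(\<Sum>i\<in>J. B r i * a' i) = 0" if "r < Suc m" for r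
    proof (cases "r = m")
      case True
      then show ?thesis using p by (simp add: split s_def)
    next
      case False
      then have "0 = (\<Sum>i\<in>?J. (B r i - B r p * B m i / B m p) * a i)" using a that by simp
      also have "\<dots> = (\<Sum>i\<in>?J. B r i * a i) - B r p / B m p * s"
        by (simp add: s_def sum_distrib_left sum_subtractf[symmetric] algebra_simps)
      finally show ?thesis by (simp add: split)
    qed
    moreover have "\<exists>i\<in>J. a' i \<noteq> 0" using a(1) by (auto simp: a'_def)
    ultimately show ?thesis by blast
  qed
qed

text \<open>The span of the first \<open>j\<close> eigenfunctions of one operator contains a nonzero vector that is orthogonal to the first
  \<open>j - 1\<close> eigenfunctions of the other. At this vector the first form is at least \<open>l j\<close> and the second one at most \<open>l' j\<close>
  times the squared norm.\<close>

lemma weyl_one_sided: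
  assumes "psd_eigen c l e" "psd_eigen c' l' e'" and j: "j \<ge> 1"
  shows "l j - l' j \<le> nm leb2 (\<lambda>p. case_prod c p - case_prod c' p)"
proof -
  interpret A: psd_eigen c l e by fact
  interpret B: psd_eigen c' l' e' by fact
  have "\<exists>a. (\<exists>i\<in>{1..j}. a i \<noteq> 0) \<and> (\<forall>r<j - 1. (\<Sum>i\<in>{1..j}. ip01 (e i) (e' (Suc r)) * a i) = 0)"
    using j by (intro underdetermined_system) auto
  then obtain a where a: "\<exists>i\<in>{1..j}. a i \<noteq> 0" "\<And>r. r < j - 1 \<Longrightarrow> (\<Sum>i\<in>{1..j}. ip01 (e i) (e' (Suc r)) * a i) = 0" by blast
  define f where "f = (\<lambda>x. \<Sum>i=1..j. a i * e i x)"
  have f: "f \<in> sq01" unfolding f_def using A.e_sqint by (intro sqint_sum sqint_scale) auto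
  have fe': "ip01 f (e' i) = 0" if i: "1 \<le> i" "i < j" for i
  proof -
    have "ip01 f (e' i) = (\<Sum>r\<in>{1..j}. ip01 (e r) (e' i) * a r)"
      unfolding f_def using A.e_sqint B.e_sqint[OF i(1)]
      by (subst ip_sum_left) (auto simp: ip_scale_left mult.commute intro: sqint_scale)
    then show ?thesis using a(2)[of "i - 1"] i by simp
  qed
  have fe: "ip01 f (e i) = (if i \<le> j then a i else 0)" if i: "1 \<le> i" for i
  proof -
    have "ip01 f (e i) = (\<Sum>r\<in>{1..j}. a r * ip01 (e r) (e i))"
      unfolding f_def using A.e_sqint i
      by (subst ip_sum_left) (auto simp: ip_scale_left intro: sqint_scale)
    also have "\<dots> = (\<Sum>r\<in>{1..j}. if r = i then a i else 0)"
      using i by (intro sum.cong) (auto simp: A.e_ip)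
    finally show ?thesis using i by simp
  qed
  have nmf: "(nm01 f)\<^sup>2 = (\<Sum>i=1..j. (a i)\<^sup>2)"
    unfolding nm_sq f_def using A.e_sqint A.e_ip
    by (subst orthonormal_ip_combination) (auto simp: power2_eq_square)
  have pos: "(nm01 f)\<^sup>2 > 0"
  proof -
    obtain i where "i \<in> {1..j}" "a i \<noteq> 0" using a(1) by blast
    then show ?thesis unfolding nmf by (intro sum_pos2[of _ i]) auto
  qed
  have lower: "l j * (nm01 f)\<^sup>2 \<le> ip01 (A.T f) f"
  proof (rule LIMSEQ_le_const[OF A.form_expansion[OF f]], intro exI[of _ j] allI impI)
    fix n assume n: "j \<le> n"
    have "l j * (nm01 f)\<^sup>2 \<le> (\<Sum>i=1..j. l i * (a i)\<^sup>2)"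
      unfolding nmf sum_distrib_left using A.l_decreasing by (intro sum_mono mult_right_mono) auto
    also have "\<dots> = (\<Sum>i=1..j. l i * (ip01 f (e i))\<^sup>2)" by (intro sum.cong) (auto simp: fe)
    also have "\<dots> \<le> (\<Sum>i=1..n. l i * (ip01 f (e i))\<^sup>2)"
      using n A.l_nonneg by (intro sum_mono2) auto
    finally show "l j * (nm01 f)\<^sup>2 \<le> (\<Sum>i=1..n. l i * (ip01 f (e i))\<^sup>2)" .
  qed
  have upper: "ip01 (B.T f) f \<le> l' j * (nm01 f)\<^sup>2"
  proof (rule LIMSEQ_le_const2[OF B.form_expansion[OF f]], intro exI[of _ 0] allI impI)
    fix n :: nat
    have "(\<Sum>i=1..n. l' i * (ip01 f (e' i))\<^sup>2) \<le> (\<Sum>i=1..n. l' j * (ip01 f (e' i))\<^sup>2)"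
    proof (rule sum_mono)
      fix i assume "i \<in> {1..n}"
      then show "l' i * (ip01 f (e' i))\<^sup>2 \<le> l' j * (ip01 f (e' i))\<^sup>2"
        using fe'[of i] B.l_decreasing[OF j, of i] by (cases "i < j") (auto intro: mult_right_mono)
    qed
    also have "\<dots> \<le> l' j * (nm01 f)\<^sup>2"
      unfolding sum_distrib_left[symmetric] using onseq_bessel[OF B.on f] B.l_nonneg[OF j] by (intro mult_left_mono)
    finally show "(\<Sum>i=1..n. l' i * (ip01 f (e' i))\<^sup>2) \<le> l' j * (nm01 f)\<^sup>2" .
  qed
  have ff: "tens f f \<in> sqint leb2" by (rule unit_leb2.tens_sqint[OF f f])
  have "ip01 (A.T f) f - ip01 (B.T f) f = ip leb2 (\<lambda>p. case_prod c p - case_prod c' p) (tens f f)"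
    using ip_op01_eq[OF A.k_sqint f f] ip_op01_eq[OF B.k_sqint f f] ip_diff_left[OF A.k_sqint B.k_sqint ff] by simp
  also have "\<dots> \<le> nm leb2 (\<lambda>p. case_prod c p - case_prod c' p) * nm leb2 (tens f f)"
    using ip_cauchy_schwarz[OF sqint_diff[OF A.k_sqint B.k_sqint] ff] by linarith
  also have "\<dots> = nm leb2 (\<lambda>p. case_prod c p - case_prod c' p) * (nm01 f)\<^sup>2"
    by (simp add: unit_leb2.nm_tens[OF f f] power2_eq_square)
  finally have "(l j - l' j) * (nm01 f)\<^sup>2 \<le> nm leb2 (\<lambda>p. case_prod c p - case_prod c' p) * (nm01 f)\<^sup>2"
    using lower upper by (simp only: left_diff_distrib)
  then show ?thesis using pos by (simp only: mult_le_cancel_right_pos)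
qed

lemma weyl:
  assumes "psd_eigen c l e" "psd_eigen c' l' e'" and "j \<ge> 1"
  shows "\<bar>l' j - l j\<bar> \<le> nm leb2 (\<lambda>p. case_prod c' p - case_prod c p)"
  using weyl_one_sided[OF assms] weyl_one_sided[OF assms(2,1,3)]
    nm_minus_commute[of leb2 "case_prod c" "case_prod c'"] by linarith

text \<open>By Weyl's inequality \<open>e' j\<close> is almost an eigenfunction for \<open>l j\<close> of the operator with kernel \<open>c\<close>; by the resolvent bound its
  component orthogonal to \<open>e j\<close> is then small. The left-hand side contains the squared sine of the angle, which does not depend on the
  signs of the eigenfunctions.\<close>

lemma eigenfunction_perturbation:
  assumes "psd_eigen c l e" "psd_eigen c' l' e'" and j: "j \<ge> 1"
  shows "(gap l j)\<^sup>2 * (1 - (ip01 (e' j) (e j))\<^sup>2) \<le> (2 * nm leb2 (\<lambda>p. case_prod c' p - case_prod c p))\<^sup>2"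
proof -
  interpret A: psd_eigen c l e by fact
  interpret B: psd_eigen c' l' e' by fact
  let ?d = "nm leb2 (\<lambda>p. case_prod c' p - case_prod c p)" and ?f = "e' j"
  have f: "?f \<in> sq01" by (rule B.e_sqint[OF j])
  have lf: "(\<lambda>t. a * ?f t) \<in> sq01" for a by (intro sqint_scale f)
  have "nm01 (\<lambda>t. A.T ?f t - l j * ?f t) \<le> nm01 (\<lambda>t. A.T ?f t - l' j * ?f t) + nm01 (\<lambda>t. l' j * ?f t - l j * ?f t)"
    by (rule nm_triangle_via[OF A.T_sqint[OF f] lf lf])
  also have "nm01 (\<lambda>t. A.T ?f t - l' j * ?f t) \<le> ?d"
  proof -
    have "AE t in unit_leb. op01 (\<lambda>p. case_prod c' p - case_prod c p) ?f t = B.T ?f t - A.T ?f t"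
      by (rule unit_leb2.kapp_diff_kernel[OF B.k_sqint A.k_sqint f])
    then have "AE t in unit_leb. l' j * ?f t - A.T ?f t = op01 (\<lambda>p. case_prod c' p - case_prod c p) ?f t"
      using B.T_e[OF j] by eventually_elim simp
    then have "nm01 (\<lambda>t. l' j * ?f t - A.T ?f t) = nm01 (op01 (\<lambda>p. case_prod c' p - case_prod c p) ?f)"
      using sqint_diff[OF lf A.T_sqint[OF f]] op01_sqint[OF sqint_diff[OF B.k_sqint A.k_sqint] f]
      by (intro nm_cong_AE) auto
    also have "\<dots> \<le> ?d * nm01 ?f" by (rule nm_op01_le[OF sqint_diff[OF B.k_sqint A.k_sqint] f])
    finally show ?thesis using B.e_nm[OF j] nm_minus_commute[of unit_leb "A.T ?f" "\<lambda>t. l' j * ?f t"] by simp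
  qed
  also have "nm01 (\<lambda>t. l' j * ?f t - l j * ?f t) \<le> ?d"
  proof -
    have "(\<lambda>t. l' j * ?f t - l j * ?f t) = (\<lambda>t. (l' j - l j) * ?f t)" by (simp add: left_diff_distrib)
    then show ?thesis using weyl[OF assms] B.e_nm[OF j] by (simp add: nm_scale)
  qed
  finally have "nm01 (\<lambda>t. A.T ?f t - l j * ?f t) \<le> 2 * ?d" by simp
  then have "(nm01 (\<lambda>t. A.T ?f t - l j * ?f t))\<^sup>2 \<le> (2 * ?d)\<^sup>2" by (intro power_mono) auto
  then show ?thesis using A.resolvent_bound[OF f j] B.e_nm[OF j] by simp
qed

section \<open>The estimation error for given covariance perturbations\<close>

lemma product_eigenfunctions:
  assumes u: "psd_eigen cY g u" and v: "psd_eigen cX l v"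
  shows "i \<ge> 1 \<Longrightarrow> j \<ge> 1 \<Longrightarrow> tens (u i) (v j) \<in> sqint leb2"
    and "i \<ge> 1 \<Longrightarrow> j \<ge> 1 \<Longrightarrow> i' \<ge> 1 \<Longrightarrow> j' \<ge> 1 \<Longrightarrow>
      ip leb2 (tens (u i) (v j)) (tens (u i') (v j')) = (if (i, j) = (i', j') then 1 else 0)"
proof -
  interpret U: psd_eigen cY g u by fact
  interpret V: psd_eigen cX l v by fact
  show "i \<ge> 1 \<Longrightarrow> j \<ge> 1 \<Longrightarrow> tens (u i) (v j) \<in> sqint leb2"
    by (intro unit_leb2.tens_sqint U.e_sqint V.e_sqint)
  show "i \<ge> 1 \<Longrightarrow> j \<ge> 1 \<Longrightarrow> i' \<ge> 1 \<Longrightarrow> j' \<ge> 1 \<Longrightarrow>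
      ip leb2 (tens (u i) (v j)) (tens (u i') (v j')) = (if (i, j) = (i', j') then 1 else 0)"
    by (simp add: unit_leb2.ip_tens_tens U.e_sqint V.e_sqint U.e_ip V.e_ip)
qed

text \<open>The error of one summand of the estimator splits into the errors of the eigenvalue, of the cross-covariance and of the
  eigenfunctions. The last one is the movement of a one-dimensional projection in the space of kernels, so it is bounded by the angles of
  the two pairs of eigenfunctions.\<close>

lemma summand_error:
  assumes VX: "psd_eigen cX l v" and VXh: "psd_eigen cXh lh vh"
    and UY: "psd_eigen cY g u" and UYh: "psd_eigen cYh gh uh"
    and D: "D \<in> sqint leb2" and Dh: "Dh \<in> sqint leb2"
    and dX: "nm leb2 (\<lambda>p. case_prod cXh p - case_prod cX p) \<le> \<delta>"
    and dY: "nm leb2 (\<lambda>p. case_prod cYh p - case_prod cY p) \<le> \<delta>"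
    and dD: "nm leb2 (\<lambda>p. Dh p - D p) \<le> \<delta>"
    and i: "i \<ge> 1" and j: "j \<ge> 1" and m: "m > 0" "m \<le> l j" and h: "h > 0" "h \<le> gap l j" "h \<le> gap g i"
    and small: "2 * \<delta> \<le> m"
  shows "nm leb2 (\<lambda>p. inverse (lh j) * ip leb2 Dh (tens (uh i) (vh j)) * tens (uh i) (vh j) p
      - inverse (l j) * ip leb2 D (tens (u i) (v j)) * tens (u i) (v j) p)
    \<le> \<delta> / (m * h) * (5 * nm leb2 D + 3 * l 1)"
proof -
  interpret V: psd_eigen cX l v by fact
  interpret Vh: psd_eigen cXh lh vh by fact
  interpret U: psd_eigen cY g u by fact
  interpret Uh: psd_eigen cYh gh uh by fact
  define e where "e = tens (u i) (v j)"
  define e' where "e' = tens (uh i) (vh j)"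
  have e: "e \<in> sqint leb2" "ip leb2 e e = 1" and e': "e' \<in> sqint leb2" "ip leb2 e' e' = 1"
    using product_eigenfunctions[OF UY VX] product_eigenfunctions[OF UYh VXh] i j by (auto simp: e_def e'_def)
  have nme': "nm leb2 e' = 1" using e'(2) by (simp add: nm_def ip_def power2_eq_square)
  have d0: "0 \<le> \<delta>" using dX nm_nonneg order_trans by blast
  have lhj: "\<bar>lh j - l j\<bar> \<le> \<delta>" using weyl[OF VX VXh j] dX by linarith
  have lj: "0 < l j" using m by linarith
  \<comment> \<open>The perturbation is at most half of the eigenvalue, so the empirical eigenvalue stays away from zero.\<close>
  have lh2: "l j / 2 \<le> lh j" using lhj small m by linarith
  have lhpos: "0 < lh j" using lh2 lj by linarith
  have l1: "l j \<le> l 1" using V.l_decreasing[of 1 j] j by simp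
  have hl: "h \<le> l j" using h V.gap_le[OF j] by linarith
  have A: "\<bar>inverse (lh j) - inverse (l j)\<bar> \<le> 2 * \<delta> / (m * h)"
  proof -
    have "\<bar>inverse (lh j) - inverse (l j)\<bar> = \<bar>lh j - l j\<bar> / (lh j * l j)"
      using lj lhpos by (simp add: abs_if field_simps)
    also have "\<dots> \<le> \<delta> / ((l j / 2) * l j)"
      using lhj lj lh2 d0 lhpos by (intro frac_le mult_right_mono mult_pos_pos) auto
    also have "\<dots> \<le> \<delta> / ((h / 2) * m)"
      using d0 lj hl h m by (intro divide_left_mono mult_mono mult_pos_pos divide_right_mono) auto
    finally show ?thesis by (simp add: mult_ac)
  qed
  have il: "inverse (l j) \<le> l 1 / (m * h)"
  proof -
    have "inverse (l j) \<le> inverse m" using m lj by simp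
    also have "\<dots> \<le> l 1 / (m * h)" using hl l1 h m by (simp add: field_simps)
    finally show ?thesis .
  qed
  have il': "inverse (l j) / h \<le> 1 / (m * h)"
  proof -
    have "inverse (l j) \<le> inverse m" using m lj by simp
    then have "inverse (l j) / h \<le> inverse m / h" using h by (intro divide_right_mono) auto
    then show ?thesis by (simp add: inverse_eq_divide)
  qed
  have angle: "nm leb2 (\<lambda>p. ip leb2 D e' * e' p - ip leb2 D e * e p) \<le> nm leb2 D * (3 * \<delta> / h)"
  proof -
    define a where "a = ip01 (uh i) (u i)"
    define b where "b = ip01 (vh j) (v j)"
    have hh: "h\<^sup>2 * (1 - x\<^sup>2) \<le> (2 * \<delta>)\<^sup>2"
      if "G\<^sup>2 * (1 - x\<^sup>2) \<le> (2 * d)\<^sup>2" "h \<le> G" "d \<le> \<delta>" "x\<^sup>2 \<le> 1" "0 \<le> d" for G x d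
    proof -
      have "h\<^sup>2 * (1 - x\<^sup>2) \<le> G\<^sup>2 * (1 - x\<^sup>2)" using that h(1) by (intro mult_right_mono power_mono) auto
      moreover have "(2 * d)\<^sup>2 \<le> (2 * \<delta>)\<^sup>2" using that by (intro power_mono) auto
      ultimately show ?thesis using that by linarith
    qed
    have a1: "a\<^sup>2 \<le> 1"
      using ip_cauchy_schwarz_sq[OF Uh.e_sqint[OF i] U.e_sqint[OF i]] i by (simp add: a_def Uh.e_ip U.e_ip)
    have b1: "b\<^sup>2 \<le> 1"
      using ip_cauchy_schwarz_sq[OF Vh.e_sqint[OF j] V.e_sqint[OF j]] j by (simp add: b_def Vh.e_ip V.e_ip)
    have ha: "h\<^sup>2 * (1 - a\<^sup>2) \<le> (2 * \<delta>)\<^sup>2"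
      using eigenfunction_perturbation[OF UY UYh i] by (intro hh[of "gap g i" a]) (use h dY a1 in \<open>auto simp: a_def\<close>)
    have hb: "h\<^sup>2 * (1 - b\<^sup>2) \<le> (2 * \<delta>)\<^sup>2"
      using eigenfunction_perturbation[OF VX VXh j] by (intro hh[of "gap l j" b]) (use h dX b1 in \<open>auto simp: b_def\<close>)
    have ee: "ip leb2 e' e = a * b"
      unfolding e_def e'_def a_def b_def
      by (rule unit_leb2.ip_tens_tens) (auto intro: U.e_sqint V.e_sqint Uh.e_sqint Vh.e_sqint i j)
    have "1 - (a * b)\<^sup>2 = (1 - a\<^sup>2) + a\<^sup>2 * (1 - b\<^sup>2)" by (simp add: power_mult_distrib algebra_simps)
    also have "\<dots> \<le> (1 - a\<^sup>2) + 1 * (1 - b\<^sup>2)" using a1 b1 by (intro add_left_mono mult_right_mono) auto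
    finally have "h\<^sup>2 * (1 - (a * b)\<^sup>2) \<le> h\<^sup>2 * ((1 - a\<^sup>2) + 1 * (1 - b\<^sup>2))" by (rule mult_left_mono) simp
    also have "\<dots> = h\<^sup>2 * (1 - a\<^sup>2) + h\<^sup>2 * (1 - b\<^sup>2)" by (simp only: distrib_left mult_1)
    also have "\<dots> \<le> (2 * \<delta>)\<^sup>2 + (2 * \<delta>)\<^sup>2" using ha hb by (rule add_mono)
    \<comment> \<open>The sum of the two squares is \<open>8 \<delta>\<^sup>2\<close>.\<close>
    also have "\<dots> \<le> (3 * \<delta>)\<^sup>2" by (simp add: power_mult_distrib)
    finally have "(1 - (a * b)\<^sup>2) * h\<^sup>2 \<le> (3 * \<delta>)\<^sup>2" by (simp only: mult.commute)
    then have "1 - (a * b)\<^sup>2 \<le> (3 * \<delta>)\<^sup>2 / h\<^sup>2" using h(1) by (subst pos_le_divide_eq) auto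
    then have "1 - (a * b)\<^sup>2 \<le> (3 * \<delta> / h)\<^sup>2" by (simp only: power_divide)
    then have "(nm leb2 D)\<^sup>2 * (1 - (a * b)\<^sup>2) \<le> (nm leb2 D)\<^sup>2 * (3 * \<delta> / h)\<^sup>2" by (rule mult_left_mono) simp
    also have "\<dots> = (nm leb2 D * (3 * \<delta> / h))\<^sup>2" by (rule power_mult_distrib[symmetric])
    finally have "(nm leb2 (\<lambda>p. ip leb2 D e' * e' p - ip leb2 D e * e p))\<^sup>2 \<le> (nm leb2 D * (3 * \<delta> / h))\<^sup>2"
      by (rule order_trans[OF rank_one_projection_diff[OF D e(1) e'(1) e(2) e'(2), unfolded ee]])
    moreover have "0 \<le> nm leb2 D * (3 * \<delta> / h)" using d0 h(1) by simp
    ultimately show ?thesis by (rule power2_le_imp_le)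
  qed
  let ?p1 = "\<lambda>p. (inverse (lh j) - inverse (l j)) * ip leb2 Dh e' * e' p"
  let ?p2 = "\<lambda>p. inverse (l j) * ip leb2 (\<lambda>p. Dh p - D p) e' * e' p"
  let ?p3 = "\<lambda>p. inverse (l j) * (ip leb2 D e' * e' p - ip leb2 D e * e p)"
  have s: "?p1 \<in> sqint leb2" "?p2 \<in> sqint leb2" "?p3 \<in> sqint leb2"
    using e e' by (auto intro!: sqint_intros)
  have split: "(\<lambda>p. inverse (lh j) * ip leb2 Dh e' * e' p - inverse (l j) * ip leb2 D e * e p) = (\<lambda>p. ?p1 p + (?p2 p + ?p3 p))"
    using Dh D e' by (simp add: ip_diff_left algebra_simps)
  have "nm leb2 (\<lambda>p. ?p1 p + (?p2 p + ?p3 p)) \<le> nm leb2 ?p1 + (nm leb2 ?p2 + nm leb2 ?p3)"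
    using nm_triangle[OF s(1) sqint_add[OF s(2,3)]] nm_triangle[OF s(2,3)] by linarith
  also have "nm leb2 ?p1 \<le> 2 * \<delta> / (m * h) * (nm leb2 D + l 1)"
  proof -
    have "nm leb2 Dh \<le> nm leb2 D + \<delta>" using nm_le_add_diff[OF Dh D] dD by linarith
    then have "\<bar>ip leb2 Dh e'\<bar> \<le> nm leb2 D + l 1"
      using ip_cauchy_schwarz[OF Dh e'(1)] nme' small m l1 d0 by simp
    then have "\<bar>inverse (lh j) - inverse (l j)\<bar> * \<bar>ip leb2 Dh e'\<bar> \<le> 2 * \<delta> / (m * h) * (nm leb2 D + l 1)"
      using A by (intro mult_mono) (use d0 m h in auto)
    moreover have "nm leb2 ?p1 = \<bar>inverse (lh j) - inverse (l j)\<bar> * \<bar>ip leb2 Dh e'\<bar>"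
      unfolding nm_scale nme' by (simp add: abs_mult)
    ultimately show ?thesis by simp
  qed
  also have "nm leb2 ?p2 \<le> \<delta> / (m * h) * l 1"
  proof -
    have "\<bar>ip leb2 (\<lambda>p. Dh p - D p) e'\<bar> \<le> \<delta>"
      using ip_cauchy_schwarz[OF sqint_diff[OF Dh D] e'(1)] nme' dD by simp
    then have "inverse (l j) * \<bar>ip leb2 (\<lambda>p. Dh p - D p) e'\<bar> \<le> l 1 / (m * h) * \<delta>"
      using il lj by (intro mult_mono) (use lj l1 m h in auto)
    moreover have "nm leb2 ?p2 = inverse (l j) * \<bar>ip leb2 (\<lambda>p. Dh p - D p) e'\<bar>"
      unfolding nm_scale nme' using lj by (simp add: abs_mult)
    ultimately show ?thesis by (simp add: mult_ac)
  qed
  also have "nm leb2 ?p3 \<le> \<delta> / (m * h) * (3 * nm leb2 D)"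
  proof -
    have "nm leb2 ?p3 = inverse (l j) * nm leb2 (\<lambda>p. ip leb2 D e' * e' p - ip leb2 D e * e p)"
      unfolding nm_scale using lj by simp
    also have "\<dots> \<le> inverse (l j) * (nm leb2 D * (3 * \<delta> / h))" using angle lj by (intro mult_left_mono) auto
    also have "\<dots> = (inverse (l j) / h) * (3 * nm leb2 D * \<delta>)" by simp
    also have "\<dots> \<le> (1 / (m * h)) * (3 * nm leb2 D * \<delta>)" using il' d0 by (intro mult_right_mono) auto
    finally show ?thesis by (simp add: mult_ac)
  qed
  finally have "nm leb2 (\<lambda>p. ?p1 p + (?p2 p + ?p3 p))
    \<le> 2 * \<delta> / (m * h) * (nm leb2 D + l 1) + (\<delta> / (m * h) * l 1 + \<delta> / (m * h) * (3 * nm leb2 D))" by simp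
  also have "\<dots> = \<delta> / (m * h) * (5 * nm leb2 D + 3 * l 1)"
  proof -
    have "2 * q * (x + y) + (q * y + q * (3 * x)) = q * (5 * x + 3 * y)" for q x y :: real
      by (simp add: algebra_simps)
    from this[of "\<delta> / (m * h)" "nm leb2 D" "l 1"] show ?thesis by (simp only: times_divide_eq_right)
  qed
  finally show ?thesis unfolding e_def[symmetric] e'_def[symmetric] split .
qed

text \<open>Each of the \<open>K L\<close> empirical summands is replaced by its population counterpart. Because \<open>D\<close> is the composition of \<open>P\<close> with the covariance
  operator, division by the eigenvalue turns the coefficients of \<open>D\<close> into those of \<open>P\<close>: the population sum is an orthogonal
  projection of \<open>P\<close>, and its distance from \<open>P\<close> is given by Pythagoras.\<close>

lemma estimator_error:
  assumes VX: "psd_eigen cX l v" and VXh: "psd_eigen cXh lh vh"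
    and UY: "psd_eigen cY g u" and UYh: "psd_eigen cYh gh uh"
    and D: "D \<in> sqint leb2" and Dh: "Dh \<in> sqint leb2" and P: "P \<in> sqint leb2"
    and DP: "\<And>i j. i \<ge> 1 \<Longrightarrow> j \<ge> 1 \<Longrightarrow> ip leb2 D (tens (u i) (v j)) = l j * ip leb2 P (tens (u i) (v j))"
    and dX: "nm leb2 (\<lambda>p. case_prod cXh p - case_prod cX p) \<le> \<delta>"
    and dY: "nm leb2 (\<lambda>p. case_prod cYh p - case_prod cY p) \<le> \<delta>"
    and dD: "nm leb2 (\<lambda>p. Dh p - D p) \<le> \<delta>"
    and KL: "K \<ge> 1" "L \<ge> 1" and lL: "l L > 0"
    and h: "h = min (min_gap l L) (min_gap g K)" "h > 0"
    and small: "2 * \<delta> \<le> l L"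
  shows "nm leb2 (\<lambda>p. (\<Sum>i=1..K. \<Sum>j=1..L. inverse (lh j) * ip leb2 Dh (tens (uh i) (vh j)) * tens (uh i) (vh j) p) - P p)
    \<le> real K * real L * (\<delta> / (l L * h) * (5 * nm leb2 D + 3 * l 1))
      + sqrt ((nm leb2 P)\<^sup>2 - (\<Sum>i=1..K. \<Sum>j=1..L. (ip leb2 P (tens (u i) (v j)))\<^sup>2))"
proof -
  interpret V: psd_eigen cX l v by fact
  interpret Vh: psd_eigen cXh lh vh by fact
  interpret U: psd_eigen cY g u by fact
  interpret Uh: psd_eigen cYh gh uh by fact
  let ?I = "{1..K} \<times> {1..L}"
  let ?E = "\<lambda>(i, j). tens (u i) (v j)"
  let ?a = "\<lambda>(i, j) p. inverse (lh j) * ip leb2 Dh (tens (uh i) (vh j)) * tens (uh i) (vh j) p"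
  let ?b = "\<lambda>(i, j) p. inverse (l j) * ip leb2 D (tens (u i) (v j)) * tens (u i) (v j) p"
  have a: "?a x \<in> sqint leb2" if "x \<in> ?I" for x
    using that product_eigenfunctions(1)[OF UYh VXh] by (auto intro!: sqint_scale)
  have b: "?b x \<in> sqint leb2" if "x \<in> ?I" for x
    using that product_eigenfunctions(1)[OF UY VX] by (auto intro!: sqint_scale)
  have lpos: "l j > 0" if "j \<in> {1..L}" for j
    using V.l_decreasing[of j L] that lL by auto
  have b': "?b x = (\<lambda>p. ip leb2 P (?E x) * ?E x p)" if "x \<in> ?I" for x
  proof -
    obtain i j where x: "x = (i, j)" "i \<ge> 1" "j \<in> {1..L}" using \<open>x \<in> ?I\<close> by auto
    then have "inverse (l j) * ip leb2 D (tens (u i) (v j)) = ip leb2 P (tens (u i) (v j))"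
      using DP[of i j] lpos[of j] by simp
    then show ?thesis using x(1) by simp
  qed
  have 1: "nm leb2 (\<lambda>p. (\<Sum>x\<in>?I. ?a x p) - (\<Sum>x\<in>?I. ?b x p))
    \<le> real K * real L * (\<delta> / (l L * h) * (5 * nm leb2 D + 3 * l 1))"
  proof -
    have "nm leb2 (\<lambda>p. (\<Sum>x\<in>?I. ?a x p) - (\<Sum>x\<in>?I. ?b x p)) = nm leb2 (\<lambda>p. \<Sum>x\<in>?I. ?a x p - ?b x p)"
      by (simp add: sum_subtractf)
    also have "\<dots> \<le> (\<Sum>x\<in>?I. nm leb2 (\<lambda>p. ?a x p - ?b x p))"
      by (intro nm_sum_le sqint_diff a b)
    also have "\<dots> \<le> (\<Sum>x\<in>?I. \<delta> / (l L * h) * (5 * nm leb2 D + 3 * l 1))"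
    proof (rule sum_mono)
      fix x assume "x \<in> ?I"
      then obtain i j where x: "x = (i, j)" "i \<in> {1..K}" "j \<in> {1..L}" by auto
      have "min_gap l L \<le> gap l j" unfolding min_gap_def by (rule Min_le) (use x in auto)
      then have "h \<le> gap l j" using h(1) by linarith
      moreover have "min_gap g K \<le> gap g i" unfolding min_gap_def by (rule Min_le) (use x in auto)
      then have "h \<le> gap g i" using h(1) by linarith
      moreover have "l L \<le> l j" using x V.l_decreasing[of j L] by auto
      ultimately show "nm leb2 (\<lambda>p. ?a x p - ?b x p) \<le> \<delta> / (l L * h) * (5 * nm leb2 D + 3 * l 1)"
        using summand_error[OF VX VXh UY UYh D Dh dX dY dD, of i j "l L" h] x lL h(2) small by simp
    qed
    also have "\<dots> = real K * real L * (\<delta> / (l L * h) * (5 * nm leb2 D + 3 * l 1))" by simp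
    finally show ?thesis .
  qed
  have 2: "nm leb2 (\<lambda>p. (\<Sum>x\<in>?I. ?b x p) - P p)
    = sqrt ((nm leb2 P)\<^sup>2 - (\<Sum>i=1..K. \<Sum>j=1..L. (ip leb2 P (tens (u i) (v j)))\<^sup>2))"
  proof -
    have "(nm leb2 (\<lambda>p. P p - (\<Sum>x\<in>?I. ip leb2 P (?E x) * ?E x p)))\<^sup>2 = (nm leb2 P)\<^sup>2 - (\<Sum>x\<in>?I. (ip leb2 P (?E x))\<^sup>2)"
    proof (rule orthonormal_residual[OF _ _ _ P])
      fix x y assume "x \<in> ?I" "y \<in> ?I"
      then show "ip leb2 (?E x) (?E y) = (if x = y then 1 else 0)"
        using product_eigenfunctions(2)[OF UY VX] by (auto split: if_splits)
    qed (use product_eigenfunctions(1)[OF UY VX] in auto)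
    also have "(\<Sum>x\<in>?I. (ip leb2 P (?E x))\<^sup>2) = (\<Sum>i=1..K. \<Sum>j=1..L. (ip leb2 P (tens (u i) (v j)))\<^sup>2)"
      by (simp add: sum.cartesian_product case_prod_beta')
    also have "(\<lambda>p. P p - (\<Sum>x\<in>?I. ip leb2 P (?E x) * ?E x p)) = (\<lambda>p. P p - (\<Sum>x\<in>?I. ?b x p))"
    proof -
      have "(\<Sum>x\<in>?I. ip leb2 P (?E x) * ?E x p) = (\<Sum>x\<in>?I. ?b x p)" for p
      proof (rule sum.cong[OF refl])
        fix x assume "x \<in> ?I"
        from fun_cong[OF b'[OF this], of p] show "ip leb2 P (?E x) * ?E x p = ?b x p" by (simp only:)
      qed
      then show ?thesis by (simp only:)
    qed
    finally have "(nm leb2 (\<lambda>p. P p - (\<Sum>x\<in>?I. ?b x p)))\<^sup>2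
      = (nm leb2 P)\<^sup>2 - (\<Sum>i=1..K. \<Sum>j=1..L. (ip leb2 P (tens (u i) (v j)))\<^sup>2)" .
    then have "nm leb2 (\<lambda>p. P p - (\<Sum>x\<in>?I. ?b x p))
      = sqrt ((nm leb2 P)\<^sup>2 - (\<Sum>i=1..K. \<Sum>j=1..L. (ip leb2 P (tens (u i) (v j)))\<^sup>2))"
      by (rule real_sqrt_unique[symmetric, OF _ nm_nonneg])
    then show ?thesis by (simp only: nm_minus_commute[of leb2 P])
  qed
  have "nm leb2 (\<lambda>p. (\<Sum>x\<in>?I. ?a x p) - P p)
    \<le> nm leb2 (\<lambda>p. (\<Sum>x\<in>?I. ?a x p) - (\<Sum>x\<in>?I. ?b x p)) + nm leb2 (\<lambda>p. (\<Sum>x\<in>?I. ?b x p) - P p)"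
    by (intro nm_triangle_via sqint_sum a b P)
  then show ?thesis using 1 2 by (simp add: sum.cartesian_product case_prod_beta')
qed

section \<open>Measurability in the space of square-integrable functions\<close>

lemma L2_open_subset: "{V. L2_open V} \<subseteq> Pow L2_fun"
  by (auto simp: L2_open_def)

lemma space_L2_borel [simp]: "space L2_borel = sq01"
  unfolding L2_borel_def using L2_open_subset by (simp add: space_measure_of L2_fun_eq)

lemma sets_L2_borel: "sets L2_borel = sigma_sets sq01 {V. L2_open V}"
  unfolding L2_borel_def using L2_open_subset by (simp add: sets_measure_of L2_fun_eq)

lemma L2_open_in_sets: "L2_open V \<Longrightarrow> V \<in> sets L2_borel"
  unfolding sets_L2_borel by (rule sigma_sets.Basic) simp

lemma L2_openI:
  assumes "V \<subseteq> sq01" "\<And>f. f \<in> V \<Longrightarrow> \<exists>e>0. \<forall>g\<in>sq01. nm01 (\<lambda>t. g t - f t) < e \<longrightarrow> g \<in> V"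
  shows "L2_open V"
  using assms by (simp add: L2_open_def L2_fun_eq L2_norm_eq)

lemma continuous_imp_L2_measurable:
  fixes \<phi> :: "(real \<Rightarrow> real) \<Rightarrow> real"
  assumes cont: "\<And>z e. z \<in> sq01 \<Longrightarrow> e > 0 \<Longrightarrow>
    \<exists>d>0. \<forall>z'\<in>sq01. nm01 (\<lambda>t. z' t - z t) < d \<longrightarrow> \<bar>\<phi> z' - \<phi> z\<bar> < e"
  shows "\<phi> \<in> borel_measurable L2_borel"
proof (rule borel_measurableI)
  fix S :: "real set" assume S: "open S"
  have "L2_open (\<phi> -` S \<inter> sq01)"
  proof (rule L2_openI)
    fix f assume f: "f \<in> \<phi> -` S \<inter> sq01"
    then obtain e where e: "e > 0" "\<And>y. \<bar>y - \<phi> f\<bar> < e \<Longrightarrow> y \<in> S"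
      using S open_dist[of S] by (auto simp: dist_real_def)
    obtain d where "d > 0" "\<forall>z'\<in>sq01. nm01 (\<lambda>t. z' t - f t) < d \<longrightarrow> \<bar>\<phi> z' - \<phi> f\<bar> < e"
      using cont[of f e] f e(1) by auto
    then show "\<exists>e>0. \<forall>g\<in>sq01. nm01 (\<lambda>t. g t - f t) < e \<longrightarrow> g \<in> \<phi> -` S \<inter> sq01"
      using e(2) by (intro exI[of _ d]) auto
  qed auto
  then show "\<phi> -` S \<inter> space L2_borel \<in> sets L2_borel" by (simp add: L2_open_in_sets)
qed

lemma measurable_nm01 [measurable]: "nm01 \<in> borel_measurable L2_borel"
proof (rule continuous_imp_L2_measurable)
  fix z and e :: real assume z: "z \<in> sq01" and e: "e > 0"
  have "\<bar>nm01 z' - nm01 z\<bar> \<le> nm01 (\<lambda>t. z' t - z t)" if "z' \<in> sq01" for z'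
    using nm_le_add_diff[OF that z] nm_le_add_diff[OF z that] nm_minus_commute[of unit_leb z z'] by linarith
  then show "\<exists>d>0. \<forall>z'\<in>sq01. nm01 (\<lambda>t. z' t - z t) < d \<longrightarrow> \<bar>nm01 z' - nm01 z\<bar> < e"
    using e by (intro exI[of _ e]) force
qed

lemma measurable_ip01_const:
  assumes g: "g \<in> sq01"
  shows "(\<lambda>z. ip01 z g) \<in> borel_measurable L2_borel"
proof (rule continuous_imp_L2_measurable)
  fix z and e :: real assume z: "z \<in> sq01" and e: "e > 0"
  let ?d = "e / (nm01 g + 1)"
  have pos: "nm01 g + 1 > 0" using nm_nonneg[of unit_leb g] by linarith
  have "\<bar>ip01 z' g - ip01 z g\<bar> < e" if z': "z' \<in> sq01" and d: "nm01 (\<lambda>t. z' t - z t) < ?d" for z'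
  proof -
    have "\<bar>ip01 z' g - ip01 z g\<bar> \<le> nm01 (\<lambda>t. z' t - z t) * nm01 g"
      using ip_cauchy_schwarz[OF sqint_diff[OF z' z] g] by (simp add: ip_diff_left z z' g)
    also have "\<dots> \<le> nm01 (\<lambda>t. z' t - z t) * (nm01 g + 1)" by (intro mult_left_mono) auto
    also have "\<dots> < e" using d pos by (simp add: pos_less_divide_eq)
    finally show ?thesis .
  qed
  then show "\<exists>d>0. \<forall>z'\<in>sq01. nm01 (\<lambda>t. z' t - z t) < d \<longrightarrow> \<bar>ip01 z' g - ip01 z g\<bar> < e"
    using e pos by (intro exI[of _ ?d]) auto
qed

lemma measurable_translation:
  assumes m: "m \<in> sq01"
  shows "(\<lambda>z t. z t - m t) \<in> measurable L2_borel L2_borel"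
  unfolding L2_borel_def
proof (rule measurable_measure_of[OF L2_open_subset], unfold L2_borel_def[symmetric])
  show "(\<lambda>z t. z t - m t) \<in> space L2_borel \<rightarrow> L2_fun" using m by (auto simp: L2_fun_eq intro: sqint_diff)
  fix V assume "V \<in> {V. L2_open V}"
  then have V: "\<And>f. f \<in> V \<Longrightarrow> \<exists>e>0. \<forall>g\<in>sq01. nm01 (\<lambda>t. g t - f t) < e \<longrightarrow> g \<in> V"
    by (simp add: L2_open_def L2_fun_eq L2_norm_eq)
  have "L2_open ((\<lambda>z t. z t - m t) -` V \<inter> sq01)"
  proof (rule L2_openI)
    fix f assume f: "f \<in> (\<lambda>z t. z t - m t) -` V \<inter> sq01"
    then obtain e where e: "e > 0" "\<forall>g\<in>sq01. nm01 (\<lambda>t. g t - (f t - m t)) < e \<longrightarrow> g \<in> V" using V by auto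
    have "(\<lambda>t. g t - m t) \<in> V" if "g \<in> sq01" "nm01 (\<lambda>t. g t - f t) < e" for g
      using e(2) sqint_diff[OF that(1) m] that(2) by simp
    then show "\<exists>e>0. \<forall>g\<in>sq01. nm01 (\<lambda>t. g t - f t) < e \<longrightarrow> g \<in> (\<lambda>z t. z t - m t) -` V \<inter> sq01"
      using e(1) by (intro exI[of _ e]) auto
  qed auto
  then show "(\<lambda>z t. z t - m t) -` V \<inter> space L2_borel \<in> sets L2_borel" by (simp add: L2_open_in_sets)
qed

text \<open>Unlike all combinations of initial indicators, these form a countable dense set.\<close>

definition rat_comb :: "(rat \<times> rat) list \<Rightarrow> real \<Rightarrow> real" where
  "rat_comb xs = span_comb initial_ind (map (\<lambda>(c, q). (of_rat c, q)) xs)"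

lemma rat_comb_sqint: "rat_comb xs \<in> sq01"
  by (simp add: rat_comb_def span_comb_sqint initial_ind_sqint)

lemma nm_initial_ind_le: "nm01 (initial_ind q) \<le> 1"
proof -
  have "(\<integral>t. (initial_ind q t)\<^sup>2 \<partial>unit_leb) \<le> (\<integral>t. 1 \<partial>unit_leb)"
    by (intro integral_mono sqint_integrable_sq initial_ind_sqint) (auto simp: initial_ind_def indicator_def)
  then show ?thesis using unit_leb.prob_space by (simp add: nm_def)
qed

lemma rat_comb_approx:
  assumes "r > 0"
  shows "\<exists>ys. nm01 (\<lambda>t. span_comb initial_ind xs t - rat_comb ys t) < r"
  using assms
proof (induction xs arbitrary: r)
  case Nil
  have "nm01 (\<lambda>t. span_comb initial_ind [] t - rat_comb [] t) = 0"
    by (simp add: span_comb_def rat_comb_def nm_def)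
  then show ?case using Nil by metis
next
  case (Cons a xs)
  obtain c q where a: "a = (c, q)" by (cases a)
  obtain ys where ys: "nm01 (\<lambda>t. span_comb initial_ind xs t - rat_comb ys t) < r / 2"
    using Cons.IH[of "r / 2"] Cons.prems by auto
  obtain d where d: "c < of_rat d" "of_rat d < c + r / 2" using of_rat_dense[of c "c + r / 2"] Cons.prems by auto
  have eq: "(\<lambda>t. span_comb initial_ind (a # xs) t - rat_comb ((d, q) # ys) t)
    = (\<lambda>t. (c - of_rat d) * initial_ind q t + (span_comb initial_ind xs t - rat_comb ys t))"
    by (simp add: a span_comb_def rat_comb_def fun_eq_iff algebra_simps)
  have "nm01 (\<lambda>t. span_comb initial_ind (a # xs) t - rat_comb ((d, q) # ys) t)
    \<le> nm01 (\<lambda>t. (c - of_rat d) * initial_ind q t) + nm01 (\<lambda>t. span_comb initial_ind xs t - rat_comb ys t)"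
    unfolding eq by (intro nm_triangle sqint_scale sqint_diff initial_ind_sqint span_comb_sqint rat_comb_sqint)
  also have "nm01 (\<lambda>t. (c - of_rat d) * initial_ind q t) \<le> r / 2"
  proof -
    have "\<bar>c - of_rat d\<bar> * nm01 (initial_ind q) \<le> (r / 2) * 1"
      using d nm_initial_ind_le by (intro mult_mono) auto
    then show ?thesis by (simp add: nm_scale)
  qed
  finally have "nm01 (\<lambda>t. span_comb initial_ind (a # xs) t - rat_comb ((d, q) # ys) t) < r" using ys by linarith
  then show ?case by blast
qed

lemma rat_comb_dense:
  assumes f: "f \<in> sq01" and r: "r > 0"
  obtains ys where "nm01 (\<lambda>t. f t - rat_comb ys t) < r"
proof -
  obtain xs where xs: "nm01 (\<lambda>x. f x - span_comb initial_ind xs x) < r / 2"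
    using initial_ind_dense[OF f, of "r / 2"] r by auto
  obtain ys where ys: "nm01 (\<lambda>t. span_comb initial_ind xs t - rat_comb ys t) < r / 2"
    using rat_comb_approx[of "r / 2" xs] r by auto
  have "nm01 (\<lambda>t. f t - rat_comb ys t)
    \<le> nm01 (\<lambda>x. f x - span_comb initial_ind xs x) + nm01 (\<lambda>t. span_comb initial_ind xs t - rat_comb ys t)"
    by (intro nm_triangle_via f span_comb_sqint initial_ind_sqint rat_comb_sqint)
  then show ?thesis using that[of ys] xs ys by linarith
qed

text \<open>The affine functions on the right equal \<open>\<parallel>z\<parallel>\<^sup>2 - \<parallel>z - d\<parallel>\<^sup>2\<close> with \<open>d\<close> from a dense set. The point is that the supremum is countable:
  this yields joint measurability of the distance, hence of the inner product, with respect to the product \<open>\<sigma>\<close>-algebra.\<close>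

lemma nm_sq_eq_SUP:
  assumes z: "z \<in> sq01"
  shows "bdd_above (range (\<lambda>ys. 2 * ip01 z (rat_comb ys) - (nm01 (rat_comb ys))\<^sup>2))"
    and "(nm01 z)\<^sup>2 = (SUP ys. 2 * ip01 z (rat_comb ys) - (nm01 (rat_comb ys))\<^sup>2)"
proof -
  let ?F = "\<lambda>ys. 2 * ip01 z (rat_comb ys) - (nm01 (rat_comb ys))\<^sup>2"
  have F: "?F ys = (nm01 z)\<^sup>2 - (nm01 (\<lambda>t. z t - rat_comb ys t))\<^sup>2" for ys
    unfolding nm_sq ip_diff_self[OF z rat_comb_sqint] by simp
  have le: "?F ys \<le> (nm01 z)\<^sup>2" for ys unfolding F by simp
  show bdd: "bdd_above (range ?F)" using le by (intro bdd_aboveI2)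
  show "(nm01 z)\<^sup>2 = (SUP ys. ?F ys)"
  proof (rule antisym)
    show "(SUP ys. ?F ys) \<le> (nm01 z)\<^sup>2" using le by (intro cSUP_least) auto
    show "(nm01 z)\<^sup>2 \<le> (SUP ys. ?F ys)"
    proof (rule field_le_epsilon)
      fix e :: real assume e: "e > 0"
      obtain ys where "nm01 (\<lambda>t. z t - rat_comb ys t) < sqrt e" using rat_comb_dense[OF z, of "sqrt e"] e by auto
      then have "(nm01 (\<lambda>t. z t - rat_comb ys t))\<^sup>2 < (sqrt e)\<^sup>2" by (intro power_strict_mono) auto
      then have "(nm01 z)\<^sup>2 \<le> ?F ys + e" unfolding F using e by simp
      also have "?F ys \<le> (SUP ys. ?F ys)" by (intro cSUP_upper bdd) simp
      finally show "(nm01 z)\<^sup>2 \<le> (SUP ys. ?F ys) + e" by simp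
    qed
  qed
qed

lemma measurable_dist_sq:
  "(\<lambda>p. (nm01 (\<lambda>t. fst p t - snd p t))\<^sup>2) \<in> borel_measurable (L2_borel \<Otimes>\<^sub>M L2_borel)"
proof -
  let ?F = "\<lambda>ys p. 2 * (ip01 (fst p) (rat_comb ys) - ip01 (snd p) (rat_comb ys)) - (nm01 (rat_comb ys))\<^sup>2"
  have ipd: "ip01 (\<lambda>t. fst p t - snd p t) (rat_comb ys) = ip01 (fst p) (rat_comb ys) - ip01 (snd p) (rat_comb ys)"
    and d: "(\<lambda>t. fst p t - snd p t) \<in> sq01"
    if "p \<in> space (L2_borel \<Otimes>\<^sub>M L2_borel)" for p ys
    using that by (auto simp: space_pair_measure ip_diff_left rat_comb_sqint intro: sqint_diff)
  have "(\<lambda>p. SUP ys. ?F ys p) \<in> borel_measurable (L2_borel \<Otimes>\<^sub>M L2_borel)"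
  proof (rule borel_measurable_cSUP)
    fix ys
    have [measurable]: "(\<lambda>z. ip01 z (rat_comb ys)) \<in> borel_measurable L2_borel"
      by (rule measurable_ip01_const[OF rat_comb_sqint])
    show "?F ys \<in> borel_measurable (L2_borel \<Otimes>\<^sub>M L2_borel)" by measurable
  next
    fix p assume "p \<in> space (L2_borel \<Otimes>\<^sub>M L2_borel)"
    then show "bdd_above (range (\<lambda>ys. ?F ys p))" using nm_sq_eq_SUP(1)[OF d] ipd by simp
  qed simp
  moreover have "(SUP ys. ?F ys p) = (nm01 (\<lambda>t. fst p t - snd p t))\<^sup>2"
    if p: "p \<in> space (L2_borel \<Otimes>\<^sub>M L2_borel)" for p
    using nm_sq_eq_SUP(2)[OF d[OF p]] by (simp add: ipd[OF p])
  ultimately show ?thesis by (subst measurable_cong[symmetric]) auto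
qed

lemma measurable_dist [measurable]:
  "(\<lambda>p. nm01 (\<lambda>t. fst p t - snd p t)) \<in> borel_measurable (L2_borel \<Otimes>\<^sub>M L2_borel)"
proof -
  have "(\<lambda>p. sqrt ((nm01 (\<lambda>t. fst p t - snd p t))\<^sup>2)) \<in> borel_measurable (L2_borel \<Otimes>\<^sub>M L2_borel)"
    using measurable_dist_sq by measurable
  then show ?thesis by simp
qed

lemma measurable_ip01 [measurable]:
  "(\<lambda>p. ip01 (fst p) (snd p)) \<in> borel_measurable (L2_borel \<Otimes>\<^sub>M L2_borel)"
proof -
  have m: "(\<lambda>p. ((nm01 (fst p))\<^sup>2 + (nm01 (snd p))\<^sup>2 - (nm01 (\<lambda>t. fst p t - snd p t))\<^sup>2) / 2)
      \<in> borel_measurable (L2_borel \<Otimes>\<^sub>M L2_borel)"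
    using measurable_dist_sq by measurable
  have eq: "((nm01 (fst p))\<^sup>2 + (nm01 (snd p))\<^sup>2 - (nm01 (\<lambda>t. fst p t - snd p t))\<^sup>2) / 2 = ip01 (fst p) (snd p)"
    if "p \<in> space (L2_borel \<Otimes>\<^sub>M L2_borel)" for p
    using that by (simp add: space_pair_measure mem_Times_iff nm_sq ip_diff_self)
  show ?thesis by (rule measurable_cong[THEN iffD1, rotated, OF m]) (rule eq)
qed

text \<open>Open sets are defined by the seminorm, which does not see null sets; the property passes to the generated \<open>\<sigma>\<close>-algebra.\<close>

lemma L2_borel_AE_invariant:
  assumes "A \<in> sets L2_borel" "x \<in> sq01" "y \<in> sq01" "AE t in unit_leb. x t = y t"
  shows "x \<in> A \<longleftrightarrow> y \<in> A"
proof -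
  have "\<forall>x\<in>sq01. \<forall>y\<in>sq01. (AE t in unit_leb. x t = y t) \<longrightarrow> (x \<in> A \<longleftrightarrow> y \<in> A)"
    using assms(1) unfolding sets_L2_borel
  proof (induction rule: sigma_sets.induct)
    case (Basic V)
    have *: "y \<in> V" if xy: "x \<in> V" "y \<in> sq01" "AE t in unit_leb. x t = y t" for x y
    proof -
      obtain e where e: "e > 0" "\<forall>g\<in>sq01. nm01 (\<lambda>t. g t - x t) < e \<longrightarrow> g \<in> V" and x: "x \<in> sq01"
      proof -
        have "V \<subseteq> sq01" "\<forall>f\<in>V. \<exists>e>0. \<forall>g\<in>sq01. nm01 (\<lambda>t. g t - f t) < e \<longrightarrow> g \<in> V"
          using Basic by (simp_all add: L2_open_def L2_fun_eq L2_norm_eq)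
        then show thesis using xy(1) that by (meson subsetD)
      qed
      have "nm01 (\<lambda>t. y t - x t) = 0"
        using xy(3) by (subst nm_eq_0_iff[OF sqint_diff[OF xy(2) x]]) auto
      then show ?thesis using e xy(2) by simp
    qed
    have sym: "AE t in unit_leb. y t = x t" if "AE t in unit_leb. x t = y t" for x y :: "real \<Rightarrow> real"
      using that by auto
    show ?case
    proof (intro ballI impI iffI)
      fix x y assume "x \<in> sq01" "y \<in> sq01" "AE t in unit_leb. x t = y t"
      note xy = this
      show "y \<in> V" if "x \<in> V" by (rule *[OF that xy(2,3)])
      show "x \<in> V" if "y \<in> V" by (rule *[OF that xy(1) sym[OF xy(3)]])
    qed
  next
    case Empty
    show ?case by simp
  next
    case (Compl a)
    show ?case
    proof (intro ballI impI)
      fix x y assume xy: "x \<in> sq01" "y \<in> sq01" "AE t in unit_leb. x t = y t"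
      then have "x \<in> a \<longleftrightarrow> y \<in> a" using Compl.IH by blast
      then show "x \<in> sq01 - a \<longleftrightarrow> y \<in> sq01 - a" using xy(1,2) by simp
    qed
  next
    case (Union a)
    show ?case
    proof (intro ballI impI)
      fix x y assume "x \<in> sq01" "y \<in> sq01" "AE t in unit_leb. x t = y t"
      then have "x \<in> a i \<longleftrightarrow> y \<in> a i" for i using Union.IH[of i] by blast
      then show "x \<in> (\<Union>i. a i) \<longleftrightarrow> y \<in> (\<Union>i. a i)" by simp
    qed
  qed
  then show ?thesis using assms(2-4) by blast
qed

lemma distr_L2_borel_cong_AE:
  assumes Z: "Z \<in> measurable M L2_borel" and Z': "Z' \<in> measurable M L2_borel"
    and eq: "AE \<omega> in M. AE t in unit_leb. Z \<omega> t = Z' \<omega> t"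
  shows "distr M L2_borel Z = distr M L2_borel Z'"
proof (rule measure_eqI)
  fix A assume "A \<in> sets (distr M L2_borel Z)"
  then have A: "A \<in> sets L2_borel" by simp
  have "AE \<omega> in M. \<omega> \<in> Z -` A \<inter> space M \<longleftrightarrow> \<omega> \<in> Z' -` A \<inter> space M"
    using eq AE_space
  proof eventually_elim
    case (elim \<omega>)
    have "Z \<omega> \<in> sq01" "Z' \<omega> \<in> sq01" using elim(2) Z Z' by (auto dest: measurable_space)
    then show ?case using L2_borel_AE_invariant[OF A _ _ elim(1)] elim(2) by simp
  qed
  then have "emeasure M (Z -` A \<inter> space M) = emeasure M (Z' -` A \<inter> space M)"
    by (rule emeasure_eq_AE) (use A Z Z' in \<open>auto intro: measurable_sets\<close>)
  then show "emeasure (distr M L2_borel Z) A = emeasure (distr M L2_borel Z') A"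
    using A Z Z' by (simp add: emeasure_distr)
qed simp

section \<open>Random functions and their moments\<close>

lemma prob_space_leb2: "prob_space leb2"
  by unfold_locales

lemma (in pair_prob_space) ktransp_ip:
  assumes "k \<in> sqint (M1 \<Otimes>\<^sub>M M2)" "h \<in> sqint (M1 \<Otimes>\<^sub>M M2)"
  shows "ip (M2 \<Otimes>\<^sub>M M1) (ktransp k) (ktransp h) = ip (M1 \<Otimes>\<^sub>M M2) k h"
proof -
  have m: "(\<lambda>p. k p * h p) \<in> borel_measurable (M1 \<Otimes>\<^sub>M M2)" using assms by (auto simp: sqint_def)
  show ?thesis
    unfolding ip_def integral_product_swap[OF m, symmetric] ktransp_def case_prod_beta' ..
qed

lemma power4_add_le: "(x + y) ^ 4 \<le> 8 * (x ^ 4 + y ^ 4)" for x y :: real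
proof -
  have 1: "(x + y)\<^sup>2 \<le> 2 * (x\<^sup>2 + y\<^sup>2)" using zero_le_power2[of "x - y"] by (simp add: power2_sum power2_diff)
  have 2: "(x\<^sup>2 + y\<^sup>2)\<^sup>2 \<le> 2 * ((x\<^sup>2)\<^sup>2 + (y\<^sup>2)\<^sup>2)"
    using zero_le_power2[of "x\<^sup>2 - y\<^sup>2"] by (simp add: power2_sum power2_diff)
  have "((x + y)\<^sup>2)\<^sup>2 \<le> (2 * (x\<^sup>2 + y\<^sup>2))\<^sup>2" using 1 by (intro power_mono) auto
  also have "\<dots> = 4 * (x\<^sup>2 + y\<^sup>2)\<^sup>2" by (simp only: power_mult_distrib) simp
  also have "\<dots> \<le> 8 * ((x\<^sup>2)\<^sup>2 + (y\<^sup>2)\<^sup>2)" using 2 by linarith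
  finally show ?thesis by (simp add: power_mult[symmetric])
qed

text \<open>Random functions are treated as functions on a product space, where Fubini's theorem and the Hilbert space
  structure of square-integrable functions are available.\<close>

definition joint :: "('w \<Rightarrow> real \<Rightarrow> real) \<Rightarrow> 'w \<times> real \<Rightarrow> real" where
  "joint Z p = Z (fst p) (snd p)"

definition rprod :: "('w \<Rightarrow> real \<Rightarrow> real) \<Rightarrow> ('w \<Rightarrow> real \<Rightarrow> real) \<Rightarrow> 'w \<times> real \<times> real \<Rightarrow> real" where
  "rprod Z W p = tens (Z (fst p)) (W (fst p)) (snd p)"

definition L4 :: "'w measure \<Rightarrow> ('w \<Rightarrow> real \<Rightarrow> real) \<Rightarrow> bool" where
  "L4 M Z \<longleftrightarrow> random_fun M Z \<and> integrable M (\<lambda>\<omega>. nm01 (Z \<omega>) ^ 4)"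

definition mom2 :: "'w measure \<Rightarrow> ('w \<Rightarrow> real \<Rightarrow> real) \<Rightarrow> ('w \<Rightarrow> real \<Rightarrow> real) \<Rightarrow> real \<times> real \<Rightarrow> real" where
  "mom2 M Z W p = (\<integral>\<omega>. Z \<omega> (fst p) * W \<omega> (snd p) \<partial>M)"

lemma in_LpH_4_iff: "in_LpH M 4 Z \<longleftrightarrow> L4 M Z"
proof -
  have "x powr 4 = x ^ 4" if "0 \<le> x" for x :: real
    using that by (cases "x = 0") (auto simp: powr_numeral)
  then show ?thesis by (simp add: in_LpH_def L4_def L2_norm_eq)
qed

context prob_space
begin

interpretation MU: pair_prob_space M unit_leb by unfold_locales
interpretation UM: pair_prob_space unit_leb M by unfold_locales
interpretation MUU: pair_prob_space M leb2 by unfold_locales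
interpretation UUM: pair_prob_space leb2 M by unfold_locales

lemma joint_measurable: "random_fun M Z \<Longrightarrow> joint Z \<in> borel_measurable (M \<Otimes>\<^sub>M unit_leb)"
  by (simp add: random_fun_def joint_def[abs_def] case_prod_beta')

lemma random_fun_sqint: "random_fun M Z \<Longrightarrow> \<omega> \<in> space M \<Longrightarrow> Z \<omega> \<in> sq01"
  by (simp add: random_fun_def L2_fun_eq)

lemma rprod_measurable:
  assumes "random_fun M Z" "random_fun M W"
  shows "rprod Z W \<in> borel_measurable (M \<Otimes>\<^sub>M leb2)"
proof -
  have f: "(\<lambda>p. (fst p, fst (snd p))) \<in> measurable (M \<Otimes>\<^sub>M leb2) (M \<Otimes>\<^sub>M unit_leb)"
    and g: "(\<lambda>p. (fst p, snd (snd p))) \<in> measurable (M \<Otimes>\<^sub>M leb2) (M \<Otimes>\<^sub>M unit_leb)"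
    by measurable
  have "(\<lambda>p. joint Z (fst p, fst (snd p)) * joint W (fst p, snd (snd p))) \<in> borel_measurable (M \<Otimes>\<^sub>M leb2)"
    by (intro borel_measurable_times measurable_compose[OF f joint_measurable] measurable_compose[OF g joint_measurable] assms)
  then show ?thesis by (simp add: rprod_def[abs_def] tens_def joint_def)
qed

lemma measurable_nm_random:
  assumes "random_fun M Z" shows "(\<lambda>\<omega>. nm01 (Z \<omega>)) \<in> borel_measurable M"
  using MU.measurable_nm_section[OF joint_measurable[OF assms]] by (simp add: joint_def)

lemma measurable_ip_random:
  assumes "random_fun M Z" "random_fun M W" shows "(\<lambda>\<omega>. ip01 (Z \<omega>) (W \<omega>)) \<in> borel_measurable M"
proof -
  have "(\<lambda>\<omega>. \<integral>t. joint Z (\<omega>, t) * joint W (\<omega>, t) \<partial>unit_leb) \<in> borel_measurable M"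
    using joint_measurable[OF assms(1)] joint_measurable[OF assms(2)]
    by (intro unit_leb.borel_measurable_lebesgue_integral) (simp add: case_prod_beta')
  then show ?thesis by (simp add: joint_def ip_def)
qed

lemma random_fun_const: "m \<in> sq01 \<Longrightarrow> random_fun M (\<lambda>\<omega>. m)"
  unfolding random_fun_def L2_fun_eq using measurable_compose[OF measurable_snd, of m unit_leb borel M]
  by (auto simp: case_prod_beta')

lemma random_fun_diff:
  assumes "random_fun M Z" "random_fun M W" shows "random_fun M (\<lambda>\<omega> t. Z \<omega> t - W \<omega> t)"
  using assms borel_measurable_diff[of "\<lambda>(\<omega>, t). Z \<omega> t" "M \<Otimes>\<^sub>M unit_leb" "\<lambda>(\<omega>, t). W \<omega> t"]
  by (auto simp: random_fun_def L2_fun_eq case_prod_beta' intro: sqint_diff)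

lemma L4_random_fun: "L4 M Z \<Longrightarrow> random_fun M Z"
  by (simp add: L4_def)

lemma L4_sqint: "L4 M Z \<Longrightarrow> \<omega> \<in> space M \<Longrightarrow> Z \<omega> \<in> sq01"
  by (simp add: L4_def random_fun_sqint)

lemma L4_nm_sq: "L4 M Z \<Longrightarrow> (\<lambda>\<omega>. (nm01 (Z \<omega>))\<^sup>2) \<in> sqint M"
  using measurable_nm_random[of Z] by (auto simp: L4_def sqint_def power_mult[symmetric])

lemma L4_nm: "L4 M Z \<Longrightarrow> (\<lambda>\<omega>. nm01 (Z \<omega>)) \<in> sqint M"
  using sqint_integrable[OF L4_nm_sq] measurable_nm_random[of Z] by (auto simp: L4_def sqint_def)

lemma L4_mult: "L4 M Z \<Longrightarrow> L4 M W \<Longrightarrow> integrable M (\<lambda>\<omega>. (nm01 (Z \<omega>))\<^sup>2 * (nm01 (W \<omega>))\<^sup>2)"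
  by (intro sqint_integrable_mult L4_nm_sq)

lemma L4_joint: assumes "L4 M Z" shows "joint Z \<in> sqint (M \<Otimes>\<^sub>M unit_leb)"
proof (rule MU.sqint_pairI)
  show "joint Z \<in> borel_measurable (M \<Otimes>\<^sub>M unit_leb)" by (rule joint_measurable[OF L4_random_fun[OF assms]])
  show "AE \<omega> in M. (\<lambda>t. joint Z (\<omega>, t)) \<in> sq01" using L4_sqint[OF assms] by (auto simp: joint_def)
  show "integrable M (\<lambda>\<omega>. (nm01 (\<lambda>t. joint Z (\<omega>, t)))\<^sup>2)"
    using sqint_integrable_sq[OF L4_nm[OF assms]] by (simp add: joint_def)
qed

lemma L4_rprod: assumes "L4 M Z" "L4 M W" shows "rprod Z W \<in> sqint (M \<Otimes>\<^sub>M leb2)"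
proof (rule MUU.sqint_pairI)
  show "rprod Z W \<in> borel_measurable (M \<Otimes>\<^sub>M leb2)"
    by (rule rprod_measurable[OF L4_random_fun[OF assms(1)] L4_random_fun[OF assms(2)]])
  show "AE \<omega> in M. (\<lambda>p. rprod Z W (\<omega>, p)) \<in> sqint leb2"
    using L4_sqint[OF assms(1)] L4_sqint[OF assms(2)] by (auto simp: rprod_def intro: unit_leb2.tens_sqint)
  have "integrable M (\<lambda>\<omega>. (nm leb2 (\<lambda>p. rprod Z W (\<omega>, p)))\<^sup>2) \<longleftrightarrow> integrable M (\<lambda>\<omega>. (nm01 (Z \<omega>))\<^sup>2 * (nm01 (W \<omega>))\<^sup>2)"
    using L4_sqint[OF assms(1)] L4_sqint[OF assms(2)]
    by (intro Bochner_Integration.integrable_cong) (auto simp: rprod_def unit_leb2.nm_tens power_mult_distrib)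
  then show "integrable M (\<lambda>\<omega>. (nm leb2 (\<lambda>p. rprod Z W (\<omega>, p)))\<^sup>2)" using L4_mult[OF assms] by simp
qed

lemma L4_ip_integrable:
  assumes "L4 M Z" "L4 M W"
  shows "integrable M (\<lambda>\<omega>. ip01 (Z \<omega>) (W \<omega>))" "integrable M (\<lambda>\<omega>. (ip01 (Z \<omega>) (W \<omega>))\<^sup>2)"
proof -
  have m: "(\<lambda>\<omega>. ip01 (Z \<omega>) (W \<omega>)) \<in> borel_measurable M"
    by (rule measurable_ip_random[OF L4_random_fun[OF assms(1)] L4_random_fun[OF assms(2)]])
  have "AE \<omega> in M. norm ((ip01 (Z \<omega>) (W \<omega>))\<^sup>2) \<le> norm ((nm01 (Z \<omega>))\<^sup>2 * (nm01 (W \<omega>))\<^sup>2)"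
  proof (rule AE_I2)
    fix \<omega> assume \<omega>: "\<omega> \<in> space M"
    show "norm ((ip01 (Z \<omega>) (W \<omega>))\<^sup>2) \<le> norm ((nm01 (Z \<omega>))\<^sup>2 * (nm01 (W \<omega>))\<^sup>2)"
      using ip_cauchy_schwarz_sq[OF L4_sqint[OF assms(1) \<omega>] L4_sqint[OF assms(2) \<omega>]] by (simp add: nm_sq)
  qed
  then show 2: "integrable M (\<lambda>\<omega>. (ip01 (Z \<omega>) (W \<omega>))\<^sup>2)"
    using m by (intro Bochner_Integration.integrable_bound[OF L4_mult[OF assms]]) auto
  then have "(\<lambda>\<omega>. ip01 (Z \<omega>) (W \<omega>)) \<in> sqint M" using m by (simp add: sqint_def)
  then show "integrable M (\<lambda>\<omega>. ip01 (Z \<omega>) (W \<omega>))" by (rule sqint_integrable)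
qed

lemma L4_const: "m \<in> sq01 \<Longrightarrow> L4 M (\<lambda>\<omega>. m)"
  by (simp add: L4_def random_fun_const)

text \<open>Domination by a linear combination of the norms of functions with finite fourth moment.\<close>

lemma L4I:
  assumes "random_fun M Z" "L4 M W" "L4 M V" "c \<ge> 0"
    and le: "AE \<omega> in M. nm01 (Z \<omega>) \<le> nm01 (W \<omega>) + c * nm01 (V \<omega>)"
  shows "L4 M Z"
proof -
  have m: "(\<lambda>\<omega>. nm01 (Z \<omega>)) \<in> borel_measurable M" by (rule measurable_nm_random[OF assms(1)])
  have int: "integrable M (\<lambda>\<omega>. 8 * (nm01 (W \<omega>) ^ 4 + (c * nm01 (V \<omega>)) ^ 4))"
    using assms by (auto simp: L4_def power_mult_distrib)
  have "integrable M (\<lambda>\<omega>. nm01 (Z \<omega>) ^ 4)"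
  proof (rule Bochner_Integration.integrable_bound[OF int])
    show "(\<lambda>\<omega>. nm01 (Z \<omega>) ^ 4) \<in> borel_measurable M" using m by measurable
    show "AE \<omega> in M. norm (nm01 (Z \<omega>) ^ 4) \<le> norm (8 * (nm01 (W \<omega>) ^ 4 + (c * nm01 (V \<omega>)) ^ 4))"
      using le
    proof eventually_elim
      case (elim \<omega>)
      have "nm01 (Z \<omega>) ^ 4 \<le> (nm01 (W \<omega>) + c * nm01 (V \<omega>)) ^ 4" using elim by (intro power_mono) auto
      also have "\<dots> \<le> 8 * (nm01 (W \<omega>) ^ 4 + (c * nm01 (V \<omega>)) ^ 4)" by (rule power4_add_le)
      finally show ?case by simp
    qed
  qed
  then show ?thesis using assms(1) by (simp add: L4_def)
qed

lemma L4_diff: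
  assumes "L4 M Z" "L4 M W" shows "L4 M (\<lambda>\<omega> t. Z \<omega> t - W \<omega> t)"
  using L4_sqint[OF assms(1)] L4_sqint[OF assms(2)]
  by (intro L4I[OF random_fun_diff[OF L4_random_fun[OF assms(1)] L4_random_fun[OF assms(2)]] assms, of 1])
    (auto intro!: nm_triangle_diff)

subsection \<open>Means and second-moment kernels\<close>

text \<open>Means and second-moment kernels are integral operators applied to the constant function \<open>1\<close> on the probability space, so
  integrability and the interchange with inner products follow from the general facts on kernels.\<close>

lemma mean_fun_eq: "mean_fun M Z = kapp M (ktransp (joint Z)) (\<lambda>\<omega>. 1)"
  by (simp add: fun_eq_iff mean_fun_def kapp_def ip_def ktransp_def joint_def)

lemma one_sqint: "(\<lambda>\<omega>. 1) \<in> sqint M"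
  by (simp add: sqint_def)

lemma mean_fun_sqint: "L4 M Z \<Longrightarrow> mean_fun M Z \<in> sq01"
  unfolding mean_fun_eq by (intro UM.kapp_sqint MU.ktransp_sqint L4_joint one_sqint)

lemma ip_mean_fun:
  assumes Z: "L4 M Z" and g: "g \<in> sq01"
  shows "ip01 (mean_fun M Z) g = expectation (\<lambda>\<omega>. ip01 (Z \<omega>) g)"
proof -
  have t: "tens (\<lambda>\<omega>. 1) g \<in> sqint (M \<Otimes>\<^sub>M unit_leb)" by (rule MU.tens_sqint[OF one_sqint g])
  have "ip01 (mean_fun M Z) g = ip (unit_leb \<Otimes>\<^sub>M M) (ktransp (joint Z)) (tens g (\<lambda>\<omega>. 1))"
    unfolding mean_fun_eq using Z g by (simp add: UM.ip_tens_right MU.ktransp_sqint L4_joint one_sqint)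
  also have "tens g (\<lambda>\<omega>. 1) = ktransp (tens (\<lambda>\<omega>::'a. 1::real) g)" by (simp only: ktransp_tens)
  also have "ip (unit_leb \<Otimes>\<^sub>M M) (ktransp (joint Z)) (ktransp (tens (\<lambda>\<omega>. 1) g)) = ip (M \<Otimes>\<^sub>M unit_leb) (joint Z) (tens (\<lambda>\<omega>. 1) g)"
    by (rule MU.ktransp_ip[OF L4_joint[OF Z] t])
  also have "\<dots> = expectation (\<lambda>\<omega>. ip01 (Z \<omega>) g)"
    unfolding MU.ip_sections(2)[OF L4_joint[OF Z] t] by (simp add: joint_def tens_def)
  finally show ?thesis .
qed

lemma expectation_ip_mean_zero:
  assumes X: "L4 M X" and mean: "AE t in unit_leb. mean_fun M X t = 0" and g: "g \<in> sq01"
  shows "expectation (\<lambda>\<omega>. ip01 (X \<omega>) g) = 0"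
proof -
  have "expectation (\<lambda>\<omega>. ip01 (X \<omega>) g) = ip01 (mean_fun M X) g" by (rule ip_mean_fun[OF X g, symmetric])
  also have "\<dots> = ip01 (\<lambda>t. 0) g" using mean mean_fun_sqint[OF X] g by (intro ip_cong_AE) auto
  finally show ?thesis by simp
qed

lemma mom2_eq: "mom2 M Z W = kapp M (ktransp (rprod Z W)) (\<lambda>\<omega>. 1)"
  by (simp add: fun_eq_iff mom2_def kapp_def ip_def ktransp_def rprod_def tens_def)

lemma mom2_sqint: "L4 M Z \<Longrightarrow> L4 M W \<Longrightarrow> mom2 M Z W \<in> sqint leb2"
  unfolding mom2_eq by (intro UUM.kapp_sqint MUU.ktransp_sqint L4_rprod one_sqint)

lemma ip_mom2:
  assumes Z: "L4 M Z" and W: "L4 M W" and k: "k \<in> sqint leb2"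
  shows "ip leb2 (mom2 M Z W) k = expectation (\<lambda>\<omega>. ip leb2 (tens (Z \<omega>) (W \<omega>)) k)"
    and "integrable M (\<lambda>\<omega>. ip leb2 (tens (Z \<omega>) (W \<omega>)) k)"
proof -
  have t: "tens (\<lambda>\<omega>. 1) k \<in> sqint (M \<Otimes>\<^sub>M leb2)" by (rule MUU.tens_sqint[OF one_sqint k])
  have "ip leb2 (mom2 M Z W) k = ip (leb2 \<Otimes>\<^sub>M M) (ktransp (rprod Z W)) (tens k (\<lambda>\<omega>. 1))"
    unfolding mom2_eq using Z W k by (simp add: UUM.ip_tens_right MUU.ktransp_sqint L4_rprod one_sqint)
  also have "tens k (\<lambda>\<omega>. 1) = ktransp (tens (\<lambda>\<omega>::'a. 1::real) k)" by (simp only: ktransp_tens)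
  also have "ip (leb2 \<Otimes>\<^sub>M M) (ktransp (rprod Z W)) (ktransp (tens (\<lambda>\<omega>. 1) k)) = ip (M \<Otimes>\<^sub>M leb2) (rprod Z W) (tens (\<lambda>\<omega>. 1) k)"
    by (rule MUU.ktransp_ip[OF L4_rprod[OF Z W] t])
  also have "\<dots> = expectation (\<lambda>\<omega>. ip leb2 (tens (Z \<omega>) (W \<omega>)) k)"
    unfolding MUU.ip_sections(2)[OF L4_rprod[OF Z W] t] by (simp add: rprod_def tens_def[of "\<lambda>\<omega>. 1"])
  finally show "ip leb2 (mom2 M Z W) k = expectation (\<lambda>\<omega>. ip leb2 (tens (Z \<omega>) (W \<omega>)) k)" .
  show "integrable M (\<lambda>\<omega>. ip leb2 (tens (Z \<omega>) (W \<omega>)) k)"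
    using MUU.ip_sections(1)[OF L4_rprod[OF Z W] t] by (simp add: rprod_def tens_def[of "\<lambda>\<omega>. 1"])
qed

lemma ip_mom2_tens:
  assumes Z: "L4 M Z" and W: "L4 M W" and f: "f \<in> sq01" and g: "g \<in> sq01"
  shows "ip leb2 (mom2 M Z W) (tens f g) = expectation (\<lambda>\<omega>. ip01 (Z \<omega>) f * ip01 (W \<omega>) g)"
    and "integrable M (\<lambda>\<omega>. ip01 (Z \<omega>) f * ip01 (W \<omega>) g)"
proof -
  have eq: "ip leb2 (tens (Z \<omega>) (W \<omega>)) (tens f g) = ip01 (Z \<omega>) f * ip01 (W \<omega>) g" if "\<omega> \<in> space M" for \<omega>
    using L4_sqint[OF Z that] L4_sqint[OF W that] f g by (intro unit_leb2.ip_tens_tens)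
  note k = unit_leb2.tens_sqint[OF f g]
  show "ip leb2 (mom2 M Z W) (tens f g) = expectation (\<lambda>\<omega>. ip01 (Z \<omega>) f * ip01 (W \<omega>) g)"
    unfolding ip_mom2(1)[OF Z W k] by (intro Bochner_Integration.integral_cong eq refl)
  show "integrable M (\<lambda>\<omega>. ip01 (Z \<omega>) f * ip01 (W \<omega>) g)"
    using ip_mom2(2)[OF Z W k] Bochner_Integration.integrable_cong[OF refl eq, of M] by simp
qed

lemma psd_mom2: assumes Z: "L4 M Z" shows "psd_kernel (mom2 M Z Z)"
  using mom2_sqint[OF Z Z] ip_mom2_tens(1)[OF Z Z] by (intro psd_kernelI) (auto simp: mult.commute)

lemma cov_kernel_eq: "case_prod (cov_kernel M Z) = mom2 M (\<lambda>\<omega> t. Z \<omega> t - mean_fun M Z t) (\<lambda>\<omega> t. Z \<omega> t - mean_fun M Z t)"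
  by (simp add: fun_eq_iff cov_kernel_def mom2_def)

subsection \<open>Independent random functions with a common distribution\<close>

text \<open>All three quantities are iterated integrals of \<open>\<langle>w, z\<rangle>\<^sup>2\<close> with respect to the common distribution of \<open>Z\<close> and
  \<open>W\<close>, because the quadratic form of the second-moment kernel at \<open>z\<close> is the mean of \<open>\<langle>Z, z\<rangle>\<^sup>2\<close>.\<close>

lemma law_second_moment:
  assumes Z: "L4 M Z" and Zm: "Z \<in> measurable M L2_borel"
    and W: "L4 M W" and Wm: "W \<in> measurable M L2_borel"
    and law: "distr M L2_borel W = distr M L2_borel Z"
  defines "\<rho> \<equiv> distr M L2_borel Z"
  shows "integrable (\<rho> \<Otimes>\<^sub>M \<rho>) (\<lambda>p. (ip01 (fst p) (snd p))\<^sup>2)"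
    and "(nm leb2 (mom2 M Z Z))\<^sup>2 = (\<integral>p. (ip01 (fst p) (snd p))\<^sup>2 \<partial>(\<rho> \<Otimes>\<^sub>M \<rho>))"
    and "expectation (\<lambda>\<omega>. ip leb2 (tens (W \<omega>) (W \<omega>)) (mom2 M Z Z)) = (nm leb2 (mom2 M Z Z))\<^sup>2"
proof -
  interpret R: prob_space \<rho> unfolding \<rho>_def by (rule prob_space_distr[OF Zm])
  interpret RR: pair_prob_space \<rho> \<rho> by unfold_locales
  have sets_\<rho> [measurable_cong]: "sets \<rho> = sets L2_borel" by (simp add: \<rho>_def)
  have sp: "space \<rho> = sq01" by (simp add: \<rho>_def)
  have nm2: "integrable \<rho> (\<lambda>z. (nm01 z)\<^sup>2)"
    unfolding \<rho>_def using sqint_integrable_sq[OF L4_nm[OF Z]] Zm by (subst integrable_distr_eq) auto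
  have nm_int: "integrable (\<rho> \<Otimes>\<^sub>M \<rho>) (\<lambda>p. (nm01 (fst p))\<^sup>2 * (nm01 (snd p))\<^sup>2)"
    using nm2 by (intro RR.Fubini_integrable) auto
  show int: "integrable (\<rho> \<Otimes>\<^sub>M \<rho>) (\<lambda>p. (ip01 (fst p) (snd p))\<^sup>2)"
  proof (rule Bochner_Integration.integrable_bound[OF nm_int])
    show "(\<lambda>p. (ip01 (fst p) (snd p))\<^sup>2) \<in> borel_measurable (\<rho> \<Otimes>\<^sub>M \<rho>)" by measurable
    show "AE p in \<rho> \<Otimes>\<^sub>M \<rho>. norm ((ip01 (fst p) (snd p))\<^sup>2) \<le> norm ((nm01 (fst p))\<^sup>2 * (nm01 (snd p))\<^sup>2)"
      using ip_cauchy_schwarz_sq by (intro AE_I2) (auto simp: space_pair_measure sp nm_sq)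
  qed
  have form: "ip leb2 (tens z z) (mom2 M Z Z) = (\<integral>w. (ip01 z w)\<^sup>2 \<partial>\<rho>)" if z: "z \<in> sq01" for z
  proof -
    have "ip leb2 (tens z z) (mom2 M Z Z) = expectation (\<lambda>\<omega>. (ip01 (Z \<omega>) z)\<^sup>2)"
      using ip_mom2_tens(1)[OF Z Z z z] by (simp add: ip_commute[of leb2 "tens z z"] power2_eq_square)
    also have "\<dots> = (\<integral>w. (ip01 w z)\<^sup>2 \<partial>\<rho>)"
      unfolding \<rho>_def using measurable_ip01_const[OF z] Zm by (subst integral_distr) auto
    finally show ?thesis by (simp add: ip_commute[of _ z])
  qed
  have fm: "(\<lambda>z. \<integral>w. (ip01 z w)\<^sup>2 \<partial>\<rho>) \<in> borel_measurable L2_borel"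
  proof -
    have "(\<lambda>z. \<integral>w. (ip01 z w)\<^sup>2 \<partial>\<rho>) \<in> borel_measurable \<rho>"
      using R.borel_measurable_lebesgue_integral[of "\<lambda>z w. (ip01 z w)\<^sup>2" \<rho>] int
      by (simp add: case_prod_beta' borel_measurable_integrable)
    then show ?thesis by simp
  qed
  have gen: "expectation (\<lambda>\<omega>. ip leb2 (tens (V \<omega>) (V \<omega>)) (mom2 M Z Z)) = (\<integral>p. (ip01 (fst p) (snd p))\<^sup>2 \<partial>(\<rho> \<Otimes>\<^sub>M \<rho>))"
    if V: "L4 M V" "V \<in> measurable M L2_borel" "distr M L2_borel V = \<rho>" for V
  proof -
    have "expectation (\<lambda>\<omega>. ip leb2 (tens (V \<omega>) (V \<omega>)) (mom2 M Z Z)) = expectation (\<lambda>\<omega>. \<integral>w. (ip01 (V \<omega>) w)\<^sup>2 \<partial>\<rho>)"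
      using L4_sqint[OF V(1)] by (intro Bochner_Integration.integral_cong form refl)
    also have "\<dots> = (\<integral>z. (\<integral>w. (ip01 z w)\<^sup>2 \<partial>\<rho>) \<partial>distr M L2_borel V)"
      by (rule integral_distr[OF V(2) fm, symmetric])
    also have "\<dots> = (\<integral>p. (ip01 (fst p) (snd p))\<^sup>2 \<partial>(\<rho> \<Otimes>\<^sub>M \<rho>))"
      using RR.integral_fst'[OF int] by (simp add: V(3))
    finally show ?thesis .
  qed
  have "(nm leb2 (mom2 M Z Z))\<^sup>2 = expectation (\<lambda>\<omega>. ip leb2 (tens (Z \<omega>) (Z \<omega>)) (mom2 M Z Z))"
    unfolding nm_sq by (rule ip_mom2(1)[OF Z Z mom2_sqint[OF Z Z]])
  then show 1: "(nm leb2 (mom2 M Z Z))\<^sup>2 = (\<integral>p. (ip01 (fst p) (snd p))\<^sup>2 \<partial>(\<rho> \<Otimes>\<^sub>M \<rho>))"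
    using gen[OF Z Zm] by (simp add: \<rho>_def)
  show "expectation (\<lambda>\<omega>. ip leb2 (tens (W \<omega>) (W \<omega>)) (mom2 M Z Z)) = (nm leb2 (mom2 M Z Z))\<^sup>2"
    using gen[OF W Wm] law 1 by (simp add: \<rho>_def)
qed

text \<open>The joint distribution is the product of the common distribution with itself, so the moments are the iterated
  integrals that also represent the squared norms of the second-moment kernel and of the mean function.\<close>

lemma indep_inner_product_moments:
  assumes Z: "L4 M Z" and Zm: "Z \<in> measurable M L2_borel"
    and ind: "indep_var L2_borel A L2_borel B"
    and law: "distr M L2_borel A = distr M L2_borel Z" "distr M L2_borel B = distr M L2_borel Z"
  shows "expectation (\<lambda>\<omega>. (ip01 (A \<omega>) (B \<omega>))\<^sup>2) = (nm leb2 (mom2 M Z Z))\<^sup>2"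
    and "integrable M (\<lambda>\<omega>. (ip01 (A \<omega>) (B \<omega>))\<^sup>2)"
    and "expectation (\<lambda>\<omega>. ip01 (A \<omega>) (B \<omega>)) = (nm01 (mean_fun M Z))\<^sup>2"
proof -
  define \<rho> where "\<rho> = distr M L2_borel Z"
  interpret R: prob_space \<rho> unfolding \<rho>_def by (rule prob_space_distr[OF Zm])
  interpret RR: pair_prob_space \<rho> \<rho> by unfold_locales
  have sets_\<rho> [measurable_cong]: "sets \<rho> = sets L2_borel" by (simp add: \<rho>_def)
  have AB: "(\<lambda>\<omega>. (A \<omega>, B \<omega>)) \<in> measurable M (L2_borel \<Otimes>\<^sub>M L2_borel)"
    and d: "distr M (L2_borel \<Otimes>\<^sub>M L2_borel) (\<lambda>\<omega>. (A \<omega>, B \<omega>)) = \<rho> \<Otimes>\<^sub>M \<rho>"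
    using ind law unfolding indep_var_distribution_eq by (auto simp: \<rho>_def)
  note lsm = law_second_moment[OF Z Zm Z Zm refl, folded \<rho>_def]
  have m2: "(\<lambda>p. (ip01 (fst p) (snd p))\<^sup>2) \<in> borel_measurable (L2_borel \<Otimes>\<^sub>M L2_borel)" by measurable
  show "expectation (\<lambda>\<omega>. (ip01 (A \<omega>) (B \<omega>))\<^sup>2) = (nm leb2 (mom2 M Z Z))\<^sup>2"
    using integral_distr[OF AB m2] lsm(2) by (simp add: d)
  show "integrable M (\<lambda>\<omega>. (ip01 (A \<omega>) (B \<omega>))\<^sup>2)"
    using integrable_distr_eq[OF AB m2] lsm(1) by (simp add: d)
  have "(\<lambda>p. ip01 (fst p) (snd p)) \<in> sqint (\<rho> \<Otimes>\<^sub>M \<rho>)" using lsm(1) by (simp add: sqint_def)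
  then have int1: "integrable (\<rho> \<Otimes>\<^sub>M \<rho>) (\<lambda>p. ip01 (fst p) (snd p))" by (rule RR.P.sqint_integrable)
  have mf: "ip01 z (mean_fun M Z) = (\<integral>w. ip01 z w \<partial>\<rho>)" if z: "z \<in> sq01" for z
  proof -
    have "ip01 z (mean_fun M Z) = (\<integral>w. ip01 w z \<partial>\<rho>)"
      unfolding ip_commute[of _ z "mean_fun M Z"] ip_mean_fun[OF Z z] \<rho>_def using measurable_ip01_const[OF z] Zm
      by (subst integral_distr) auto
    then show ?thesis by (simp only: ip_commute[of _ z])
  qed
  have "expectation (\<lambda>\<omega>. ip01 (A \<omega>) (B \<omega>)) = (\<integral>p. ip01 (fst p) (snd p) \<partial>(\<rho> \<Otimes>\<^sub>M \<rho>))"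
    using integral_distr[OF AB measurable_ip01] by (simp add: d)
  also have "\<dots> = (\<integral>z. (\<integral>w. ip01 z w \<partial>\<rho>) \<partial>\<rho>)"
    using RR.integral_fst'[OF int1] by simp
  also have "\<dots> = (\<integral>z. ip01 z (mean_fun M Z) \<partial>\<rho>)"
    by (intro Bochner_Integration.integral_cong mf[symmetric]) (auto simp: \<rho>_def)
  also have "\<dots> = expectation (\<lambda>\<omega>. ip01 (Z \<omega>) (mean_fun M Z))"
    unfolding \<rho>_def using measurable_ip01_const[OF mean_fun_sqint[OF Z]] Zm by (subst integral_distr) auto
  also have "\<dots> = (nm01 (mean_fun M Z))\<^sup>2"
    unfolding nm_sq by (rule ip_mean_fun[OF Z mean_fun_sqint[OF Z], symmetric])
  finally show "expectation (\<lambda>\<omega>. ip01 (A \<omega>) (B \<omega>)) = (nm01 (mean_fun M Z))\<^sup>2" .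
qed

end

section \<open>Averages of weakly dependent random functions\<close>

text \<open>Every row of the Gram matrix has a sum of at most \<open>2 \<Sum> r\<close>.\<close>

lemma nm_sum_short_range:
  assumes G: "\<And>i. i \<in> {1..N} \<Longrightarrow> G i \<in> sqint \<mu>"
    and r: "\<And>i j. 1 \<le> i \<Longrightarrow> i \<le> j \<Longrightarrow> j \<le> N \<Longrightarrow> \<bar>ip \<mu> (G i) (G j)\<bar> \<le> r (j - i)"
    and sum: "summable r" and nn: "\<And>n. 0 \<le> r n"
  shows "(nm \<mu> (\<lambda>x. \<Sum>i=1..N. G i x))\<^sup>2 \<le> real N * (2 * suminf r)"
proof -
  have bd: "(\<Sum>j\<in>A. r (h j)) \<le> suminf r" if "finite A" "inj_on h A" for A :: "nat set" and h
  proof -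
    have "(\<Sum>j\<in>A. r (h j)) = (\<Sum>n\<in>h ` A. r n)" using that by (simp add: sum.reindex)
    also have "\<dots> \<le> suminf r" using that nn by (intro sum_le_suminf sum) auto
    finally show ?thesis .
  qed
  have "(nm \<mu> (\<lambda>x. \<Sum>i=1..N. G i x))\<^sup>2 = (\<Sum>i=1..N. \<Sum>j=1..N. ip \<mu> (G i) (G j))"
    unfolding nm_sq by (rule ip_sum_self[OF G])
  also have "\<dots> \<le> (\<Sum>i=1..N. 2 * suminf r)"
  proof (rule sum_mono)
    fix i assume i: "i \<in> {1..N}"
    have le: "ip \<mu> (G i) (G j) \<le> (if i \<le> j then r (j - i) else r (i - j))" if "j \<in> {1..N}" for j
      using r[of i j] r[of j i] i that ip_commute[of \<mu> "G i" "G j"] by auto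
    have "(\<Sum>j=1..N. ip \<mu> (G i) (G j)) \<le> (\<Sum>j=1..N. if i \<le> j then r (j - i) else r (i - j))"
      by (intro sum_mono le)
    also have "\<dots> = (\<Sum>j\<in>{1..N} \<inter> {j. i \<le> j}. r (j - i)) + (\<Sum>j\<in>{1..N} \<inter> - {j. i \<le> j}. r (i - j))"
      by (rule sum.If_cases) simp
    also have "\<dots> \<le> suminf r + suminf r"
      by (intro add_mono bd) (auto simp: inj_on_def)
    finally show "(\<Sum>j=1..N. ip \<mu> (G i) (G j)) \<le> 2 * suminf r" by simp
  qed
  also have "\<dots> = real N * (2 * suminf r)" by simp
  finally show ?thesis .
qed

context prob_space
begin

interpretation MU: pair_prob_space M unit_leb by unfold_locales
interpretation MUU: pair_prob_space M leb2 by unfold_locales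

text \<open>The random functions are vectors in the space of square-integrable functions on the product with the probability
  space; the squared norm there is the expected squared norm.\<close>

lemma average_short_range:
  assumes "prob_space \<nu>"
    and G: "\<And>i. i \<ge> 1 \<Longrightarrow> G i \<in> sqint (M \<Otimes>\<^sub>M \<nu>)"
    and r: "\<And>i j. 1 \<le> i \<Longrightarrow> i \<le> j \<Longrightarrow> \<bar>ip (M \<Otimes>\<^sub>M \<nu>) (G i) (G j)\<bar> \<le> r (j - i)"
    and sum: "summable r" and nn: "\<And>n. 0 \<le> r n" and N: "N \<ge> 1"
  shows "integrable M (\<lambda>\<omega>. (nm \<nu> (\<lambda>p. (\<Sum>i=1..N. G i (\<omega>, p)) / real N))\<^sup>2)"
    and "expectation (\<lambda>\<omega>. (nm \<nu> (\<lambda>p. (\<Sum>i=1..N. G i (\<omega>, p)) / real N))\<^sup>2) \<le> 2 * suminf r / real N"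
proof -
  interpret N: prob_space \<nu> by fact
  interpret P: pair_prob_space M \<nu> by unfold_locales
  let ?H = "\<lambda>q. (1 / real N) * (\<Sum>i=1..N. G i q)"
  have H: "?H \<in> sqint (M \<Otimes>\<^sub>M \<nu>)" using G by (intro sqint_scale sqint_sum) auto
  show "integrable M (\<lambda>\<omega>. (nm \<nu> (\<lambda>p. (\<Sum>i=1..N. G i (\<omega>, p)) / real N))\<^sup>2)"
    using P.nm_sections(1)[OF H] by simp
  have "expectation (\<lambda>\<omega>. (nm \<nu> (\<lambda>p. (\<Sum>i=1..N. G i (\<omega>, p)) / real N))\<^sup>2) = (nm (M \<Otimes>\<^sub>M \<nu>) ?H)\<^sup>2"
    using P.nm_sections(2)[OF H] by simp
  also have "\<dots> = (1 / real N)\<^sup>2 * (nm (M \<Otimes>\<^sub>M \<nu>) (\<lambda>q. \<Sum>i=1..N. G i q))\<^sup>2"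
    by (simp only: nm_scale power_mult_distrib power2_abs)
  also have "\<dots> \<le> (1 / real N)\<^sup>2 * (real N * (2 * suminf r))"
    using G r sum nn by (intro mult_left_mono nm_sum_short_range) auto
  also have "\<dots> = 2 * suminf r / real N" using N by (simp add: power2_eq_square)
  finally show "expectation (\<lambda>\<omega>. (nm \<nu> (\<lambda>p. (\<Sum>i=1..N. G i (\<omega>, p)) / real N))\<^sup>2) \<le> 2 * suminf r / real N" .
qed

lemma average_mean:
  assumes Z: "\<And>i. i \<ge> 1 \<Longrightarrow> L4 M (Z i)"
    and r: "\<And>i j. 1 \<le> i \<Longrightarrow> i \<le> j \<Longrightarrow> \<bar>expectation (\<lambda>\<omega>. ip01 (Z i \<omega>) (Z j \<omega>))\<bar> \<le> r (j - i)"
    and "summable r" "\<And>n. 0 \<le> r n" "N \<ge> 1"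
  shows "integrable M (\<lambda>\<omega>. (nm01 (\<lambda>t. (\<Sum>i=1..N. Z i \<omega> t) / real N))\<^sup>2)"
    and "expectation (\<lambda>\<omega>. (nm01 (\<lambda>t. (\<Sum>i=1..N. Z i \<omega> t) / real N))\<^sup>2) \<le> 2 * suminf r / real N"
proof -
  have e: "ip (M \<Otimes>\<^sub>M unit_leb) (joint (Z i)) (joint (Z j)) = expectation (\<lambda>\<omega>. ip01 (Z i \<omega>) (Z j \<omega>))"
    if "1 \<le> i" "1 \<le> j" for i j
    using MU.ip_sections(2)[OF L4_joint[OF Z] L4_joint[OF Z], of i j] that by (simp add: joint_def)
  have r': "\<bar>ip (M \<Otimes>\<^sub>M unit_leb) (joint (Z i)) (joint (Z j))\<bar> \<le> r (j - i)" if "1 \<le> i" "i \<le> j" for i j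
    using r[OF that] e[of i j] that by simp
  note * = average_short_range[OF prob_space_unit_leb, of "\<lambda>i. joint (Z i)", OF L4_joint[OF Z] r' assms(3-5)]
  show "integrable M (\<lambda>\<omega>. (nm01 (\<lambda>t. (\<Sum>i=1..N. Z i \<omega> t) / real N))\<^sup>2)"
    "expectation (\<lambda>\<omega>. (nm01 (\<lambda>t. (\<Sum>i=1..N. Z i \<omega> t) / real N))\<^sup>2) \<le> 2 * suminf r / real N"
    using * by (simp_all add: joint_def)
qed

lemma average_cross:
  assumes Z: "\<And>i. i \<ge> 1 \<Longrightarrow> L4 M (Z i)" and W: "\<And>i. i \<ge> 1 \<Longrightarrow> L4 M (W i)"
    and r: "\<And>i j. 1 \<le> i \<Longrightarrow> i \<le> j \<Longrightarrow>
      \<bar>expectation (\<lambda>\<omega>. ip01 (Z i \<omega>) (Z j \<omega>) * ip01 (W i \<omega>) (W j \<omega>))\<bar> \<le> r (j - i)"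
    and "summable r" "\<And>n. 0 \<le> r n" "N \<ge> 1"
  shows "integrable M (\<lambda>\<omega>. (nm leb2 (\<lambda>p. (\<Sum>i=1..N. tens (Z i \<omega>) (W i \<omega>) p) / real N))\<^sup>2)"
    and "expectation (\<lambda>\<omega>. (nm leb2 (\<lambda>p. (\<Sum>i=1..N. tens (Z i \<omega>) (W i \<omega>) p) / real N))\<^sup>2) \<le> 2 * suminf r / real N"
proof -
  have r': "\<bar>ip (M \<Otimes>\<^sub>M leb2) (rprod (Z i) (W i)) (rprod (Z j) (W j))\<bar> \<le> r (j - i)" if ij: "1 \<le> i" "i \<le> j" for i j
  proof -
    have j: "1 \<le> j" using ij by simp
    have "ip (M \<Otimes>\<^sub>M leb2) (rprod (Z i) (W i)) (rprod (Z j) (W j))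
      = expectation (\<lambda>\<omega>. ip leb2 (tens (Z i \<omega>) (W i \<omega>)) (tens (Z j \<omega>) (W j \<omega>)))"
      using MUU.ip_sections(2)[OF L4_rprod[OF Z W] L4_rprod[OF Z W], of i i j j] ij j by (simp add: rprod_def)
    also have "\<dots> = expectation (\<lambda>\<omega>. ip01 (Z i \<omega>) (Z j \<omega>) * ip01 (W i \<omega>) (W j \<omega>))"
      using L4_sqint[OF Z] L4_sqint[OF W] ij j
      by (intro Bochner_Integration.integral_cong refl unit_leb2.ip_tens_tens) auto
    finally show ?thesis using r[OF ij] by simp
  qed
  note * = average_short_range[OF prob_space_leb2, of "\<lambda>i. rprod (Z i) (W i)", OF L4_rprod[OF Z W] r' assms(4-6)]
  show "integrable M (\<lambda>\<omega>. (nm leb2 (\<lambda>p. (\<Sum>i=1..N. tens (Z i \<omega>) (W i \<omega>) p) / real N))\<^sup>2)"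
    "expectation (\<lambda>\<omega>. (nm leb2 (\<lambda>p. (\<Sum>i=1..N. tens (Z i \<omega>) (W i \<omega>) p) / real N))\<^sup>2) \<le> 2 * suminf r / real N"
    using * by (simp_all add: rprod_def)
qed

text \<open>The Gram matrix of the centred products \<open>Z i \<otimes> Z i - c\<close> has the entries \<open>E \<langle>Z i, Z j\<rangle>\<^sup>2 - \<parallel>c\<parallel>\<^sup>2\<close>: the mixed terms
  with \<open>c\<close> have mean \<open>\<parallel>c\<parallel>\<^sup>2\<close> because the distributions agree.\<close>

lemma average_second_moment:
  assumes Z: "\<And>i. i \<ge> 1 \<Longrightarrow> L4 M (Z i)" and Zm: "\<And>i. i \<ge> 1 \<Longrightarrow> Z i \<in> measurable M L2_borel"
    and law: "\<And>i. i \<ge> 1 \<Longrightarrow> distr M L2_borel (Z i) = distr M L2_borel (Z 1)"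
    and r: "\<And>i j. 1 \<le> i \<Longrightarrow> i \<le> j \<Longrightarrow>
      \<bar>expectation (\<lambda>\<omega>. (ip01 (Z i \<omega>) (Z j \<omega>))\<^sup>2) - (nm leb2 (mom2 M (Z 1) (Z 1)))\<^sup>2\<bar> \<le> r (j - i)"
    and "summable r" "\<And>n. 0 \<le> r n" "N \<ge> 1"
  defines "c \<equiv> mom2 M (Z 1) (Z 1)"
  shows "integrable M (\<lambda>\<omega>. (nm leb2 (\<lambda>p. (\<Sum>i=1..N. tens (Z i \<omega>) (Z i \<omega>) p) / real N - c p))\<^sup>2)"
    and "expectation (\<lambda>\<omega>. (nm leb2 (\<lambda>p. (\<Sum>i=1..N. tens (Z i \<omega>) (Z i \<omega>) p) / real N - c p))\<^sup>2) \<le> 2 * suminf r / real N"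
proof -
  have c: "c \<in> sqint leb2" unfolding c_def using Z by (intro mom2_sqint) auto
  define G where "G i q = rprod (Z i) (Z i) q - tens (\<lambda>\<omega>. 1) c q" for i q
  have G: "G i \<in> sqint (M \<Otimes>\<^sub>M leb2)" if "i \<ge> 1" for i
    unfolding G_def[abs_def] using Z[OF that] by (intro sqint_diff L4_rprod MUU.tens_sqint one_sqint c)
  have sec: "(\<lambda>p. G i (\<omega>, p)) = (\<lambda>p. tens (Z i \<omega>) (Z i \<omega>) p - c p)" for i \<omega>
    by (simp add: G_def rprod_def tens_def[of "\<lambda>\<omega>. 1"])
  have r': "\<bar>ip (M \<Otimes>\<^sub>M leb2) (G i) (G j)\<bar> \<le> r (j - i)" if ij: "1 \<le> i" "i \<le> j" for i j
  proof -
    have j: "1 \<le> j" using ij by simp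
    let ?T = "\<lambda>i \<omega>. tens (Z i \<omega>) (Z i \<omega>)"
    have T: "?T i \<omega> \<in> sqint leb2" if "\<omega> \<in> space M" "1 \<le> i" for i \<omega>
      using L4_sqint[OF Z[OF that(2)] that(1)] by (intro unit_leb2.tens_sqint)
    have "ip (M \<Otimes>\<^sub>M leb2) (G i) (G j) = expectation (\<lambda>\<omega>. ip leb2 (\<lambda>p. ?T i \<omega> p - c p) (\<lambda>p. ?T j \<omega> p - c p))"
      using MUU.ip_sections(2)[OF G[OF ij(1)] G[OF j]] by (simp add: sec)
    also have "\<dots> = expectation (\<lambda>\<omega>. (ip01 (Z i \<omega>) (Z j \<omega>))\<^sup>2 - ip leb2 (?T i \<omega>) c - ip leb2 (?T j \<omega>) c + (nm leb2 c)\<^sup>2)"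
    proof (intro Bochner_Integration.integral_cong refl)
      fix \<omega> assume \<omega>: "\<omega> \<in> space M"
      have "ip leb2 (?T i \<omega>) (?T j \<omega>) = (ip01 (Z i \<omega>) (Z j \<omega>))\<^sup>2"
        using L4_sqint[OF Z \<omega>] ij j by (simp add: unit_leb2.ip_tens_tens power2_eq_square)
      then show "ip leb2 (\<lambda>p. ?T i \<omega> p - c p) (\<lambda>p. ?T j \<omega> p - c p)
        = (ip01 (Z i \<omega>) (Z j \<omega>))\<^sup>2 - ip leb2 (?T i \<omega>) c - ip leb2 (?T j \<omega>) c + (nm leb2 c)\<^sup>2"
        using T[OF \<omega> ij(1)] T[OF \<omega> j] c ip_commute[of leb2 c "?T j \<omega>"]
        by (simp add: ip_diff_left ip_diff_right sqint_diff nm_sq)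
    qed
    also have "\<dots> = expectation (\<lambda>\<omega>. (ip01 (Z i \<omega>) (Z j \<omega>))\<^sup>2) - expectation (\<lambda>\<omega>. ip leb2 (?T i \<omega>) c)
      - expectation (\<lambda>\<omega>. ip leb2 (?T j \<omega>) c) + (nm leb2 c)\<^sup>2"
    proof -
      have lin: "expectation (\<lambda>\<omega>. a \<omega> - b \<omega> - b' \<omega> + k) = expectation a - expectation b - expectation b' + k"
        if "integrable M a" "integrable M b" "integrable M b'" for a b b' :: "'a \<Rightarrow> real" and k
        using that by (simp add: prob_space)
      show ?thesis
        by (rule lin[OF L4_ip_integrable(2)[OF Z[OF ij(1)] Z[OF j]] ip_mom2(2)[OF Z[OF ij(1)] Z[OF ij(1)] c]
              ip_mom2(2)[OF Z[OF j] Z[OF j] c]])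
    qed
    also have "expectation (\<lambda>\<omega>. ip leb2 (?T i \<omega>) c) = (nm leb2 c)\<^sup>2"
      unfolding c_def
      by (rule law_second_moment(3)[OF Z[OF order_refl] Zm[OF order_refl] Z[OF ij(1)] Zm[OF ij(1)] law[OF ij(1)]])
    also have "expectation (\<lambda>\<omega>. ip leb2 (?T j \<omega>) c) = (nm leb2 c)\<^sup>2"
      unfolding c_def
      by (rule law_second_moment(3)[OF Z[OF order_refl] Zm[OF order_refl] Z[OF j] Zm[OF j] law[OF j]])
    finally show ?thesis using r[OF ij] by (simp add: c_def)
  qed
  have avg: "(\<Sum>i=1..N. G i (\<omega>, p)) / real N = (\<Sum>i=1..N. tens (Z i \<omega>) (Z i \<omega>) p) / real N - c p" for \<omega> p
    using assms(7) fun_cong[OF sec] by (simp add: sum_subtractf diff_divide_distrib)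
  note * = average_short_range[OF prob_space_leb2, of G, OF G r' assms(5-7)]
  show "integrable M (\<lambda>\<omega>. (nm leb2 (\<lambda>p. (\<Sum>i=1..N. tens (Z i \<omega>) (Z i \<omega>) p) / real N - c p))\<^sup>2)"
    "expectation (\<lambda>\<omega>. (nm leb2 (\<lambda>p. (\<Sum>i=1..N. tens (Z i \<omega>) (Z i \<omega>) p) / real N - c p))\<^sup>2) \<le> 2 * suminf r / real N"
    using * by (simp_all only: avg)
qed

end

section \<open>Coupling\<close>

text \<open>The innovations and their independent copy as one family. Independence of functions of disjoint blocks of indices
  then covers both the original and the coupled sequence.\<close>

definition both :: "(int \<Rightarrow> 'w \<Rightarrow> 's) \<Rightarrow> (int \<Rightarrow> 'w \<Rightarrow> 's) \<Rightarrow> bool \<times> int \<Rightarrow> 'w \<Rightarrow> 's" where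
  "both \<delta> \<delta>' x = (if fst x then \<delta> (snd x) else \<delta>' (snd x))"

context prob_space
begin

text \<open>The probability of a finite intersection factors between the two sequences because the copy is independent, and within
  each sequence because it is independent itself; the copy inherits the latter from the original by equality of the laws.\<close>

lemma indep_vars_both:
  fixes S :: "'s measure" and \<delta> \<delta>' :: "int \<Rightarrow> 'a \<Rightarrow> 's"
  assumes iid: "iid M S \<delta> UNIV" and copy: "independent_copy M S \<delta> \<delta>'"
  shows "indep_vars (\<lambda>_. S) (both \<delta> \<delta>') UNIV"
    and "distr M S (both \<delta> \<delta>' x) = distr M S (\<delta> 0)"
proof -
  let ?P = "Pi\<^sub>M UNIV (\<lambda>_::int. S)"
  let ?d = "\<lambda>\<omega> i. \<delta> i \<omega>" and ?d' = "\<lambda>\<omega> i. \<delta>' i \<omega>"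
  have ind: "indep_vars (\<lambda>_. S) \<delta> UNIV" and eqd: "\<And>i j. distr M S (\<delta> i) = distr M S (\<delta> j)"
    using iid by (auto simp: iid_def)
  have cop: "indep_var ?P ?d ?P ?d'" and law: "distr M ?P ?d' = distr M ?P ?d"
    using copy by (auto simp: independent_copy_def Let_def)
  have dm: "?d \<in> measurable M ?P" and dm': "?d' \<in> measurable M ?P"
    using cop by (auto dest: indep_var_rv1 indep_var_rv2)
  have comp: "(\<lambda>x. x i) \<in> measurable ?P S" for i by (rule measurable_component_singleton) simp
  have m: "\<delta> i \<in> measurable M S" for i using measurable_compose[OF dm comp] .
  have m': "\<delta>' i \<in> measurable M S" for i using measurable_compose[OF dm' comp] .
  have pr: "prob (?d' -` D \<inter> space M) = prob (?d -` D \<inter> space M)" if "D \<in> sets ?P" for D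
    using measure_distr[OF dm that] measure_distr[OF dm' that] law by simp
  define cyl where "cyl J B = {x \<in> space ?P. \<forall>i\<in>J. x i \<in> B i}" for J and B :: "int \<Rightarrow> 's set"
  have cyl: "cyl J B \<in> sets ?P" if "finite J" "\<And>i. i \<in> J \<Longrightarrow> B i \<in> sets S" for J B
  proof (cases "J = {}")
    case True
    then have "cyl J B = space ?P" by (auto simp: cyl_def)
    then show ?thesis by simp
  next
    case False
    then have "cyl J B = (\<Inter>i\<in>J. (\<lambda>x. x i) -` B i \<inter> space ?P)" by (auto simp: cyl_def)
    moreover have "(\<Inter>i\<in>J. (\<lambda>x. x i) -` B i \<inter> space ?P) \<in> sets ?P"
      using False that by (intro sets.finite_INT measurable_sets[OF comp]) auto
    ultimately show ?thesis by simp
  qed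
  have cyl_pr: "prob (?d -` cyl J B \<inter> space M) = (\<Prod>i\<in>J. prob (\<delta> i -` B i \<inter> space M))"
    if "finite J" "\<And>i. i \<in> J \<Longrightarrow> B i \<in> sets S" for J B
  proof (cases "J = {}")
    case True
    then have "?d -` cyl J B \<inter> space M = space M" using measurable_space[OF dm] by (auto simp: cyl_def)
    then show ?thesis using True by (simp add: prob_space)
  next
    case False
    have "?d -` cyl J B \<inter> space M = (\<Inter>i\<in>J. \<delta> i -` B i \<inter> space M)"
      using False measurable_space[OF dm] by (auto simp: cyl_def)
    also have "prob \<dots> = (\<Prod>i\<in>J. prob (\<delta> i -` B i \<inter> space M))"
      using ind that False unfolding indep_vars_def2 by (intro indep_setsD[where I = UNIV]) auto
    finally show ?thesis .
  qed
  have pm: "prob (\<delta>' i -` B \<inter> space M) = prob (\<delta> i -` B \<inter> space M)" if "B \<in> sets S" for i B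
  proof -
    have "(\<lambda>x. x i) -` B \<inter> space ?P \<in> sets ?P" by (rule measurable_sets[OF comp that])
    from pr[OF this] have "prob (?d' -` ((\<lambda>x. x i) -` B \<inter> space ?P) \<inter> space M) = prob (?d -` ((\<lambda>x. x i) -` B \<inter> space ?P) \<inter> space M)" .
    moreover have "?d' -` ((\<lambda>x. x i) -` B \<inter> space ?P) \<inter> space M = \<delta>' i -` B \<inter> space M"
      "?d -` ((\<lambda>x. x i) -` B \<inter> space ?P) \<inter> space M = \<delta> i -` B \<inter> space M"
      using measurable_space[OF dm] measurable_space[OF dm'] by auto
    ultimately show ?thesis by simp
  qed
  have bm: "both \<delta> \<delta>' x \<in> measurable M S" for x using m m' by (simp add: both_def)
  show "indep_vars (\<lambda>_. S) (both \<delta> \<delta>') UNIV"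
    unfolding indep_vars_def2
  proof (intro conjI ballI bm indep_setsI)
    fix x show "{both \<delta> \<delta>' x -` A \<inter> space M |A. A \<in> sets S} \<subseteq> events" using measurable_sets[OF bm[of x]] by blast
  next
    fix A J assume J: "J \<noteq> {}" "finite (J :: (bool \<times> int) set)"
      and A: "\<forall>x\<in>J. A x \<in> {both \<delta> \<delta>' x -` A \<inter> space M |A. A \<in> sets S}"
    then have "\<forall>x\<in>J. \<exists>B. B \<in> sets S \<and> A x = both \<delta> \<delta>' x -` B \<inter> space M" by blast
    then obtain B where B: "\<And>x. x \<in> J \<Longrightarrow> B x \<in> sets S" "\<And>x. x \<in> J \<Longrightarrow> A x = both \<delta> \<delta>' x -` B x \<inter> space M" by metis
    define J1 where "J1 = {i. (True, i) \<in> J}"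
    define J2 where "J2 = {i. (False, i) \<in> J}"
    have JJ: "J = Pair True ` J1 \<union> Pair False ` J2" unfolding J1_def J2_def
    proof (intro set_eqI iffI)
      fix x assume "x \<in> J"
      then show "x \<in> Pair True ` {i. (True, i) \<in> J} \<union> Pair False ` {i. (False, i) \<in> J}" by (cases x; cases "fst x") auto
    qed auto
    have f1: "finite J1" unfolding J1_def using finite_vimageI[OF J(2), of "Pair True"] by (simp add: vimage_def inj_on_def)
    have f2: "finite J2" unfolding J2_def using finite_vimageI[OF J(2), of "Pair False"] by (simp add: vimage_def inj_on_def)
    define D1 where "D1 = cyl J1 (\<lambda>i. B (True, i))"
    define D2 where "D2 = cyl J2 (\<lambda>i. B (False, i))"
    have D1: "D1 \<in> sets ?P" unfolding D1_def using f1 B(1) by (intro cyl) (auto simp: J1_def)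
    have D2: "D2 \<in> sets ?P" unfolding D2_def using f2 B(1) by (intro cyl) (auto simp: J2_def)
    have "(\<Inter>x\<in>J. A x) = (\<lambda>\<omega>. (?d \<omega>, ?d' \<omega>)) -` (D1 \<times> D2) \<inter> space M"
    proof (intro set_eqI iffI)
      fix \<omega> assume \<omega>: "\<omega> \<in> (\<Inter>x\<in>J. A x)"
      then have \<omega>M: "\<omega> \<in> space M" using J(1) B(2) by fastforce
      have "both \<delta> \<delta>' x \<omega> \<in> B x" if xJ: "x \<in> J" for x
      proof -
        have "\<omega> \<in> A x" using \<omega> xJ by blast
        then show ?thesis using B(2)[OF xJ] by blast
      qed
      then show "\<omega> \<in> (\<lambda>\<omega>. (?d \<omega>, ?d' \<omega>)) -` (D1 \<times> D2) \<inter> space M"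
        using \<omega>M measurable_space[OF dm \<omega>M] measurable_space[OF dm' \<omega>M]
        by (force simp: D1_def D2_def cyl_def J1_def J2_def both_def)
    next
      fix \<omega> assume \<omega>: "\<omega> \<in> (\<lambda>\<omega>. (?d \<omega>, ?d' \<omega>)) -` (D1 \<times> D2) \<inter> space M"
      show "\<omega> \<in> (\<Inter>x\<in>J. A x)"
      proof
        fix x assume x: "x \<in> J"
        obtain b i where bi: "x = (b, i)" by (cases x)
        have "both \<delta> \<delta>' x \<omega> \<in> B x"
          using \<omega> x by (cases b) (auto simp: bi D1_def D2_def cyl_def J1_def J2_def both_def)
        then show "\<omega> \<in> A x" using B(2)[OF x] \<omega> by auto
      qed
    qed
    also have "prob \<dots> = prob (?d -` D1 \<inter> space M) * prob (?d' -` D2 \<inter> space M)"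
      by (rule indep_varD[OF cop D1 D2])
    also have "prob (?d' -` D2 \<inter> space M) = prob (?d -` D2 \<inter> space M)" by (rule pr[OF D2])
    also have "prob (?d -` D1 \<inter> space M) = (\<Prod>i\<in>J1. prob (\<delta> i -` B (True, i) \<inter> space M))"
      unfolding D1_def using f1 B(1) by (intro cyl_pr) (auto simp: J1_def)
    also have "\<dots> = (\<Prod>x\<in>Pair True ` J1. prob (A x))"
      by (subst prod.reindex) (auto simp: inj_on_def B(2) J1_def both_def intro!: prod.cong)
    also have "prob (?d -` D2 \<inter> space M) = (\<Prod>i\<in>J2. prob (\<delta> i -` B (False, i) \<inter> space M))"
      unfolding D2_def using f2 B(1) by (intro cyl_pr) (auto simp: J2_def)
    also have "\<dots> = (\<Prod>i\<in>J2. prob (\<delta>' i -` B (False, i) \<inter> space M))"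
      using B(1) by (intro prod.cong refl pm[symmetric]) (auto simp: J2_def)
    also have "\<dots> = (\<Prod>x\<in>Pair False ` J2. prob (A x))"
      by (subst prod.reindex) (auto simp: inj_on_def B(2) J2_def both_def intro!: prod.cong)
    also have "(\<Prod>x\<in>Pair True ` J1. prob (A x)) * (\<Prod>x\<in>Pair False ` J2. prob (A x)) = (\<Prod>x\<in>J. prob (A x))"
      unfolding JJ using f1 f2 by (intro prod.union_disjoint[symmetric]) auto
    finally show "prob (\<Inter>x\<in>J. A x) = (\<Prod>x\<in>J. prob (A x))" .
  qed
  show "distr M S (both \<delta> \<delta>' x) = distr M S (\<delta> 0)"
  proof (rule measure_eqI)
    fix B assume "B \<in> sets (distr M S (both \<delta> \<delta>' x))"
    then have B: "B \<in> sets S" by simp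
    have "prob (both \<delta> \<delta>' x -` B \<inter> space M) = prob (\<delta> (snd x) -` B \<inter> space M)" using pm[OF B] by (simp add: both_def)
    also have "\<dots> = prob (\<delta> 0 -` B \<inter> space M)"
      using measure_distr[OF m B] eqd[of "snd x" 0] by metis
    finally show "emeasure (distr M S (both \<delta> \<delta>' x)) B = emeasure (distr M S (\<delta> 0)) B"
      using B bm m by (simp add: emeasure_distr emeasure_eq_measure)
  qed simp
qed

lemma indep_vars_inj_reindex:
  assumes ind: "indep_vars (\<lambda>_. S) X UNIV" and inj: "inj \<phi>"
  shows "indep_vars (\<lambda>_. S) (\<lambda>j. X (\<phi> j)) UNIV"
  unfolding indep_vars_def2
proof (intro conjI ballI indep_setsI)
  have m: "X i \<in> measurable M S" for i using ind by (simp add: indep_vars_def2)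
  show "X (\<phi> j) \<in> measurable M S" for j by (rule m)
  show "{X (\<phi> j) -` A \<inter> space M |A. A \<in> sets S} \<subseteq> events" for j using measurable_sets[OF m] by auto
  fix A J assume J: "J \<noteq> {}" "finite J" and A: "\<forall>j\<in>J. A j \<in> {X (\<phi> j) -` A \<inter> space M |A. A \<in> sets S}"
  let ?A = "\<lambda>i. A (inv \<phi> i)"
  have "prob (\<Inter>i\<in>\<phi> ` J. ?A i) = (\<Prod>i\<in>\<phi> ` J. prob (?A i))"
    using ind J A inj unfolding indep_vars_def2 by (intro indep_setsD[where I = UNIV]) auto
  then show "prob (\<Inter>j\<in>J. A j) = (\<Prod>j\<in>J. prob (A j))"
    using inj by (simp add: prod.reindex inj_on_subset[OF inj])
qed

lemma indep_vars_law:
  assumes "indep_vars (\<lambda>_. S) (X :: 'i \<Rightarrow> 'a \<Rightarrow> 's) UNIV" "\<And>i. distr M S (X i) = \<rho>"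
  shows "(\<lambda>\<omega> i. X i \<omega>) \<in> measurable M (Pi\<^sub>M UNIV (\<lambda>_. S))"
    "distr M (Pi\<^sub>M UNIV (\<lambda>_. S)) (\<lambda>\<omega> i. X i \<omega>) = Pi\<^sub>M UNIV (\<lambda>_. \<rho>)"
proof -
  have m: "X i \<in> measurable M S" for i using assms by (simp add: indep_vars_def2)
  show "(\<lambda>\<omega> i. X i \<omega>) \<in> measurable M (Pi\<^sub>M UNIV (\<lambda>_. S))"
    using m by (intro measurable_PiM_single') (auto simp: PiE_def extensional_def Pi_def dest: measurable_space)
  show "distr M (Pi\<^sub>M UNIV (\<lambda>_. S)) (\<lambda>\<omega> i. X i \<omega>) = Pi\<^sub>M UNIV (\<lambda>_. \<rho>)"
    using indep_vars_iff_distr_eq_PiM'[of UNIV X "\<lambda>_. S"] assms m by (simp add: restrict_UNIV)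
qed

end

text \<open>The innovations that enter the random function at time \<open>n\<close>, most recent first, and their coupled version with lag \<open>m\<close>.\<close>

definition past :: "(int \<Rightarrow> 'w \<Rightarrow> 's) \<Rightarrow> nat \<Rightarrow> 'w \<Rightarrow> nat \<Rightarrow> 's" where
  "past \<delta> n \<omega> k = \<delta> (int n - int k) \<omega>"

definition coupled_past :: "(int \<Rightarrow> 'w \<Rightarrow> 's) \<Rightarrow> (int \<Rightarrow> 'w \<Rightarrow> 's) \<Rightarrow> nat \<Rightarrow> nat \<Rightarrow> 'w \<Rightarrow> nat \<Rightarrow> 's" where
  "coupled_past \<delta> \<delta>' m n \<omega> k = (if k < m then \<delta> (int n - int k) \<omega> else \<delta>' (int n - int k) \<omega>)"

lemma shift_rep_eq: "shift_rep f \<delta> n = (\<lambda>\<omega>. f (past \<delta> n \<omega>))"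
  by (simp add: fun_eq_iff shift_rep_def past_def[abs_def])

lemma coupled_rep_eq: "coupled_rep f \<delta> \<delta>' m n = (\<lambda>\<omega>. f (coupled_past \<delta> \<delta>' m n \<omega>))"
  by (simp add: fun_eq_iff coupled_rep_def coupled_past_def[abs_def])

locale coupling = prob_space M for M :: "'w measure" +
  fixes S :: "'s measure" and \<delta> \<delta>' :: "int \<Rightarrow> 'w \<Rightarrow> 's"
  assumes iid: "iid M S \<delta> UNIV" and copy: "independent_copy M S \<delta> \<delta>'"
begin

abbreviation seqs where "seqs \<equiv> Pi\<^sub>M UNIV (\<lambda>_::nat. S)"
abbreviation seq_law where "seq_law \<equiv> Pi\<^sub>M UNIV (\<lambda>_::nat. distr M S (\<delta> 0))"

text \<open>All distributional facts on the coupling are instances of this one: they differ only in the injection \<open>\<phi>\<close> that selects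
  the innovations.\<close>

lemma family:
  assumes "inj \<phi>"
  shows "indep_vars (\<lambda>_. S) (\<lambda>j. both \<delta> \<delta>' (\<phi> j)) UNIV"
    "(\<lambda>\<omega> j. both \<delta> \<delta>' (\<phi> j) \<omega>) \<in> measurable M (Pi\<^sub>M UNIV (\<lambda>_. S))"
    "distr M (Pi\<^sub>M UNIV (\<lambda>_. S)) (\<lambda>\<omega> j. both \<delta> \<delta>' (\<phi> j) \<omega>) = Pi\<^sub>M UNIV (\<lambda>_. distr M S (\<delta> 0))"
proof -
  show i: "indep_vars (\<lambda>_. S) (\<lambda>j. both \<delta> \<delta>' (\<phi> j)) UNIV"
    by (rule indep_vars_inj_reindex[OF indep_vars_both(1)[OF iid copy] assms])
  note d = indep_vars_both(2)[OF iid copy]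
  show "(\<lambda>\<omega> j. both \<delta> \<delta>' (\<phi> j) \<omega>) \<in> measurable M (Pi\<^sub>M UNIV (\<lambda>_. S))"
    "distr M (Pi\<^sub>M UNIV (\<lambda>_. S)) (\<lambda>\<omega> j. both \<delta> \<delta>' (\<phi> j) \<omega>) = Pi\<^sub>M UNIV (\<lambda>_. distr M S (\<delta> 0))"
    using indep_vars_law[OF i d] by auto
qed

lemma past_law: "past \<delta> n \<in> measurable M seqs" "distr M seqs (past \<delta> n) = seq_law"
proof -
  have inj: "inj (\<lambda>k::nat. (True, int n - int k))" by (auto simp: inj_def)
  have eq: "past \<delta> n = (\<lambda>\<omega> k. both \<delta> \<delta>' (True, int n - int k) \<omega>)"
    by (simp add: fun_eq_iff past_def both_def)
  show "past \<delta> n \<in> measurable M seqs" "distr M seqs (past \<delta> n) = seq_law"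
    unfolding eq using family[OF inj] by auto
qed

lemma coupled_past_law:
  "coupled_past \<delta> \<delta>' m n \<in> measurable M seqs" "distr M seqs (coupled_past \<delta> \<delta>' m n) = seq_law"
proof -
  have inj: "inj (\<lambda>k::nat. (k < m, int n - int k))" by (auto simp: inj_def)
  have eq: "coupled_past \<delta> \<delta>' m n = (\<lambda>\<omega> k. both \<delta> \<delta>' (k < m, int n - int k) \<omega>)"
    by (simp add: fun_eq_iff coupled_past_def both_def)
  show "coupled_past \<delta> \<delta>' m n \<in> measurable M seqs" "distr M seqs (coupled_past \<delta> \<delta>' m n) = seq_law"
    unfolding eq using family[OF inj] by auto
qed

text \<open>The coupled sequence at time \<open>i + m\<close> uses original innovations only after time \<open>i\<close>.\<close>

lemma past_indep_coupled: "indep_var seqs (past \<delta> i) seqs (coupled_past \<delta> \<delta>' m (i + m))"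
proof -
  define \<phi> :: "bool \<times> nat \<Rightarrow> bool \<times> int" where
    "\<phi> x = (if fst x then (True, int i - int (snd x)) else (snd x < m, int (i + m) - int (snd x)))" for x
  have inj: "inj \<phi>"
  proof (rule injI)
    fix x y assume "\<phi> x = \<phi> y"
    then show "x = y" by (cases x; cases y) (auto simp: \<phi>_def split: if_splits)
  qed
  let ?X = "\<lambda>j. both \<delta> \<delta>' (\<phi> j)"
  let ?A = "{True} \<times> (UNIV :: nat set)" and ?B = "{False} \<times> (UNIV :: nat set)"
  have ind: "indep_var (Pi\<^sub>M ?A (\<lambda>_. S)) (\<lambda>\<omega>. restrict (\<lambda>j. ?X j \<omega>) ?A) (Pi\<^sub>M ?B (\<lambda>_. S)) (\<lambda>\<omega>. restrict (\<lambda>j. ?X j \<omega>) ?B)"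
    by (rule indep_var_restrict[OF family(1)[OF inj]]) auto
  have ma: "(\<lambda>x k. x (b, k)) \<in> measurable (Pi\<^sub>M ({b} \<times> UNIV) (\<lambda>_. S)) seqs" for b :: bool
    by (intro measurable_PiM_single') (auto intro!: measurable_component_singleton simp: space_PiM PiE_def Pi_def extensional_def)
  have "indep_var seqs ((\<lambda>x k. x (True, k)) \<circ> (\<lambda>\<omega>. restrict (\<lambda>j. ?X j \<omega>) ?A)) seqs ((\<lambda>x k. x (False, k)) \<circ> (\<lambda>\<omega>. restrict (\<lambda>j. ?X j \<omega>) ?B))"
    by (rule indep_var_compose[OF ind ma ma])
  moreover have "(\<lambda>x k. x (True, k)) \<circ> (\<lambda>\<omega>. restrict (\<lambda>j. ?X j \<omega>) ?A) = past \<delta> i"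
    by (simp add: fun_eq_iff past_def both_def \<phi>_def)
  moreover have "(\<lambda>x k. x (False, k)) \<circ> (\<lambda>\<omega>. restrict (\<lambda>j. ?X j \<omega>) ?B) = coupled_past \<delta> \<delta>' m (i + m)"
    by (simp add: fun_eq_iff coupled_past_def both_def \<phi>_def)
  ultimately show ?thesis by simp
qed

text \<open>Both sequences are fixed measurable functions of the doubled innovations, shifted in time.\<close>

lemma pair_law_stationary:
  "distr M (seqs \<Otimes>\<^sub>M seqs) (\<lambda>\<omega>. (past \<delta> n \<omega>, coupled_past \<delta> \<delta>' m n \<omega>))
    = distr M (seqs \<Otimes>\<^sub>M seqs) (\<lambda>\<omega>. (past \<delta> n' \<omega>, coupled_past \<delta> \<delta>' m n' \<omega>))"
proof -
  let ?Q = "Pi\<^sub>M UNIV (\<lambda>_ :: bool \<times> nat. S)"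
  let ?E = "\<lambda>n \<omega> j. both \<delta> \<delta>' (fst j, int n - int (snd j)) \<omega>"
  let ?h = "\<lambda>x :: bool \<times> nat \<Rightarrow> 's. (\<lambda>k. x (True, k), \<lambda>k. x (k < m, k))"
  have inj: "inj (\<lambda>j::bool \<times> nat. (fst j, int n - int (snd j)))" for n by (auto simp: inj_def prod_eq_iff)
  have hm: "?h \<in> measurable ?Q (seqs \<Otimes>\<^sub>M seqs)"
    by (intro measurable_Pair measurable_PiM_single')
      (auto intro!: measurable_component_singleton simp: space_PiM PiE_def Pi_def extensional_def)
  have "distr M (seqs \<Otimes>\<^sub>M seqs) (\<lambda>\<omega>. (past \<delta> n \<omega>, coupled_past \<delta> \<delta>' m n \<omega>)) = distr (distr M ?Q (?E n)) (seqs \<Otimes>\<^sub>M seqs) ?h" for n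
  proof -
    have "(\<lambda>\<omega>. (past \<delta> n \<omega>, coupled_past \<delta> \<delta>' m n \<omega>)) = ?h \<circ> ?E n"
      by (auto simp: fun_eq_iff past_def coupled_past_def both_def)
    then show ?thesis using distr_distr[OF hm family(2)[OF inj]] by simp
  qed
  then show ?thesis by (simp only: family(3)[OF inj])
qed

end

context prob_space
begin

lemma in_sqint_pow4:
  assumes "f \<in> borel_measurable M" "integrable M (\<lambda>\<omega>. f \<omega> ^ 4)"
  shows "(\<lambda>\<omega>. (f \<omega>)\<^sup>2) \<in> sqint M" "f \<in> sqint M"
    "nm M (\<lambda>\<omega>. (f \<omega>)\<^sup>2) = sqrt (expectation (\<lambda>\<omega>. f \<omega> ^ 4))"
    "nm M f \<le> sqrt (sqrt (expectation (\<lambda>\<omega>. f \<omega> ^ 4)))"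
proof -
  show s: "(\<lambda>\<omega>. (f \<omega>)\<^sup>2) \<in> sqint M" using assms by (auto simp: sqint_def power_mult[symmetric])
  then show "f \<in> sqint M" using sqint_integrable[OF s] assms by (simp add: sqint_def)
  show n: "nm M (\<lambda>\<omega>. (f \<omega>)\<^sup>2) = sqrt (expectation (\<lambda>\<omega>. f \<omega> ^ 4))"
    by (simp add: nm_def power_mult[symmetric])
  have "(nm M f)\<^sup>2 \<le> nm M (\<lambda>\<omega>. (f \<omega>)\<^sup>2)" using sqint_L1_le[OF s] by (simp add: nm_sq_int)
  then show "nm M f \<le> sqrt (sqrt (expectation (\<lambda>\<omega>. f \<omega> ^ 4)))"
    unfolding n by (rule real_le_rsqrt)
qed

text \<open>Hoelder's inequality for \<open>\<langle>A, B\<rangle>\<^sup>2 - \<langle>A, C\<rangle>\<^sup>2 = \<langle>A, B - C\<rangle> \<langle>A, B + C\<rangle>\<close>, written as two applications of the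
  Cauchy--Schwarz inequality. The cost of replacing \<open>B\<close> by \<open>C\<close> is linear in their fourth-moment distance \<open>d\<close>, which is what
  \<open>m\<close>-approximability controls. The factor \<open>16\<close> comes from the fourth moment of \<open>\<parallel>B\<parallel> + \<parallel>C\<parallel>\<close>.\<close>

lemma inner_product_moment_perturbation:
  assumes A: "A \<in> measurable M L2_borel" and B: "B \<in> measurable M L2_borel" and C: "C \<in> measurable M L2_borel"
    and m4: "integrable M (\<lambda>\<omega>. nm01 (A \<omega>) ^ 4)" "expectation (\<lambda>\<omega>. nm01 (A \<omega>) ^ 4) = m"
      "integrable M (\<lambda>\<omega>. nm01 (B \<omega>) ^ 4)" "expectation (\<lambda>\<omega>. nm01 (B \<omega>) ^ 4) = m"
      "integrable M (\<lambda>\<omega>. nm01 (C \<omega>) ^ 4)" "expectation (\<lambda>\<omega>. nm01 (C \<omega>) ^ 4) = m"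
  defines "d \<equiv> sqrt (sqrt (expectation (\<lambda>\<omega>. nm01 (\<lambda>t. B \<omega> t - C \<omega> t) ^ 4)))"
  shows "\<bar>expectation (\<lambda>\<omega>. (ip01 (A \<omega>) (B \<omega>))\<^sup>2) - expectation (\<lambda>\<omega>. (ip01 (A \<omega>) (C \<omega>))\<^sup>2)\<bar>
      \<le> sqrt m * sqrt (sqrt (16 * m)) * d"
    and "\<bar>expectation (\<lambda>\<omega>. ip01 (A \<omega>) (B \<omega>)) - expectation (\<lambda>\<omega>. ip01 (A \<omega>) (C \<omega>))\<bar> \<le> sqrt (sqrt m) * d"
proof -
  have sp: "A \<omega> \<in> sq01" "B \<omega> \<in> sq01" "C \<omega> \<in> sq01" if "\<omega> \<in> space M" for \<omega>
    using measurable_space[OF A that] measurable_space[OF B that] measurable_space[OF C that] by auto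
  have pair: "(\<lambda>\<omega>. (A \<omega>, B \<omega>)) \<in> measurable M (L2_borel \<Otimes>\<^sub>M L2_borel)"
    "(\<lambda>\<omega>. (A \<omega>, C \<omega>)) \<in> measurable M (L2_borel \<Otimes>\<^sub>M L2_borel)"
    "(\<lambda>\<omega>. (B \<omega>, C \<omega>)) \<in> measurable M (L2_borel \<Otimes>\<^sub>M L2_borel)"
    using A B C by (auto intro: measurable_Pair)
  have mA: "(\<lambda>\<omega>. nm01 (A \<omega>)) \<in> borel_measurable M" and mB: "(\<lambda>\<omega>. nm01 (B \<omega>)) \<in> borel_measurable M"
    and mC: "(\<lambda>\<omega>. nm01 (C \<omega>)) \<in> borel_measurable M"
    using A B C measurable_nm01 by (auto intro: measurable_compose)
  have mAB: "(\<lambda>\<omega>. ip01 (A \<omega>) (B \<omega>)) \<in> borel_measurable M" and mAC: "(\<lambda>\<omega>. ip01 (A \<omega>) (C \<omega>)) \<in> borel_measurable M"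
    and mBC: "(\<lambda>\<omega>. nm01 (\<lambda>t. B \<omega> t - C \<omega> t)) \<in> borel_measurable M"
    using measurable_compose[OF pair(1) measurable_ip01] measurable_compose[OF pair(2) measurable_ip01]
      measurable_compose[OF pair(3) measurable_dist] by simp_all
  let ?a = "\<lambda>\<omega>. nm01 (A \<omega>)" and ?b = "\<lambda>\<omega>. nm01 (\<lambda>t. B \<omega> t - C \<omega> t)" and ?c = "\<lambda>\<omega>. nm01 (B \<omega>) + nm01 (C \<omega>)"
  have ic8: "integrable M (\<lambda>\<omega>. 8 * (nm01 (B \<omega>) ^ 4 + nm01 (C \<omega>) ^ 4))" using m4 by auto
  have ic: "integrable M (\<lambda>\<omega>. ?c \<omega> ^ 4)"
  proof (rule Bochner_Integration.integrable_bound[OF ic8])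
    show "(\<lambda>\<omega>. ?c \<omega> ^ 4) \<in> borel_measurable M" using mB mC by measurable
    show "AE \<omega> in M. norm (?c \<omega> ^ 4) \<le> norm (8 * (nm01 (B \<omega>) ^ 4 + nm01 (C \<omega>) ^ 4))"
      using power4_add_le by (intro AE_I2) simp
  qed
  have ec: "expectation (\<lambda>\<omega>. ?c \<omega> ^ 4) \<le> 16 * m"
  proof -
    have "expectation (\<lambda>\<omega>. ?c \<omega> ^ 4) \<le> expectation (\<lambda>\<omega>. 8 * (nm01 (B \<omega>) ^ 4 + nm01 (C \<omega>) ^ 4))"
      by (intro integral_mono ic ic8 power4_add_le)
    also have "\<dots> = 16 * m" using m4 by simp
    finally show ?thesis .
  qed
  have bc: "?b \<omega> \<le> ?c \<omega>" if "\<omega> \<in> space M" for \<omega> using sp[OF that] by (intro nm_triangle_diff)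
  have ib: "integrable M (\<lambda>\<omega>. ?b \<omega> ^ 4)"
  proof (rule Bochner_Integration.integrable_bound[OF ic])
    show "(\<lambda>\<omega>. ?b \<omega> ^ 4) \<in> borel_measurable M" using mBC by measurable
    show "AE \<omega> in M. norm (?b \<omega> ^ 4) \<le> norm (?c \<omega> ^ 4)" using bc by (intro AE_I2) (simp add: power_mono)
  qed
  have mc: "?c \<in> borel_measurable M" using mB mC by measurable
  note sa = in_sqint_pow4[OF mA m4(1)] and sb = in_sqint_pow4[OF mBC ib] and sc = in_sqint_pow4[OF mc ic]
  have i_bc: "integrable M (\<lambda>\<omega>. (?b \<omega>)\<^sup>2 * (?c \<omega>)\<^sup>2)" by (rule sqint_integrable_mult[OF sb(1) sc(1)])
  have sbc: "(\<lambda>\<omega>. ?b \<omega> * ?c \<omega>) \<in> sqint M" using i_bc mBC mc by (auto simp: sqint_def power_mult_distrib)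
  have nbc: "nm M (\<lambda>\<omega>. ?b \<omega> * ?c \<omega>) \<le> d * sqrt (sqrt (16 * m))"
  proof -
    have "(nm M (\<lambda>\<omega>. ?b \<omega> * ?c \<omega>))\<^sup>2 = ip M (\<lambda>\<omega>. (?b \<omega>)\<^sup>2) (\<lambda>\<omega>. (?c \<omega>)\<^sup>2)"
      by (simp add: nm_sq_int ip_def power_mult_distrib)
    also have "\<dots> \<le> nm M (\<lambda>\<omega>. (?b \<omega>)\<^sup>2) * nm M (\<lambda>\<omega>. (?c \<omega>)\<^sup>2)" using ip_cauchy_schwarz[OF sb(1) sc(1)] by linarith
    also have "\<dots> \<le> sqrt (expectation (\<lambda>\<omega>. ?b \<omega> ^ 4)) * sqrt (16 * m)"
      unfolding sb(3) sc(3) using ec by (intro mult_left_mono) auto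
    finally have "nm M (\<lambda>\<omega>. ?b \<omega> * ?c \<omega>) \<le> sqrt (sqrt (expectation (\<lambda>\<omega>. ?b \<omega> ^ 4)) * sqrt (16 * m))"
      by (rule real_le_rsqrt)
    then show ?thesis by (simp add: d_def real_sqrt_mult)
  qed
  have abs_ab: "\<bar>ip01 (A \<omega>) (B \<omega>) - ip01 (A \<omega>) (C \<omega>)\<bar> \<le> ?a \<omega> * ?b \<omega>" if \<omega>: "\<omega> \<in> space M" for \<omega>
    using ip_cauchy_schwarz[OF sp(1)[OF \<omega>] sqint_diff[OF sp(2,3)[OF \<omega>]]] sp[OF \<omega>] by (simp add: ip_diff_right)
  have ipsq: "integrable M (\<lambda>\<omega>. (ip01 (A \<omega>) (D \<omega>))\<^sup>2)"
    if D: "D \<in> measurable M L2_borel" "integrable M (\<lambda>\<omega>. nm01 (D \<omega>) ^ 4)"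
      "(\<lambda>\<omega>. ip01 (A \<omega>) (D \<omega>)) \<in> borel_measurable M" for D
  proof -
    have mD: "(\<lambda>\<omega>. nm01 (D \<omega>)) \<in> borel_measurable M" using D(1) measurable_nm01 by (auto intro: measurable_compose)
    have i: "integrable M (\<lambda>\<omega>. (?a \<omega>)\<^sup>2 * (nm01 (D \<omega>))\<^sup>2)"
      by (rule sqint_integrable_mult[OF sa(1) in_sqint_pow4(1)[OF mD D(2)]])
    show ?thesis
    proof (rule Bochner_Integration.integrable_bound[OF i])
      show "(\<lambda>\<omega>. (ip01 (A \<omega>) (D \<omega>))\<^sup>2) \<in> borel_measurable M" using D(3) by measurable
      show "AE \<omega> in M. norm ((ip01 (A \<omega>) (D \<omega>))\<^sup>2) \<le> norm ((?a \<omega>)\<^sup>2 * (nm01 (D \<omega>))\<^sup>2)"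
      proof (rule AE_I2)
        fix \<omega> assume \<omega>: "\<omega> \<in> space M"
        have "D \<omega> \<in> sq01" using measurable_space[OF D(1) \<omega>] by simp
        then show "norm ((ip01 (A \<omega>) (D \<omega>))\<^sup>2) \<le> norm ((?a \<omega>)\<^sup>2 * (nm01 (D \<omega>))\<^sup>2)"
          using ip_cauchy_schwarz_sq[OF sp(1)[OF \<omega>]] by (simp add: nm_sq)
      qed
    qed
  qed
  have iAB2: "integrable M (\<lambda>\<omega>. (ip01 (A \<omega>) (B \<omega>))\<^sup>2)" by (rule ipsq[OF B m4(3) mAB])
  have iAC2: "integrable M (\<lambda>\<omega>. (ip01 (A \<omega>) (C \<omega>))\<^sup>2)" by (rule ipsq[OF C m4(5) mAC])
  have iAB: "integrable M (\<lambda>\<omega>. ip01 (A \<omega>) (B \<omega>))" using iAB2 mAB by (intro sqint_integrable) (simp add: sqint_def)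
  have iAC: "integrable M (\<lambda>\<omega>. ip01 (A \<omega>) (C \<omega>))" using iAC2 mAC by (intro sqint_integrable) (simp add: sqint_def)
  have "\<bar>expectation (\<lambda>\<omega>. (ip01 (A \<omega>) (B \<omega>))\<^sup>2) - expectation (\<lambda>\<omega>. (ip01 (A \<omega>) (C \<omega>))\<^sup>2)\<bar>
    = \<bar>expectation (\<lambda>\<omega>. (ip01 (A \<omega>) (B \<omega>))\<^sup>2 - (ip01 (A \<omega>) (C \<omega>))\<^sup>2)\<bar>"
    using iAB2 iAC2 by simp
  also have "\<dots> \<le> expectation (\<lambda>\<omega>. \<bar>(ip01 (A \<omega>) (B \<omega>))\<^sup>2 - (ip01 (A \<omega>) (C \<omega>))\<^sup>2\<bar>)"
    by (rule integral_abs_bound)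
  also have "\<dots> \<le> expectation (\<lambda>\<omega>. (?a \<omega>)\<^sup>2 * (?b \<omega> * ?c \<omega>))"
  proof (rule integral_mono)
    show "integrable M (\<lambda>\<omega>. \<bar>(ip01 (A \<omega>) (B \<omega>))\<^sup>2 - (ip01 (A \<omega>) (C \<omega>))\<^sup>2\<bar>)" using iAB2 iAC2 by auto
    show "integrable M (\<lambda>\<omega>. (?a \<omega>)\<^sup>2 * (?b \<omega> * ?c \<omega>))" by (rule sqint_integrable_mult[OF sa(1) sbc])
    fix \<omega> assume \<omega>: "\<omega> \<in> space M"
    have "\<bar>ip01 (A \<omega>) (B \<omega>) + ip01 (A \<omega>) (C \<omega>)\<bar> \<le> ?a \<omega> * ?c \<omega>"
      using ip_cauchy_schwarz[OF sp(1,2)[OF \<omega>]] ip_cauchy_schwarz[OF sp(1,3)[OF \<omega>]] by (simp add: distrib_left)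
    then have "\<bar>ip01 (A \<omega>) (B \<omega>) - ip01 (A \<omega>) (C \<omega>)\<bar> * \<bar>ip01 (A \<omega>) (B \<omega>) + ip01 (A \<omega>) (C \<omega>)\<bar> \<le> (?a \<omega> * ?b \<omega>) * (?a \<omega> * ?c \<omega>)"
      using abs_ab[OF \<omega>] by (intro mult_mono) auto
    then show "\<bar>(ip01 (A \<omega>) (B \<omega>))\<^sup>2 - (ip01 (A \<omega>) (C \<omega>))\<^sup>2\<bar> \<le> (?a \<omega>)\<^sup>2 * (?b \<omega> * ?c \<omega>)"
      by (simp add: abs_mult[symmetric] power2_eq_square algebra_simps)
  qed
  also have "\<dots> = ip M (\<lambda>\<omega>. (?a \<omega>)\<^sup>2) (\<lambda>\<omega>. ?b \<omega> * ?c \<omega>)" by (simp add: ip_def)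
  also have "\<dots> \<le> nm M (\<lambda>\<omega>. (?a \<omega>)\<^sup>2) * nm M (\<lambda>\<omega>. ?b \<omega> * ?c \<omega>)" using ip_cauchy_schwarz[OF sa(1) sbc] by linarith
  also have "\<dots> \<le> sqrt m * (d * sqrt (sqrt (16 * m)))"
    using nbc sa(3) m4(2) by (intro mult_mono) auto
  finally show "\<bar>expectation (\<lambda>\<omega>. (ip01 (A \<omega>) (B \<omega>))\<^sup>2) - expectation (\<lambda>\<omega>. (ip01 (A \<omega>) (C \<omega>))\<^sup>2)\<bar>
      \<le> sqrt m * sqrt (sqrt (16 * m)) * d" by (simp add: mult_ac)
  have "\<bar>expectation (\<lambda>\<omega>. ip01 (A \<omega>) (B \<omega>)) - expectation (\<lambda>\<omega>. ip01 (A \<omega>) (C \<omega>))\<bar>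
    = \<bar>expectation (\<lambda>\<omega>. ip01 (A \<omega>) (B \<omega>) - ip01 (A \<omega>) (C \<omega>))\<bar>"
    using iAB iAC by simp
  also have "\<dots> \<le> expectation (\<lambda>\<omega>. \<bar>ip01 (A \<omega>) (B \<omega>) - ip01 (A \<omega>) (C \<omega>)\<bar>)"
    by (rule integral_abs_bound)
  also have "\<dots> \<le> expectation (\<lambda>\<omega>. ?a \<omega> * ?b \<omega>)"
    using iAB iAC sqint_integrable_mult[OF sa(2) sb(2)] abs_ab by (intro integral_mono) auto
  also have "\<dots> = ip M ?a ?b" by (simp add: ip_def)
  also have "\<dots> \<le> nm M ?a * nm M ?b" using ip_cauchy_schwarz[OF sa(2) sb(2)] by linarith
  also have "\<dots> \<le> sqrt (sqrt m) * d"
    unfolding d_def using sa(4) sb(4) m4(2) by (intro mult_mono) auto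
  finally show "\<bar>expectation (\<lambda>\<omega>. ip01 (A \<omega>) (B \<omega>)) - expectation (\<lambda>\<omega>. ip01 (A \<omega>) (C \<omega>))\<bar> \<le> sqrt (sqrt m) * d" .
qed

text \<open>For \<open>i < j\<close> the coupled version of \<open>X j\<close> with lag \<open>j - i\<close> is independent of \<open>X i\<close> and has the common distribution. If it
  replaced \<open>X j\<close>, then the moments of the inner product would be those of independent random functions; the replacement costs a
  multiple of the coupling distance, which is summable in the lag.\<close>

lemma approximable_weak_dependence:
  assumes app: "Lp_m_approximable M S 4 X" and Xm: "\<And>n. n \<ge> 1 \<Longrightarrow> X n \<in> measurable M L2_borel"
  obtains r where "summable r" "\<And>n. 0 \<le> r n"
    "\<And>n. n \<ge> 1 \<Longrightarrow> distr M L2_borel (X n) = distr M L2_borel (X 1)"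
    "\<And>i j. 1 \<le> i \<Longrightarrow> i \<le> j \<Longrightarrow>
      \<bar>expectation (\<lambda>\<omega>. (ip01 (X i \<omega>) (X j \<omega>))\<^sup>2) - (nm leb2 (mom2 M (X 1) (X 1)))\<^sup>2\<bar> \<le> r (j - i)"
    "\<And>i j. 1 \<le> i \<Longrightarrow> i \<le> j \<Longrightarrow>
      \<bar>expectation (\<lambda>\<omega>. ip01 (X i \<omega>) (X j \<omega>)) - (nm01 (mean_fun M (X 1)))\<^sup>2\<bar> \<le> r (j - i)"
proof -
  obtain \<delta> \<delta>' f where iid: "iid M S \<delta> UNIV" and copy: "independent_copy M S \<delta> \<delta>'"
    and f: "f \<in> measurable (Pi\<^sub>M UNIV (\<lambda>_::nat. S)) L2_borel"
    and rep: "\<And>n. n \<ge> 1 \<Longrightarrow> AE \<omega> in M. AE t in unit_leb. X n \<omega> t = shift_rep f \<delta> n \<omega> t"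
    and summ: "(\<lambda>m. nu M 4 (\<lambda>\<omega> t. X m \<omega> t - coupled_rep f \<delta> \<delta>' m m \<omega> t)) summable_on {1..}"
    and L: "\<And>n. n \<ge> 1 \<Longrightarrow> in_LpH M 4 (X n)"
    using app unfolding Lp_m_approximable_def by blast
  interpret C: coupling M S \<delta> \<delta>'
    by (intro coupling.intro coupling_axioms.intro prob_space_axioms iid copy)
  have XL: "L4 M (X n)" if "n \<ge> 1" for n using L[OF that] by (simp add: in_LpH_4_iff)
  define F where "F = shift_rep f \<delta>"
  define G where "G = coupled_rep f \<delta> \<delta>'"
  have F_eq: "F n = f \<circ> past \<delta> n" for n by (simp add: F_def shift_rep_eq comp_def)
  have G_eq: "G m n = f \<circ> coupled_past \<delta> \<delta>' m n" for m n by (simp add: G_def coupled_rep_eq comp_def)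
  have Fm: "F n \<in> measurable M L2_borel" for n unfolding F_eq by (rule measurable_comp[OF C.past_law(1) f])
  have Gm: "G m n \<in> measurable M L2_borel" for m n unfolding G_eq by (rule measurable_comp[OF C.coupled_past_law(1) f])
  have Flaw: "distr M L2_borel (F n) = distr C.seq_law L2_borel f" for n
    unfolding F_eq using distr_distr[OF f C.past_law(1), of n] C.past_law(2)[of n] by simp
  have Glaw: "distr M L2_borel (G m n) = distr C.seq_law L2_borel f" for m n
    unfolding G_eq using distr_distr[OF f C.coupled_past_law(1), of m n] C.coupled_past_law(2)[of m n] by simp
  have XF: "AE \<omega> in M. AE t in unit_leb. X n \<omega> t = F n \<omega> t" if "n \<ge> 1" for n
    using rep[OF that] by (simp add: F_def)
  have Xlaw: "distr M L2_borel (X n) = distr C.seq_law L2_borel f" if "n \<ge> 1" for n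
    using distr_L2_borel_cong_AE[OF Xm[OF that] Fm XF[OF that]] Flaw[of n] by simp
  define R where "R = distr C.seq_law L2_borel f"
  define m where "m = expectation (\<lambda>\<omega>. nm01 (X 1 \<omega>) ^ 4)"
  have nm4: "(\<lambda>z. nm01 z ^ 4) \<in> borel_measurable L2_borel" by measurable
  have V4: "integrable M (\<lambda>\<omega>. nm01 (V \<omega>) ^ 4) \<and> expectation (\<lambda>\<omega>. nm01 (V \<omega>) ^ 4) = m"
    if V: "V \<in> measurable M L2_borel" "distr M L2_borel V = R" for V
  proof -
    have X1: "X 1 \<in> measurable M L2_borel" "distr M L2_borel (X 1) = R" using Xm[of 1] Xlaw[of 1] by (auto simp: R_def)
    have "integrable M (\<lambda>\<omega>. nm01 (X 1 \<omega>) ^ 4)" using XL[of 1] by (simp add: L4_def)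
    then have "integrable R (\<lambda>z. nm01 z ^ 4)" using integrable_distr_eq[OF X1(1) nm4] X1(2) by simp
    then have "integrable M (\<lambda>\<omega>. nm01 (V \<omega>) ^ 4)" using integrable_distr_eq[OF V(1) nm4] V(2) by simp
    moreover have "expectation (\<lambda>\<omega>. nm01 (V \<omega>) ^ 4) = m"
      using integral_distr[OF V(1) nm4] integral_distr[OF X1(1) nm4] V(2) X1(2) by (simp add: m_def)
    ultimately show ?thesis by blast
  qed
  note F4 = V4[OF Fm Flaw[folded R_def]] and G4 = V4[OF Gm Glaw[folded R_def]]
  define \<nu> where "\<nu> k = nu M 4 (\<lambda>\<omega> t. X k \<omega> t - G k k \<omega> t)" for k
  have pairm: "(\<lambda>\<omega>. (V \<omega>, V' \<omega>)) \<in> measurable M (L2_borel \<Otimes>\<^sub>M L2_borel)"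
    if "V \<in> measurable M L2_borel" "V' \<in> measurable M L2_borel" for V V'
    using that by (rule measurable_Pair)
  have dm: "(\<lambda>\<omega>. nm01 (\<lambda>t. V \<omega> t - V' \<omega> t)) \<in> borel_measurable M"
    if "V \<in> measurable M L2_borel" "V' \<in> measurable M L2_borel" for V V'
    using measurable_compose[OF pairm[OF that] measurable_dist] by simp
  have im: "(\<lambda>\<omega>. ip01 (V \<omega>) (V' \<omega>)) \<in> borel_measurable M"
    if "V \<in> measurable M L2_borel" "V' \<in> measurable M L2_borel" for V V'
    using measurable_compose[OF pairm[OF that] measurable_ip01] by simp
  have sq: "V \<omega> \<in> sq01" if "V \<in> measurable M L2_borel" "\<omega> \<in> space M" for V \<omega>
    using measurable_space[OF that] by simp
  have p4: "x powr 4 = x ^ 4" if "0 \<le> x" for x :: real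
    using that by (cases "x = 0") (auto simp: powr_numeral)
  have p14: "x powr (1 / 4) = sqrt (sqrt x)" if "0 \<le> x" for x :: real
  proof -
    have "x powr (1 / 4) = (x powr (1 / 2)) powr (1 / 2)" by (simp add: powr_powr)
    then show ?thesis using that by (simp add: powr_half_sqrt)
  qed
  have \<nu>_eq: "\<nu> k = sqrt (sqrt (expectation (\<lambda>\<omega>. nm01 (\<lambda>t. F k \<omega> t - G k k \<omega> t) ^ 4)))" if k: "k \<ge> 1" for k
  proof -
    have "expectation (\<lambda>\<omega>. L2_norm (\<lambda>t. X k \<omega> t - G k k \<omega> t) powr 4) = expectation (\<lambda>\<omega>. nm01 (\<lambda>t. F k \<omega> t - G k k \<omega> t) ^ 4)"
    proof (rule integral_cong_AE)
      show "AE \<omega> in M. L2_norm (\<lambda>t. X k \<omega> t - G k k \<omega> t) powr 4 = nm01 (\<lambda>t. F k \<omega> t - G k k \<omega> t) ^ 4"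
        using XF[OF k] AE_space
      proof eventually_elim
        case (elim \<omega>)
        have "nm01 (\<lambda>t. X k \<omega> t - G k k \<omega> t) = nm01 (\<lambda>t. F k \<omega> t - G k k \<omega> t)"
          using elim(1) sqint_diff[OF sq[OF Xm[OF k] elim(2)] sq[OF Gm elim(2)]] sqint_diff[OF sq[OF Fm elim(2)] sq[OF Gm elim(2)]]
          by (intro nm_cong_AE) auto
        then show ?case by (simp add: L2_norm_eq p4)
      qed
    qed (use dm[OF Xm[OF k] Gm] dm[OF Fm Gm] in \<open>auto simp: L2_norm_eq\<close>)
    then show ?thesis by (simp add: \<nu>_def nu_def p14)
  qed
  have stat: "expectation (\<lambda>\<omega>. nm01 (\<lambda>t. F n \<omega> t - G k n \<omega> t) ^ 4) = expectation (\<lambda>\<omega>. nm01 (\<lambda>t. F k \<omega> t - G k k \<omega> t) ^ 4)" for n k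
  proof -
    let ?g = "\<lambda>p. nm01 (\<lambda>t. f (fst p) t - f (snd p) t) ^ 4"
    have ff: "(\<lambda>p. (f (fst p), f (snd p))) \<in> measurable (C.seqs \<Otimes>\<^sub>M C.seqs) (L2_borel \<Otimes>\<^sub>M L2_borel)"
      using f by (intro measurable_Pair measurable_compose[OF measurable_fst f] measurable_compose[OF measurable_snd f])
    have g: "?g \<in> borel_measurable (C.seqs \<Otimes>\<^sub>M C.seqs)"
      using measurable_compose[OF ff measurable_dist] by simp
    have pp: "(\<lambda>\<omega>. (past \<delta> n \<omega>, coupled_past \<delta> \<delta>' k n \<omega>)) \<in> measurable M (C.seqs \<Otimes>\<^sub>M C.seqs)" for n
      by (intro measurable_Pair C.past_law(1) C.coupled_past_law(1))
    have "expectation (\<lambda>\<omega>. nm01 (\<lambda>t. F n \<omega> t - G k n \<omega> t) ^ 4)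
      = (\<integral>p. ?g p \<partial>distr M (C.seqs \<Otimes>\<^sub>M C.seqs) (\<lambda>\<omega>. (past \<delta> n \<omega>, coupled_past \<delta> \<delta>' k n \<omega>)))" for n
      using integral_distr[OF pp g, of n] by (simp add: F_eq G_eq)
    then show ?thesis using C.pair_law_stationary[of n k k] by simp
  qed
  let ?\<kappa> = "(nm leb2 (mom2 M (X 1) (X 1)))\<^sup>2" and ?a = "(nm01 (mean_fun M (X 1)))\<^sup>2"
  have indm: "expectation (\<lambda>\<omega>. (ip01 (F i \<omega>) (G (j - i) j \<omega>))\<^sup>2) = ?\<kappa>"
    "expectation (\<lambda>\<omega>. ip01 (F i \<omega>) (G (j - i) j \<omega>)) = ?a" if ij: "i \<le> j" for i j
  proof -
    have "indep_var L2_borel (F i) L2_borel (G (j - i) j)"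
      unfolding F_eq G_eq using indep_var_compose[OF C.past_indep_coupled[of i "j - i"] f f] ij by simp
    note I = indep_inner_product_moments[OF XL[OF order_refl] Xm[OF order_refl] this]
    have l: "distr M L2_borel (F i) = distr M L2_borel (X 1)" "distr M L2_borel (G (j - i) j) = distr M L2_borel (X 1)"
      using Flaw[of i] Glaw[of "j - i" j] Xlaw[of 1] by simp_all
    show "expectation (\<lambda>\<omega>. (ip01 (F i \<omega>) (G (j - i) j \<omega>))\<^sup>2) = ?\<kappa>"
      "expectation (\<lambda>\<omega>. ip01 (F i \<omega>) (G (j - i) j \<omega>)) = ?a"
      using I(1)[OF l] I(3)[OF l] by auto
  qed
  define K where "K = sqrt m * sqrt (sqrt (16 * m)) + sqrt (sqrt m)"
  have m0: "0 \<le> m" unfolding m_def by (intro Bochner_Integration.integral_nonneg) auto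
  have K0: "0 \<le> K" using m0 by (simp add: K_def)
  have nu0: "0 \<le> \<nu> k" for k by (simp add: \<nu>_def nu_def)
  have pert: "\<bar>expectation (\<lambda>\<omega>. (ip01 (F i \<omega>) (F j \<omega>))\<^sup>2) - ?\<kappa>\<bar> \<le> K * \<nu> (j - i)"
    "\<bar>expectation (\<lambda>\<omega>. ip01 (F i \<omega>) (F j \<omega>)) - ?a\<bar> \<le> K * \<nu> (j - i)" if ij: "i < j" for i j
  proof -
    have k: "j - i \<ge> 1" using ij by simp
    note P = inner_product_moment_perturbation[OF Fm Fm Gm F4[THEN conjunct1] F4[THEN conjunct2] F4[THEN conjunct1] F4[THEN conjunct2]
        G4[THEN conjunct1] G4[THEN conjunct2], of i j "j - i" j]
    have d: "sqrt (sqrt (expectation (\<lambda>\<omega>. nm01 (\<lambda>t. F j \<omega> t - G (j - i) j \<omega> t) ^ 4))) = \<nu> (j - i)"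
      using \<nu>_eq[OF k] stat[of j "j - i"] by simp
    have K1: "sqrt m * sqrt (sqrt (16 * m)) \<le> K" "sqrt (sqrt m) \<le> K" using m0 by (simp_all add: K_def)
    show "\<bar>expectation (\<lambda>\<omega>. (ip01 (F i \<omega>) (F j \<omega>))\<^sup>2) - ?\<kappa>\<bar> \<le> K * \<nu> (j - i)"
      using P(1) indm(1)[of i j] ij mult_right_mono[OF K1(1) nu0[of "j - i"]] unfolding d by simp
    show "\<bar>expectation (\<lambda>\<omega>. ip01 (F i \<omega>) (F j \<omega>)) - ?a\<bar> \<le> K * \<nu> (j - i)"
      using P(2) indm(2)[of i j] ij mult_right_mono[OF K1(2) nu0[of "j - i"]] unfolding d by simp
  qed
  have XFip: "AE \<omega> in M. ip01 (X i \<omega>) (X j \<omega>) = ip01 (F i \<omega>) (F j \<omega>)" if ij: "i \<ge> 1" "j \<ge> 1" for i j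
    using XF[OF ij(1)] XF[OF ij(2)] AE_space
  proof eventually_elim
    case (elim \<omega>)
    show ?case
      using elim sq[OF Xm[OF ij(1)] elim(3)] sq[OF Xm[OF ij(2)] elim(3)] sq[OF Fm elim(3)]
      by (intro ip_cong_AE) auto
  qed
  have EX: "expectation (\<lambda>\<omega>. (ip01 (X i \<omega>) (X j \<omega>))\<^sup>2) = expectation (\<lambda>\<omega>. (ip01 (F i \<omega>) (F j \<omega>))\<^sup>2)"
    "expectation (\<lambda>\<omega>. ip01 (X i \<omega>) (X j \<omega>)) = expectation (\<lambda>\<omega>. ip01 (F i \<omega>) (F j \<omega>))" if ij: "i \<ge> 1" "j \<ge> 1" for i j
  proof -
    have mX: "(\<lambda>\<omega>. ip01 (X i \<omega>) (X j \<omega>)) \<in> borel_measurable M" by (rule im[OF Xm[OF ij(1)] Xm[OF ij(2)]])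
    have mF: "(\<lambda>\<omega>. ip01 (F i \<omega>) (F j \<omega>)) \<in> borel_measurable M" by (rule im[OF Fm Fm])
    show "expectation (\<lambda>\<omega>. (ip01 (X i \<omega>) (X j \<omega>))\<^sup>2) = expectation (\<lambda>\<omega>. (ip01 (F i \<omega>) (F j \<omega>))\<^sup>2)"
      by (rule integral_cong_AE) (use mX mF XFip[OF ij] in auto)
    show "expectation (\<lambda>\<omega>. ip01 (X i \<omega>) (X j \<omega>)) = expectation (\<lambda>\<omega>. ip01 (F i \<omega>) (F j \<omega>))"
      by (rule integral_cong_AE) (use mX mF XFip[OF ij] in auto)
  qed
  \<comment> \<open>On the diagonal there is no independence to exploit; a crude bound suffices because it enters once.\<close>
  define r0 where "r0 = m + ?\<kappa> + sqrt m + ?a"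
  have r00: "0 \<le> r0" using m0 by (simp add: r0_def)
  define r where "r k = (if k = 0 then r0 else K * \<nu> k)" for k
  have diag: "\<bar>expectation (\<lambda>\<omega>. (ip01 (X i \<omega>) (X i \<omega>))\<^sup>2) - ?\<kappa>\<bar> \<le> r0" "\<bar>expectation (\<lambda>\<omega>. ip01 (X i \<omega>) (X i \<omega>)) - ?a\<bar> \<le> r0"
    if i: "i \<ge> 1" for i
  proof -
    have 4: "integrable M (\<lambda>\<omega>. nm01 (X i \<omega>) ^ 4)" "expectation (\<lambda>\<omega>. nm01 (X i \<omega>) ^ 4) = m"
      using V4[OF Xm[OF i] Xlaw[OF i, folded R_def]] by auto
    have e2: "expectation (\<lambda>\<omega>. (ip01 (X i \<omega>) (X i \<omega>))\<^sup>2) = m"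
      using 4(2) by (simp add: nm_sq[symmetric] power_mult[symmetric])
    have s: "(\<lambda>\<omega>. (nm01 (X i \<omega>))\<^sup>2) \<in> sqint M" by (rule L4_nm_sq[OF XL[OF i]])
    have "expectation (\<lambda>\<omega>. ip01 (X i \<omega>) (X i \<omega>)) \<le> nm M (\<lambda>\<omega>. (nm01 (X i \<omega>))\<^sup>2)"
      using sqint_L1_le[OF s] by (simp add: nm_sq)
    also have "\<dots> = sqrt m"
      using in_sqint_pow4(3)[OF measurable_nm_random[OF L4_random_fun[OF XL[OF i]]] 4(1)] 4(2) by simp
    finally have e1: "expectation (\<lambda>\<omega>. ip01 (X i \<omega>) (X i \<omega>)) \<le> sqrt m" .
    have e1': "0 \<le> expectation (\<lambda>\<omega>. ip01 (X i \<omega>) (X i \<omega>))" by (intro Bochner_Integration.integral_nonneg) auto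
    have pos: "0 \<le> ?\<kappa>" "0 \<le> ?a" "0 \<le> sqrt m" using m0 by auto
    show "\<bar>expectation (\<lambda>\<omega>. (ip01 (X i \<omega>) (X i \<omega>))\<^sup>2) - ?\<kappa>\<bar> \<le> r0"
      unfolding e2 r0_def using pos m0 by linarith
    show "\<bar>expectation (\<lambda>\<omega>. ip01 (X i \<omega>) (X i \<omega>)) - ?a\<bar> \<le> r0"
      unfolding r0_def using e1 e1' pos m0 by linarith
  qed
  have sumr: "summable r"
  proof -
    let ?n = "\<lambda>k. if k = 0 then 0 else \<nu> k"
    have "\<nu> summable_on {1..}" using summ unfolding \<nu>_def[abs_def] G_def .
    then have "?n summable_on UNIV"
      by (rule summable_on_cong_neutral[THEN iffD1, rotated -1]) auto
    then have "summable ?n" using nu0 by (subst (asm) summable_on_UNIV_nonneg_real_iff) auto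
    then have "summable (\<lambda>k. K * ?n k)" by (rule summable_mult)
    moreover have "summable (\<lambda>k. if k = 0 then r0 else 0)" by (rule summable_single)
    ultimately have "summable (\<lambda>k. K * ?n k + (if k = 0 then r0 else 0))" by (rule summable_add)
    moreover have "(\<lambda>k. K * ?n k + (if k = 0 then r0 else 0)) = r" by (auto simp: r_def fun_eq_iff)
    ultimately show ?thesis by simp
  qed
  show ?thesis
  proof (rule that[of r])
    show "summable r" by (rule sumr)
    show "0 \<le> r n" for n using r00 K0 nu0 by (simp add: r_def)
    show "distr M L2_borel (X n) = distr M L2_borel (X 1)" if "n \<ge> 1" for n using Xlaw[OF that] Xlaw[of 1] by simp
    show "\<bar>expectation (\<lambda>\<omega>. (ip01 (X i \<omega>) (X j \<omega>))\<^sup>2) - ?\<kappa>\<bar> \<le> r (j - i)" if ij: "1 \<le> i" "i \<le> j" for i j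
    proof (cases "i = j")
      case True
      then show ?thesis using diag(1)[OF ij(1)] by (simp add: r_def)
    next
      case False
      then show ?thesis using pert(1)[of i j] EX(1)[of i j] ij by (simp add: r_def)
    qed
    show "\<bar>expectation (\<lambda>\<omega>. ip01 (X i \<omega>) (X j \<omega>)) - ?a\<bar> \<le> r (j - i)" if ij: "1 \<le> i" "i \<le> j" for i j
    proof (cases "i = j")
      case True
      then show ?thesis using diag(2)[OF ij(1)] by (simp add: r_def)
    next
      case False
      then show ?thesis using pert(2)[of i j] EX(2)[of i j] ij by (simp add: r_def)
    qed
  qed
qed

end

section \<open>The regression kernel is a Hilbert--Schmidt kernel\<close>

lemma onseq_projection_span:
  assumes e: "onseq unit_leb e" and f: "f \<in> sq01"
  obtains p where "p \<in> sq01" "\<And>j. j \<ge> 1 \<Longrightarrow> ip01 p (e j) = ip01 f (e j)"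
    "\<And>r. r \<in> sq01 \<Longrightarrow> (\<And>j. j \<ge> 1 \<Longrightarrow> ip01 r (e j) = 0) \<Longrightarrow> ip01 p r = 0"
proof -
  let ?s = "\<lambda>n x. \<Sum>i=1..n. ip01 f (e i) * e i x"
  have s: "?s n \<in> sq01" for n using e by (intro sqint_sum sqint_scale) (auto simp: onseq_def)
  obtain p where p: "p \<in> sq01" "(\<lambda>n. nm01 (\<lambda>x. ?s n x - p x)) \<longlonglongrightarrow> 0"
    "\<And>j. j \<ge> 1 \<Longrightarrow> ip01 p (e j) = ip01 f (e j)"
    using unit_leb.onseq_projection[OF e f] by blast
  have "ip01 p r = 0" if r: "r \<in> sq01" "\<And>j. j \<ge> 1 \<Longrightarrow> ip01 r (e j) = 0" for r
  proof -
    have "(\<lambda>n. ip01 (?s n) r) \<longlonglongrightarrow> ip01 p r" by (rule ip_tendsto[OF s p(1) r(1) p(2)])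
    moreover have "ip01 (?s n) r = 0" for n
    proof -
      have "ip01 (?s n) r = (\<Sum>i=1..n. ip01 f (e i) * ip01 (e i) r)"
        using e r(1) by (subst ip_sum_left) (auto simp: ip_scale_left onseq_def intro: sqint_scale)
      also have "\<dots> = 0" using r(2) by (intro sum.neutral) (auto simp: ip_commute[of _ _ r])
      finally show ?thesis .
    qed
    ultimately show ?thesis using LIMSEQ_unique[of "\<lambda>n. 0::real"] by simp
  qed
  then show ?thesis using that p by blast
qed

lemma op01_ktransp:
  assumes k: "k \<in> sqint leb2" and f: "f \<in> sq01" and g: "g \<in> sq01"
  shows "ip01 (op01 k f) g = ip01 (op01 (ktransp k) g) f"
proof -
  have "ip01 (op01 k f) g = ip leb2 k (tens g f)" by (rule ip_op01_eq[OF k f g])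
  also have "\<dots> = ip leb2 (ktransp k) (ktransp (tens g f))"
    by (rule unit_leb2.ktransp_ip[OF k unit_leb2.tens_sqint[OF g f], symmetric])
  also have "\<dots> = ip01 (op01 (ktransp k) g) f"
    using ip_op01_eq[OF unit_leb2.ktransp_sqint(1)[OF k] g f] by (simp add: ktransp_tens)
  finally show ?thesis .
qed

text \<open>Almost every section \<open>P (t, \<cdot>)\<close> lies in the closed span of the sequence, for which Parseval's identity holds. It
  suffices to test orthogonality on the residuals of a countable total family, which makes the exceptional null set
  independent of the test function.\<close>

lemma section_parseval:
  assumes e: "onseq unit_leb e" and Ps: "AE t in unit_leb. (\<lambda>s. P (t, s)) \<in> sq01"
    and null: "\<And>f. f \<in> sq01 \<Longrightarrow> (\<And>j. j \<ge> 1 \<Longrightarrow> ip01 f (e j) = 0) \<Longrightarrow> AE t in unit_leb. op01 P f t = 0"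
  shows "AE t in unit_leb. (\<lambda>n. \<Sum>j=1..n. (op01 P (e j) t)\<^sup>2) \<longlonglongrightarrow> (nm01 (\<lambda>s. P (t, s)))\<^sup>2"
proof -
  have "\<exists>p. p \<in> sq01 \<and> (\<forall>j\<ge>1. ip01 p (e j) = ip01 (initial_ind q) (e j)) \<and>
      (\<forall>r\<in>sq01. (\<forall>j\<ge>1. ip01 r (e j) = 0) \<longrightarrow> ip01 p r = 0)" for q
    using onseq_projection_span[OF e initial_ind_sqint[of q]] by metis
  then obtain p where p: "\<And>q. p q \<in> sq01" "\<And>q j. j \<ge> 1 \<Longrightarrow> ip01 (p q) (e j) = ip01 (initial_ind q) (e j)"
    "\<And>q r. r \<in> sq01 \<Longrightarrow> (\<And>j. j \<ge> 1 \<Longrightarrow> ip01 r (e j) = 0) \<Longrightarrow> ip01 (p q) r = 0" by metis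
  \<comment> \<open>the residuals of the initial indicators, which are annihilated by the operator\<close>
  define z where "z q = (\<lambda>t. initial_ind q t - p q t)" for q
  have z: "z q \<in> sq01" for q unfolding z_def by (intro sqint_diff initial_ind_sqint p)
  have ze: "ip01 (z q) (e j) = 0" if "j \<ge> 1" for q j
    unfolding z_def using ip_diff_left[OF initial_ind_sqint p(1) onseq_sqint[OF e that]] p(2)[OF that] by simp
  have "AE t in unit_leb. op01 P (z q) t = 0" for q by (rule null[OF z ze])
  then have "AE t in unit_leb. \<forall>q. op01 P (z q) t = 0" by (simp add: AE_all_countable)
  with Ps show ?thesis
  proof eventually_elim
    case (elim t)
    define g where "g = (\<lambda>s. P (t, s))"
    have g: "g \<in> sq01" using elim(1) by (simp add: g_def)
    have gz: "ip01 g (z q) = 0" for q using elim(2) by (simp add: g_def kapp_def)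
    obtain h where h: "h \<in> sq01" "\<And>j. j \<ge> 1 \<Longrightarrow> ip01 h (e j) = ip01 g (e j)"
      "\<And>r. r \<in> sq01 \<Longrightarrow> (\<And>j. j \<ge> 1 \<Longrightarrow> ip01 r (e j) = 0) \<Longrightarrow> ip01 h r = 0"
      using onseq_projection_span[OF e g] by blast
    define d where "d = (\<lambda>s. g s - h s)"
    have d: "d \<in> sq01" unfolding d_def by (intro sqint_diff g h(1))
    have de: "ip01 d (e j) = 0" if "j \<ge> 1" for j
      unfolding d_def using ip_diff_left[OF g h(1) onseq_sqint[OF e that]] h(2)[OF that] by simp
    have "ip01 d (initial_ind q) = 0" for q
    proof -
      have dz: "ip01 d (z q) = 0"
        unfolding d_def using ip_diff_left[OF g h(1) z[of q]] gz[of q] h(3)[OF z ze, of q] by simp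
      have dp: "ip01 d (p q) = 0" using p(3)[OF d de, of q] ip_commute[of unit_leb d "p q"] by simp
      have "ip01 d (z q) = ip01 d (initial_ind q) - ip01 d (p q)"
        unfolding z_def by (rule ip_diff_right[OF initial_ind_sqint p(1) d])
      then show ?thesis using dz dp by simp
    qed
    then have d0: "AE s in unit_leb. d s = 0" by (rule initial_ind_total[OF d])
    have "(\<lambda>n. \<Sum>j=1..n. (ip01 g (e j))\<^sup>2) \<longlonglongrightarrow> (nm01 g)\<^sup>2"
    proof (rule unit_leb.onseq_parseval[OF e g])
      fix r assume r: "r \<in> sq01" "\<And>j. j \<ge> 1 \<Longrightarrow> ip01 r (e j) = 0"
      have "ip01 r g = ip01 r h"
        using d0 r(1) g h(1) by (intro ip_cong_AE) (auto simp: d_def)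
      also have "\<dots> = 0" using h(3)[OF r] ip_commute[of unit_leb r h] by simp
      finally show "ip01 r g = 0" .
    qed
    then show ?case by (simp add: g_def kapp_def)
  qed
qed

text \<open>Integrating Parseval's identity for the sections, with Fatou's lemma, shows at the same time that \<open>P\<close> is
  square-integrable and how large its norm is.\<close>

lemma sqint_of_section_sums:
  assumes P: "P \<in> borel_measurable leb2" and Ps: "AE t in unit_leb. (\<lambda>s. P (t, s)) \<in> sq01"
    and w: "\<And>j. j \<ge> 1 \<Longrightarrow> op01 P (e j) \<in> sq01"
    and lim: "AE t in unit_leb. (\<lambda>n. \<Sum>j=1..n. (op01 P (e j) t)\<^sup>2) \<longlonglongrightarrow> (nm01 (\<lambda>s. P (t, s)))\<^sup>2"
    and bound: "\<And>n. (\<Sum>j=1..n. (nm01 (op01 P (e j)))\<^sup>2) \<le> B"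
  shows "P \<in> sqint leb2" "(nm leb2 P)\<^sup>2 \<le> B"
proof -
  let ?g = "\<lambda>t. nm01 (\<lambda>s. P (t, s))"
  let ?h = "\<lambda>n t. sqrt (\<Sum>j=1..n. (op01 P (e j) t)\<^sup>2)"
  have B0: "0 \<le> B" using bound[of 0] by simp
  have wi: "integrable unit_leb (\<lambda>t. (op01 P (e j) t)\<^sup>2)" if "j \<in> {1..n}" for j n
    using sqint_integrable_sq[OF w[of j]] that by simp
  have hm: "?h n \<in> borel_measurable unit_leb" for n
    using sqint_measurable[OF w] by (intro measurable_compose[OF _ borel_measurable_sqrt] borel_measurable_sum borel_measurable_power) auto
  have hsq: "(\<lambda>t. (?h n t)\<^sup>2) = (\<lambda>t. \<Sum>j=1..n. (op01 P (e j) t)\<^sup>2)" for n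
    by (simp add: fun_eq_iff sum_nonneg)
  have h: "?h n \<in> sq01" for n
    unfolding sqint_def mem_Collect_eq hsq using hm[of n] wi by (auto intro!: Bochner_Integration.integrable_sum)
  have hn: "nm01 (?h n) \<le> sqrt B" for n
  proof -
    have "(nm01 (?h n))\<^sup>2 = (\<Sum>j=1..n. (nm01 (op01 P (e j)))\<^sup>2)"
      unfolding nm_sq_int hsq using wi by (intro Bochner_Integration.integral_sum) auto
    then show ?thesis using bound[of n] by (intro real_le_rsqrt) simp
  qed
  have gm: "?g \<in> borel_measurable unit_leb" by (rule unit_leb2.measurable_nm_section[OF P])
  have hl: "AE t in unit_leb. (\<lambda>n. ?h n t) \<longlonglongrightarrow> ?g t"
    using lim
  proof eventually_elim
    case (elim t)
    have "(\<lambda>n. ?h n t) \<longlonglongrightarrow> sqrt ((?g t)\<^sup>2)" using elim by (rule tendsto_real_sqrt)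
    then show ?case by simp
  qed
  have g: "?g \<in> sq01" "nm01 ?g \<le> sqrt B"
    using nm_le_of_AE_limit[OF h gm hl, of 0 "sqrt B"] hn by auto
  show Ps2: "P \<in> sqint leb2"
    by (rule unit_leb2.sqint_pairI[OF P Ps sqint_integrable_sq[OF g(1)]])
  have "(nm leb2 P)\<^sup>2 = (nm01 ?g)\<^sup>2" unfolding unit_leb2.nm_sections(2)[OF Ps2] by (simp add: nm_sq_int)
  also have "\<dots> \<le> (sqrt B)\<^sup>2" using g(2) by (intro power_mono) auto
  finally show "(nm leb2 P)\<^sup>2 \<le> B" using B0 by simp
qed

context prob_space
begin

lemma ip_centred:
  assumes X: "L4 M X" and mean: "AE t in unit_leb. mean_fun M X t = 0" and \<omega>: "\<omega> \<in> space M" and g: "g \<in> sq01"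
  shows "ip01 (\<lambda>t. X \<omega> t - mean_fun M X t) g = ip01 (X \<omega>) g"
  using mean L4_sqint[OF X \<omega>] mean_fun_sqint[OF X] g sqint_diff[OF L4_sqint[OF X \<omega>] mean_fun_sqint[OF X]]
  by (intro ip_cong_AE) auto

lemma psd_eigen_cov_kernel:
  assumes X: "L4 M X" and es: "eigensystem (cov_kernel M X) l e"
  shows "psd_eigen (cov_kernel M X) l e"
  by (intro psd_eigen.intro es, unfold cov_kernel_eq)
    (intro psd_mom2 L4_diff X L4_const mean_fun_sqint)

text \<open>Multiplying the model by \<open>\<langle>X, v\<rangle>\<close> and taking means removes the error and leaves \<open>\<psi>\<close> applied to the covariance
  operator at \<open>v\<close>. As \<open>\<psi>\<close> may so far have sections of unbounded norm, this is done separately on each set where the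
  norms are bounded: there the operator is bounded and may be exchanged with the expectation.\<close>

lemma regression_eigenfunction:
  assumes X: "L4 M X" and Y: "L4 M Y" and E: "random_fun M E"
    and mean: "AE t in unit_leb. mean_fun M X t = 0"
    and ind: "indep_var L2_borel X L2_borel E"
    and P: "P \<in> borel_measurable leb2" and Ps: "AE t in unit_leb. (\<lambda>s. P (t, s)) \<in> sq01"
    and model: "AE \<omega> in M. AE t in unit_leb. Y \<omega> t = op01 P (X \<omega>) t + E \<omega> t"
    and v: "v \<in> sq01" "AE t in unit_leb. op01 (case_prod (cov_kernel M X)) v t = l * v t"
  shows "AE t in unit_leb. op01 (mom2 M Y X) v t = l * op01 P v t"
proof -
  define m where "m = op01 (mom2 M Y X) v"
  have m: "m \<in> sq01" unfolding m_def by (rule op01_sqint[OF mom2_sqint[OF Y X] v(1)])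
  have ipm: "ip01 m g = expectation (\<lambda>\<omega>. ip01 (Y \<omega>) g * ip01 (X \<omega>) v)" if g: "g \<in> sq01" for g
    unfolding m_def ip_op01_eq[OF mom2_sqint[OF Y X] v(1) g] by (rule ip_mom2_tens(1)[OF Y X g v(1)])
  have Xm: "X \<in> measurable M L2_borel" and Em: "E \<in> measurable M L2_borel"
    using ind by (auto dest: indep_var_rv1 indep_var_rv2)
  have E_sq: "E \<omega> \<in> sq01" if "\<omega> \<in> space M" for \<omega> using random_fun_sqint[OF E that] .
  define N where "N t = (\<integral>\<^sup>+s. ennreal ((P (t, s))\<^sup>2) \<partial>unit_leb)" for t
  have Nm: "N \<in> borel_measurable unit_leb"
    unfolding N_def[abs_def] using P by (intro unit_leb.borel_measurable_nn_integral) (simp add: case_prod_beta')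
  \<comment> \<open>the points at which the section of \<open>P\<close> has a squared norm of at most \<open>R\<close>\<close>
  define A where "A R = {t \<in> space unit_leb. N t \<le> ennreal (real R)}" for R :: nat
  have Am: "A R \<in> sets unit_leb" for R unfolding A_def using Nm by measurable
  define PR where "PR R p = indicator (A R) (fst p) * P p" for R p
  have sec: "(\<lambda>s. P (t, s)) \<in> sq01" "(nm01 (\<lambda>s. P (t, s)))\<^sup>2 \<le> real R" if t: "t \<in> A R" for t R
  proof -
    have tm: "(\<lambda>s. P (t, s)) \<in> borel_measurable unit_leb"
      using unit_leb2.measurable_section[OF P] t by (auto simp: A_def)
    have "N t < \<infinity>" using t by (auto simp: A_def intro: le_less_trans)
    then have "integrable unit_leb (\<lambda>s. (P (t, s))\<^sup>2)"
      using tm by (intro integrableI_nonneg) (auto simp: N_def)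
    then show s: "(\<lambda>s. P (t, s)) \<in> sq01" using tm by (simp add: sqint_def)
    have "ennreal ((nm01 (\<lambda>s. P (t, s)))\<^sup>2) = N t"
      unfolding N_def nm_sq_int using s by (intro nn_integral_eq_integral[symmetric]) (auto simp: sqint_def)
    then have "ennreal ((nm01 (\<lambda>s. P (t, s)))\<^sup>2) \<le> ennreal (real R)" using t by (simp add: A_def)
    then show "(nm01 (\<lambda>s. P (t, s)))\<^sup>2 \<le> real R" by simp
  qed
  have PRs: "PR R \<in> sqint leb2" for R
  proof (rule unit_leb2.sqint_pairI)
    have i: "(\<lambda>p. indicator (A R) (fst p) :: real) \<in> borel_measurable leb2"
      using Am by (intro measurable_compose[OF measurable_fst]) simp
    show PRm: "PR R \<in> borel_measurable leb2" unfolding PR_def[abs_def] by (rule borel_measurable_times[OF i P])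
    show "AE t in unit_leb. (\<lambda>s. PR R (t, s)) \<in> sq01"
    proof (rule AE_I2)
      fix t show "(\<lambda>s. PR R (t, s)) \<in> sq01" using sec(1)[of t R] by (cases "t \<in> A R") (auto simp: PR_def)
    qed
    show "integrable unit_leb (\<lambda>t. (nm01 (\<lambda>s. PR R (t, s)))\<^sup>2)"
    proof (rule unit_leb.integrable_const_bound[of _ "real R"])
      show "AE t in unit_leb. norm ((nm01 (\<lambda>s. PR R (t, s)))\<^sup>2) \<le> real R"
      proof (rule AE_I2)
        fix t show "norm ((nm01 (\<lambda>s. PR R (t, s)))\<^sup>2) \<le> real R"
          using sec(2)[of t R] by (cases "t \<in> A R") (auto simp: PR_def nm_def)
      qed
      show "(\<lambda>t. (nm01 (\<lambda>s. PR R (t, s)))\<^sup>2) \<in> borel_measurable unit_leb"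
        using unit_leb2.measurable_nm_section[OF PRm] by measurable
    qed
  qed
  have opPR: "op01 (PR R) f t = indicator (A R) t * op01 P f t" for R f t
    by (simp add: kapp_def PR_def ip_def mult.assoc)
  have main: "AE t in unit_leb. indicator (A R) t * m t = indicator (A R) t * (l * op01 P v t)" for R
  proof -
    have iAm: "indicator (A R) \<in> borel_measurable unit_leb" using Am by simp
    have cut: "(\<lambda>t. indicator (A R) t * g t) \<in> sq01" if g: "g \<in> sq01" for g
    proof (rule sqint_bound[OF g])
      show "(\<lambda>t. indicator (A R) t * g t) \<in> borel_measurable unit_leb" using iAm g by (intro borel_measurable_times) auto
    qed (auto simp: indicator_def)
    let ?d = "\<lambda>t. indicator (A R) t * m t - l * op01 (PR R) v t"
    have d: "?d \<in> sq01" by (intro sqint_diff sqint_scale cut m op01_sqint[OF PRs v(1)])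
    have "AE t in unit_leb. ?d t = 0"
    proof (rule sqint_eq_0I[OF d])
      fix g0 assume g0: "g0 \<in> sq01"
      let ?g = "\<lambda>t. indicator (A R) t * g0 t"
      have g: "?g \<in> sq01" by (rule cut[OF g0])
      define h where "h = op01 (ktransp (PR R)) g0"
      have h: "h \<in> sq01" unfolding h_def by (rule op01_sqint[OF unit_leb2.ktransp_sqint(1)[OF PRs] g0])
      have YE: "AE \<omega> in M. ip01 (Y \<omega>) ?g = ip01 (X \<omega>) h + ip01 (E \<omega>) ?g"
        using model AE_space
      proof eventually_elim
        case (elim \<omega>)
        note x = L4_sqint[OF X elim(2)]
        have "ip01 (X \<omega>) h = ip01 (op01 (PR R) (X \<omega>)) g0"
          unfolding h_def op01_ktransp[OF PRs x g0] by (rule ip_commute)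
        moreover have "ip01 (Y \<omega>) ?g = (\<integral>t. op01 (PR R) (X \<omega>) t * g0 t + E \<omega> t * ?g t \<partial>unit_leb)"
          unfolding ip_def
        proof (rule integral_cong_AE)
          show "(\<lambda>t. Y \<omega> t * ?g t) \<in> borel_measurable unit_leb"
            using sqint_integrable_mult[OF L4_sqint[OF Y elim(2)] g] by auto
          show "(\<lambda>t. op01 (PR R) (X \<omega>) t * g0 t + E \<omega> t * ?g t) \<in> borel_measurable unit_leb"
            using sqint_integrable_mult[OF op01_sqint[OF PRs x] g0] sqint_integrable_mult[OF E_sq[OF elim(2)] g] by auto
          show "AE t in unit_leb. Y \<omega> t * ?g t = op01 (PR R) (X \<omega>) t * g0 t + E \<omega> t * ?g t"
            using elim(1) by eventually_elim (simp add: opPR algebra_simps)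
        qed
        moreover have "\<dots> = ip01 (op01 (PR R) (X \<omega>)) g0 + ip01 (E \<omega>) ?g"
          unfolding ip_def
          by (rule Bochner_Integration.integral_add[OF sqint_integrable_mult[OF op01_sqint[OF PRs x] g0]
                sqint_integrable_mult[OF E_sq[OF elim(2)] g]])
        ultimately show ?case by simp
      qed
      have iX: "integrable M (\<lambda>\<omega>. ip01 (X \<omega>) f)" if "f \<in> sq01" for f
        by (rule L4_ip_integrable(1)[OF X L4_const[OF that]])
      have iY: "integrable M (\<lambda>\<omega>. ip01 (Y \<omega>) ?g)" by (rule L4_ip_integrable(1)[OF Y L4_const[OF g]])
      have Egm: "(\<lambda>\<omega>. ip01 (E \<omega>) ?g) \<in> borel_measurable M"
        using measurable_compose[OF Em measurable_ip01_const[OF g]] .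
      have iE: "integrable M (\<lambda>\<omega>. ip01 (E \<omega>) ?g)"
      proof (rule integrable_cong_AE_imp[OF Bochner_Integration.integrable_diff[OF iY iX[OF h]] Egm])
        show "AE \<omega> in M. ip01 (Y \<omega>) ?g - ip01 (X \<omega>) h = ip01 (E \<omega>) ?g" using YE by eventually_elim simp
      qed
      have ind': "indep_var borel (\<lambda>\<omega>. ip01 (X \<omega>) v) borel (\<lambda>\<omega>. ip01 (E \<omega>) ?g)"
        using indep_var_compose[OF ind measurable_ip01_const[OF v(1)] measurable_ip01_const[OF g]] by (simp add: comp_def)
      note EX0 = expectation_ip_mean_zero[OF X mean v(1)]
      have iXE: "integrable M (\<lambda>\<omega>. ip01 (X \<omega>) v * ip01 (E \<omega>) ?g)"
        by (rule indep_var_integrable[OF ind' iX[OF v(1)] iE])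
      have XE0: "expectation (\<lambda>\<omega>. ip01 (X \<omega>) v * ip01 (E \<omega>) ?g) = 0"
        using indep_var_lebesgue_integral[OF ind' iX[OF v(1)] iE] EX0 by simp
      have iXX: "integrable M (\<lambda>\<omega>. ip01 (X \<omega>) h * ip01 (X \<omega>) v)" by (rule ip_mom2_tens(2)[OF X X h v(1)])
      have "ip01 m ?g = expectation (\<lambda>\<omega>. ip01 (X \<omega>) h * ip01 (X \<omega>) v + ip01 (X \<omega>) v * ip01 (E \<omega>) ?g)"
        unfolding ipm[OF g]
      proof (rule integral_cong_AE)
        show "AE \<omega> in M. ip01 (Y \<omega>) ?g * ip01 (X \<omega>) v = ip01 (X \<omega>) h * ip01 (X \<omega>) v + ip01 (X \<omega>) v * ip01 (E \<omega>) ?g"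
          using YE by eventually_elim (simp add: algebra_simps)
      qed (use ip_mom2_tens(2)[OF Y X g v(1)] iXX iXE in auto)
      also have "\<dots> = expectation (\<lambda>\<omega>. ip01 (X \<omega>) h * ip01 (X \<omega>) v)" using iXX iXE XE0 by simp
      also have "\<dots> = ip01 (op01 (case_prod (cov_kernel M X)) v) h"
      proof -
        let ?Xc = "\<lambda>\<omega> t. X \<omega> t - mean_fun M X t"
        have Xc: "L4 M ?Xc" by (intro L4_diff X L4_const mean_fun_sqint)
        have "ip01 (op01 (case_prod (cov_kernel M X)) v) h = ip leb2 (mom2 M ?Xc ?Xc) (tens h v)"
          unfolding cov_kernel_eq by (rule ip_op01_eq[OF mom2_sqint[OF Xc Xc] v(1) h])
        also have "\<dots> = expectation (\<lambda>\<omega>. ip01 (?Xc \<omega>) h * ip01 (?Xc \<omega>) v)" by (rule ip_mom2_tens(1)[OF Xc Xc h v(1)])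
        also have "\<dots> = expectation (\<lambda>\<omega>. ip01 (X \<omega>) h * ip01 (X \<omega>) v)"
          by (intro Bochner_Integration.integral_cong refl) (simp add: ip_centred[OF X mean] h v(1))
        finally show ?thesis by simp
      qed
      also have "\<dots> = ip01 (\<lambda>t. l * v t) h"
      proof (rule ip_cong_AE)
        have "case_prod (cov_kernel M X) \<in> sqint leb2"
          unfolding cov_kernel_eq by (intro mom2_sqint L4_diff X L4_const mean_fun_sqint)
        then show "op01 (case_prod (cov_kernel M X)) v \<in> borel_measurable unit_leb"
          using op01_sqint v(1) by auto
      qed (use v h in auto)
      also have "\<dots> = l * ip01 (op01 (PR R) v) g0"
        unfolding h_def ip_scale_left op01_ktransp[OF PRs v(1) g0] by (simp only: ip_commute)
      finally have "ip01 m ?g = l * ip01 (op01 (PR R) v) g0" .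
      moreover have "ip01 (\<lambda>t. indicator (A R) t * m t) g0 = ip01 m ?g" by (simp add: ip_def mult_ac)
      ultimately show "ip01 ?d g0 = 0"
        using ip_diff_left[OF cut[OF m] sqint_scale[OF op01_sqint[OF PRs v(1)], of l] g0] by (simp add: ip_scale_left)
    qed
    then show ?thesis by eventually_elim (simp add: opPR)
  qed
  have "AE t in unit_leb. \<forall>R. indicator (A R) t * m t = indicator (A R) t * (l * op01 P v t)"
    unfolding AE_all_countable using main by blast
  then show ?thesis using Ps AE_space
  proof eventually_elim
    case (elim t)
    have "N t < \<infinity>"
      unfolding N_def using elim(2) by (auto simp: sqint_def integrable_iff_bounded)
    then obtain x where x: "N t = ennreal x" by (metis ennreal_cases infinity_ennreal_def less_irrefl)
    obtain R :: nat where "x \<le> real R" using real_arch_simple by blast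
    then have "t \<in> A R" using x elim(3) by (simp add: A_def ennreal_leI)
    then show ?case using elim(1)[rule_format, of R] by (simp add: m_def)
  qed
qed

text \<open>By the previous lemma \<open>\<Psi>\<close> is the sum of the squared coefficients of \<open>\<psi>\<close> in products of eigenfunctions. These products
  are complete for \<open>\<psi>\<close>: on the side of \<open>X\<close> by identifiability, and on the side of \<open>Y\<close> because \<open>\<langle>Y, r\<rangle>\<close> is almost
  surely constant for every \<open>r\<close> orthogonal to the eigenfunctions of the covariance operator of \<open>Y\<close>. So \<open>\<Psi>\<close> is the
  squared Hilbert--Schmidt norm.\<close>

lemma regression_kernel_hilbert_schmidt:
  assumes X: "L4 M X" and Y: "L4 M Y" and E: "random_fun M E"
    and mean: "AE t in unit_leb. mean_fun M X t = 0"
    and ind: "indep_var L2_borel X L2_borel E"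
    and P: "P \<in> borel_measurable leb2" and Ps: "AE t in unit_leb. (\<lambda>s. P (t, s)) \<in> sq01"
    and model: "AE \<omega> in M. AE t in unit_leb. Y \<omega> t = op01 P (X \<omega>) t + E \<omega> t"
    and VX: "psd_eigen (cov_kernel M X) lam v" and UY: "psd_eigen (cov_kernel M Y) gam u"
    and pos: "\<And>j. j \<ge> 1 \<Longrightarrow> lam j > 0"
    and ident: "\<And>f. f \<in> sq01 \<Longrightarrow> AE t in unit_leb. op01 (case_prod (cov_kernel M X)) f t = 0 \<Longrightarrow>
      AE t in unit_leb. op01 P f t = 0"
    and Psi: "(\<lambda>(k, l). (expectation (\<lambda>\<omega>. ip01 (X \<omega>) (v l) * ip01 (Y \<omega>) (u k)))\<^sup>2 / (lam l)\<^sup>2)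
      summable_on ({1..} \<times> {1..})"
  shows "P \<in> sqint leb2"
    and "e > 0 \<Longrightarrow> \<exists>n0. \<forall>K\<ge>n0. \<forall>L\<ge>n0.
      (nm leb2 P)\<^sup>2 - (\<Sum>i=1..K. \<Sum>j=1..L. (ip leb2 P (tens (u i) (v j)))\<^sup>2) < e"
proof -
  interpret V: psd_eigen "cov_kernel M X" lam v by fact
  interpret U: psd_eigen "cov_kernel M Y" gam u by fact
  define c where "c k l = expectation (\<lambda>\<omega>. ip01 (Y \<omega>) (u k) * ip01 (X \<omega>) (v l))" for k l
  define a where "a x = (case x of (k, l) \<Rightarrow> (c k l)\<^sup>2 / (lam l)\<^sup>2)" for x
  have a_summable: "a summable_on ({1..} \<times> {1..})"
    using Psi by (simp add: a_def[abs_def] c_def mult.commute)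
  have a0: "0 \<le> a x" for x by (simp add: a_def case_prod_beta)
  define \<Psi> where "\<Psi> = infsum a ({1..} \<times> {1..})"
  let ?m = "\<lambda>j. op01 (mom2 M Y X) (v j)" and ?w = "\<lambda>j. op01 P (v j)"
  have ms: "?m j \<in> sq01" if "j \<ge> 1" for j by (rule op01_sqint[OF mom2_sqint[OF Y X] V.e_sqint[OF that]])
  have mw: "AE t in unit_leb. ?m j t = lam j * ?w j t" if "j \<ge> 1" for j
    by (rule regression_eigenfunction[OF X Y E mean ind P Ps model V.e_sqint[OF that] V.T_e[OF that]])
  have wm: "AE t in unit_leb. ?w j t = inverse (lam j) * ?m j t" if "j \<ge> 1" for j
    using mw[OF that] by eventually_elim (use pos[OF that] in simp)
  have wmeas: "?w j \<in> borel_measurable unit_leb" if "j \<ge> 1" for j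
    by (rule unit_leb2.measurable_kapp[OF P sqint_measurable[OF V.e_sqint[OF that]]])
  have w: "?w j \<in> sq01" if "j \<ge> 1" for j
    by (rule sqint_cong_AE[OF sqint_scale[OF ms[OF that]] wmeas[OF that] wm[OF that]])
  have ipm: "ip01 (?m j) g = expectation (\<lambda>\<omega>. ip01 (Y \<omega>) g * ip01 (X \<omega>) (v j))" if "j \<ge> 1" "g \<in> sq01" for j g
    unfolding ip_op01_eq[OF mom2_sqint[OF Y X] V.e_sqint[OF that(1)] that(2)]
    by (rule ip_mom2_tens(1)[OF Y X that(2) V.e_sqint[OF that(1)]])
  have ipw: "ip01 (?w j) g = inverse (lam j) * ip01 (?m j) g" if "j \<ge> 1" "g \<in> sq01" for j g
  proof -
    have "ip01 (?w j) g = ip01 (\<lambda>t. inverse (lam j) * ?m j t) g"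
      using wmeas[OF that(1)] sqint_scale[OF ms[OF that(1)], of "inverse (lam j)"] that(2) wm[OF that(1)]
      by (intro ip_cong_AE) auto
    then show ?thesis by (simp only: ip_scale_left)
  qed
  have ipwu: "(ip01 (?w j) (u k))\<^sup>2 = a (k, j)" if "j \<ge> 1" "k \<ge> 1" for j k
    using ipw[OF that(1) U.e_sqint[OF that(2)]] ipm[OF that(1) U.e_sqint[OF that(2)]]
    by (simp add: a_def c_def power_mult_distrib power_inverse divide_inverse mult.commute)
  note EX0 = expectation_ip_mean_zero[OF X mean]
  have orth: "ip01 r (?w j) = 0" if j: "j \<ge> 1" and r: "r \<in> sq01" "\<And>k. k \<ge> 1 \<Longrightarrow> ip01 r (u k) = 0" for j r
  proof -
    let ?Yc = "\<lambda>\<omega> t. Y \<omega> t - mean_fun M Y t"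
    have Yc: "L4 M ?Yc" by (intro L4_diff Y L4_const mean_fun_sqint)
    have "expectation (\<lambda>\<omega>. ip01 (?Yc \<omega>) r * ip01 (?Yc \<omega>) r) = ip01 (U.T r) r"
      unfolding cov_kernel_eq ip_op01_eq[OF mom2_sqint[OF Yc Yc] r(1) r(1)]
      by (rule ip_mom2_tens(1)[OF Yc Yc r(1) r(1), symmetric])
    also have "\<dots> = 0" by (rule U.ip_T_complement[OF r(1) r])
    finally have "expectation (\<lambda>\<omega>. (ip01 (?Yc \<omega>) r)\<^sup>2) = 0" by (simp add: power2_eq_square)
    then have "AE \<omega> in M. (ip01 (?Yc \<omega>) r)\<^sup>2 = 0"
      using L4_ip_integrable(2)[OF Yc L4_const[OF r(1)]] by (subst (asm) integral_nonneg_eq_0_iff_AE) auto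
    then have Yr: "AE \<omega> in M. ip01 (Y \<omega>) r = ip01 (mean_fun M Y) r"
      using AE_space by eventually_elim (simp add: ip_diff_left[OF L4_sqint[OF Y] mean_fun_sqint[OF Y] r(1)])
    have "ip01 (?m j) r = expectation (\<lambda>\<omega>. ip01 (mean_fun M Y) r * ip01 (X \<omega>) (v j))"
      unfolding ipm[OF j r(1)]
    proof (rule integral_cong_AE)
      show "AE \<omega> in M. ip01 (Y \<omega>) r * ip01 (X \<omega>) (v j) = ip01 (mean_fun M Y) r * ip01 (X \<omega>) (v j)"
        using Yr by eventually_elim simp
    qed (use ip_mom2_tens(2)[OF Y X r(1) V.e_sqint[OF j]] L4_ip_integrable(1)[OF X L4_const[OF V.e_sqint[OF j]]] in auto)
    also have "\<dots> = 0" using EX0[OF V.e_sqint[OF j]] by simp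
    finally have "ip01 (?w j) r = 0" using ipw[OF j r(1)] by simp
    then show ?thesis by (simp only: ip_commute[of _ r])
  qed
  have wpars: "(\<lambda>n. \<Sum>k=1..n. a (k, j)) \<longlonglongrightarrow> (nm01 (?w j))\<^sup>2" if j: "j \<ge> 1" for j
  proof -
    have "(\<lambda>n. \<Sum>k=1..n. (ip01 (?w j) (u k))\<^sup>2) \<longlonglongrightarrow> (nm01 (?w j))\<^sup>2"
      by (rule unit_leb.onseq_parseval[OF U.on w[OF j] orth[OF j]])
    moreover have "(\<Sum>k=1..n. (ip01 (?w j) (u k))\<^sup>2) = (\<Sum>k=1..n. a (k, j))" for n
      by (intro sum.cong) (auto simp: ipwu[OF j])
    ultimately show ?thesis by simp
  qed
  have bound: "(\<Sum>j=1..n. (nm01 (?w j))\<^sup>2) \<le> \<Psi>" for n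
  proof (rule LIMSEQ_le_const2)
    show "(\<lambda>N. \<Sum>j=1..n. \<Sum>k=1..N. a (k, j)) \<longlonglongrightarrow> (\<Sum>j=1..n. (nm01 (?w j))\<^sup>2)"
      by (intro tendsto_sum wpars) simp
    show "\<exists>N0. \<forall>N\<ge>N0. (\<Sum>j=1..n. \<Sum>k=1..N. a (k, j)) \<le> \<Psi>"
    proof (intro exI[of _ 0] allI impI)
      fix N :: nat
      have "(\<Sum>j=1..n. \<Sum>k=1..N. a (k, j)) = (\<Sum>k=1..N. \<Sum>j=1..n. a (k, j))" by (rule sum.swap)
      also have "\<dots> = sum a ({1..N} \<times> {1..n})" by (simp add: sum.cartesian_product)
      also have "\<dots> \<le> \<Psi>" unfolding \<Psi>_def using a0 by (intro finite_sum_le_infsum a_summable) auto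
      finally show "(\<Sum>j=1..n. \<Sum>k=1..N. a (k, j)) \<le> \<Psi>" .
    qed
  qed
  have sp: "AE t in unit_leb. (\<lambda>n. \<Sum>j=1..n. (?w j t)\<^sup>2) \<longlonglongrightarrow> (nm01 (\<lambda>s. P (t, s)))\<^sup>2"
    by (rule section_parseval[OF V.on Ps]) (use ident V.null_on_complement in blast)
  note HS = sqint_of_section_sums[OF P Ps w sp bound]
  show Pq: "P \<in> sqint leb2" by (rule HS(1))
  show "\<exists>n0. \<forall>K\<ge>n0. \<forall>L\<ge>n0.
      (nm leb2 P)\<^sup>2 - (\<Sum>i=1..K. \<Sum>j=1..L. (ip leb2 P (tens (u i) (v j)))\<^sup>2) < e" if e: "e > 0"
  proof -
    have "(a has_sum \<Psi>) ({1..} \<times> {1..})" unfolding \<Psi>_def by (rule has_sum_infsum[OF a_summable])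
    then have "\<forall>\<^sub>F F in finite_subsets_at_top ({1..} \<times> {1..}). \<Psi> - e < sum a F"
      unfolding has_sum_def using e by (intro order_tendstoD(1)) auto
    then obtain F where F: "finite F" "F \<subseteq> {1..} \<times> {1..}" "\<Psi> - e < sum a F"
      unfolding eventually_finite_subsets_at_top by blast
    define n0 where "n0 = Max (insert 0 (fst ` F \<union> snd ` F))"
    have n0: "fst x \<le> n0" "snd x \<le> n0" if "x \<in> F" for x
      unfolding n0_def using F(1) that by (auto intro!: Max_ge)
    show ?thesis
    proof (intro exI[of _ n0] allI impI)
      fix K L assume KL: "n0 \<le> K" "n0 \<le> L"
      have "F \<subseteq> {1..K} \<times> {1..L}" using F(2) n0 KL by (fastforce simp: subset_eq)
      then have "sum a F \<le> sum a ({1..K} \<times> {1..L})" using a0 by (intro sum_mono2) auto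
      also have "\<dots> = (\<Sum>i=1..K. \<Sum>j=1..L. a (i, j))" by (simp add: sum.cartesian_product)
      also have "\<dots> = (\<Sum>i=1..K. \<Sum>j=1..L. (ip leb2 P (tens (u i) (v j)))\<^sup>2)"
        by (intro sum.cong refl) (simp add: ipwu[symmetric] ip_op01_eq[OF Pq V.e_sqint U.e_sqint])
      finally show "(nm leb2 P)\<^sup>2 - (\<Sum>i=1..K. \<Sum>j=1..L. (ip leb2 P (tens (u i) (v j)))\<^sup>2) < e"
        using F(3) HS(2) by linarith
    qed
  qed
qed

end

section \<open>Empirical operators\<close>

text \<open>A sample covariance is invariant under subtraction of a fixed function; for the responses this removes the mean of the errors.\<close>

lemma sample_cov_kernel_shift:
  assumes N: "N \<ge> 1"
  shows "case_prod (sample_cov_kernel N z) p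
    = (\<Sum>n=1..N. tens (\<lambda>t. z n t - m t) (\<lambda>t. z n t - m t) p) / real N
      - tens (\<lambda>t. sample_mean N z t - m t) (\<lambda>t. sample_mean N z t - m t) p"
proof -
  define a where "a n = z n (fst p) - m (fst p)" for n
  define b where "b n = z n (snd p) - m (snd p)" for n
  define A where "A = sample_mean N z (fst p) - m (fst p)"
  define B where "B = sample_mean N z (snd p) - m (snd p)"
  have N0: "real N \<noteq> 0" using N by simp
  have sa: "(\<Sum>n=1..N. a n) = real N * A" and sb: "(\<Sum>n=1..N. b n) = real N * B"
    using N0 by (simp_all add: a_def A_def b_def B_def sum_subtractf sample_mean_def right_diff_distrib)
  have "(\<Sum>n=1..N. (a n - A) * (b n - B)) = (\<Sum>n=1..N. a n * b n) - (\<Sum>n=1..N. a n) * B - A * (\<Sum>n=1..N. b n) + real N * (A * B)"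
    by (simp add: left_diff_distrib right_diff_distrib sum_subtractf sum.distrib sum_distrib_left[symmetric] sum_distrib_right[symmetric])
  also have "\<dots> = (\<Sum>n=1..N. a n * b n) - real N * (A * B)" unfolding sa sb by (simp add: algebra_simps)
  finally have "(\<Sum>n=1..N. (a n - A) * (b n - B)) / real N = (\<Sum>n=1..N. a n * b n) / real N - A * B"
    using N0 by (simp add: diff_divide_distrib)
  moreover have "case_prod (sample_cov_kernel N z) p = (\<Sum>n=1..N. (a n - A) * (b n - B)) / real N"
    by (simp add: case_prod_beta sample_cov_kernel_def a_def b_def A_def B_def)
  ultimately show ?thesis by (simp add: tens_def a_def b_def A_def B_def)
qed

lemma sample_mean_sqint: "(\<And>n. n \<in> {1..N} \<Longrightarrow> z n \<in> sq01) \<Longrightarrow> sample_mean N z \<in> sq01"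
  using sqint_scale[OF sqint_sum[of "{1..N}" z unit_leb], of "1 / real N"] by (simp add: sample_mean_def[abs_def])

lemma psd_sample_cov:
  assumes z: "\<And>n. n \<in> {1..N} \<Longrightarrow> z n \<in> sq01"
  shows "psd_kernel (case_prod (sample_cov_kernel N z))"
proof -
  define z' where "z' n t = z n t - sample_mean N z t" for n t
  have z': "z' n \<in> sq01" if "n \<in> {1..N}" for n
    unfolding z'_def[abs_def] by (intro sqint_diff z that sample_mean_sqint)
  have eq: "case_prod (sample_cov_kernel N z) = (\<lambda>p. (1 / real N) * (\<Sum>n\<in>{1..N}. tens (z' n) (z' n) p))"
    by (simp add: fun_eq_iff sample_cov_kernel_def tens_def z'_def)
  have t: "tens (z' n) (z' n) \<in> sqint leb2" if "n \<in> {1..N}" for n by (intro unit_leb2.tens_sqint z' that)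
  have form: "ip leb2 (case_prod (sample_cov_kernel N z)) (tens f g) = (1 / real N) * (\<Sum>n\<in>{1..N}. ip01 (z' n) f * ip01 (z' n) g)"
    if f: "f \<in> sq01" and g: "g \<in> sq01" for f g
  proof -
    have "ip leb2 (case_prod (sample_cov_kernel N z)) (tens f g) = (1 / real N) * (\<Sum>n\<in>{1..N}. ip leb2 (tens (z' n) (z' n)) (tens f g))"
      unfolding eq ip_scale_left by (subst ip_sum_left[OF t unit_leb2.tens_sqint[OF f g]]) auto
    also have "(\<Sum>n\<in>{1..N}. ip leb2 (tens (z' n) (z' n)) (tens f g)) = (\<Sum>n\<in>{1..N}. ip01 (z' n) f * ip01 (z' n) g)"
      by (intro sum.cong refl unit_leb2.ip_tens_tens z' f g)
    finally show ?thesis .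
  qed
  show ?thesis
  proof (rule psd_kernelI)
    show "case_prod (sample_cov_kernel N z) \<in> sqint leb2" unfolding eq by (intro sqint_scale sqint_sum t)
    show "ip leb2 (case_prod (sample_cov_kernel N z)) (tens f g) = ip leb2 (case_prod (sample_cov_kernel N z)) (tens g f)"
      if "f \<in> sq01" "g \<in> sq01" for f g
      unfolding form[OF that] form[OF that(2,1)] by (simp only: mult.commute)
    show "0 \<le> ip leb2 (case_prod (sample_cov_kernel N z)) (tens f f)" if "f \<in> sq01" for f
      unfolding form[OF that that] by (intro mult_nonneg_nonneg[OF _ sum_nonneg]) auto
  qed
qed

lemma op01_average:
  assumes k: "k \<in> sqint leb2" and f: "\<And>i. i \<in> I \<Longrightarrow> f i \<in> sq01"
  shows "AE t in unit_leb. op01 k (\<lambda>x. (\<Sum>i\<in>I. f i x) / c) t = (\<Sum>i\<in>I. op01 k (f i) t) / c"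
  using unit_leb2.sqint_section[OF k]
proof eventually_elim
  case (elim t)
  have "ip01 (\<lambda>s. k (t, s)) (\<lambda>x. (1 / c) * (\<Sum>i\<in>I. f i x)) = (1 / c) * (\<Sum>i\<in>I. ip01 (\<lambda>s. k (t, s)) (f i))"
    unfolding ip_scale_right by (subst ip_sum_right[OF f elim]) auto
  then show ?case by (simp add: kapp_def)
qed

lemma tens_cong_AE:
  assumes "f \<in> sq01" "f' \<in> sq01" "g \<in> sq01" "g' \<in> sq01"
    "AE t in unit_leb. f t = f' t" "AE t in unit_leb. g t = g' t"
  shows "AE p in leb2. tens f g p = tens f' g' p"
proof (rule unit_leb2.AE_pairI)
  show "tens f g \<in> borel_measurable leb2" "tens f' g' \<in> borel_measurable leb2"
    using assms by (auto intro!: unit_leb2.tens_measurable)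
  show "AE x in unit_leb. AE y in unit_leb. tens f g (x, y) = tens f' g' (x, y)"
    using assms(5)
  proof eventually_elim
    case (elim t)
    show ?case using assms(6) by eventually_elim (simp add: tens_def elim)
  qed
qed

text \<open>For fixed observations that follow the model with errors \<open>\<eta> i + \<mu>\<close>, the deviations of all empirical second moments are controlled by
  five averages that involve only the regressors and the centred errors. Averages with \<open>op01 P (x i)\<close> in place of \<open>x i\<close> arise by
  composition with \<open>P\<close> and lose a factor \<open>\<parallel>P\<parallel>\<close>. In this way the responses inherit their weak dependence from the regressors.\<close>

locale observations =
  fixes x y \<eta> :: "nat \<Rightarrow> real \<Rightarrow> real" and P c ce :: "real \<times> real \<Rightarrow> real" and \<mu> :: "real \<Rightarrow> real" and N :: nat
  assumes N: "N \<ge> 1" and x: "\<And>i. i \<in> {1..N} \<Longrightarrow> x i \<in> sq01" and y: "\<And>i. i \<in> {1..N} \<Longrightarrow> y i \<in> sq01"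
    and \<eta>: "\<And>i. i \<in> {1..N} \<Longrightarrow> \<eta> i \<in> sq01" and P: "P \<in> sqint leb2" and c: "c \<in> sqint leb2"
    and ce: "ce \<in> sqint leb2" and \<mu>: "\<mu> \<in> sq01"
    and model: "\<And>i. i \<in> {1..N} \<Longrightarrow> AE t in unit_leb. y i t = op01 P (x i) t + (\<eta> i t + \<mu> t)"
begin

abbreviation avg2 where "avg2 f g \<equiv> (\<lambda>p. (\<Sum>i=1..N. tens (f i) (g i) p) / real N)"
abbreviation avg1 where "avg1 f \<equiv> (\<lambda>t. (\<Sum>i=1..N. f i t) / real N)"

definition "err_xx = nm leb2 (\<lambda>p. avg2 x x p - c p)"
definition "err_x = nm01 (avg1 x)"
definition "err_ex = nm leb2 (avg2 \<eta> x)"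
definition "err_ee = nm leb2 (\<lambda>p. avg2 \<eta> \<eta> p - ce p)"
definition "err_e = nm01 (avg1 \<eta>)"

lemma avg2_sqint:
  assumes "\<And>i. i \<in> {1..N} \<Longrightarrow> f i \<in> sq01" "\<And>i. i \<in> {1..N} \<Longrightarrow> g i \<in> sq01"
  shows "avg2 f g \<in> sqint leb2"
proof -
  have "(\<lambda>p. (1 / real N) * (\<Sum>i\<in>{1..N}. tens (f i) (g i) p)) \<in> sqint leb2"
    by (intro sqint_scale sqint_sum unit_leb2.tens_sqint assms)
  then show ?thesis by simp
qed

lemma avg1_sqint:
  assumes "\<And>i. i \<in> {1..N} \<Longrightarrow> f i \<in> sq01" shows "avg1 f \<in> sq01"
proof -
  have "(\<lambda>t. (1 / real N) * (\<Sum>i\<in>{1..N}. f i t)) \<in> sq01" by (intro sqint_scale sqint_sum assms)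
  then show ?thesis by simp
qed

definition "w i = op01 P (x i)"

lemma w: "i \<in> {1..N} \<Longrightarrow> w i \<in> sq01"
  unfolding w_def by (rule op01_sqint[OF P x])

lemma nm_compose_avg:
  assumes g: "\<And>i. i \<in> {1..N} \<Longrightarrow> g i \<in> sq01" and h: "h \<in> sqint leb2"
  shows "nm leb2 (\<lambda>p. avg2 w g p - kcomp P h p) \<le> nm leb2 P * nm leb2 (\<lambda>p. avg2 x g p - h p)"
proof -
  have t: "tens (x i) (g i) \<in> sqint leb2" if "i \<in> {1..N}" for i by (intro unit_leb2.tens_sqint x g that)
  have d: "(\<lambda>p. avg2 x g p - h p) \<in> sqint leb2" by (intro sqint_diff avg2_sqint x g h)
  have d': "(\<lambda>p. avg2 w g p - kcomp P h p) \<in> sqint leb2" by (intro sqint_diff avg2_sqint w g kcomp_sqint(1) P h)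
  have "AE p in leb2. kcomp P (\<lambda>p. (1 / real N) * (\<Sum>i\<in>{1..N}. tens (x i) (g i) p) - h p) p
    = (1 / real N) * (\<Sum>i\<in>{1..N}. kcomp P (tens (x i) (g i)) p) - kcomp P h p"
    by (rule kcomp_sum_diff[OF _ P t h]) auto
  then have "AE p in leb2. avg2 w g p - kcomp P h p = kcomp P (\<lambda>p. avg2 x g p - h p) p"
    by eventually_elim (simp add: kcomp_tens w_def)
  then have "nm leb2 (\<lambda>p. avg2 w g p - kcomp P h p) = nm leb2 (kcomp P (\<lambda>p. avg2 x g p - h p))"
    using d' kcomp_sqint(1)[OF P d] by (intro nm_cong_AE) auto
  also have "\<dots> \<le> nm leb2 P * nm leb2 (\<lambda>p. avg2 x g p - h p)" by (rule kcomp_sqint(2)[OF P d])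
  finally show ?thesis .
qed

lemma ktransp_avg2: "ktransp (avg2 f g) = avg2 g f"
  by (simp add: fun_eq_iff ktransp_def tens_def mult.commute)

lemma nm_avg2_commute:
  assumes "\<And>i. i \<in> {1..N} \<Longrightarrow> f i \<in> sq01" "\<And>i. i \<in> {1..N} \<Longrightarrow> g i \<in> sq01"
  shows "nm leb2 (avg2 f g) = nm leb2 (avg2 g f)"
  using unit_leb2.ktransp_sqint(2)[OF avg2_sqint[OF assms]] by (simp only: ktransp_avg2)

lemma regressor_cov_deviation: "nm leb2 (\<lambda>p. case_prod (sample_cov_kernel N x) p - c p) \<le> err_xx + err_x\<^sup>2"
proof -
  have eq: "(\<lambda>p. case_prod (sample_cov_kernel N x) p - c p) = (\<lambda>p. (avg2 x x p - c p) - tens (avg1 x) (avg1 x) p)"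
    by (simp add: fun_eq_iff sample_cov_kernel_shift[OF N, where m = "\<lambda>t. 0"] sample_mean_def[abs_def] del: split_paired_All)
  have a: "avg1 x \<in> sq01" by (rule avg1_sqint[OF x])
  have "nm leb2 (\<lambda>p. (avg2 x x p - c p) - tens (avg1 x) (avg1 x) p) \<le> err_xx + nm leb2 (tens (avg1 x) (avg1 x))"
    unfolding err_xx_def by (intro nm_triangle_diff sqint_diff avg2_sqint x c unit_leb2.tens_sqint a)
  then show ?thesis unfolding eq unit_leb2.nm_tens[OF a a] err_x_def power2_eq_square .
qed

lemma cross_cov_deviation:
  "nm leb2 (\<lambda>p. avg2 y x p - kcomp P c p) \<le> nm leb2 P * err_xx + err_ex + nm01 \<mu> * err_x"
proof -
  have a: "avg1 x \<in> sq01" by (rule avg1_sqint[OF x])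
  have k1: "(\<lambda>p. avg2 w x p - kcomp P c p) \<in> sqint leb2" by (intro sqint_diff avg2_sqint w x kcomp_sqint(1) P c)
  have k2: "avg2 \<eta> x \<in> sqint leb2" by (rule avg2_sqint[OF \<eta> x])
  have k3: "tens \<mu> (avg1 x) \<in> sqint leb2" by (rule unit_leb2.tens_sqint[OF \<mu> a])
  have "AE p in leb2. \<forall>i\<in>{1..N}. tens (y i) (x i) p = tens (\<lambda>t. w i t + (\<eta> i t + \<mu> t)) (x i) p"
  proof (rule AE_finite_allI)
    fix i assume i: "i \<in> {1..N}"
    show "AE p in leb2. tens (y i) (x i) p = tens (\<lambda>t. w i t + (\<eta> i t + \<mu> t)) (x i) p"
      using model[OF i] by (intro tens_cong_AE y x i sqint_add w \<eta> \<mu>) (auto simp: w_def)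
  qed simp
  then have "AE p in leb2. avg2 y x p - kcomp P c p = (avg2 w x p - kcomp P c p) + (avg2 \<eta> x p + tens \<mu> (avg1 x) p)"
  proof eventually_elim
    case (elim p)
    have "(\<Sum>i=1..N. tens (y i) (x i) p) = (\<Sum>i=1..N. tens (w i) (x i) p + (tens (\<eta> i) (x i) p + \<mu> (fst p) * x i (snd p)))"
      by (intro sum.cong refl) (use elim in \<open>simp add: tens_def algebra_simps\<close>)
    then show ?case by (simp add: sum.distrib add_divide_distrib tens_def sum_distrib_left)
  qed
  then have "nm leb2 (\<lambda>p. avg2 y x p - kcomp P c p)
    = nm leb2 (\<lambda>p. (avg2 w x p - kcomp P c p) + (avg2 \<eta> x p + tens \<mu> (avg1 x) p))"
    using sqint_measurable[OF sqint_diff[OF avg2_sqint[of y x, OF y x] kcomp_sqint(1)[OF P c]]] sqint_measurable[OF sqint_add[OF k1 sqint_add[OF k2 k3]]]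
    by (intro nm_cong_AE) auto
  also have "\<dots> \<le> nm leb2 (\<lambda>p. avg2 w x p - kcomp P c p) + (nm leb2 (avg2 \<eta> x) + nm leb2 (tens \<mu> (avg1 x)))"
    using nm_triangle[OF k1 sqint_add[OF k2 k3]] nm_triangle[OF k2 k3] by linarith
  finally show ?thesis
    using nm_compose_avg[of x, OF x c] unit_leb2.nm_tens[OF \<mu> a] unfolding err_xx_def err_x_def err_ex_def by linarith
qed

text \<open>Expanding the products of \<open>y i - \<mu> = w i + \<eta> i\<close> gives a signal part, to which composition with \<open>P\<close> applies once for each
  variable, two cross terms, an error part, and the product of the sample means.\<close>

lemma response_cov_deviation:
  "nm leb2 (\<lambda>p. case_prod (sample_cov_kernel N y) p - (kcomp P (ktransp (kcomp P c)) p + ce p))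
    \<le> (nm leb2 P)\<^sup>2 * err_xx + 2 * (nm leb2 P * err_ex) + err_ee + (nm leb2 P * err_x + err_e)\<^sup>2"
proof -
  let ?C = "kcomp P (ktransp (kcomp P c))"
  have Pc: "kcomp P c \<in> sqint leb2" by (rule kcomp_sqint(1)[OF P c])
  have C: "?C \<in> sqint leb2" by (intro kcomp_sqint(1) P unit_leb2.ktransp_sqint(1) Pc)
  let ?k1 = "\<lambda>p. avg2 w w p - ?C p"
  have k1: "?k1 \<in> sqint leb2" by (intro sqint_diff avg2_sqint w C)
  have n1: "nm leb2 ?k1 \<le> (nm leb2 P)\<^sup>2 * err_xx"
  proof -
    have d: "(\<lambda>p. avg2 w x p - kcomp P c p) \<in> sqint leb2" by (intro sqint_diff avg2_sqint w x Pc)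
    have tr: "(\<lambda>p. avg2 x w p - ktransp (kcomp P c) p) = ktransp (\<lambda>p. avg2 w x p - kcomp P c p)"
      by (simp add: fun_eq_iff ktransp_def tens_def mult.commute)
    have "nm leb2 ?k1 \<le> nm leb2 P * nm leb2 (\<lambda>p. avg2 x w p - ktransp (kcomp P c) p)"
      by (rule nm_compose_avg[OF w unit_leb2.ktransp_sqint(1)[OF Pc]])
    also have "\<dots> = nm leb2 P * nm leb2 (\<lambda>p. avg2 w x p - kcomp P c p)"
      unfolding tr unit_leb2.ktransp_sqint(2)[OF d] ..
    also have "\<dots> \<le> nm leb2 P * (nm leb2 P * err_xx)"
      unfolding err_xx_def by (intro mult_left_mono nm_compose_avg x c) auto
    finally show ?thesis by (simp add: power2_eq_square mult.assoc)
  qed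
  have k2: "avg2 w \<eta> \<in> sqint leb2" and k3: "avg2 \<eta> w \<in> sqint leb2" by (intro avg2_sqint w \<eta>; assumption)+
  have n2: "nm leb2 (avg2 w \<eta>) \<le> nm leb2 P * err_ex"
  proof -
    have "kcomp P (\<lambda>p. 0) = (\<lambda>p. 0)" by (simp add: kcomp_def fun_eq_iff)
    then have "nm leb2 (avg2 w \<eta>) \<le> nm leb2 P * nm leb2 (avg2 x \<eta>)"
      using nm_compose_avg[of \<eta>, OF \<eta> sqint_zero] by simp
    then show ?thesis using nm_avg2_commute[of x \<eta>, OF x \<eta>] by (simp add: err_ex_def)
  qed
  have n3: "nm leb2 (avg2 \<eta> w) \<le> nm leb2 P * err_ex" using n2 nm_avg2_commute[of w \<eta>, OF w \<eta>] by simp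
  let ?k4 = "\<lambda>p. avg2 \<eta> \<eta> p - ce p"
  have k4: "?k4 \<in> sqint leb2" by (intro sqint_diff avg2_sqint \<eta> ce)
  let ?m = "\<lambda>t. sample_mean N y t - \<mu> t"
  have m: "?m \<in> sq01" by (intro sqint_diff sample_mean_sqint y \<mu>)
  have nmm: "nm01 ?m \<le> nm leb2 P * err_x + err_e"
  proof -
    have a: "avg1 x \<in> sq01" by (rule avg1_sqint[OF x])
    have Pa: "op01 P (avg1 x) \<in> sq01" by (rule op01_sqint[OF P a])
    have "AE t in unit_leb. \<forall>i\<in>{1..N}. y i t = w i t + (\<eta> i t + \<mu> t)"
      using model by (intro AE_finite_allI) (auto simp: w_def)
    moreover have "AE t in unit_leb. op01 P (avg1 x) t = (\<Sum>i=1..N. op01 P (x i) t) / real N"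
      by (rule op01_average[OF P x])
    ultimately have "AE t in unit_leb. ?m t = op01 P (avg1 x) t + avg1 \<eta> t"
    proof eventually_elim
      case (elim t)
      have "(\<Sum>i=1..N. y i t) = (\<Sum>i=1..N. w i t + (\<eta> i t + \<mu> t))" using elim(1) by (intro sum.cong) auto
      also have "\<dots> = (\<Sum>i=1..N. w i t) + (\<Sum>i=1..N. \<eta> i t) + real N * \<mu> t" by (simp add: sum.distrib)
      finally have "sample_mean N y t = (\<Sum>i=1..N. w i t) / real N + (\<Sum>i=1..N. \<eta> i t) / real N + \<mu> t"
        using N by (simp add: sample_mean_def add_divide_distrib)
      then show ?case using elim(2) by (simp add: w_def)
    qed
    then have "nm01 ?m = nm01 (\<lambda>t. op01 P (avg1 x) t + avg1 \<eta> t)"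
      using m sqint_measurable[OF sqint_add[OF Pa avg1_sqint[of \<eta>, OF \<eta>]]] by (intro nm_cong_AE) auto
    also have "\<dots> \<le> nm01 (op01 P (avg1 x)) + nm01 (avg1 \<eta>)" by (rule nm_triangle[OF Pa avg1_sqint[of \<eta>, OF \<eta>]])
    finally show ?thesis using nm_op01_le[OF P a] unfolding err_x_def err_e_def by linarith
  qed
  have k5: "tens ?m ?m \<in> sqint leb2" by (rule unit_leb2.tens_sqint[OF m m])
  have n5: "nm leb2 (tens ?m ?m) \<le> (nm leb2 P * err_x + err_e)\<^sup>2"
    unfolding unit_leb2.nm_tens[OF m m] power2_eq_square using nmm by (intro mult_mono) (auto intro: order_trans[OF nm_nonneg])
  have cov: "case_prod (sample_cov_kernel N y) \<in> sqint leb2"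
    using psd_sample_cov[of N y] y by (simp add: psd_kernel_def)
  have "AE p in leb2. \<forall>i\<in>{1..N}. tens (\<lambda>t. y i t - \<mu> t) (\<lambda>t. y i t - \<mu> t) p = tens (\<lambda>t. w i t + \<eta> i t) (\<lambda>t. w i t + \<eta> i t) p"
  proof (rule AE_finite_allI)
    fix i assume i: "i \<in> {1..N}"
    have e: "AE t in unit_leb. y i t - \<mu> t = w i t + \<eta> i t" using model[OF i] by eventually_elim (simp add: w_def)
    show "AE p in leb2. tens (\<lambda>t. y i t - \<mu> t) (\<lambda>t. y i t - \<mu> t) p = tens (\<lambda>t. w i t + \<eta> i t) (\<lambda>t. w i t + \<eta> i t) p"
      by (intro tens_cong_AE sqint_add sqint_diff y w \<eta> \<mu> i e)
  qed simp
  then have "AE p in leb2. case_prod (sample_cov_kernel N y) p - (?C p + ce p)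
    = ((?k1 p + (avg2 w \<eta> p + avg2 \<eta> w p)) + ?k4 p) - tens ?m ?m p"
  proof eventually_elim
    case (elim p)
    have "(\<Sum>i=1..N. tens (\<lambda>t. y i t - \<mu> t) (\<lambda>t. y i t - \<mu> t) p)
      = (\<Sum>i=1..N. tens (w i) (w i) p + (tens (w i) (\<eta> i) p + tens (\<eta> i) (w i) p) + tens (\<eta> i) (\<eta> i) p)"
      by (intro sum.cong refl) (use elim in \<open>simp add: tens_def algebra_simps\<close>)
    then show ?case
      unfolding sample_cov_kernel_shift[OF N, where m = \<mu>] by (simp add: sum.distrib add_divide_distrib)
  qed
  then have "nm leb2 (\<lambda>p. case_prod (sample_cov_kernel N y) p - (?C p + ce p))
    = nm leb2 (\<lambda>p. ((?k1 p + (avg2 w \<eta> p + avg2 \<eta> w p)) + ?k4 p) - tens ?m ?m p)"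
    using sqint_measurable[OF sqint_diff[OF cov sqint_add[OF C ce]]]
      sqint_measurable[OF sqint_diff[OF sqint_add[OF sqint_add[OF k1 sqint_add[OF k2 k3]] k4] k5]]
    by (intro nm_cong_AE) auto
  also have "\<dots> \<le> nm leb2 ?k1 + (nm leb2 (avg2 w \<eta>) + nm leb2 (avg2 \<eta> w)) + nm leb2 ?k4 + nm leb2 (tens ?m ?m)"
    using nm_triangle_diff[OF sqint_add[OF sqint_add[OF k1 sqint_add[OF k2 k3]] k4] k5]
      nm_triangle[OF sqint_add[OF k1 sqint_add[OF k2 k3]] k4] nm_triangle[OF k1 sqint_add[OF k2 k3]] nm_triangle[OF k2 k3]
    by linarith
  finally show ?thesis using n1 n2 n3 n5 unfolding err_ee_def by linarith
qed

lemma sigma_hat_eq: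
  assumes v: "vh l \<in> sq01" and u: "uh k \<in> sq01"
  shows "sigma_hat N x y vh uh l k = ip leb2 (avg2 y x) (tens (uh k) (vh l))"
proof -
  have t: "tens (y i) (x i) \<in> sqint leb2" if "i \<in> {1..N}" for i by (intro unit_leb2.tens_sqint y x that)
  have "ip leb2 (\<lambda>p. (1 / real N) * (\<Sum>i\<in>{1..N}. tens (y i) (x i) p)) (tens (uh k) (vh l))
    = (1 / real N) * (\<Sum>i\<in>{1..N}. ip leb2 (tens (y i) (x i)) (tens (uh k) (vh l)))"
    unfolding ip_scale_left by (subst ip_sum_left[OF t unit_leb2.tens_sqint[OF u v]]) auto
  also have "(\<Sum>i\<in>{1..N}. ip leb2 (tens (y i) (x i)) (tens (uh k) (vh l))) = (\<Sum>i\<in>{1..N}. ip01 (x i) (vh l) * ip01 (y i) (uh k))"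
    by (intro sum.cong refl) (simp add: unit_leb2.ip_tens_tens y x u v)
  finally show ?thesis by (simp add: sigma_hat_def L2_inner_eq)
qed

end

section \<open>Independent errors\<close>

context prob_space
begin

lemma indep_vars_imp_indep_var:
  assumes "indep_vars (\<lambda>_. N) X I" "i \<in> I" "j \<in> I" "i \<noteq> j"
  shows "indep_var N (X i) N (X j)"
proof -
  have ind: "indep_var (Pi\<^sub>M {i} (\<lambda>_. N)) (\<lambda>\<omega>. restrict (\<lambda>k. X k \<omega>) {i}) (Pi\<^sub>M {j} (\<lambda>_. N)) (\<lambda>\<omega>. restrict (\<lambda>k. X k \<omega>) {j})"
    by (rule indep_var_restrict[OF assms(1)]) (use assms in auto)
  have "indep_var N ((\<lambda>f. f i) \<circ> (\<lambda>\<omega>. restrict (\<lambda>k. X k \<omega>) {i})) N ((\<lambda>f. f j) \<circ> (\<lambda>\<omega>. restrict (\<lambda>k. X k \<omega>) {j}))"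
    by (rule indep_var_compose[OF ind]) (auto intro: measurable_component_singleton)
  then show ?thesis by (simp add: comp_def)
qed

lemma mean_fun_centred:
  assumes Z: "L4 M Z"
  shows "nm01 (mean_fun M (\<lambda>\<omega> t. Z \<omega> t - mean_fun M Z t)) = 0"
proof -
  let ?Zc = "\<lambda>\<omega> t. Z \<omega> t - mean_fun M Z t"
  have Zc: "L4 M ?Zc" by (intro L4_diff Z L4_const mean_fun_sqint)
  define g where "g = mean_fun M ?Zc"
  have g: "g \<in> sq01" unfolding g_def by (rule mean_fun_sqint[OF Zc])
  have i: "integrable M (\<lambda>\<omega>. ip01 (Z \<omega>) g)" by (rule L4_ip_integrable(1)[OF Z L4_const[OF g]])
  have "(nm01 g)\<^sup>2 = expectation (\<lambda>\<omega>. ip01 (?Zc \<omega>) g)"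
    unfolding nm_sq using ip_mean_fun[OF Zc g] by (simp only: g_def)
  also have "\<dots> = expectation (\<lambda>\<omega>. ip01 (Z \<omega>) g - ip01 (mean_fun M Z) g)"
    using L4_sqint[OF Z] mean_fun_sqint[OF Z] g by (intro Bochner_Integration.integral_cong refl ip_diff_left)
  also have "\<dots> = 0" using i ip_mean_fun[OF Z g] by (simp add: prob_space)
  finally show ?thesis by (simp add: g_def)
qed

text \<open>Off the diagonal the terms are independent, and the mean function is null.\<close>

lemma iid_centred_moments:
  fixes Z :: "nat \<Rightarrow> 'a \<Rightarrow> real \<Rightarrow> real"
  assumes Z: "\<And>n. n \<ge> 1 \<Longrightarrow> L4 M (Z n)" and Zm: "\<And>n. n \<ge> 1 \<Longrightarrow> Z n \<in> measurable M L2_borel"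
    and law: "\<And>n. n \<ge> 1 \<Longrightarrow> distr M L2_borel (Z n) = distr M L2_borel (Z 1)"
    and ind: "\<And>i j. 1 \<le> i \<Longrightarrow> i < j \<Longrightarrow> indep_var L2_borel (Z i) L2_borel (Z j)"
    and mean: "nm01 (mean_fun M (Z 1)) = 0"
  defines "\<kappa> \<equiv> (nm leb2 (mom2 M (Z 1) (Z 1)))\<^sup>2"
    and "s \<equiv> expectation (\<lambda>\<omega>. (nm01 (Z 1 \<omega>))\<^sup>2)" and "m \<equiv> expectation (\<lambda>\<omega>. nm01 (Z 1 \<omega>) ^ 4)"
  shows "1 \<le> i \<Longrightarrow> i \<le> j \<Longrightarrow> \<bar>expectation (\<lambda>\<omega>. (ip01 (Z i \<omega>) (Z j \<omega>))\<^sup>2) - \<kappa>\<bar> \<le> (if j - i = 0 then m + \<kappa> else 0)"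
    and "1 \<le> i \<Longrightarrow> i \<le> j \<Longrightarrow> expectation (\<lambda>\<omega>. ip01 (Z i \<omega>) (Z j \<omega>)) = (if j - i = 0 then s else 0)"
proof -
  have transfer: "expectation (\<lambda>\<omega>. \<phi> (Z i \<omega>)) = expectation (\<lambda>\<omega>. \<phi> (Z 1 \<omega>))"
    if "i \<ge> 1" "\<phi> \<in> borel_measurable L2_borel" for i and \<phi> :: "(real \<Rightarrow> real) \<Rightarrow> real"
    using integral_distr[OF Zm[OF that(1)] that(2)] integral_distr[OF Zm[OF order_refl] that(2)] law[OF that(1)] by simp
  have off: "expectation (\<lambda>\<omega>. (ip01 (Z i \<omega>) (Z j \<omega>))\<^sup>2) = \<kappa>" "expectation (\<lambda>\<omega>. ip01 (Z i \<omega>) (Z j \<omega>)) = 0"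
    if ij: "1 \<le> i" "i < j" for i j
  proof -
    have j: "1 \<le> j" using ij by simp
    note I = indep_inner_product_moments[OF Z[OF order_refl] Zm[OF order_refl] ind[OF ij] law[OF ij(1)] law[OF j]]
    show "expectation (\<lambda>\<omega>. (ip01 (Z i \<omega>) (Z j \<omega>))\<^sup>2) = \<kappa>" unfolding \<kappa>_def by (rule I(1))
    show "expectation (\<lambda>\<omega>. ip01 (Z i \<omega>) (Z j \<omega>)) = 0" using I(3) mean by simp
  qed
  have d4: "expectation (\<lambda>\<omega>. (ip01 (Z i \<omega>) (Z i \<omega>))\<^sup>2) = m" if "1 \<le> i" for i
    using transfer[OF that, of "\<lambda>z. nm01 z ^ 4"] by (simp add: m_def nm_sq[symmetric] power_mult[symmetric])
  have d2: "expectation (\<lambda>\<omega>. ip01 (Z i \<omega>) (Z i \<omega>)) = s" if "1 \<le> i" for i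
    using transfer[OF that, of "\<lambda>z. (nm01 z)\<^sup>2"] by (simp add: s_def nm_sq[symmetric])
  have m0: "0 \<le> m" "0 \<le> \<kappa>" by (auto simp: m_def \<kappa>_def intro!: Bochner_Integration.integral_nonneg)
  show "\<bar>expectation (\<lambda>\<omega>. (ip01 (Z i \<omega>) (Z j \<omega>))\<^sup>2) - \<kappa>\<bar> \<le> (if j - i = 0 then m + \<kappa> else 0)" if ij: "1 \<le> i" "i \<le> j"
  proof (cases "i = j")
    case True
    then show ?thesis using d4[OF ij(1)] m0 by simp
  next
    case False
    then show ?thesis using off(1)[of i j] ij by simp
  qed
  show "expectation (\<lambda>\<omega>. ip01 (Z i \<omega>) (Z j \<omega>)) = (if j - i = 0 then s else 0)" if ij: "1 \<le> i" "i \<le> j"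
  proof (cases "i = j")
    case True
    then show ?thesis using d2[OF ij(1)] by simp
  next
    case False
    then show ?thesis using off(2)[of i j] ij by simp
  qed
qed

text \<open>Tested against products \<open>f \<otimes> g\<close>, the cross terms vanish by independence and because \<open>X\<close> has mean zero; the part of the signal is
  the covariance of \<open>X\<close> composed with \<open>P\<close> on both sides.\<close>

lemma cov_kernel_response:
  assumes X: "L4 M X" and Y: "L4 M Y" and E: "L4 M E"
    and mean: "AE t in unit_leb. mean_fun M X t = 0"
    and ind: "indep_var L2_borel X L2_borel E"
    and P: "P \<in> sqint leb2"
    and model: "AE \<omega> in M. AE t in unit_leb. Y \<omega> t = op01 P (X \<omega>) t + E \<omega> t"
  defines "c \<equiv> case_prod (cov_kernel M X)" and "\<eta> \<equiv> \<lambda>\<omega> t. E \<omega> t - mean_fun M E t"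
  shows "AE p in leb2. case_prod (cov_kernel M Y) p = kcomp P (ktransp (kcomp P c)) p + mom2 M \<eta> \<eta> p"
proof -
  let ?Xc = "\<lambda>\<omega> t. X \<omega> t - mean_fun M X t" and ?Yc = "\<lambda>\<omega> t. Y \<omega> t - mean_fun M Y t"
  have Xc: "L4 M ?Xc" by (intro L4_diff X L4_const mean_fun_sqint)
  have Yc: "L4 M ?Yc" by (intro L4_diff Y L4_const mean_fun_sqint)
  have H: "L4 M \<eta>" unfolding \<eta>_def by (intro L4_diff E L4_const mean_fun_sqint)
  have c: "c \<in> sqint leb2" unfolding c_def cov_kernel_eq by (rule mom2_sqint[OF Xc Xc])
  have Pc: "kcomp P c \<in> sqint leb2" by (rule kcomp_sqint(1)[OF P c])
  have tPc: "ktransp (kcomp P c) \<in> sqint leb2" by (rule unit_leb2.ktransp_sqint(1)[OF Pc])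
  have C: "kcomp P (ktransp (kcomp P c)) \<in> sqint leb2" by (rule kcomp_sqint(1)[OF P tPc])
  have cY: "case_prod (cov_kernel M Y) \<in> sqint leb2" unfolding cov_kernel_eq by (rule mom2_sqint[OF Yc Yc])
  have ce: "mom2 M \<eta> \<eta> \<in> sqint leb2" by (rule mom2_sqint[OF H H])
  define h where "h g = op01 (ktransp P) g" for g
  have h: "h g \<in> sq01" if "g \<in> sq01" for g unfolding h_def by (rule op01_sqint[OF unit_leb2.ktransp_sqint(1)[OF P] that])
  note EX0 = expectation_ip_mean_zero[OF X mean]
  have YE: "AE \<omega> in M. ip01 (Y \<omega>) g = ip01 (X \<omega>) (h g) + ip01 (E \<omega>) g" if g: "g \<in> sq01" for g
    using model AE_space
  proof eventually_elim
    case (elim \<omega>)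
    note x = L4_sqint[OF X elim(2)] and e = L4_sqint[OF E elim(2)]
    have "ip01 (Y \<omega>) g = ip01 (\<lambda>t. op01 P (X \<omega>) t + E \<omega> t) g"
      using elim(1) L4_sqint[OF Y elim(2)] sqint_add[OF op01_sqint[OF P x] e] g by (intro ip_cong_AE) auto
    also have "\<dots> = ip01 (op01 P (X \<omega>)) g + ip01 (E \<omega>) g" by (rule ip_add_left[OF op01_sqint[OF P x] e g])
    also have "ip01 (op01 P (X \<omega>)) g = ip01 (X \<omega>) (h g)"
      unfolding h_def op01_ktransp[OF P x g] by (rule ip_commute)
    finally show ?case .
  qed
  have iX: "integrable M (\<lambda>\<omega>. ip01 (X \<omega>) g)" if "g \<in> sq01" for g by (rule L4_ip_integrable(1)[OF X L4_const[OF that]])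
  have iE: "integrable M (\<lambda>\<omega>. ip01 (E \<omega>) g)" if "g \<in> sq01" for g by (rule L4_ip_integrable(1)[OF E L4_const[OF that]])
  have iY: "integrable M (\<lambda>\<omega>. ip01 (Y \<omega>) g)" if "g \<in> sq01" for g by (rule L4_ip_integrable(1)[OF Y L4_const[OF that]])
  have iH: "integrable M (\<lambda>\<omega>. ip01 (\<eta> \<omega>) g)" if "g \<in> sq01" for g by (rule L4_ip_integrable(1)[OF H L4_const[OF that]])
  have mY: "ip01 (mean_fun M Y) g = ip01 (mean_fun M E) g" if g: "g \<in> sq01" for g
  proof -
    have "ip01 (mean_fun M Y) g = expectation (\<lambda>\<omega>. ip01 (X \<omega>) (h g) + ip01 (E \<omega>) g)"
      unfolding ip_mean_fun[OF Y g] using YE[OF g] iY[OF g] iX[OF h[OF g]] iE[OF g] by (intro integral_cong_AE) auto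
    then show ?thesis using iX[OF h[OF g]] iE[OF g] EX0[OF h[OF g]] ip_mean_fun[OF E g] by simp
  qed
  have split: "AE \<omega> in M. ip01 (?Yc \<omega>) g = ip01 (X \<omega>) (h g) + ip01 (\<eta> \<omega>) g" if g: "g \<in> sq01" for g
    using YE[OF g] AE_space
  proof eventually_elim
    case (elim \<omega>)
    show ?case
      using elim(1) mY[OF g] ip_diff_left[OF L4_sqint[OF Y elim(2)] mean_fun_sqint[OF Y] g]
        ip_diff_left[OF L4_sqint[OF E elim(2)] mean_fun_sqint[OF E] g] by (simp add: \<eta>_def)
  qed
  have cross: "expectation (\<lambda>\<omega>. ip01 (X \<omega>) f * ip01 (\<eta> \<omega>) g) = 0 \<and> integrable M (\<lambda>\<omega>. ip01 (X \<omega>) f * ip01 (\<eta> \<omega>) g)"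
    if f: "f \<in> sq01" and g: "g \<in> sq01" for f g
  proof -
    have m\<eta>: "(\<lambda>z. ip01 (\<lambda>t. z t - mean_fun M E t) g) \<in> borel_measurable L2_borel"
      using measurable_compose[OF measurable_translation[OF mean_fun_sqint[OF E]] measurable_ip01_const[OF g]] .
    have i: "indep_var borel (\<lambda>\<omega>. ip01 (X \<omega>) f) borel (\<lambda>\<omega>. ip01 (\<eta> \<omega>) g)"
      using indep_var_compose[OF ind measurable_ip01_const[OF f] m\<eta>] by (simp add: comp_def \<eta>_def)
    show ?thesis
      using indep_var_lebesgue_integral[OF i iX[OF f] iH[OF g]] indep_var_integrable[OF i iX[OF f] iH[OF g]] EX0[OF f] by simp
  qed
  have form: "ip leb2 (case_prod (cov_kernel M Y)) (tens f g) = ip leb2 (\<lambda>p. kcomp P (ktransp (kcomp P c)) p + mom2 M \<eta> \<eta> p) (tens f g)"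
    if f: "f \<in> sq01" and g: "g \<in> sq01" for f g
  proof -
    note t = unit_leb2.tens_sqint[OF f g]
    have i1: "integrable M (\<lambda>\<omega>. ip01 (X \<omega>) (h f) * ip01 (X \<omega>) (h g))" by (rule ip_mom2_tens(2)[OF X X h[OF f] h[OF g]])
    have i2: "integrable M (\<lambda>\<omega>. ip01 (\<eta> \<omega>) f * ip01 (\<eta> \<omega>) g)" by (rule ip_mom2_tens(2)[OF H H f g])
    note i3 = cross[OF h[OF f] g] and i4 = cross[OF h[OF g] f]
    have lin: "expectation (\<lambda>\<omega>. (a \<omega> + b \<omega>) + (a' \<omega> + b' \<omega>)) = expectation a + expectation b + (expectation a' + expectation b')"
      if "integrable M a" "integrable M b" "integrable M a'" "integrable M b'" for a b a' b' :: "'a \<Rightarrow> real"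
      using that by simp
    have "ip leb2 (case_prod (cov_kernel M Y)) (tens f g) = expectation (\<lambda>\<omega>. ip01 (?Yc \<omega>) f * ip01 (?Yc \<omega>) g)"
      unfolding cov_kernel_eq by (rule ip_mom2_tens(1)[OF Yc Yc f g])
    also have "\<dots> = expectation (\<lambda>\<omega>. (ip01 (X \<omega>) (h f) * ip01 (X \<omega>) (h g) + ip01 (\<eta> \<omega>) f * ip01 (\<eta> \<omega>) g)
      + (ip01 (X \<omega>) (h f) * ip01 (\<eta> \<omega>) g + ip01 (X \<omega>) (h g) * ip01 (\<eta> \<omega>) f))"
    proof (rule integral_cong_AE)
      show "AE \<omega> in M. ip01 (?Yc \<omega>) f * ip01 (?Yc \<omega>) g = (ip01 (X \<omega>) (h f) * ip01 (X \<omega>) (h g) + ip01 (\<eta> \<omega>) f * ip01 (\<eta> \<omega>) g)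
        + (ip01 (X \<omega>) (h f) * ip01 (\<eta> \<omega>) g + ip01 (X \<omega>) (h g) * ip01 (\<eta> \<omega>) f)"
        using split[OF f] split[OF g] by eventually_elim (simp add: algebra_simps)
    qed (use ip_mom2_tens(2)[OF Yc Yc f g] i1 i2 i3 i4 in auto)
    also have "\<dots> = expectation (\<lambda>\<omega>. ip01 (X \<omega>) (h f) * ip01 (X \<omega>) (h g)) + expectation (\<lambda>\<omega>. ip01 (\<eta> \<omega>) f * ip01 (\<eta> \<omega>) g)"
      using lin[OF i1 i2 conjunct2[OF i3] conjunct2[OF i4]] i3 i4 by simp
    also have "expectation (\<lambda>\<omega>. ip01 (\<eta> \<omega>) f * ip01 (\<eta> \<omega>) g) = ip leb2 (mom2 M \<eta> \<eta>) (tens f g)"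
      by (rule ip_mom2_tens(1)[OF H H f g, symmetric])
    also have "expectation (\<lambda>\<omega>. ip01 (X \<omega>) (h f) * ip01 (X \<omega>) (h g)) = ip leb2 (kcomp P (ktransp (kcomp P c))) (tens f g)"
    proof -
      have "ip leb2 (kcomp P (ktransp (kcomp P c))) (tens f g) = ip leb2 P (tens f (op01 (ktransp (kcomp P c)) g))"
        by (rule ip_kcomp_tens[OF P tPc f g])
      also have "\<dots> = ip01 (op01 P (op01 (ktransp (kcomp P c)) g)) f"
        by (rule ip_op01_eq[OF P op01_sqint[OF tPc g] f, symmetric])
      also have "\<dots> = ip01 (op01 (ktransp (kcomp P c)) g) (h f)"
        unfolding h_def op01_ktransp[OF P op01_sqint[OF tPc g] f] by (rule ip_commute)
      also have "\<dots> = ip01 (op01 (kcomp P c) (h f)) g" by (rule op01_ktransp[OF Pc h[OF f] g, symmetric])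
      also have "\<dots> = ip leb2 P (tens g (op01 c (h f)))"
        unfolding ip_op01_eq[OF Pc h[OF f] g] by (rule ip_kcomp_tens[OF P c g h[OF f]])
      also have "\<dots> = ip01 (op01 P (op01 c (h f))) g" by (rule ip_op01_eq[OF P op01_sqint[OF c h[OF f]] g, symmetric])
      also have "\<dots> = ip01 (op01 c (h f)) (h g)"
        unfolding h_def op01_ktransp[OF P op01_sqint[OF c h[OF f], unfolded h_def] g] by (rule ip_commute)
      also have "\<dots> = expectation (\<lambda>\<omega>. ip01 (?Xc \<omega>) (h g) * ip01 (?Xc \<omega>) (h f))"
        unfolding c_def cov_kernel_eq ip_op01_eq[OF mom2_sqint[OF Xc Xc] h[OF f] h[OF g]]
        by (rule ip_mom2_tens(1)[OF Xc Xc h[OF g] h[OF f]])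
      also have "\<dots> = expectation (\<lambda>\<omega>. ip01 (X \<omega>) (h f) * ip01 (X \<omega>) (h g))"
        by (intro Bochner_Integration.integral_cong refl) (simp add: ip_centred[OF X mean] h f g)
      finally show ?thesis by simp
    qed
    finally show ?thesis unfolding ip_add_left[OF C ce t] .
  qed
  have "AE p in leb2. case_prod (cov_kernel M Y) p - (kcomp P (ktransp (kcomp P c)) p + mom2 M \<eta> \<eta> p) = 0"
  proof (rule kernel_eq_0I[OF sqint_diff[OF cY sqint_add[OF C ce]]])
    fix f g assume fg: "f \<in> sq01" "g \<in> sq01"
    show "ip leb2 (\<lambda>p. case_prod (cov_kernel M Y) p - (kcomp P (ktransp (kcomp P c)) p + mom2 M \<eta> \<eta> p)) (tens f g) = 0"
      unfolding ip_diff_left[OF cY sqint_add[OF C ce] unit_leb2.tens_sqint[OF fg]] form[OF fg] by simp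
  qed
  then show ?thesis by eventually_elim simp
qed

lemma cov_kernel_centred_eq:
  assumes X: "L4 M X" and mean: "AE t in unit_leb. mean_fun M X t = 0"
  shows "AE p in leb2. case_prod (cov_kernel M X) p = mom2 M X X p"
proof -
  let ?Xc = "\<lambda>\<omega> t. X \<omega> t - mean_fun M X t"
  have Xc: "L4 M ?Xc" by (intro L4_diff X L4_const mean_fun_sqint)
  have "AE p in leb2. mom2 M ?Xc ?Xc p - mom2 M X X p = 0"
  proof (rule kernel_eq_0I[OF sqint_diff[OF mom2_sqint[OF Xc Xc] mom2_sqint[OF X X]]])
    fix f g assume f: "f \<in> sq01" and g: "g \<in> sq01"
    have "expectation (\<lambda>\<omega>. ip01 (?Xc \<omega>) f * ip01 (?Xc \<omega>) g) = expectation (\<lambda>\<omega>. ip01 (X \<omega>) f * ip01 (X \<omega>) g)"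
      by (intro Bochner_Integration.integral_cong refl) (simp add: ip_centred[OF X mean] f g)
    then show "ip leb2 (\<lambda>p. mom2 M ?Xc ?Xc p - mom2 M X X p) (tens f g) = 0"
      unfolding ip_diff_left[OF mom2_sqint[OF Xc Xc] mom2_sqint[OF X X] unit_leb2.tens_sqint[OF f g]]
      using ip_mom2_tens(1)[OF Xc Xc f g] ip_mom2_tens(1)[OF X X f g] by simp
  qed
  then show ?thesis unfolding cov_kernel_eq by eventually_elim simp
qed

end

section \<open>Consistency of the estimator\<close>

lemma kernel_nn_integral:
  assumes k: "k \<in> sqint leb2"
  shows "(\<integral>\<^sup>+t. \<integral>\<^sup>+s. ennreal ((k (t, s))\<^sup>2) \<partial>unit_leb \<partial>unit_leb) = ennreal ((nm leb2 k)\<^sup>2)"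
proof -
  have "(\<integral>\<^sup>+t. \<integral>\<^sup>+s. ennreal ((k (t, s))\<^sup>2) \<partial>unit_leb \<partial>unit_leb) = (\<integral>\<^sup>+p. ennreal ((k p)\<^sup>2) \<partial>leb2)"
    using sqint_measurable[OF k] by (intro unit_leb.nn_integral_fst) measurable
  also have "\<dots> = ennreal ((nm leb2 k)\<^sup>2)"
    unfolding nm_sq_int using sqint_integrable_sq[OF k] by (intro nn_integral_eq_integral) auto
  finally show ?thesis .
qed

text \<open>Markov's inequality for a set that is contained in the large-value event up to a null set only. The set may fail
  to be an event, as when it is defined by empirical eigenvalues that depend on the outcome in an arbitrary way; its \<open>prob\<close> is
  \<open>0\<close> then.\<close>

lemma (in prob_space) prob_le_of_AE_event:
  assumes sub: "AE \<omega> in M. \<omega> \<in> A \<longrightarrow> c \<le> u \<omega>" and A: "A \<subseteq> space M"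
    and u: "integrable M u" "\<And>\<omega>. 0 \<le> u \<omega>" and c: "c > 0"
  shows "prob A \<le> expectation u / c"
proof (cases "A \<in> events")
  case True
  have B: "{\<omega> \<in> space M. c \<le> u \<omega>} \<in> events" using u(1) by measurable
  have "prob A \<le> prob {\<omega> \<in> space M. c \<le> u \<omega>}"
  proof (rule finite_measure_mono_AE)
    show "AE \<omega> in M. \<omega> \<in> A \<longrightarrow> \<omega> \<in> {\<omega> \<in> space M. c \<le> u \<omega>}" using sub AE_space by eventually_elim auto
  qed (rule B)
  also have "\<dots> \<le> expectation u / c"
    using integral_Markov_inequality_measure[OF u(1), of "space M" c] u(2) c by simp
  finally show ?thesis .
next
  case False
  then show ?thesis using u c by (simp add: measure_notin_sets)
qed

theorem theorem6p1:
  fixes M :: "'w measure" and S :: "'s measure"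
    and X Y \<epsilon> :: "nat \<Rightarrow> 'w \<Rightarrow> real \<Rightarrow> real"
    and \<psi> :: "real \<Rightarrow> real \<Rightarrow> real"
    and lam gam :: "nat \<Rightarrow> real" and v u :: "nat \<Rightarrow> real \<Rightarrow> real"
    and lamh gamh :: "nat \<Rightarrow> 'w \<Rightarrow> nat \<Rightarrow> real"
    and vh uh :: "nat \<Rightarrow> 'w \<Rightarrow> nat \<Rightarrow> real \<Rightarrow> real"
    and K L :: "nat \<Rightarrow> nat"
  assumes prob: "prob_space M"
    \<comment> \<open>regressors\<close>
    and X_approx: "Lp_m_approximable M S 4 X"
    and X_mean: "\<And>n. n \<ge> 1 \<Longrightarrow> AE t in unit_leb. mean_fun M (X n) t = 0"
    and X_sup: "(SUP t\<in>{0..1}. \<integral>\<^sup>+\<omega>. ennreal ((X 1 \<omega> t)\<^sup>2) \<partial>M) < \<infinity>"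
    \<comment> \<open>errors\<close>
    and eps_random: "\<And>n. n \<ge> 1 \<Longrightarrow> random_fun M (\<epsilon> n)"
    and eps_iid: "iid M L2_borel \<epsilon> {1..}"
    and X_eps_indep: "prob_space.indep_var M
          (Pi\<^sub>M {1..} (\<lambda>_. L2_borel)) (\<lambda>\<omega>. \<lambda>n\<in>{1..}. X n \<omega>)
          (Pi\<^sub>M {1..} (\<lambda>_. L2_borel)) (\<lambda>\<omega>. \<lambda>n\<in>{1..}. \<epsilon> n \<omega>)"
    \<comment> \<open>the functional linear model\<close>
    and psi_meas: "(\<lambda>(t, s). \<psi> t s) \<in> borel_measurable (unit_leb \<Otimes>\<^sub>M unit_leb)"
    and psi_L2: "AE t in unit_leb. \<psi> t \<in> L2_fun"
    and Y_L4: "\<And>n. n \<ge> 1 \<Longrightarrow> in_LpH M 4 (Y n)"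
    and model: "\<And>n. n \<ge> 1 \<Longrightarrow> AE \<omega> in M. AE t in unit_leb.
          Y n \<omega> t = (LINT s|unit_leb. \<psi> t s * X n \<omega> s) + \<epsilon> n \<omega> t"
    \<comment> \<open>population eigenvalues and eigenfunctions\<close>
    and X_eigen: "eigensystem (cov_kernel M (X 1)) lam v"
    and Y_eigen: "eigensystem (cov_kernel M (Y 1)) gam u"
    and lam_strict: "\<And>j. j \<ge> 1 \<Longrightarrow> lam j > lam (Suc j)"
    and gam_strict: "\<And>j. j \<ge> 1 \<Longrightarrow> gam j > gam (Suc j)"
    \<comment> \<open>identifiability: \<open>\<psi>\<close> vanishes on the null space of the covariance operator of \<open>X\<close>\<close>
    and psi_ident: "\<And>f. f \<in> L2_fun \<Longrightarrow>
          (AE t in unit_leb. kernel_op (cov_kernel M (X 1)) f t = 0) \<Longrightarrow>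
          (AE t in unit_leb. kernel_op \<psi> f t = 0)"
    and Psi_finite: "(\<lambda>(k, l).
          (LINT \<omega>|M. L2_inner (X 1 \<omega>) (v l) * L2_inner (Y 1 \<omega>) (u k))\<^sup>2 / (lam l)\<^sup>2)
          summable_on ({1..} \<times> {1..})"
    \<comment> \<open>empirical eigenvalues and eigenfunctions\<close>
    and X_emp: "\<And>N \<omega>. N \<ge> 1 \<Longrightarrow> \<omega> \<in> space M \<Longrightarrow>
          eigensystem (sample_cov_kernel N (\<lambda>n. X n \<omega>)) (lamh N \<omega>) (vh N \<omega>)"
    and Y_emp: "\<And>N \<omega>. N \<ge> 1 \<Longrightarrow> \<omega> \<in> space M \<Longrightarrow>
          eigensystem (sample_cov_kernel N (\<lambda>n. Y n \<omega>)) (gamh N \<omega>) (uh N \<omega>)"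
    and vh_random: "\<And>N j. N \<ge> 1 \<Longrightarrow> j \<ge> 1 \<Longrightarrow> random_fun M (\<lambda>\<omega>. vh N \<omega> j)"
    and uh_random: "\<And>N j. N \<ge> 1 \<Longrightarrow> j \<ge> 1 \<Longrightarrow> random_fun M (\<lambda>\<omega>. uh N \<omega> j)"
    \<comment> \<open>growth of the truncation levels\<close>
    and K_lim: "filterlim K at_top at_top"
    and L_lim: "filterlim L at_top at_top"
    and rate: "(\<lambda>N. real (K N) * real (L N) /
            (lam (L N) * min (min_gap lam (L N)) (min_gap gam (K N))))
          \<in> o(\<lambda>N. real N powr (1/2))"
  shows "to_zero_in_prob M (\<lambda>N \<omega>.
      \<integral>\<^sup>+t. \<integral>\<^sup>+s. ennreal
        ((psi_hat N (\<lambda>n. X n \<omega>) (\<lambda>n. Y n \<omega>) (lamh N \<omega>) (vh N \<omega>) (uh N \<omega>) (K N) (L N) t s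
           - \<psi> t s)\<^sup>2) \<partial>unit_leb \<partial>unit_leb)"
proof -
  interpret prob_space M by (rule prob)
  \<comment> \<open>The regression kernel as a function on the square; it is a Hilbert--Schmidt kernel because \<open>\<Psi>\<close> is finite.\<close>
  define P where "P = case_prod \<psi>"
  have Pm: "P \<in> borel_measurable leb2" using psi_meas by (simp add: P_def case_prod_beta')
  have Ps: "AE t in unit_leb. (\<lambda>s. P (t, s)) \<in> sq01" using psi_L2 by (simp add: P_def L2_fun_eq)
  have XL: "L4 M (X n)" if "n \<ge> 1" for n
    using X_approx that by (simp add: Lp_m_approximable_def in_LpH_4_iff)
  have YL: "L4 M (Y n)" if "n \<ge> 1" for n using Y_L4[OF that] by (simp add: in_LpH_4_iff)
  have comp: "(\<lambda>x. x n) \<in> measurable (Pi\<^sub>M {1..} (\<lambda>_. L2_borel)) L2_borel" if "n \<ge> 1" for n :: nat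
    using that by (intro measurable_component_singleton) simp
  have indXE: "indep_var L2_borel (X i) L2_borel (\<epsilon> j)" if "i \<ge> 1" "j \<ge> 1" for i j
    using indep_var_compose[OF X_eps_indep comp[OF that(1)] comp[OF that(2)]] that by (simp add: comp_def)
  \<comment> \<open>Measurability with respect to the Borel sets of the function space comes from independence.\<close>
  have Xm: "X n \<in> measurable M L2_borel" and Em: "\<epsilon> n \<in> measurable M L2_borel" if "n \<ge> 1" for n
    using indXE[OF that that] by (auto dest: indep_var_rv1 indep_var_rv2)
  have model': "AE \<omega> in M. AE t in unit_leb. Y n \<omega> t = op01 P (X n \<omega>) t + \<epsilon> n \<omega> t" if "n \<ge> 1" for n
    using model[OF that] by (simp add: kapp_def ip_def P_def)
  have one: "(1::nat) \<le> 1" by simp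
  interpret V: psd_eigen "cov_kernel M (X 1)" lam v by (rule psd_eigen_cov_kernel[OF XL[OF one] X_eigen])
  interpret U: psd_eigen "cov_kernel M (Y 1)" gam u by (rule psd_eigen_cov_kernel[OF YL[OF one] Y_eigen])
  have lam_pos: "lam j > 0" if "j \<ge> 1" for j using lam_strict[OF that] V.l_nonneg[of "Suc j"] by simp
  have ident: "AE t in unit_leb. op01 P f t = 0"
    if "f \<in> sq01" "AE t in unit_leb. op01 (case_prod (cov_kernel M (X 1))) f t = 0" for f
    using psi_ident[of f] that by (simp add: L2_fun_eq kernel_op_eq P_def)
  have Psi: "(\<lambda>(k, l). (expectation (\<lambda>\<omega>. ip01 (X 1 \<omega>) (v l) * ip01 (Y 1 \<omega>) (u k)))\<^sup>2 / (lam l)\<^sup>2)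
      summable_on ({1..} \<times> {1..})"
    using Psi_finite by (simp add: L2_inner_eq)
  note HS = regression_kernel_hilbert_schmidt[OF XL[OF one] YL[OF one] eps_random[OF one] X_mean[OF one] indXE[OF one one]
      Pm Ps model'[OF one] V.psd_eigen_axioms U.psd_eigen_axioms lam_pos ident Psi]
  have P: "P \<in> sqint leb2" by (rule HS(1))
  \<comment> \<open>The errors have finite fourth moments because they are differences of responses and signals.\<close>
  have EL: "L4 M (\<epsilon> n)" if n: "n \<ge> 1" for n
  proof (rule L4I[OF eps_random[OF n] YL[OF n] XL[OF n], of "nm leb2 P"])
    show "AE \<omega> in M. nm01 (\<epsilon> n \<omega>) \<le> nm01 (Y n \<omega>) + nm leb2 P * nm01 (X n \<omega>)"
      using model'[OF n] AE_space
    proof eventually_elim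
      case (elim \<omega>)
      note y = L4_sqint[OF YL[OF n] elim(2)] and x = L4_sqint[OF XL[OF n] elim(2)]
      have "nm01 (\<epsilon> n \<omega>) = nm01 (\<lambda>t. Y n \<omega> t - op01 P (X n \<omega>) t)"
        using elim(1) random_fun_sqint[OF eps_random[OF n] elim(2)] sqint_diff[OF y op01_sqint[OF P x]]
        by (intro nm_cong_AE) auto
      also have "\<dots> \<le> nm01 (Y n \<omega>) + nm01 (op01 P (X n \<omega>))" by (rule nm_triangle_diff[OF y op01_sqint[OF P x]])
      finally show ?case using nm_op01_le[OF P x] by linarith
    qed
  qed simp
  \<comment> \<open>The errors may have a nonzero mean function, so they are centred.\<close>
  define \<mu> where "\<mu> = mean_fun M (\<epsilon> 1)"
  have \<mu>: "\<mu> \<in> sq01" unfolding \<mu>_def by (rule mean_fun_sqint[OF EL[OF one]])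
  define \<eta> where "\<eta> n \<omega> t = \<epsilon> n \<omega> t - \<mu> t" for n \<omega> t
  have HL: "L4 M (\<eta> n)" if "n \<ge> 1" for n
    unfolding \<eta>_def[abs_def] by (intro L4_diff EL that L4_const \<mu>)
  note tr = measurable_translation[OF \<mu>]
  have \<eta>_comp: "\<eta> n = (\<lambda>z t. z t - \<mu> t) \<circ> \<epsilon> n" for n by (simp add: fun_eq_iff \<eta>_def)
  have Hm: "\<eta> n \<in> measurable M L2_borel" if "n \<ge> 1" for n
    unfolding \<eta>_comp by (rule measurable_comp[OF Em[OF that] tr])
  have Hlaw: "distr M L2_borel (\<eta> n) = distr M L2_borel (\<eta> 1)" if n: "n \<ge> 1" for n
  proof -
    have "\<forall>i\<in>{1..}. \<forall>j\<in>{1..}. distr M L2_borel (\<epsilon> i) = distr M L2_borel (\<epsilon> j)"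
      using eps_iid unfolding iid_def by blast
    then have "distr M L2_borel (\<epsilon> n) = distr M L2_borel (\<epsilon> 1)" using n by blast
    then show ?thesis
      unfolding \<eta>_comp distr_distr[OF tr Em[OF n], symmetric] distr_distr[OF tr Em[OF one], symmetric] by (rule arg_cong)
  qed
  have Hind: "indep_var L2_borel (\<eta> i) L2_borel (\<eta> j)" if ij: "1 \<le> i" "i < j" for i j
  proof -
    have "indep_var L2_borel (\<epsilon> i) L2_borel (\<epsilon> j)"
      using eps_iid ij by (intro indep_vars_imp_indep_var[of L2_borel \<epsilon> "{1..}"]) (auto simp: iid_def)
    from indep_var_compose[OF this tr tr] show ?thesis by (simp only: \<eta>_comp)
  qed
  have Hmean: "nm01 (mean_fun M (\<eta> 1)) = 0"
    using mean_fun_centred[OF EL[OF one]] unfolding \<eta>_def[abs_def] \<mu>_def .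
  have Xmean0: "nm01 (mean_fun M (X 1)) = 0"
    using X_mean[OF one] nm_eq_0_iff[OF mean_fun_sqint[OF XL[OF one]]] by simp

  \<comment> \<open>The squared norms of the five averages have means of order \<open>1 / N\<close>: the regressors are weakly dependent, the errors
     independent, and the two are independent of each other.\<close>
  obtain r where r: "summable r" "\<And>n. 0 \<le> r n"
    "\<And>n. n \<ge> 1 \<Longrightarrow> distr M L2_borel (X n) = distr M L2_borel (X 1)"
    "\<And>i j. 1 \<le> i \<Longrightarrow> i \<le> j \<Longrightarrow>
      \<bar>expectation (\<lambda>\<omega>. (ip01 (X i \<omega>) (X j \<omega>))\<^sup>2) - (nm leb2 (mom2 M (X 1) (X 1)))\<^sup>2\<bar> \<le> r (j - i)"
    "\<And>i j. 1 \<le> i \<Longrightarrow> i \<le> j \<Longrightarrow>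
      \<bar>expectation (\<lambda>\<omega>. ip01 (X i \<omega>) (X j \<omega>)) - (nm01 (mean_fun M (X 1)))\<^sup>2\<bar> \<le> r (j - i)"
  proof (rule approximable_weak_dependence[OF X_approx Xm], goal_cases)
    case (2 r)
    show ?case by (rule that[of r]) (rule 2; assumption)+
  qed
  note Hmom = iid_centred_moments[where Z = \<eta>, OF HL Hm Hlaw Hind Hmean]
  define s\<eta> where "s\<eta> = expectation (\<lambda>\<omega>. (nm01 (\<eta> 1 \<omega>))\<^sup>2)"
  define d\<eta> where "d\<eta> = expectation (\<lambda>\<omega>. nm01 (\<eta> 1 \<omega>) ^ 4) + (nm leb2 (mom2 M (\<eta> 1) (\<eta> 1)))\<^sup>2"
  have s\<eta>0: "0 \<le> s\<eta>" unfolding s\<eta>_def by (intro Bochner_Integration.integral_nonneg) auto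
  have d\<eta>0: "0 \<le> d\<eta>" unfolding d\<eta>_def by (intro add_nonneg_nonneg Bochner_Integration.integral_nonneg) auto
  \<comment> \<open>Each average contributes twice the sum of its dependence bounds, see \<open>nm_sum_short_range\<close>.\<close>
  define B where "B = 2 * suminf r + 2 * suminf r + 2 * (s\<eta> * r 0) + 2 * d\<eta> + 2 * s\<eta>"
  \<comment> \<open>the dependence bound of a sequence whose terms at different times are uncorrelated\<close>
  define single where "single a k = (if k = (0::nat) then a else 0)" for a :: real and k
  have single: "summable (single a)" "suminf (single a) = a" "a \<ge> 0 \<Longrightarrow> single a n \<ge> 0" for a n
    using sums_single[of 0 "\<lambda>_. a"] by (auto simp: single_def[abs_def] sums_iff)
  define Q_xx where "Q_xx N \<omega> = nm leb2 (\<lambda>p. (\<Sum>i=1..N. tens (X i \<omega>) (X i \<omega>) p) / real N - mom2 M (X 1) (X 1) p)" for N \<omega>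
  define Q_x where "Q_x N \<omega> = nm01 (\<lambda>t. (\<Sum>i=1..N. X i \<omega> t) / real N)" for N \<omega>
  define Q_ex where "Q_ex N \<omega> = nm leb2 (\<lambda>p. (\<Sum>i=1..N. tens (\<eta> i \<omega>) (X i \<omega>) p) / real N)" for N \<omega>
  define Q_ee where "Q_ee N \<omega> = nm leb2 (\<lambda>p. (\<Sum>i=1..N. tens (\<eta> i \<omega>) (\<eta> i \<omega>) p) / real N - mom2 M (\<eta> 1) (\<eta> 1) p)" for N \<omega>
  define Q_e where "Q_e N \<omega> = nm01 (\<lambda>t. (\<Sum>i=1..N. \<eta> i \<omega> t) / real N)" for N \<omega>
  define Q where "Q N \<omega> = (Q_xx N \<omega>)\<^sup>2 + (Q_x N \<omega>)\<^sup>2 + (Q_ex N \<omega>)\<^sup>2 + (Q_ee N \<omega>)\<^sup>2 + (Q_e N \<omega>)\<^sup>2" for N \<omega>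
  have Q0: "0 \<le> Q N \<omega>" for N \<omega> by (simp add: Q_def)
  have Qint: "integrable M (Q N) \<and> expectation (Q N) \<le> B / real N" if N: "N \<ge> 1" for N
  proof -
    have r5: "\<bar>expectation (\<lambda>\<omega>. ip01 (X i \<omega>) (X j \<omega>))\<bar> \<le> r (j - i)" if "1 \<le> i" "i \<le> j" for i j
      using r(5)[OF that] Xmean0 by simp
    note A1 = average_second_moment[where Z = X and r = r, OF XL Xm r(3) r(4) r(1) r(2) N]
    note A2 = average_mean[where Z = X and r = r, OF XL r5 r(1) r(2) N]
    have hm: "expectation (\<lambda>\<omega>. ip01 (\<eta> i \<omega>) (\<eta> j \<omega>)) = single s\<eta> (j - i)" if "1 \<le> i" "i \<le> j" for i j
      unfolding single_def s\<eta>_def by (rule Hmom(2)) (use that in auto)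
    have cr: "\<bar>expectation (\<lambda>\<omega>. ip01 (\<eta> i \<omega>) (\<eta> j \<omega>) * ip01 (X i \<omega>) (X j \<omega>))\<bar> \<le> single (s\<eta> * r 0) (j - i)"
      if ij: "1 \<le> i" "i \<le> j" for i j
    proof -
      have j: "1 \<le> j" using ij by simp
      have pm: "(\<lambda>x. (x i, x j)) \<in> measurable (Pi\<^sub>M {1..} (\<lambda>_. L2_borel)) (L2_borel \<Otimes>\<^sub>M L2_borel)"
        by (intro measurable_Pair comp ij(1) j)
      have pm': "(\<lambda>x. ((\<lambda>t. x i t - \<mu> t), (\<lambda>t. x j t - \<mu> t))) \<in> measurable (Pi\<^sub>M {1..} (\<lambda>_. L2_borel)) (L2_borel \<Otimes>\<^sub>M L2_borel)"
        by (intro measurable_Pair measurable_compose[OF comp[OF ij(1)] tr] measurable_compose[OF comp[OF j] tr])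
      have ind: "indep_var borel (\<lambda>\<omega>. ip01 (X i \<omega>) (X j \<omega>)) borel (\<lambda>\<omega>. ip01 (\<eta> i \<omega>) (\<eta> j \<omega>))"
        using indep_var_compose[OF X_eps_indep measurable_compose[OF pm measurable_ip01] measurable_compose[OF pm' measurable_ip01]] ij j
        by (simp add: comp_def \<eta>_def[abs_def])
      have iX: "integrable M (\<lambda>\<omega>. ip01 (X i \<omega>) (X j \<omega>))" by (rule L4_ip_integrable(1)[OF XL[OF ij(1)] XL[OF j]])
      have iH: "integrable M (\<lambda>\<omega>. ip01 (\<eta> i \<omega>) (\<eta> j \<omega>))" by (rule L4_ip_integrable(1)[OF HL[OF ij(1)] HL[OF j]])
      have eq: "expectation (\<lambda>\<omega>. ip01 (\<eta> i \<omega>) (\<eta> j \<omega>) * ip01 (X i \<omega>) (X j \<omega>))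
        = expectation (\<lambda>\<omega>. ip01 (X i \<omega>) (X j \<omega>)) * expectation (\<lambda>\<omega>. ip01 (\<eta> i \<omega>) (\<eta> j \<omega>))"
        using indep_var_lebesgue_integral[OF ind iX iH] by (simp add: mult.commute)
      show ?thesis
      proof (cases "j - i = 0")
        case True
        then have "\<bar>expectation (\<lambda>\<omega>. ip01 (X i \<omega>) (X j \<omega>))\<bar> * s\<eta> \<le> r 0 * s\<eta>"
          using r5[OF ij] s\<eta>0 by (intro mult_right_mono) auto
        then show ?thesis unfolding eq hm[OF ij] using True s\<eta>0 by (simp add: single_def abs_mult mult.commute)
      next
        case False
        then show ?thesis unfolding eq hm[OF ij] by (simp add: single_def)
      qed
    qed
    have sr: "0 \<le> s\<eta> * r 0" using s\<eta>0 r(2) by simp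
    note A3 = average_cross[where Z = \<eta> and W = X and r = "single (s\<eta> * r 0)", OF HL XL cr single(1) single(3)[OF sr] N]
    have h4: "\<bar>expectation (\<lambda>\<omega>. (ip01 (\<eta> i \<omega>) (\<eta> j \<omega>))\<^sup>2) - (nm leb2 (mom2 M (\<eta> 1) (\<eta> 1)))\<^sup>2\<bar> \<le> single d\<eta> (j - i)"
      if "1 \<le> i" "i \<le> j" for i j unfolding single_def d\<eta>_def by (rule Hmom(1)) (use that in auto)
    note A4 = average_second_moment[where Z = \<eta> and r = "single d\<eta>", OF HL Hm Hlaw h4 single(1) single(3)[OF d\<eta>0] N]
    have h5: "\<bar>expectation (\<lambda>\<omega>. ip01 (\<eta> i \<omega>) (\<eta> j \<omega>))\<bar> \<le> single s\<eta> (j - i)" if "1 \<le> i" "i \<le> j" for i j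
      using hm[OF that] s\<eta>0 by (simp add: single_def)
    note A5 = average_mean[where Z = \<eta> and r = "single s\<eta>", OF HL h5 single(1) single(3)[OF s\<eta>0] N]
    have i: "integrable M (\<lambda>\<omega>. (Q_xx N \<omega>)\<^sup>2)" "integrable M (\<lambda>\<omega>. (Q_x N \<omega>)\<^sup>2)" "integrable M (\<lambda>\<omega>. (Q_ex N \<omega>)\<^sup>2)"
      "integrable M (\<lambda>\<omega>. (Q_ee N \<omega>)\<^sup>2)" "integrable M (\<lambda>\<omega>. (Q_e N \<omega>)\<^sup>2)"
      unfolding Q_xx_def Q_x_def Q_ex_def Q_ee_def Q_e_def
      by (rule A1(1) A2(1) A3(1) A4(1) A5(1); assumption)+
    have e: "expectation (\<lambda>\<omega>. (Q_xx N \<omega>)\<^sup>2) \<le> 2 * suminf r / real N" "expectation (\<lambda>\<omega>. (Q_x N \<omega>)\<^sup>2) \<le> 2 * suminf r / real N"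
      "expectation (\<lambda>\<omega>. (Q_ex N \<omega>)\<^sup>2) \<le> 2 * (s\<eta> * r 0) / real N" "expectation (\<lambda>\<omega>. (Q_ee N \<omega>)\<^sup>2) \<le> 2 * d\<eta> / real N"
      "expectation (\<lambda>\<omega>. (Q_e N \<omega>)\<^sup>2) \<le> 2 * s\<eta> / real N"
      unfolding Q_xx_def Q_x_def Q_ex_def Q_ee_def Q_e_def
      by (rule A1(2) A2(2) A3(2)[unfolded single(2)] A4(2)[unfolded single(2)] A5(2)[unfolded single(2)]; assumption)+
    have "expectation (Q N) = expectation (\<lambda>\<omega>. (Q_xx N \<omega>)\<^sup>2) + expectation (\<lambda>\<omega>. (Q_x N \<omega>)\<^sup>2) + expectation (\<lambda>\<omega>. (Q_ex N \<omega>)\<^sup>2)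
      + expectation (\<lambda>\<omega>. (Q_ee N \<omega>)\<^sup>2) + expectation (\<lambda>\<omega>. (Q_e N \<omega>)\<^sup>2)"
      unfolding Q_def[abs_def] using i by simp
    also have "\<dots> \<le> B / real N" using e by (simp add: B_def add_divide_distrib)
    finally show ?thesis using i by (simp add: Q_def[abs_def])
  qed

  \<comment> \<open>From here on the argument is deterministic: \<open>c\<close> is the covariance kernel of the regressors, \<open>D\<close> the cross-covariance kernel and
     \<open>ce\<close> the covariance kernel of the errors.\<close>
  define c where "c = case_prod (cov_kernel M (X 1))"
  define ce where "ce = mom2 M (\<eta> 1) (\<eta> 1)"
  define D where "D = kcomp P c"
  have c: "c \<in> sqint leb2" unfolding c_def by (rule V.k_sqint)
  have ce: "ce \<in> sqint leb2" unfolding ce_def by (rule mom2_sqint[OF HL[OF one] HL[OF one]])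
  have D: "D \<in> sqint leb2" unfolding D_def by (rule kcomp_sqint(1)[OF P c])
  have DP: "ip leb2 D (tens (u i) (v j)) = lam j * ip leb2 P (tens (u i) (v j))" if "i \<ge> 1" "j \<ge> 1" for i j
  proof -
    note ui = U.e_sqint[OF that(1)] and vj = V.e_sqint[OF that(2)]
    have Pu: "op01 (ktransp P) (u i) \<in> sq01" by (rule op01_sqint[OF unit_leb2.ktransp_sqint(1)[OF P] ui])
    have pr: "ip leb2 P (tens (u i) g) = ip01 (op01 (ktransp P) (u i)) g" if "g \<in> sq01" for g
      unfolding ip_op01_eq[OF P that ui, symmetric] by (rule op01_ktransp[OF P that ui])
    have "ip leb2 D (tens (u i) (v j)) = ip01 (op01 (ktransp P) (u i)) (op01 c (v j))"
      unfolding D_def ip_kcomp_tens[OF P c ui vj] by (rule pr[OF op01_sqint[OF c vj]])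
    also have "\<dots> = ip01 (op01 (ktransp P) (u i)) (\<lambda>t. lam j * v j t)"
      using Pu op01_sqint[OF c vj] sqint_scale[OF vj, of "lam j"] V.T_e[OF that(2)]
      by (intro ip_cong_AE) (auto simp: c_def)
    also have "\<dots> = lam j * ip leb2 P (tens (u i) (v j))" unfolding ip_scale_right pr[OF vj] ..
    finally show ?thesis .
  qed
  have cX: "AE p in leb2. c p = mom2 M (X 1) (X 1) p"
    unfolding c_def by (rule cov_kernel_centred_eq[OF XL[OF one] X_mean[OF one]])
  have cY: "AE p in leb2. case_prod (cov_kernel M (Y 1)) p = kcomp P (ktransp (kcomp P c)) p + ce p"
    using cov_kernel_response[OF XL[OF one] YL[OF one] EL[OF one] X_mean[OF one] indXE[OF one one] P model'[OF one]]
    unfolding c_def ce_def \<eta>_def[abs_def] \<mu>_def .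
  define tail where "tail N = (nm leb2 P)\<^sup>2 - (\<Sum>i=1..K N. \<Sum>j=1..L N. (ip leb2 P (tens (u i) (v j)))\<^sup>2)" for N
  define h where "h N = min (min_gap lam (L N)) (min_gap gam (K N))" for N
  define C0 where "C0 = 5 * nm leb2 D + 3 * lam 1"
  let ?est = "\<lambda>N \<omega> t s. psi_hat N (\<lambda>n. X n \<omega>) (\<lambda>n. Y n \<omega>) (lamh N \<omega>) (vh N \<omega>) (uh N \<omega>) (K N) (L N) t s"
  let ?Z = "\<lambda>N \<omega>. \<integral>\<^sup>+t. \<integral>\<^sup>+s. ennreal ((?est N \<omega> t s - \<psi> t s)\<^sup>2) \<partial>unit_leb \<partial>unit_leb"
  \<comment> \<open>The three summands bound the deviations of the empirical regressor covariance, cross-covariance and response covariance, each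
     divided by \<open>s\<close>, when all five averages are at most \<open>s \<le> s1\<close>; squares of \<open>s\<close> are bounded by \<open>s1 s\<close>.\<close>
  define \<kappa> where "\<kappa> s1 = (1 + s1) + (nm leb2 P + 1 + nm01 \<mu>) + (nm leb2 P + 1)\<^sup>2 * (1 + s1)" for s1
  have det: "?Z N \<omega> \<le> ennreal ((real (K N) * real (L N) * (\<kappa> s1 * s / (lam (L N) * h N) * C0) + sqrt (tail N))\<^sup>2)"
    if N: "N \<ge> 1" and KL: "K N \<ge> 1" "L N \<ge> 1" and hN: "h N > 0" and \<omega>: "\<omega> \<in> space M"
      and mod: "\<And>n. n \<ge> 1 \<Longrightarrow> AE t in unit_leb. Y n \<omega> t = op01 P (X n \<omega>) t + \<epsilon> n \<omega> t"
      and s: "0 \<le> s" "s \<le> s1" "Q N \<omega> \<le> s\<^sup>2" and small: "2 * (\<kappa> s1 * s) \<le> lam (L N)" for N \<omega> s s1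
  proof -
    interpret O: observations "\<lambda>n. X n \<omega>" "\<lambda>n. Y n \<omega>" "\<lambda>n. \<eta> n \<omega>" P c ce \<mu> N
    proof
      show "N \<ge> 1" by (rule N)
      fix i assume i: "i \<in> {1..N}"
      then show "X i \<omega> \<in> sq01" "Y i \<omega> \<in> sq01" "\<eta> i \<omega> \<in> sq01"
        using L4_sqint[OF XL \<omega>] L4_sqint[OF YL \<omega>] L4_sqint[OF HL \<omega>] by auto
      show "AE t in unit_leb. Y i \<omega> t = op01 P (X i \<omega>) t + (\<eta> i \<omega> t + \<mu> t)"
        using mod[of i] i by (simp add: \<eta>_def)
    qed (rule P c ce \<mu>)+
    interpret Vh: psd_eigen "sample_cov_kernel N (\<lambda>n. X n \<omega>)" "lamh N \<omega>" "vh N \<omega>"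
      by (intro psd_eigen.intro psd_sample_cov O.x X_emp N \<omega>)
    interpret Uh: psd_eigen "sample_cov_kernel N (\<lambda>n. Y n \<omega>)" "gamh N \<omega>" "uh N \<omega>"
      by (intro psd_eigen.intro psd_sample_cov O.y Y_emp N \<omega>)
    let ?p = "nm leb2 P" and ?\<delta> = "\<kappa> s1 * s"
    have p0: "0 \<le> ?p" "0 \<le> nm01 \<mu>" by auto
    have q1: "O.err_xx = Q_xx N \<omega>"
    proof -
      have "(\<lambda>p. O.avg2 (\<lambda>n. X n \<omega>) (\<lambda>n. X n \<omega>) p - mom2 M (X 1) (X 1) p) \<in> sqint leb2"
        by (intro sqint_diff O.avg2_sqint O.x mom2_sqint XL one)
      then show ?thesis unfolding O.err_xx_def Q_xx_def
        using sqint_measurable[OF sqint_diff[OF O.avg2_sqint[OF O.x O.x] c]] cX by (intro nm_cong_AE) auto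
    qed
    have qs: "O.err_x = Q_x N \<omega>" "O.err_ex = Q_ex N \<omega>" "O.err_ee = Q_ee N \<omega>" "O.err_e = Q_e N \<omega>"
      unfolding O.err_x_def O.err_ex_def O.err_ee_def O.err_e_def Q_x_def Q_ex_def Q_ee_def Q_e_def by (simp_all only: ce_def)
    have sq: "(O.err_xx)\<^sup>2 \<le> s\<^sup>2" "(O.err_x)\<^sup>2 \<le> s\<^sup>2" "(O.err_ex)\<^sup>2 \<le> s\<^sup>2" "(O.err_ee)\<^sup>2 \<le> s\<^sup>2" "(O.err_e)\<^sup>2 \<le> s\<^sup>2"
      unfolding q1 qs using s(3) unfolding Q_def
      by (smt (verit) zero_le_power2)+
    have q: "O.err_xx \<le> s" "O.err_x \<le> s" "O.err_ex \<le> s" "O.err_ee \<le> s" "O.err_e \<le> s"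
      using sq by (auto intro!: power2_le_imp_le[OF _ s(1)])
    have q0: "0 \<le> O.err_xx" "0 \<le> O.err_x" "0 \<le> O.err_ex" "0 \<le> O.err_ee" "0 \<le> O.err_e"
      by (simp_all add: O.err_xx_def O.err_x_def O.err_ex_def O.err_ee_def O.err_e_def)
    have ss: "s\<^sup>2 \<le> s * s1" using s by (simp add: power2_eq_square mult_left_mono)
    have s10: "0 \<le> s1" using s by linarith
    have k1: "(1 + s1) * s \<le> ?\<delta>" "(?p + 1 + nm01 \<mu>) * s \<le> ?\<delta>" "((?p + 1)\<^sup>2 * (1 + s1)) * s \<le> ?\<delta>"
      unfolding \<kappa>_def using s(1) s10 p0 by (intro mult_right_mono; simp)+
    have dX: "nm leb2 (\<lambda>p. case_prod (sample_cov_kernel N (\<lambda>n. X n \<omega>)) p - c p) \<le> ?\<delta>"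
    proof -
      have "O.err_xx + (O.err_x)\<^sup>2 \<le> (1 + s1) * s" using q(1) sq(2) ss by (simp add: algebra_simps)
      then show ?thesis using O.regressor_cov_deviation k1(1) by linarith
    qed
    have dD: "nm leb2 (\<lambda>p. O.avg2 (\<lambda>n. Y n \<omega>) (\<lambda>n. X n \<omega>) p - D p) \<le> ?\<delta>"
    proof -
      have "?p * O.err_xx + O.err_ex + nm01 \<mu> * O.err_x \<le> ?p * s + s + nm01 \<mu> * s"
        using q p0 by (intro add_mono mult_left_mono) auto
      also have "\<dots> = (?p + 1 + nm01 \<mu>) * s" by (simp add: algebra_simps)
      finally show ?thesis using O.cross_cov_deviation k1(2) unfolding D_def by linarith
    qed
    have dY: "nm leb2 (\<lambda>p. case_prod (sample_cov_kernel N (\<lambda>n. Y n \<omega>)) p - case_prod (cov_kernel M (Y 1)) p) \<le> ?\<delta>"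
    proof -
      have C: "kcomp P (ktransp (kcomp P c)) \<in> sqint leb2"
        by (intro kcomp_sqint(1) P unit_leb2.ktransp_sqint(1) c)
      have "nm leb2 (\<lambda>p. case_prod (sample_cov_kernel N (\<lambda>n. Y n \<omega>)) p - case_prod (cov_kernel M (Y 1)) p)
        = nm leb2 (\<lambda>p. case_prod (sample_cov_kernel N (\<lambda>n. Y n \<omega>)) p - (kcomp P (ktransp (kcomp P c)) p + ce p))"
      proof (rule nm_cong_AE)
        show "AE p in leb2. case_prod (sample_cov_kernel N (\<lambda>n. Y n \<omega>)) p - case_prod (cov_kernel M (Y 1)) p
          = case_prod (sample_cov_kernel N (\<lambda>n. Y n \<omega>)) p - (kcomp P (ktransp (kcomp P c)) p + ce p)"
          using cY by eventually_elim (simp only:)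
      qed (use sqint_measurable[OF sqint_diff[OF Uh.k_sqint U.k_sqint]] sqint_measurable[OF sqint_diff[OF Uh.k_sqint sqint_add[OF C ce]]] in auto)
      also have "\<dots> \<le> ?p\<^sup>2 * O.err_xx + 2 * (?p * O.err_ex) + O.err_ee + (?p * O.err_x + O.err_e)\<^sup>2" by (rule O.response_cov_deviation)
      also have "\<dots> \<le> ?p\<^sup>2 * s + 2 * (?p * s) + s + (?p * s + s)\<^sup>2"
        using q q0 p0 by (intro add_mono mult_left_mono power_mono) auto
      also have "\<dots> = (?p + 1)\<^sup>2 * (s + s\<^sup>2)" by (simp add: power2_eq_square algebra_simps)
      also have "\<dots> \<le> (?p + 1)\<^sup>2 * (s + s * s1)" using ss by (intro mult_left_mono) auto
      also have "\<dots> = ((?p + 1)\<^sup>2 * (1 + s1)) * s" by (simp add: algebra_simps)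
      finally show ?thesis using k1(3) by linarith
    qed
    let ?e = "\<lambda>p. (\<Sum>i=1..K N. \<Sum>j=1..L N. inverse (lamh N \<omega> j)
      * ip leb2 (O.avg2 (\<lambda>n. Y n \<omega>) (\<lambda>n. X n \<omega>)) (tens (uh N \<omega> i) (vh N \<omega> j)) * tens (uh N \<omega> i) (vh N \<omega> j) p)"
    have bound: "nm leb2 (\<lambda>p. ?e p - P p) \<le> real (K N) * real (L N) * (?\<delta> / (lam (L N) * h N) * C0) + sqrt (tail N)"
      unfolding tail_def C0_def
      by (rule estimator_error[OF V.psd_eigen_axioms Vh.psd_eigen_axioms U.psd_eigen_axioms Uh.psd_eigen_axioms
            D O.avg2_sqint[OF O.y O.x] P DP dX[unfolded c_def] dY dD KL lam_pos[OF KL(2)] h_def hN small])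
    have es: "(\<lambda>p. ?e p - P p) \<in> sqint leb2"
    proof (intro sqint_diff sqint_sum sqint_scale unit_leb2.tens_sqint P)
      fix i j assume "i \<in> {1..K N}" "j \<in> {1..L N}"
      then show "uh N \<omega> i \<in> sq01" "vh N \<omega> j \<in> sq01" using Uh.e_sqint Vh.e_sqint by auto
    qed
    have est: "?est N \<omega> t s - \<psi> t s = ?e (t, s) - P (t, s)" for t s
    proof -
      have "?est N \<omega> t s = ?e (t, s)"
        unfolding psi_hat_def
      proof (intro sum.cong refl)
        fix i j assume "i \<in> {1..K N}" "j \<in> {1..L N}"
        then have "uh N \<omega> i \<in> sq01" "vh N \<omega> j \<in> sq01" using Uh.e_sqint Vh.e_sqint by auto
        then show "inverse (lamh N \<omega> j) * sigma_hat N (\<lambda>n. X n \<omega>) (\<lambda>n. Y n \<omega>) (vh N \<omega>) (uh N \<omega>) j i * uh N \<omega> i t * vh N \<omega> j s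
          = inverse (lamh N \<omega> j) * ip leb2 (O.avg2 (\<lambda>n. Y n \<omega>) (\<lambda>n. X n \<omega>)) (tens (uh N \<omega> i) (vh N \<omega> j)) * tens (uh N \<omega> i) (vh N \<omega> j) (t, s)"
          using O.sigma_hat_eq[of "vh N \<omega>" j "uh N \<omega>" i] by (simp add: tens_def mult.assoc)
      qed
      then show ?thesis by (simp add: P_def)
    qed
    have "?Z N \<omega> = ennreal ((nm leb2 (\<lambda>p. ?e p - P p))\<^sup>2)"
      unfolding est by (rule kernel_nn_integral[OF es])
    also have "\<dots> \<le> ennreal ((real (K N) * real (L N) * (?\<delta> / (lam (L N) * h N) * C0) + sqrt (tail N))\<^sup>2)"
      using bound by (intro ennreal_leI power_mono) auto
    finally show ?thesis .
  qed

  \<comment> \<open>The rate condition says \<open>T N \<longlonglongrightarrow> 0\<close>, and the error bound with \<open>s\<close> of order \<open>1 / sqrt N\<close> is a multiple of \<open>T N\<close> plus the square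
     root of the tail of the expansion of \<open>\<psi>\<close>.\<close>
  define T where "T N = real (K N) * real (L N) / (lam (L N) * h N) / real N powr (1/2)" for N
  have T0: "T \<longlonglongrightarrow> 0"
    using smalloD_tendsto[OF rate] by (simp add: T_def[abs_def] h_def)
  have evK: "\<forall>\<^sub>F N in sequentially. K N \<ge> n" for n using K_lim by (simp add: filterlim_at_top)
  have evL: "\<forall>\<^sub>F N in sequentially. L N \<ge> n" for n using L_lim by (simp add: filterlim_at_top)
  have gpos: "gap l j > 0" if "j \<ge> 1" "\<And>j. j \<ge> 1 \<Longrightarrow> l j > l (Suc j)" for l :: "nat \<Rightarrow> real" and j
    using that(2)[OF that(1)] that(2)[of "j - 1"] that(2)[of 1] that(1) by (cases "j = 1") (auto simp: gap_def numeral_2_eq_2)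
  have hpos: "h N > 0" if KL: "K N \<ge> 1" "L N \<ge> 1" for N
    unfolding h_def min_gap_def using KL gpos[of _ lam] gpos[of _ gam] lam_strict gam_strict by (auto simp: Min_gr_iff)
  have hle: "h N \<le> lam 1" if KL: "K N \<ge> 1" "L N \<ge> 1" for N
  proof -
    have "h N \<le> min_gap lam (L N)" by (simp add: h_def)
    also have "\<dots> \<le> gap lam 1" unfolding min_gap_def using KL by (intro Min_le) auto
    also have "\<dots> \<le> lam 1" by (rule V.gap_le) simp
    finally show ?thesis .
  qed
  have evtail: "\<forall>\<^sub>F N in sequentially. tail N < e" if e: "e > 0" for e
  proof -
    obtain n0 where n0: "\<forall>K\<ge>n0. \<forall>L\<ge>n0. (nm leb2 P)\<^sup>2 - (\<Sum>i=1..K. \<Sum>j=1..L. (ip leb2 P (tens (u i) (v j)))\<^sup>2) < e"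
      using HS(2)[OF _ _ _ e] by blast
    show ?thesis using evK[of n0] evL[of n0] by eventually_elim (use n0 in \<open>simp add: tail_def\<close>)
  qed
  have C00: "0 \<le> C0" using lam_pos[OF one] by (simp add: C0_def)
  have small_ev: "\<forall>\<^sub>F N in sequentially. prob {\<omega> \<in> space M. ?Z N \<omega> > ennreal e} \<le> B / A"
    if e: "e > 0" and A: "A > 0" for e A
  proof -
    \<comment> \<open>By Markov's inequality the five averages exceed \<open>s N\<close> with probability at most \<open>B / A\<close>.\<close>
    define s where "s N = sqrt (A / real N)" for N
    let ?k = "\<kappa> (sqrt A)"
    have k0: "0 \<le> ?k" unfolding \<kappa>_def using A by simp
    \<comment> \<open>Below the first bound the stochastic part of the error is at most \<open>sqrt e / 2\<close>; below the second one the eigenvalue \<open>lam (L N)\<close>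
     dominates its perturbation. Adding \<open>1\<close> avoids division by zero.\<close>
    define b where "b = min (sqrt e / 2 / (?k * sqrt A * C0 + 1)) (1 / (2 * (?k * sqrt A * lam 1 + 1)))"
    have kk: "0 \<le> ?k * sqrt A * C0" "0 \<le> ?k * sqrt A * lam 1" using k0 A C00 lam_pos[OF one] by simp_all
    then have b: "b > 0" unfolding b_def using e by simp
    have "\<forall>\<^sub>F N in sequentially. T N < b" using order_tendstoD(2)[OF T0 b] .
    moreover have "\<forall>\<^sub>F N in sequentially. tail N < (sqrt e / 2)\<^sup>2" using e by (intro evtail) simp
    ultimately show ?thesis using evK[of 1] evL[of 1] eventually_ge_at_top[of 1]
    proof eventually_elim
      case (elim N)
      note N = elim(5) and KL = elim(3,4)
      have Npos: "real N > 0" using N by simp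
      have hN: "h N > 0" by (rule hpos[OF KL])
      have lL: "lam (L N) > 0" by (rule lam_pos[OF KL(2)])
      have s0: "0 \<le> s N" "s N \<le> sqrt A" "(s N)\<^sup>2 = A / real N"
        using A N by (auto simp: s_def divide_le_eq intro: real_sqrt_le_mono)
      have pw: "real N powr (1/2) = sqrt (real N)" using Npos by (simp add: powr_half_sqrt)
      have sN: "s N = sqrt A / sqrt (real N)" by (simp add: s_def real_sqrt_divide)
      have Tpos: "0 \<le> T N" unfolding T_def using lL hN by simp
      have err: "real (K N) * real (L N) * (?k * s N / (lam (L N) * h N) * C0) = ?k * sqrt A * C0 * T N"
        unfolding T_def pw sN by (simp add: mult_ac)
      have err_le: "?k * sqrt A * C0 * T N \<le> sqrt e / 2"
      proof -
        have "?k * sqrt A * C0 * T N \<le> (?k * sqrt A * C0 + 1) * T N" using Tpos by (intro mult_right_mono) auto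
        also have "\<dots> \<le> (?k * sqrt A * C0 + 1) * (sqrt e / 2 / (?k * sqrt A * C0 + 1))"
          using elim(1) kk by (intro mult_left_mono) (auto simp: b_def)
        also have "\<dots> = sqrt e / 2"
        proof -
          have "?k * sqrt A * C0 + 1 \<noteq> 0" using kk by linarith
          then show ?thesis by (rule nonzero_mult_div_cancel_left[of _ "sqrt e / 2", unfolded times_divide_eq_right[symmetric]])
        qed
        finally show ?thesis .
      qed
      have small: "2 * (?k * s N) \<le> lam (L N)"
      proof -
        \<comment> \<open>The rate condition controls \<open>1 / lam (L N)\<close> as well, because \<open>K\<close> and \<open>L\<close> are at least \<open>1\<close> and the gaps at most \<open>lam 1\<close>.\<close>
        have "1 / (lam (L N) * lam 1) \<le> real (K N) * real (L N) / (lam (L N) * h N)"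
        proof (rule frac_le)
          show "1 \<le> real (K N) * real (L N)" using KL mult_mono[of 1 "real (K N)" 1 "real (L N)"] by simp
          show "0 < lam (L N) * h N" using lL hN by simp
          show "lam (L N) * h N \<le> lam (L N) * lam 1" using hle[OF KL] lL by (intro mult_left_mono) auto
        qed simp
        then have "1 / (lam (L N) * lam 1) / sqrt (real N) \<le> T N"
          unfolding T_def pw by (intro divide_right_mono) auto
        then have "1 / sqrt (real N) \<le> T N * (lam (L N) * lam 1)"
          using mult_right_mono[of _ _ "lam (L N) * lam 1"] lL lam_pos[OF one] by (fastforce simp del: One_nat_def)
        then have "?k * sqrt A * (1 / sqrt (real N)) \<le> ?k * sqrt A * (T N * (lam (L N) * lam 1))"
          using k0 A by (intro mult_left_mono) auto
        then have "?k * s N \<le> (?k * sqrt A * lam 1) * T N * lam (L N)" unfolding sN by (simp add: mult_ac)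
        also have "\<dots> \<le> (1 / 2) * lam (L N)"
        proof (rule mult_right_mono)
          have "?k * sqrt A * lam 1 * T N \<le> (?k * sqrt A * lam 1 + 1) * T N" using Tpos by (intro mult_right_mono) auto
          also have "\<dots> \<le> (?k * sqrt A * lam 1 + 1) * (1 / (2 * (?k * sqrt A * lam 1 + 1)))"
            using elim(1) kk by (intro mult_left_mono) (auto simp: b_def)
          also have "\<dots> = 1 / 2"
          proof -
            have "x * (1 / (2 * x)) = 1 / 2" if "x \<noteq> 0" for x :: real using that by simp
            from this[of "?k * sqrt A * lam 1 + 1"] kk show ?thesis by linarith
          qed
          finally show "?k * sqrt A * lam 1 * T N \<le> 1 / 2" .
        qed (use lL in simp)
        finally show ?thesis by simp
      qed
      have "sqrt (tail N) \<le> sqrt e / 2"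
        using elim(2) e by (intro real_le_lsqrt) auto
      then have tot: "real (K N) * real (L N) * (?k * s N / (lam (L N) * h N) * C0) + sqrt (tail N) \<le> sqrt e"
        unfolding err using err_le by linarith
      have tail0: "0 \<le> tail N"
      proof -
        have "(\<Sum>x\<in>{1..K N} \<times> {1..L N}. (ip leb2 P (case x of (i, j) \<Rightarrow> tens (u i) (v j)))\<^sup>2) \<le> (nm leb2 P)\<^sup>2"
        proof -
          have "0 \<le> (nm leb2 P)\<^sup>2 - (\<Sum>x\<in>{1..K N} \<times> {1..L N}. (ip leb2 P (case x of (i, j) \<Rightarrow> tens (u i) (v j)))\<^sup>2)"
          proof (subst orthonormal_residual[OF _ _ _ P, symmetric])
            fix x y assume "x \<in> {1..K N} \<times> {1..L N}" "y \<in> {1..K N} \<times> {1..L N}"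
            then show "ip leb2 (case x of (i, j) \<Rightarrow> tens (u i) (v j)) (case y of (i, j) \<Rightarrow> tens (u i) (v j)) = (if x = y then 1 else 0)"
              using product_eigenfunctions(2)[OF U.psd_eigen_axioms V.psd_eigen_axioms] by (auto split: if_splits)
          qed (use product_eigenfunctions(1)[OF U.psd_eigen_axioms V.psd_eigen_axioms] in auto)
          then show ?thesis by simp
        qed
        then show ?thesis by (simp add: tail_def sum.cartesian_product case_prod_beta')
      qed
      have "0 \<le> real (K N) * real (L N) * (?k * s N / (lam (L N) * h N) * C0) + sqrt (tail N)"
        unfolding err using mult_nonneg_nonneg[OF kk(1) Tpos] tail0 by simp
      then have sqle: "(real (K N) * real (L N) * (?k * s N / (lam (L N) * h N) * C0) + sqrt (tail N))\<^sup>2 \<le> e"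
        using power_mono[OF tot, of 2] e by simp
      have "AE \<omega> in M. \<forall>n\<in>{1..}. AE t in unit_leb. Y n \<omega> t = op01 P (X n \<omega>) t + \<epsilon> n \<omega> t"
        using model' by (subst AE_ball_countable) auto
      then have "AE \<omega> in M. \<omega> \<in> {\<omega> \<in> space M. ?Z N \<omega> > ennreal e} \<longrightarrow> A / real N \<le> Q N \<omega>"
      proof eventually_elim
        case (elim \<omega>)
        show ?case
        proof (rule impI, rule ccontr)
          assume \<omega>: "\<omega> \<in> {\<omega> \<in> space M. ?Z N \<omega> > ennreal e}" and "\<not> A / real N \<le> Q N \<omega>"
          then have "Q N \<omega> \<le> (s N)\<^sup>2" unfolding s0(3) by simp
          from det[OF N KL hN _ _ s0(1,2) this small] \<omega> elim
          have "?Z N \<omega> \<le> ennreal ((real (K N) * real (L N) * (?k * s N / (lam (L N) * h N) * C0) + sqrt (tail N))\<^sup>2)" by simp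
          also have "\<dots> \<le> ennreal e" by (intro ennreal_leI sqle)
          finally show False using \<omega> by (simp add: not_le[symmetric])
        qed
      qed
      then have "prob {\<omega> \<in> space M. ?Z N \<omega> > ennreal e} \<le> expectation (Q N) / (A / real N)"
        by (rule prob_le_of_AE_event) (use Qint[OF N] Q0 A Npos in auto)
      also have "\<dots> \<le> (B / real N) / (A / real N)"
        using Qint[OF N] A Npos by (intro divide_right_mono) auto
      also have "\<dots> = B / A" using Npos by simp
      finally show ?case .
    qed
  qed
  have B0: "0 \<le> B"
    unfolding B_def using s\<eta>0 d\<eta>0 r(1,2) suminf_nonneg[OF r(1)] by simp
  show ?thesis
    unfolding to_zero_in_prob_def
  proof (intro allI impI LIMSEQ_I)
    fix e r :: real assume e: "e > 0" and r: "r > 0"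
    \<comment> \<open>With \<open>A = (B + 1) / r\<close> the bound \<open>B / A\<close> is less than \<open>r\<close>.\<close>
    have "\<forall>\<^sub>F N in sequentially. prob {\<omega> \<in> space M. ?Z N \<omega> > ennreal e} \<le> B / ((B + 1) / r)"
      using B0 r by (intro small_ev e) simp
    moreover have "B / ((B + 1) / r) < r" using B0 r by (simp add: field_simps)
    ultimately have "\<forall>\<^sub>F N in sequentially. prob {\<omega> \<in> space M. ?Z N \<omega> > ennreal e} < r"
      by (auto elim: eventually_mono)
    then show "\<exists>N0. \<forall>N\<ge>N0. norm (prob {\<omega> \<in> space M. ?Z N \<omega> > ennreal e} - 0) < r"
      by (simp add: eventually_sequentially)
  qed
qed

end
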